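(* Assuming ETH, there is a global constant $\beta>0$ and a positive integer $N$ such that the following holds for all graph parameters $\Phi$ with values in $\mathbb{Q}$, all functions $h:\mathbb{N}\to\mathbb{N}$ and all integers $k$ for which $h(k)\ge N$ and there exists a graph $F$ with $k$ vertices, $\mathrm{ae}_\Phi(F)\neq0$, and $F$ containing $K_{h(k),h(k)}$ as a subgraph: there is no algorithm (that reads the whole input) that, given a $k$-vertex graph $H$ and an $H$-colored graph $G$, computes $\#\mathrm{cpIndSub}_{(\Phi,H)}(G)$ in time $O(|V(G)|^{\beta h(k)})$.
   Context: All graphs are finite, simple, undirected. A graph parameter is a computable isomorphism-invariant function from graphs to $\mathbb{Q}$. The alternating enumerator is $\mathrm{ae}_\Phi(F)=\sum_{S\subseteq E(F)}\Phi((V(F),S))(-1)^{|S|}$. An $H$-colored graph is a graph $G$ together with a homomorphism $c:V(G)\to V(H)$; $A\subseteq V(G)$ with $|A|=|V(H)|$ is colorful if $c(A)=V(H)$; $\#\mathrm{cpIndSub}_{(\Phi,H)}(G)=\sum_{A\text{ colorful}}\Phi(G[A])$. $K_{a,a}$ is the complete bipartite graph with both sides of size $a$. ETH is the Exponential-Time Hypothesis. *)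

theory Defs
  imports Complex_Main "HOL-Library.Landau_Symbols"
begin

text \<open>
  Vertices are natural numbers; every finite graph is isomorphic to one of this form.
\<close>

datatype graph = Graph (verts: "nat set") (edges: "nat set set")

definition simple_graph :: "graph \<Rightarrow> bool" where
  "simple_graph G \<longleftrightarrow> finite (verts G) \<and> (\<forall>e\<in>edges G. e \<subseteq> verts G \<and> card e = 2)"

definition graph_iso :: "(nat \<Rightarrow> nat) \<Rightarrow> graph \<Rightarrow> graph \<Rightarrow> bool" where
  "graph_iso f G H \<longleftrightarrow> bij_betw f (verts G) (verts H) \<and>
     (\<forall>u\<in>verts G. \<forall>v\<in>verts G. {u, v} \<in> edges G \<longleftrightarrow> {f u, f v} \<in> edges H)"

definition graph_hom :: "(nat \<Rightarrow> nat) \<Rightarrow> graph \<Rightarrow> graph \<Rightarrow> bool" where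
  "graph_hom f G H \<longleftrightarrow> f ` verts G \<subseteq> verts H \<and>
     (\<forall>u\<in>verts G. \<forall>v\<in>verts G. {u, v} \<in> edges G \<longrightarrow> {f u, f v} \<in> edges H)"

definition contains_subgraph :: "graph \<Rightarrow> graph \<Rightarrow> bool" where
  "contains_subgraph F K \<longleftrightarrow> (\<exists>f. inj_on f (verts K) \<and> graph_hom f K F)"

definition complete_bipartite :: "nat \<Rightarrow> nat \<Rightarrow> graph" where
  "complete_bipartite a b =
     Graph {..<a + b} {{i, j} | i j. i < a \<and> a \<le> j \<and> j < a + b}"

definition induced_subgraph :: "graph \<Rightarrow> nat set \<Rightarrow> graph" where
  "induced_subgraph G A = Graph A {e \<in> edges G. e \<subseteq> A}"

definition ae :: "(graph \<Rightarrow> rat) \<Rightarrow> graph \<Rightarrow> rat" where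
  "ae \<Phi> F = (\<Sum>S\<in>Pow (edges F). \<Phi> (Graph (verts F) S) * (- 1) ^ card S)"

definition colorful :: "graph \<Rightarrow> graph \<Rightarrow> (nat \<Rightarrow> nat) \<Rightarrow> nat set \<Rightarrow> bool" where
  "colorful H G c A \<longleftrightarrow> A \<subseteq> verts G \<and> card A = card (verts H) \<and> c ` A = verts H"

definition cpIndSub :: "(graph \<Rightarrow> rat) \<Rightarrow> graph \<Rightarrow> graph \<Rightarrow> (nat \<Rightarrow> nat) \<Rightarrow> rat" where
  "cpIndSub \<Phi> H G c = (\<Sum>A | colorful H G c A. \<Phi> (induced_subgraph G A))"

text \<open>
  A machine has the non-halting states \<open>0, \<dots>, states - 1\<close> (\<open>0\<close> is initial), the single halting
  state \<open>states\<close>, and the tape symbols \<open>0, \<dots>, alph - 1\<close>. Symbol 0 is the blank; inputs and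
  outputs are words over 1 (bit zero), 2 (bit one) and 3 (delimiter). All tapes are two-way
  infinite. A machine is deterministic and its running time is its number of steps. Tape 0 holds the input and tape 1 the output, each from cell 0 on.
\<close>

datatype move = Move_Left | Move_Stay | Move_Right

fun shift :: "move \<Rightarrow> int" where
  "shift Move_Left = -1"
| "shift Move_Stay = 0"
| "shift Move_Right = 1"

record tm =
  tapes :: nat
  states :: nat
  alph :: nat
  delta :: "nat \<Rightarrow> nat list \<Rightarrow> nat \<times> (nat \<times> move) list"

definition is_tm :: "tm \<Rightarrow> bool" where
  "is_tm M \<longleftrightarrow> 2 \<le> tapes M \<and> 4 \<le> alph M \<and>
     (\<forall>q xs q' as. q < states M \<and> length xs = tapes M \<and> set xs \<subseteq> {..<alph M} \<and>
        delta M q xs = (q', as) \<longrightarrow>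
        q' \<le> states M \<and> length as = tapes M \<and> fst ` set as \<subseteq> {..<alph M})"

record config =
  state :: nat
  heads :: "nat \<Rightarrow> int"
  contents :: "nat \<Rightarrow> int \<Rightarrow> nat"

definition scanned :: "tm \<Rightarrow> config \<Rightarrow> nat list" where
  "scanned M cf = map (\<lambda>j. contents cf j (heads cf j)) [0..<tapes M]"

definition step :: "tm \<Rightarrow> config \<Rightarrow> config" where
  "step M cf =
     (if state cf < states M then
        let (q, as) = delta M (state cf) (scanned M cf) in
        \<lparr> state = q,
          heads = (\<lambda>j. if j < tapes M then heads cf j + shift (snd (as ! j)) else heads cf j),
          contents = (\<lambda>j. if j < tapes M then (contents cf j)(heads cf j := fst (as ! j))
                          else contents cf j) \<rparr>
      else cf)"

definition word_tape :: "nat list \<Rightarrow> int \<Rightarrow> nat" where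
  "word_tape w i = (if 0 \<le> i \<and> i < int (length w) then w ! nat i else 0)"

definition init :: "nat list \<Rightarrow> config" where
  "init w = \<lparr> state = 0, heads = (\<lambda>_. 0),
              contents = (\<lambda>j. if j = 0 then word_tape w else word_tape []) \<rparr>"

definition config_at :: "tm \<Rightarrow> nat list \<Rightarrow> nat \<Rightarrow> config" where
  "config_at M w t = (step M ^^ t) (init w)"

definition halts_with :: "tm \<Rightarrow> nat list \<Rightarrow> nat \<Rightarrow> nat list \<Rightarrow> bool" where
  "halts_with M w t v \<longleftrightarrow>
     state (config_at M w t) = states M \<and>
     (\<forall>s<t. state (config_at M w s) < states M) \<and>
     contents (config_at M w t) 1 = word_tape v"

definition reads_whole_input :: "tm \<Rightarrow> nat list \<Rightarrow> nat \<Rightarrow> bool" where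
  "reads_whole_input M w t \<longleftrightarrow>
     (\<forall>i<length w. \<exists>s<t. heads (config_at M w s) 0 = int i)"

definition enc_bit :: "bool \<Rightarrow> nat" where
  "enc_bit b = (if b then 2 else 1)"

fun bin :: "nat \<Rightarrow> nat list" where
  "bin n = (if n = 0 then [] else enc_bit (odd n) # bin (n div 2))"

declare bin.simps [simp del]

definition enc_nat :: "nat \<Rightarrow> nat list" where
  "enc_nat n = bin n @ [3]"

definition enc_int :: "int \<Rightarrow> nat list" where
  "enc_int i = enc_bit (i < 0) # enc_nat (nat \<bar>i\<bar>)"

definition enc_rat :: "rat \<Rightarrow> nat list" where
  "enc_rat r = (case quotient_of r of (p, q) \<Rightarrow> enc_int p @ enc_int q)"

text \<open>
  The graph and colouring encodings are meant for graphs with vertex set \<open>{..<n}\<close>; a graph is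
  given by its number of vertices in binary followed by its adjacency matrix.
\<close>

definition enc_graph :: "graph \<Rightarrow> nat list" where
  "enc_graph G = (let n = card (verts G) in
     enc_nat n @ [enc_bit ({i, j} \<in> edges G). i \<leftarrow> [0..<n], j \<leftarrow> [0..<n]])"

definition enc_colored :: "graph \<Rightarrow> graph \<Rightarrow> (nat \<Rightarrow> nat) \<Rightarrow> nat list" where
  "enc_colored H G c =
     enc_graph H @ enc_graph G @ concat (map (\<lambda>v. enc_nat (c v)) [0..<card (verts G)])"

text \<open>A literal \<open>(b, v)\<close> is satisfied by an assignment giving variable \<open>v\<close> the value \<open>b\<close>.\<close>

type_synonym cnf = "(bool \<times> nat) list list"

definition is_3cnf :: "cnf \<Rightarrow> bool" where
  "is_3cnf \<phi> \<longleftrightarrow> (\<forall>C\<in>set \<phi>. length C \<le> 3)"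

definition cnf_vars :: "cnf \<Rightarrow> nat set" where
  "cnf_vars \<phi> = (\<Union>C\<in>set \<phi>. snd ` set C)"

definition satisfiable :: "cnf \<Rightarrow> bool" where
  "satisfiable \<phi> \<longleftrightarrow> (\<exists>\<sigma>. \<forall>C\<in>set \<phi>. \<exists>(b, v)\<in>set C. \<sigma> v = b)"

definition enc_clause :: "(bool \<times> nat) list \<Rightarrow> nat list" where
  "enc_clause C = concat (map (\<lambda>(b, v). enc_bit b # enc_nat v) C) @ [3]"

definition enc_cnf :: "cnf \<Rightarrow> nat list" where
  "enc_cnf \<phi> = concat (map enc_clause \<phi>)"

definition ETH :: bool where
  "ETH \<longleftrightarrow> (\<exists>\<delta>::real. \<delta> > 0 \<and>
     \<not> (\<exists>M (d::nat). is_tm M \<and>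
          (\<forall>\<phi>. is_3cnf \<phi> \<longrightarrow>
             (\<exists>t. halts_with M (enc_cnf \<phi>) t [enc_bit (satisfiable \<phi>)] \<and>
                  real t \<le> real d * 2 powr (\<delta> * real (card (cnf_vars \<phi>)))
                             * (real (length (enc_cnf \<phi>)) + 1) ^ d))))"

definition iso_invariant :: "(graph \<Rightarrow> rat) \<Rightarrow> bool" where
  "iso_invariant \<Phi> \<longleftrightarrow> (\<forall>G H f. simple_graph G \<and> simple_graph H \<and> graph_iso f G H \<longrightarrow> \<Phi> G = \<Phi> H)"

definition computable_param :: "(graph \<Rightarrow> rat) \<Rightarrow> bool" where
  "computable_param \<Phi> \<longleftrightarrow>
     (\<exists>M. is_tm M \<and>
        (\<forall>n G. simple_graph G \<and> verts G = {..<n} \<longrightarrow>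
           (\<exists>t. halts_with M (enc_graph G) t (enc_rat (\<Phi> G)))))"

definition graph_parameter :: "(graph \<Rightarrow> rat) \<Rightarrow> bool" where
  "graph_parameter \<Phi> \<longleftrightarrow> iso_invariant \<Phi> \<and> computable_param \<Phi>"

definition solves_cpIndSub ::
  "tm \<Rightarrow> (graph \<Rightarrow> rat) \<Rightarrow> nat \<Rightarrow> (nat \<Rightarrow> real) \<Rightarrow> bool" where
  "solves_cpIndSub M \<Phi> k T \<longleftrightarrow>
     (\<forall>H n G c. simple_graph H \<and> verts H = {..<k} \<and>
                simple_graph G \<and> verts G = {..<n} \<and> graph_hom c G H \<longrightarrow>
        (\<exists>t. halts_with M (enc_colored H G c) t (enc_rat (cpIndSub \<Phi> H G c)) \<and>
             reads_whole_input M (enc_colored H G c) t \<and>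
             real t \<le> T n))"

end

theory Submission imports Defs "HOL-Library.Nat_Bijection" begin

text \<open>
  Suppose that \<open>cpIndSub\<close> were computable in time \<open>n powr (\<beta> * h)\<close>. Branching on sunflowers of clauses
  splits a 3-CNF formula with \<open>n\<close> variables into \<open>3 ^ O(n / q)\<close> sparse formulas with \<open>O(C * n)\<close> clauses
  each, where \<open>C\<close> depends on \<open>q\<close> only. The clauses of a sparse formula are distributed over \<open>h\<close> chunks,
  and the \<open>i\<close>-th chunk is assigned to the \<open>i\<close>-th vertex on either side of \<open>K\<^sub>h\<^sub>,\<^sub>h\<close> in \<open>F\<close>. A vertex of \<open>G\<close> with
  colour \<open>u\<close> is a choice of one true literal in every clause of the chunk of \<open>u\<close>, and vertices
  whose colours are adjacent in \<open>F\<close> are adjacent unless their choices conflict. Every two chunks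
  meet along an edge of \<open>K\<^sub>h\<^sub>,\<^sub>h\<close>, so the copies of \<open>F\<close> in \<open>G\<close> that respect the colours correspond to
  satisfying choices. For \<open>S \<subseteq> E(F)\<close> keep only the edges of \<open>G\<close> whose colours lie in \<open>S\<close>; the
  alternating sum of \<open>cpIndSub\<close> over all \<open>S\<close> is \<open>ae \<Phi> F\<close> times the number of these copies. Since \<open>G\<close> has
  \<open>k * 3 ^ O(C * n / h)\<close> vertices, each call takes time \<open>3 ^ O(n / q)\<close> for \<open>\<beta> = 1 / (q * C)\<close>, and a large
  \<open>q\<close> contradicts ETH.

  The reduction becomes a Turing machine by writing it in a small language that rewrites encoded
  trees on stacks; the given machine for \<open>cpIndSub\<close> is simulated by a program of this language.
\<close>

section \<open>Programs and their compilation\<close>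

text \<open>The ETH provides one fixed \<open>\<delta>\<close>, whereas \<open>\<beta>\<close> and
  \<open>N\<close> must be chosen before \<open>\<Phi>\<close>, \<open>h\<close>, \<open>k\<close>
  and the given machine are known. Hence the degree \<open>e\<close> of the polynomial overhead of
  the whole reduction must not depend on any of them. Two devices achieve this: all data of the
  pattern are a hard-wired argument of one fixed program, and simulating a machine costs a factor
  that depends on the machine but no such exponent. The constants are then fixed in the order
  \<open>\<delta>\<close>, \<open>e\<close>, \<open>q\<close>, \<open>t\<close> with
  \<open>\<mu>\<close>, \<open>C\<close>, \<open>\<beta>\<close>. With \<open>nl\<close> the number
  of literals, every exponential quantity is at most a constant times
  \<open>X = 3 ^ (nl div q)\<close>, and \<open>q \<ge> 4 * e / \<delta>\<close> gives
  \<open>X ^ e \<le> 2 powr (\<delta> * n)\<close>.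

  Sparsification is there because the ETH counts variables: the number of clauses, and with it the
  size of a chunk, may be cubic in \<open>n\<close>. The threshold \<open>h k \<ge> q * C\<close>
  keeps a chunk below about \<open>nl / q\<close> clauses, so that the list of its
  \<open>3 ^ L\<close> choices stays within the budget; only then do the \<open>h\<close> chunks fit
  to an algorithm with exponent \<open>\<beta> * h\<close>.\<close>

datatype com =
    Mv nat move
  | Wr "nat list" nat nat "nat list \<Rightarrow> nat"
  | Sq com com
  | Br nat "nat \<Rightarrow> bool" com com
  | Wh nat "nat \<Rightarrow> bool" com

text \<open>Written symbols are computed by arbitrary HOL functions; clipping them to a declared
  bound keeps the compiled machine within a finite alphabet.\<close>

definition clip :: "nat \<Rightarrow> nat \<Rightarrow> nat" where
  "clip A v = (if v < A then v else 0)"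

type_synonym tape_state = "(nat \<Rightarrow> int) \<times> (nat \<Rightarrow> int \<Rightarrow> nat)"

text \<open>The number is exact: it counts steps of the compiled machine, which spends one step on
  unfolding a \<open>Sq\<close>, on a branch and on every loop test.\<close>

inductive exec :: "com \<Rightarrow> tape_state \<Rightarrow> nat \<Rightarrow> tape_state \<Rightarrow> bool" where
  exec_Mv: "exec (Mv r m) (h, t) 1 (h(r := h r + shift m), t)"
| exec_Wr: "exec (Wr js r A g) (h, t) 1
              (h, t(r := (t r)(h r := clip A (g (map (\<lambda>j. t j (h j)) js)))))"
| exec_Sq: "exec c1 s m s' \<Longrightarrow> exec c2 s' n s'' \<Longrightarrow> exec (Sq c1 c2) s (Suc (m + n)) s''"
| exec_BrT: "P (t r (h r)) \<Longrightarrow> exec c1 (h, t) n s' \<Longrightarrow> exec (Br r P c1 c2) (h, t) (Suc n) s'"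
| exec_BrF: "\<not> P (t r (h r)) \<Longrightarrow> exec c2 (h, t) n s' \<Longrightarrow> exec (Br r P c1 c2) (h, t) (Suc n) s'"
| exec_WhF: "\<not> P (t r (h r)) \<Longrightarrow> exec (Wh r P c) (h, t) 1 (h, t)"
| exec_WhT: "P (t r (h r)) \<Longrightarrow> exec c (h, t) m s' \<Longrightarrow> exec (Wh r P c) s' n s'' \<Longrightarrow>
             exec (Wh r P c) (h, t) (Suc (m + n)) s''"

fun tape_bound :: "com \<Rightarrow> nat" where
  "tape_bound (Mv r m) = Suc r"
| "tape_bound (Wr js r A g) = Suc (r + sum_list js)"
| "tape_bound (Sq a b) = tape_bound a + tape_bound b"
| "tape_bound (Br r P a b) = Suc r + tape_bound a + tape_bound b"
| "tape_bound (Wh r P a) = Suc r + tape_bound a"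

fun symbol_bound :: "com \<Rightarrow> nat" where
  "symbol_bound (Mv r m) = 0"
| "symbol_bound (Wr js r A g) = A"
| "symbol_bound (Sq a b) = symbol_bound a + symbol_bound b"
| "symbol_bound (Br r P a b) = symbol_bound a + symbol_bound b"
| "symbol_bound (Wh r P a) = symbol_bound a"

fun next_cont :: "com list \<Rightarrow> (nat \<Rightarrow> nat) \<Rightarrow> com list" where
  "next_cont [] s = []"
| "next_cont (Mv r m # cs) s = cs"
| "next_cont (Wr js r A g # cs) s = cs"
| "next_cont (Sq a b # cs) s = a # b # cs"
| "next_cont (Br r P a b # cs) s = (if P (s r) then a else b) # cs"
| "next_cont (Wh r P a # cs) s = (if P (s r) then a # Wh r P a # cs else cs)"

fun cont_action :: "com list \<Rightarrow> (nat \<Rightarrow> nat) \<Rightarrow> nat \<Rightarrow> nat \<times> move" where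
  "cont_action (Mv r m # cs) s j = (s j, if j = r then m else Move_Stay)"
| "cont_action (Wr js r A g # cs) s j = (if j = r then clip A (g (map s js)) else s j, Move_Stay)"
| "cont_action cs s j = (s j, Move_Stay)"

text \<open>Continuations met while \<open>c\<close> runs in front of \<open>cs\<close>, without
  \<open>cs\<close> itself. The body of a loop is continued by the loop, so the set stays
  finite.\<close>

fun conts :: "com \<Rightarrow> com list \<Rightarrow> com list set" where
  "conts (Sq a b) cs = insert (Sq a b # cs) (conts a (b # cs) \<union> conts b cs)"
| "conts (Br r P a b) cs = insert (Br r P a b # cs) (conts a cs \<union> conts b cs)"
| "conts (Wh r P a) cs = insert (Wh r P a # cs) (conts a (Wh r P a # cs))"
| "conts c cs = {c # cs}"

lemma conts_self: "c # cs \<in> conts c cs"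
  by (cases c) auto

lemma finite_conts: "finite (conts c cs)"
  by (induction c arbitrary: cs) auto

lemma Nil_notin_conts: "[] \<notin> conts c cs"
  by (induction c arbitrary: cs) auto

lemma conts_closed: "x \<in> conts c cs \<Longrightarrow> next_cont x s \<in> insert cs (conts c cs)"
proof (induction c arbitrary: cs)
  case (Sq a b)
  then show ?case using conts_self[of a "b # cs"] conts_self[of b cs] by fastforce
next
  case (Br r P a b)
  from Br.prems consider "x = Br r P a b # cs" | "x \<in> conts a cs" | "x \<in> conts b cs" by auto
  then show ?case
    by cases (use Br.IH[of cs] conts_self[of a cs] conts_self[of b cs] in auto)
next
  case (Wh r P a)
  then show ?case using conts_self[of a "Wh r P a # cs"] by fastforce
qed auto

lemma conts_bounded:
  "x \<in> conts c cs \<Longrightarrow> \<forall>d\<in>set cs. tape_bound d \<le> K \<and> symbol_bound d \<le> A \<Longrightarrow>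
   tape_bound c \<le> K \<Longrightarrow> symbol_bound c \<le> A \<Longrightarrow>
   d \<in> set x \<Longrightarrow> tape_bound d \<le> K \<and> symbol_bound d \<le> A"
proof (induction c arbitrary: cs)
  case (Sq a b)
  from Sq.prems(1) consider "x = Sq a b # cs" | "x \<in> conts a (b # cs)" | "x \<in> conts b cs" by auto
  then show ?case
  proof cases
    case 1 then show ?thesis using Sq.prems by auto
  next
    case 2 show ?thesis by (rule Sq.IH(1)[OF 2]) (use Sq.prems in auto)
  next
    case 3 show ?thesis by (rule Sq.IH(2)[OF 3]) (use Sq.prems in auto)
  qed
next
  case (Br r P a b)
  from Br.prems(1) consider "x = Br r P a b # cs" | "x \<in> conts a cs" | "x \<in> conts b cs" by auto
  then show ?case
  proof cases
    case 1 then show ?thesis using Br.prems by auto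
  next
    case 2 show ?thesis by (rule Br.IH(1)[OF 2]) (use Br.prems in auto)
  next
    case 3 show ?thesis by (rule Br.IH(2)[OF 3]) (use Br.prems in auto)
  qed
next
  case (Wh r P a)
  from Wh.prems(1) consider "x = Wh r P a # cs" | "x \<in> conts a (Wh r P a # cs)" by auto
  then show ?case
  proof cases
    case 1 then show ?thesis using Wh.prems by auto
  next
    case 2 show ?thesis by (rule Wh.IH(1)[OF 2]) (use Wh.prems in auto)
  qed
qed auto

text \<open>
  The states of the compiled machine are the finitely many continuations of the program; a
  continuation is the list of commands that remain to be executed.
\<close>

definition compiled :: "nat \<Rightarrow> nat \<Rightarrow> nat \<Rightarrow> (com list \<Rightarrow> nat) \<Rightarrow> (nat \<Rightarrow> com list) \<Rightarrow> tm" where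
  "compiled K A n num dec = \<lparr> tapes = K, states = n, alph = A,
     delta = (\<lambda>q xs. let s = (\<lambda>j. if j < length xs then xs ! j else 0) in
                (num (next_cont (dec q) s), map (cont_action (dec q) s) [0..<K])) \<rparr>"

lemma compiled_simps [simp]:
  "tapes (compiled K A n num dec) = K" "states (compiled K A n num dec) = n"
  "alph (compiled K A n num dec) = A"
  by (simp_all add: compiled_def)

lemma member_le_sum_list': "j \<in> set js \<Longrightarrow> j \<le> sum_list (js :: nat list)"
  by (induction js) auto

lemma cont_action_agree:
  assumes "\<forall>d\<in>set cs. tape_bound d \<le> K" and "\<And>j. j < K \<Longrightarrow> s j = s' j" and "j < K"
  shows "cont_action cs s j = cont_action cs s' j"
proof (cases cs)
  case (Cons c cs')
  show ?thesis
  proof (cases c)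
    case (Wr js r A g)
    have "map s js = map s' js"
      using assms(1,2) Cons Wr by (auto dest!: member_le_sum_list')
    then show ?thesis using Cons Wr assms by (auto simp del: map_eq_conv)
  qed (use Cons assms in auto)
qed (use assms in auto)

lemma next_cont_agree:
  assumes "\<forall>d\<in>set cs. tape_bound d \<le> K" and "\<And>j. j < K \<Longrightarrow> s j = s' j"
  shows "next_cont cs s = next_cont cs s'"
proof (cases cs)
  case (Cons c cs')
  then show ?thesis using assms by (cases c) auto
qed simp

lemma step_compiled:
  fixes h :: "nat \<Rightarrow> int" and t :: "nat \<Rightarrow> int \<Rightarrow> nat"
  assumes "num cs < n" "dec (num cs) = cs" "\<forall>d\<in>set cs. tape_bound d \<le> K"
  defines [simp]: "s \<equiv> (\<lambda>j. t j (h j))"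
  shows "step (compiled K A n num dec) \<lparr>state = num cs, heads = h, contents = t\<rparr> =
    \<lparr>state = num (next_cont cs s),
     heads = (\<lambda>j. if j < K then h j + shift (snd (cont_action cs s j)) else h j),
     contents = (\<lambda>j. if j < K then (t j)(h j := fst (cont_action cs s j)) else t j)\<rparr>"
proof -
  define xs where "xs = map s [0..<K]"
  define s' where "s' = (\<lambda>j. if j < length xs then xs ! j else 0)"
  have ag: "s' j = s j" if "j < K" for j using that by (simp add: s'_def xs_def)
  have 1: "next_cont cs s' = next_cont cs s"
    by (rule next_cont_agree[OF assms(3)]) (simp add: ag)
  have 2: "map (cont_action cs s') [0..<K] ! j = cont_action cs s j" if "j < K" for j
    using that cont_action_agree[OF assms(3), of s' s j] ag by simp
  have "scanned (compiled K A n num dec) \<lparr>state = num cs, heads = h, contents = t\<rparr> = xs"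
    by (simp add: scanned_def xs_def s_def)
  moreover have "delta (compiled K A n num dec) (num cs) xs =
     (num (next_cont cs s'), map (cont_action cs s') [0..<K])"
    using assms(2) by (simp add: compiled_def s'_def[symmetric])
  ultimately show ?thesis
    using assms(1) by (auto simp: step_def 1 2 fun_eq_iff simp del: nth_map)
qed

text \<open>The continuation is arbitrary in the induction, since a subprogram runs in front of
  whatever remains to be done.\<close>

lemma steps_compiled:
  assumes "exec c (h, t) m (h', t')" "conts c cs \<subseteq> S"
    and S: "\<And>x. x \<in> S \<Longrightarrow> num x < n \<and> dec (num x) = x \<and> (\<forall>d\<in>set x. tape_bound d \<le> K)"
  shows "(step (compiled K A n num dec) ^^ m) \<lparr>state = num (c # cs), heads = h, contents = t\<rparr> =
    \<lparr>state = num cs, heads = h', contents = t'\<rparr>"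
  using assms(1,2)
proof (induction c "(h, t)" m "(h', t')" arbitrary: cs h t h' t' rule: exec.induct)
  case (exec_Mv r m h t)
  then have *: "Mv r m # cs \<in> S" by simp
  with S[OF *] show ?case by (auto simp: step_compiled fun_eq_iff)
next
  case (exec_Wr js r B g h t)
  then have *: "Wr js r B g # cs \<in> S" by simp
  with S[OF *] show ?case by (auto simp: step_compiled fun_eq_iff)
next
  case (exec_Sq c1 m s' c2 k)
  have *: "Sq c1 c2 # cs \<in> S" using exec_Sq by simp
  obtain h1 t1 where s': "s' = (h1, t1)" by (cases s')
  have "step (compiled K A n num dec) \<lparr>state = num (Sq c1 c2 # cs), heads = h, contents = t\<rparr>
     = \<lparr>state = num (c1 # c2 # cs), heads = h, contents = t\<rparr>"
    using S[OF *] by (auto simp: step_compiled fun_eq_iff)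
  moreover have "(step (compiled K A n num dec) ^^ m)
     \<lparr>state = num (c1 # c2 # cs), heads = h, contents = t\<rparr> =
     \<lparr>state = num (c2 # cs), heads = h1, contents = t1\<rparr>"
    by (rule exec_Sq(2)[OF s']) (use exec_Sq in auto)
  moreover have "(step (compiled K A n num dec) ^^ k)
     \<lparr>state = num (c2 # cs), heads = h1, contents = t1\<rparr> =
     \<lparr>state = num cs, heads = h', contents = t'\<rparr>"
    by (rule exec_Sq(4)[OF s']) (use exec_Sq in auto)
  moreover have "Suc (m + k) = k + (m + 1)" by simp
  ultimately show ?case by (simp only: funpow_add o_apply) simp
next
  case (exec_BrT P t r h c1 k c2)
  have *: "Br r P c1 c2 # cs \<in> S" using exec_BrT by simp
  have "step (compiled K A n num dec) \<lparr>state = num (Br r P c1 c2 # cs), heads = h, contents = t\<rparr>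
     = \<lparr>state = num (c1 # cs), heads = h, contents = t\<rparr>"
    using S[OF *] exec_BrT(1) by (auto simp: step_compiled fun_eq_iff)
  with exec_BrT show ?case by (simp add: funpow_Suc_right del: funpow.simps)
next
  case (exec_BrF P t r h c2 k c1)
  have *: "Br r P c1 c2 # cs \<in> S" using exec_BrF by simp
  have "step (compiled K A n num dec) \<lparr>state = num (Br r P c1 c2 # cs), heads = h, contents = t\<rparr>
     = \<lparr>state = num (c2 # cs), heads = h, contents = t\<rparr>"
    using S[OF *] exec_BrF(1) by (auto simp: step_compiled fun_eq_iff)
  with exec_BrF show ?case by (simp add: funpow_Suc_right del: funpow.simps)
next
  case (exec_WhF P t r h c)
  have *: "Wh r P c # cs \<in> S" using exec_WhF by simp
  with S[OF *] exec_WhF(1) show ?case by (auto simp: step_compiled fun_eq_iff)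
next
  case (exec_WhT P t r h c m s' k)
  have *: "Wh r P c # cs \<in> S" using exec_WhT by simp
  obtain h1 t1 where s': "s' = (h1, t1)" by (cases s')
  have "step (compiled K A n num dec) \<lparr>state = num (Wh r P c # cs), heads = h, contents = t\<rparr>
     = \<lparr>state = num (c # Wh r P c # cs), heads = h, contents = t\<rparr>"
    using S[OF *] exec_WhT(1) by (auto simp: step_compiled fun_eq_iff)
  moreover have "(step (compiled K A n num dec) ^^ m)
     \<lparr>state = num (c # Wh r P c # cs), heads = h, contents = t\<rparr> =
     \<lparr>state = num (Wh r P c # cs), heads = h1, contents = t1\<rparr>"
    by (rule exec_WhT(3)[OF s']) (use exec_WhT in auto)
  moreover have "(step (compiled K A n num dec) ^^ k)
     \<lparr>state = num (Wh r P c # cs), heads = h1, contents = t1\<rparr> =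
     \<lparr>state = num cs, heads = h', contents = t'\<rparr>"
    by (rule exec_WhT(5)[OF s']) (use exec_WhT in auto)
  moreover have "Suc (m + k) = k + (m + 1)" by simp
  ultimately show ?case by (simp only: funpow_add o_apply) simp
qed

lemma is_tm_compiled:
  assumes "2 \<le> K" "4 \<le> A"
    and S: "\<And>q. q < n \<Longrightarrow> dec q \<in> S"
    and B: "\<And>x d. x \<in> S \<Longrightarrow> d \<in> set x \<Longrightarrow> tape_bound d \<le> K \<and> symbol_bound d \<le> A"
    and N: "\<And>x s. x \<in> S \<Longrightarrow> num (next_cont x s) \<le> n"
  shows "is_tm (compiled K A n num dec)"
  unfolding is_tm_def
proof (intro conjI allI impI)
  fix q xs q' as
  assume a: "q < states (compiled K A n num dec) \<and> length xs = tapes (compiled K A n num dec) \<and>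
     set xs \<subseteq> {..<alph (compiled K A n num dec)} \<and> delta (compiled K A n num dec) q xs = (q', as)"
  define s where "s = (\<lambda>j. if j < length xs then xs ! j else 0)"
  have q': "q' = num (next_cont (dec q) s)" and as: "as = map (cont_action (dec q) s) [0..<K]"
    using a by (auto simp: compiled_def s_def Let_def)
  have dq: "dec q \<in> S" using a S by simp
  show "q' \<le> states (compiled K A n num dec)" using N[OF dq] q' by simp
  show "length as = tapes (compiled K A n num dec)" by (simp add: as)
  have sA: "s j < A" for j using a assms(2) by (auto simp: s_def subset_iff)
  have "fst (cont_action (dec q) s j) < A" for j
  proof (cases "dec q")
    case (Cons c cs)
    then have b: "symbol_bound c \<le> A" using B[OF dq, of c] by simp
    show ?thesis
    proof (cases c)
      case (Wr js r A' g)
      then have "A' \<le> A" using b by simp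
      then have "clip A' v < A" for v using assms(2) by (auto simp: clip_def)
      then show ?thesis using Cons Wr sA by simp
    qed (use Cons sA in auto)
  qed (use sA in auto)
  then show "fst ` set as \<subseteq> {..<alph (compiled K A n num dec)}" by (auto simp: as)
qed (use assms in auto)

theorem compile_com:
  "\<exists>M. is_tm M \<and> (\<forall>w n h' t' v.
     exec c (\<lambda>_. 0, contents (init w)) n (h', t') \<and> t' 1 = word_tape v \<longrightarrow>
     (\<exists>t\<le>n. halts_with M w t v))"
proof -
  define S where "S = conts c []"
  define K where "K = 2 + tape_bound c"
  define A where "A = 4 + symbol_bound c"
  define n where "n = card S"
  have fin: "finite S" and cS: "[c] \<in> S" and nS: "[] \<notin> S"
    by (auto simp: S_def finite_conts conts_self Nil_notin_conts)
  have "card (S - {[c]}) = card {1..<n}" using fin cS by (simp add: n_def)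
  then obtain f where f: "bij_betw f (S - {[c]}) {1..<n}"
    using finite_same_card_bij[of "S - {[c]}" "{1..<n}"] fin by auto
  \<comment> \<open>The machine model fixes 0 as the initial and \<open>states\<close> as the
    halting state: the program itself gets 0, the empty continuation gets \<open>n\<close>, and
    \<open>f\<close> distributes the numbers between them.\<close>
  define num where "num = (\<lambda>x. if x = [] then n else if x = [c] then 0 else f x)"
  have n0: "0 < n" using fin cS by (auto simp: n_def card_gt_0_iff)
  have fr: "f x \<in> {1..<n}" if "x \<in> S" "x \<noteq> [c]" for x
    using f that by (auto simp: bij_betw_def)
  have f0: "f x > 0" if "x \<in> S" "x \<noteq> [c]" for x using fr[OF that] by simp
  have "inj_on f (S - {[c]})" using f by (simp add: bij_betw_def)
  then have inj: "inj_on num S"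
    using nS f0 by (fastforce simp: inj_on_def num_def)
  have lt: "num x < n" if "x \<in> S" for x using that fr[OF that] n0 nS by (auto simp: num_def)
  define dec where "dec = inv_into S num"
  have dec: "dec (num x) = x" if "x \<in> S" for x using that inj by (simp add: dec_def)
  have "num ` S = {..<n}"
    by (rule card_subset_eq) (use lt inj fin in \<open>auto simp: card_image n_def\<close>)
  then have decS: "dec q \<in> S" if "q < n" for q
    using that by (metis dec_def inv_into_into lessThan_iff)
  have bnd: "tape_bound d \<le> K \<and> symbol_bound d \<le> A" if "x \<in> S" "d \<in> set x" for x d
    using conts_bounded[of x c "[]" K A d] that by (simp add: S_def K_def A_def)
  define M where "M = compiled K A n num dec"
  have "num (next_cont x s) \<le> n" if "x \<in> S" for x s
    using conts_closed[OF that[unfolded S_def], of s] lt[of "next_cont x s"]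
    by (auto simp: S_def[symmetric] less_imp_le) (simp add: num_def)
  then have tm: "is_tm M"
    unfolding M_def by (intro is_tm_compiled[where S = S]) (use decS bnd in \<open>auto simp: K_def A_def\<close>)
  have "\<exists>t\<le>m. halts_with M w t v"
    if e: "exec c (\<lambda>_. 0, contents (init w)) m (h', t')" and v: "t' 1 = word_tape v" for w m h' t' v
  proof -
    have "(step M ^^ m) \<lparr>state = num (c # []), heads = (\<lambda>_. 0), contents = contents (init w)\<rparr> =
       \<lparr>state = num [], heads = h', contents = t'\<rparr>"
      unfolding M_def by (rule steps_compiled[OF e, where S = S]) (use lt dec bnd in \<open>auto simp: S_def\<close>)
    moreover have "\<lparr>state = num (c # []), heads = (\<lambda>_. 0), contents = contents (init w)\<rparr> = init w"
      by (simp add: init_def num_def)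
    ultimately have fin: "config_at M w m = \<lparr>state = n, heads = h', contents = t'\<rparr>"
      by (simp add: config_at_def num_def)
    \<comment> \<open>\<open>halts_with\<close> refers to the first halting time. A halted machine
      does not move, so the configuration at that time is the one at time \<open>m\<close>.\<close>
    define t where "t = (LEAST t. \<not> state (config_at M w t) < states M)"
    have ex: "\<not> state (config_at M w m) < states M" unfolding fin by (simp add: M_def)
    have t1: "\<not> state (config_at M w t) < states M" unfolding t_def by (rule LeastI, rule ex)
    have tm: "t \<le> m" unfolding t_def by (rule Least_le, rule ex)
    have t2: "state (config_at M w u) < states M" if "u < t" for u
      using not_less_Least[of u "\<lambda>t. \<not> state (config_at M w t) < states M"] that by (simp add: t_def)
    have st: "step M (config_at M w t) = config_at M w t" using t1 by (simp add: step_def)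
    have "config_at M w (t + j) = config_at M w t" for j
    proof (induction j)
      case (Suc j)
      have "config_at M w (t + Suc j) = step M (config_at M w (t + j))" by (simp add: config_at_def)
      then show ?case by (simp add: Suc st)
    qed simp
    from this[of "m - t"] have "config_at M w t = config_at M w m" using tm by simp
    then have "config_at M w t = \<lparr>state = n, heads = h', contents = t'\<rparr>" "states M = n" using fin by (simp_all add: M_def)
    then have "halts_with M w t v" using t2 v by (simp add: halts_with_def)
    then show ?thesis using tm by blast
  qed
  then show ?thesis using tm by blast
qed

section \<open>Stacks on tapes\<close>

fun tape_of :: "nat list \<Rightarrow> int \<Rightarrow> nat" where
  "tape_of [] = (\<lambda>_. 0)"
| "tape_of (a # s) = (tape_of s)(int (length s) + 1 := a)"

lemma tape_of_above: "i > int (length s) \<Longrightarrow> tape_of s i = 0"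
  by (induction s) auto

lemma tape_of_top: "tape_of s (int (length s)) = (case s of [] \<Rightarrow> 0 | a # _ \<Rightarrow> a)"
  by (cases s) auto

lemma tape_of_pop: "(tape_of (a # s))(int (length s) + 1 := 0) = tape_of s"
  using tape_of_above[of s "int (length s) + 1"] by (auto simp: fun_eq_iff)

text \<open>
  Stack \<open>j\<close> lives on tape \<open>j + 2\<close>. Its cells are \<open>1, 2, \<dots>\<close>, and the head scans the topmost one, so that an
  empty stack shows the blank symbol.
\<close>

definition stack_rep :: "(nat \<Rightarrow> nat list) \<Rightarrow> tape_state \<Rightarrow> bool" where
  "stack_rep \<sigma> s \<longleftrightarrow> (\<forall>j. fst s (j + 2) = int (length (\<sigma> j)) \<and> snd s (j + 2) = tape_of (\<sigma> j))"

definition top_sym :: "nat list \<Rightarrow> nat" where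
  "top_sym s = (case s of [] \<Rightarrow> 0 | a # _ \<Rightarrow> a)"

lemma top_sym_simps [simp]: "top_sym [] = 0" "top_sym (a # s) = a"
  by (simp_all add: top_sym_def)

text \<open>From here on times are upper bounds. Tapes 0 and 1, the input and the output of the
  machine, are left untouched.\<close>

definition sx :: "com \<Rightarrow> (nat \<Rightarrow> nat list) \<Rightarrow> (nat \<Rightarrow> nat list) \<Rightarrow> nat \<Rightarrow> bool" where
  "sx c \<sigma> \<sigma>' n \<longleftrightarrow> (\<forall>h t. stack_rep \<sigma> (h, t) \<longrightarrow>
     (\<exists>m\<le>n. \<exists>h' t'. exec c (h, t) m (h', t') \<and> stack_rep \<sigma>' (h', t') \<and>
        (\<forall>j<2. h' j = h j \<and> t' j = t j)))"

definition push :: "nat \<Rightarrow> nat \<Rightarrow> com" where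
  "push j a = Sq (Mv (j + 2) Move_Right) (Wr [] (j + 2) (Suc a) (\<lambda>_. a))"

definition pop :: "nat \<Rightarrow> com" where
  "pop j = Sq (Wr [] (j + 2) 1 (\<lambda>_. 0)) (Mv (j + 2) Move_Left)"

definition cpy :: "nat \<Rightarrow> nat \<Rightarrow> nat \<Rightarrow> com" where
  "cpy A i j = Sq (Mv (j + 2) Move_Right) (Wr [i + 2] (j + 2) A hd)"

definition push_fun :: "nat list \<Rightarrow> nat \<Rightarrow> nat \<Rightarrow> (nat list \<Rightarrow> nat) \<Rightarrow> com" where
  "push_fun is j A g = Sq (Mv (j + 2) Move_Right) (Wr (map (\<lambda>i. i + 2) is) (j + 2) A g)"

definition set_top :: "nat list \<Rightarrow> nat \<Rightarrow> nat \<Rightarrow> (nat list \<Rightarrow> nat) \<Rightarrow> com" where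
  "set_top is j A g = Wr (map (\<lambda>i. i + 2) is) (j + 2) A g"

definition Bs :: "nat \<Rightarrow> (nat \<Rightarrow> bool) \<Rightarrow> com \<Rightarrow> com \<Rightarrow> com" where
  "Bs j P a b = Br (j + 2) P a b"

definition Ws :: "nat \<Rightarrow> (nat \<Rightarrow> bool) \<Rightarrow> com \<Rightarrow> com" where
  "Ws j P a = Wh (j + 2) P a"

lemma stack_repD:
  assumes "stack_rep \<sigma> (h, t)"
  shows "h (Suc (Suc j)) = int (length (\<sigma> j))" "t (Suc (Suc j)) = tape_of (\<sigma> j)"
    "tape_of (\<sigma> j) (int (length (\<sigma> j))) = top_sym (\<sigma> j)"
  using assms by (simp_all add: stack_rep_def tape_of_top top_sym_def)

lemma sx_mono: "sx c \<sigma> \<sigma>' m \<Longrightarrow> m \<le> n \<Longrightarrow> sx c \<sigma> \<sigma>' n"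
  unfolding sx_def by (meson order_trans)

lemma sx_Sq:
  assumes "sx c1 \<sigma> \<sigma>1 m" "sx c2 \<sigma>1 \<sigma>2 n"
  shows "sx (Sq c1 c2) \<sigma> \<sigma>2 (Suc (m + n))"
  unfolding sx_def
proof (intro allI impI)
  fix h t assume "stack_rep \<sigma> (h, t)"
  then obtain m1 h1 t1 where 1: "m1 \<le> m" "exec c1 (h, t) m1 (h1, t1)" "stack_rep \<sigma>1 (h1, t1)"
    "\<forall>j<2. h1 j = h j \<and> t1 j = t j" using assms(1) unfolding sx_def by meson
  then obtain m2 h2 t2 where 2: "m2 \<le> n" "exec c2 (h1, t1) m2 (h2, t2)" "stack_rep \<sigma>2 (h2, t2)"
    "\<forall>j<2. h2 j = h1 j \<and> t2 j = t1 j" using assms(2) unfolding sx_def by meson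
  show "\<exists>ma\<le>Suc (m + n). \<exists>h' t'. exec (Sq c1 c2) (h, t) ma (h', t') \<and> stack_rep \<sigma>2 (h', t') \<and>
      (\<forall>j<2. h' j = h j \<and> t' j = t j)"
    by (intro exI[of _ "Suc (m1 + m2)"] exI[of _ h2] exI[of _ t2] conjI exec_Sq[OF 1(2) 2(2)])
       (use 1 2 in auto)
qed

lemma sx_BsT:
  assumes "P (top_sym (\<sigma> j))" "sx a \<sigma> \<sigma>' n"
  shows "sx (Bs j P a b) \<sigma> \<sigma>' (Suc n)"
  unfolding sx_def
proof (intro allI impI)
  fix h t assume r: "stack_rep \<sigma> (h, t)"
  then obtain m1 h1 t1 where 1: "m1 \<le> n" "exec a (h, t) m1 (h1, t1)" "stack_rep \<sigma>' (h1, t1)"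
    "\<forall>j<2. h1 j = h j \<and> t1 j = t j" using assms(2) unfolding sx_def by meson
  have "exec (Bs j P a b) (h, t) (Suc m1) (h1, t1)"
    unfolding Bs_def by (rule exec_BrT) (use 1 assms(1) stack_repD[OF r, of j] in auto)
  then show "\<exists>m\<le>Suc n. \<exists>h' t'. exec (Bs j P a b) (h, t) m (h', t') \<and> stack_rep \<sigma>' (h', t') \<and>
      (\<forall>j<2. h' j = h j \<and> t' j = t j)" using 1 by (meson Suc_le_mono)
qed

lemma sx_BsF:
  assumes "\<not> P (top_sym (\<sigma> j))" "sx b \<sigma> \<sigma>' n"
  shows "sx (Bs j P a b) \<sigma> \<sigma>' (Suc n)"
  unfolding sx_def
proof (intro allI impI)
  fix h t assume r: "stack_rep \<sigma> (h, t)"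
  then obtain m1 h1 t1 where 1: "m1 \<le> n" "exec b (h, t) m1 (h1, t1)" "stack_rep \<sigma>' (h1, t1)"
    "\<forall>j<2. h1 j = h j \<and> t1 j = t j" using assms(2) unfolding sx_def by meson
  have "exec (Bs j P a b) (h, t) (Suc m1) (h1, t1)"
    unfolding Bs_def by (rule exec_BrF) (use 1 assms(1) stack_repD[OF r, of j] in auto)
  then show "\<exists>m\<le>Suc n. \<exists>h' t'. exec (Bs j P a b) (h, t) m (h', t') \<and> stack_rep \<sigma>' (h', t') \<and>
      (\<forall>j<2. h' j = h j \<and> t' j = t j)" using 1 by (meson Suc_le_mono)
qed

lemma sx_WsF:
  assumes "\<not> P (top_sym (\<sigma> j))"
  shows "sx (Ws j P a) \<sigma> \<sigma> 1"
  unfolding sx_def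
proof (intro allI impI)
  fix h t assume r: "stack_rep \<sigma> (h, t)"
  have "exec (Ws j P a) (h, t) 1 (h, t)"
    unfolding Ws_def by (rule exec_WhF) (use assms(1) stack_repD[OF r, of j] in auto)
  then show "\<exists>m\<le>1. \<exists>h' t'. exec (Ws j P a) (h, t) m (h', t') \<and> stack_rep \<sigma> (h', t') \<and>
      (\<forall>j<2. h' j = h j \<and> t' j = t j)" using r by blast
qed

lemma sx_WsT:
  assumes "P (top_sym (\<sigma> j))" "sx a \<sigma> \<sigma>1 m" "sx (Ws j P a) \<sigma>1 \<sigma>2 n"
  shows "sx (Ws j P a) \<sigma> \<sigma>2 (Suc (m + n))"
  unfolding sx_def
proof (intro allI impI)
  fix h t assume r: "stack_rep \<sigma> (h, t)"
  then obtain m1 h1 t1 where 1: "m1 \<le> m" "exec a (h, t) m1 (h1, t1)" "stack_rep \<sigma>1 (h1, t1)"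
    "\<forall>j<2. h1 j = h j \<and> t1 j = t j" using assms(2) unfolding sx_def by meson
  then obtain m2 h2 t2 where 2: "m2 \<le> n" "exec (Ws j P a) (h1, t1) m2 (h2, t2)"
    "stack_rep \<sigma>2 (h2, t2)"
    "\<forall>j<2. h2 j = h1 j \<and> t2 j = t1 j" using assms(3) unfolding sx_def by meson
  have "exec (Ws j P a) (h, t) (Suc (m1 + m2)) (h2, t2)"
    using 1(2) 2(2) unfolding Ws_def
    by (intro exec_WhT[where s' = "(h1, t1)"]) (use assms(1) stack_repD[OF r, of j] in auto)
  then show "\<exists>ma\<le>Suc (m + n). \<exists>h' t'. exec (Ws j P a) (h, t) ma (h', t') \<and>
      stack_rep \<sigma>2 (h', t') \<and> (\<forall>j<2. h' j = h j \<and> t' j = t j)"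
    using 1 2 by (intro exI[of _ "Suc (m1 + m2)"] exI[of _ h2] exI[of _ t2] conjI) auto
qed

text \<open>\<open>j\<close> is kept out of \<open>is\<close> because the head of stack
  \<open>j\<close> already stands on the new cell when the symbols are read.\<close>

lemma sx_push_fun:
  assumes "j \<notin> set is" "g (map (\<lambda>i. top_sym (\<sigma> i)) is) < A"
  shows "sx (push_fun is j A g) \<sigma> (\<sigma>(j := g (map (\<lambda>i. top_sym (\<sigma> i)) is) # \<sigma> j)) 3"
  unfolding sx_def
proof (intro allI impI)
  fix h t assume r: "stack_rep \<sigma> (h, t)"
  let ?h = "h(j + 2 := h (j + 2) + shift Move_Right)"
  let ?v = "g (map (\<lambda>i. top_sym (\<sigma> i)) is)"
  have m: "map (\<lambda>j. t j (?h j)) (map (\<lambda>i. i + 2) is) = map (\<lambda>i. top_sym (\<sigma> i)) is"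
    using assms(1) r by (auto simp: stack_rep_def tape_of_top top_sym_def)
  have "exec (push_fun is j A g) (h, t) (Suc (1 + 1))
     (?h, t(j + 2 := (t (j + 2))(?h (j + 2) := clip A (g (map (\<lambda>j. t j (?h j)) (map (\<lambda>i. i + 2) is))))))"
    unfolding push_fun_def by (rule exec_Sq[OF exec_Mv exec_Wr])
  then have e: "exec (push_fun is j A g) (h, t) (Suc (1 + 1)) (?h, t(j + 2 := (t (j + 2))(?h (j + 2) := ?v)))"
    by (simp only: m clip_def assms(2) if_True)
  show "\<exists>m\<le>3. \<exists>h' t'. exec (push_fun is j A g) (h, t) m (h', t') \<and>
        stack_rep (\<sigma>(j := ?v # \<sigma> j)) (h', t') \<and> (\<forall>j<2. h' j = h j \<and> t' j = t j)"
    by (rule exI[of _ "Suc (1 + 1)"], intro conjI exI, simp, rule e)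
       (use r in \<open>auto simp: stack_rep_def\<close>)
qed

lemma sx_push: "sx (push j a) \<sigma> (\<sigma>(j := a # \<sigma> j)) 3"
  using sx_push_fun[of j "[]" "\<lambda>_. a" \<sigma> "Suc a"] by (simp add: push_def push_fun_def)

lemma sx_cpy:
  assumes "i \<noteq> j" "top_sym (\<sigma> i) < A"
  shows "sx (cpy A i j) \<sigma> (\<sigma>(j := top_sym (\<sigma> i) # \<sigma> j)) 3"
  using sx_push_fun[of j "[i]" hd \<sigma> A] assms by (simp add: cpy_def push_fun_def)

lemma sx_set_top:
  assumes "g (map (\<lambda>i. top_sym (\<sigma> i)) is) < A" "\<sigma> j \<noteq> []"
  shows "sx (set_top is j A g) \<sigma> (\<sigma>(j := g (map (\<lambda>i. top_sym (\<sigma> i)) is) # tl (\<sigma> j))) 1"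
  unfolding sx_def
proof (intro allI impI)
  fix h t assume r: "stack_rep \<sigma> (h, t)"
  let ?v = "g (map (\<lambda>i. top_sym (\<sigma> i)) is)"
  have m: "map (\<lambda>j. t j (h j)) (map (\<lambda>i. i + 2) is) = map (\<lambda>i. top_sym (\<sigma> i)) is"
    using r by (auto simp: stack_rep_def tape_of_top top_sym_def)
  have "exec (set_top is j A g) (h, t) 1
     (h, t(j + 2 := (t (j + 2))(h (j + 2) := clip A (g (map (\<lambda>j. t j (h j)) (map (\<lambda>i. i + 2) is))))))"
    unfolding set_top_def by (rule exec_Wr)
  then have e: "exec (set_top is j A g) (h, t) 1 (h, t(j + 2 := (t (j + 2))(h (j + 2) := ?v)))"
    by (simp only: m clip_def assms(1) if_True)
  obtain a s where s: "\<sigma> j = a # s" using assms(2) by (cases "\<sigma> j") auto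
  show "\<exists>m\<le>1. \<exists>h' t'. exec (set_top is j A g) (h, t) m (h', t') \<and>
        stack_rep (\<sigma>(j := ?v # tl (\<sigma> j))) (h', t') \<and> (\<forall>j<2. h' j = h j \<and> t' j = t j)"
    by (rule exI[of _ 1], intro conjI exI, simp, rule e)
       (use r s in \<open>auto simp: stack_rep_def add.commute\<close>)
qed

lemma sx_pop:
  assumes "\<sigma> j \<noteq> []"
  shows "sx (pop j) \<sigma> (\<sigma>(j := tl (\<sigma> j))) 3"
  unfolding sx_def
proof (intro allI impI)
  fix h t assume r: "stack_rep \<sigma> (h, t)"
  have e: "exec (pop j) (h, t) (Suc (1 + 1))
     (h(j + 2 := h (j + 2) + shift Move_Left),
      t(j + 2 := (t (j + 2))(h (j + 2) := clip 1 ((\<lambda>_. 0) (map (\<lambda>j. t j (h j)) [])))))"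
    unfolding pop_def by (rule exec_Sq[OF exec_Wr exec_Mv])
  obtain a s where s: "\<sigma> j = a # s" using assms by (cases "\<sigma> j") auto
  show "\<exists>m\<le>3. \<exists>h' t'. exec (pop j) (h, t) m (h', t') \<and>
        stack_rep (\<sigma>(j := tl (\<sigma> j))) (h', t') \<and> (\<forall>j<2. h' j = h j \<and> t' j = t j)"
    by (rule exI[of _ "Suc (1 + 1)"], intro conjI exI, simp, rule e)
       (use r s tape_of_pop[of a s] in \<open>auto simp: stack_rep_def clip_def add.commute simp del: tape_of.simps\<close>)
qed

section \<open>Trees on stacks\<close>

datatype tree = Nl | Cn tree tree

text \<open>A prefix code, so trees can be stacked without delimiters; symbol 3 stays free to mark
  the bottom of a temporary segment.\<close>

fun code :: "tree \<Rightarrow> nat list" where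
  "code Nl = [1]"
| "code (Cn x y) = 2 # code x @ code y"

definition sz :: "tree \<Rightarrow> nat" where "sz x = length (code x)"

lemma sz_simps [simp]: "sz Nl = 1" "sz (Cn x y) = Suc (sz x + sz y)"
  by (simp_all add: sz_def)

lemma sz_pos: "sz x \<ge> 1" by (cases x) auto

lemma code_symbols: "a \<in> set (code x) \<Longrightarrow> a = 1 \<or> a = 2"
  by (induction x) auto

lemma sx_cong: "sx c \<sigma> \<sigma>' n \<Longrightarrow> \<sigma>' = \<sigma>'' \<Longrightarrow> n \<le> m \<Longrightarrow> sx c \<sigma> \<sigma>'' m"
  using sx_mono by blast

definition skip :: com where "skip = Mv 2 Move_Stay"

lemma sx_skip: "sx skip \<sigma> \<sigma> 1"
  unfolding sx_def skip_def
proof (intro allI impI)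
  fix h :: "nat \<Rightarrow> int" and t assume r: "stack_rep \<sigma> (h, t)"
  have "exec (Mv 2 Move_Stay) (h, t) 1 (h, t)"
    using exec_Mv[of 2 Move_Stay h t] by simp
  then show "\<exists>m\<le>1. \<exists>h' t'. exec (Mv 2 Move_Stay) (h, t) m (h', t') \<and> stack_rep \<sigma> (h', t') \<and>
      (\<forall>j<2. h' j = h j \<and> t' j = t j)" using r by blast
qed

text \<open>
  Processes the symbols of the tree on top of stack 0 with \<open>b\<close>. Stack 2 counts in unary the
  subtrees that are still to be read, which is how the end of a prefix code is detected.
\<close>

definition scan_body :: "com \<Rightarrow> com" where
  "scan_body b = Bs 0 (\<lambda>s. s = 2) (Sq (push 2 1) b) (Sq (pop 2) b)"

definition scan :: "com \<Rightarrow> com" where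
  "scan b = Sq (push 2 3) (Sq (push 2 1) (Sq (Ws 2 (\<lambda>s. s = 1) (scan_body b)) (pop 2)))"

text \<open>The loop does not stop after a subtree. The statement therefore extends a given run that
  starts behind the code of \<open>x\<close> to one that starts in front of it, which makes the
  induction over \<open>x\<close> compositional.\<close>

lemma scan_loop:
  assumes b: "\<And>\<sigma> a r. \<sigma> 0 = a # r \<Longrightarrow> a < 3 \<Longrightarrow> sx b \<sigma> (\<sigma>(0 := r, 1 := e a (\<sigma> 1))) kb"
    and "sx (Ws 2 (\<lambda>s. s = 1) (scan_body b)) (\<sigma>(0 := r, 1 := fold e (code x) (\<sigma> 1), 2 := u)) \<tau> n"
    and "\<sigma> 0 = code x @ r" "\<sigma> 2 = 1 # u"
  shows "sx (Ws 2 (\<lambda>s. s = 1) (scan_body b)) \<sigma> \<tau> (n + (kb + 8) * sz x)"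
  using assms(2-)
proof (induction x arbitrary: \<sigma> r u n)
  case Nl
  let ?\<sigma>1 = "\<sigma>(2 := u)"
  let ?\<sigma>2 = "?\<sigma>1(0 := r, 1 := e 1 (?\<sigma>1 1))"
  have 1: "sx (pop 2) \<sigma> ?\<sigma>1 3" using sx_pop[of \<sigma> 2] Nl by simp
  have 2: "sx b ?\<sigma>1 ?\<sigma>2 kb" by (rule b) (use Nl in auto)
  have 3: "sx (scan_body b) \<sigma> ?\<sigma>2 (Suc (Suc (3 + kb)))"
    unfolding scan_body_def by (rule sx_BsF[OF _ sx_Sq[OF 1 2]]) (use Nl in auto)
  have eq: "?\<sigma>2 = \<sigma>(0 := r, 1 := fold e (code Nl) (\<sigma> 1), 2 := u)" by (auto simp: fun_eq_iff)
  show ?case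
    by (rule sx_mono[OF sx_WsT[OF _ 3 Nl(1)[folded eq]]]) (use Nl in auto)
next
  case (Cn x y)
  let ?\<sigma>1 = "\<sigma>(2 := 1 # 1 # u)"
  let ?\<sigma>2 = "?\<sigma>1(0 := code x @ code y @ r, 1 := e 2 (?\<sigma>1 1))"
  let ?\<sigma>3 = "?\<sigma>2(0 := code y @ r, 1 := fold e (code x) (?\<sigma>2 1), 2 := 1 # u)"
  have 1: "sx (push 2 1) \<sigma> ?\<sigma>1 3" using sx_push[of 2 1 \<sigma>] Cn by simp
  have 2: "sx b ?\<sigma>1 ?\<sigma>2 kb" by (rule b) (use Cn in auto)
  have 3: "sx (scan_body b) \<sigma> ?\<sigma>2 (Suc (Suc (3 + kb)))"
    unfolding scan_body_def by (rule sx_BsT[OF _ sx_Sq[OF 1 2]]) (use Cn in auto)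
  have eq: "?\<sigma>3(0 := r, 1 := fold e (code y) (?\<sigma>3 1), 2 := u) =
      \<sigma>(0 := r, 1 := fold e (code (Cn x y)) (\<sigma> 1), 2 := u)" by (auto simp: fun_eq_iff)
  have 4: "sx (Ws 2 (\<lambda>s. s = 1) (scan_body b)) ?\<sigma>3 \<tau> (n + (kb + 8) * sz y)"
  proof (rule Cn.IH(2)[where r = r and u = u])
    show "sx (Ws 2 (\<lambda>s. s = 1) (scan_body b)) (?\<sigma>3(0 := r, 1 := fold e (code y) (?\<sigma>3 1), 2 := u)) \<tau> n"
      unfolding eq by (rule Cn.prems(1))
  qed auto
  have 5: "sx (Ws 2 (\<lambda>s. s = 1) (scan_body b)) ?\<sigma>2 \<tau> ((n + (kb + 8) * sz y) + (kb + 8) * sz x)"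
    by (rule Cn.IH(1)[OF 4]) auto
  show ?case
    by (rule sx_mono[OF sx_WsT[OF _ 3 5]]) (use Cn.prems in \<open>auto simp: algebra_simps\<close>)
qed

lemma sx_scan:
  assumes b: "\<And>\<sigma> a r. \<sigma> 0 = a # r \<Longrightarrow> a < 3 \<Longrightarrow> sx b \<sigma> (\<sigma>(0 := r, 1 := e a (\<sigma> 1))) kb"
    and s: "\<sigma> 0 = code x @ r"
  shows "sx (scan b) \<sigma> (\<sigma>(0 := r, 1 := fold e (code x) (\<sigma> 1))) ((kb + 8) * sz x + 15)"
proof -
  \<comment> \<open>The 3 below the counter stops the loop even if stack 2 held further ones
    before.\<close>
  let ?\<sigma>1 = "\<sigma>(2 := 3 # \<sigma> 2)" let ?\<sigma>2 = "\<sigma>(2 := 1 # 3 # \<sigma> 2)"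
  let ?\<sigma>3 = "\<sigma>(0 := r, 1 := fold e (code x) (\<sigma> 1), 2 := 3 # \<sigma> 2)"
  let ?\<sigma>4 = "\<sigma>(0 := r, 1 := fold e (code x) (\<sigma> 1))"
  have 1: "sx (push 2 3) \<sigma> ?\<sigma>1 3" by (rule sx_push)
  have 2: "sx (push 2 1) ?\<sigma>1 ?\<sigma>2 3" using sx_push[of 2 1 ?\<sigma>1] by simp
  have 3: "sx (Ws 2 (\<lambda>s. s = 1) (scan_body b)) ?\<sigma>3 ?\<sigma>3 1" by (rule sx_WsF) simp
  have eq: "?\<sigma>2(0 := r, 1 := fold e (code x) (?\<sigma>2 1), 2 := 3 # \<sigma> 2) = ?\<sigma>3" by (auto simp: fun_eq_iff)
  have 4: "sx (Ws 2 (\<lambda>s. s = 1) (scan_body b)) ?\<sigma>2 ?\<sigma>3 (1 + (kb + 8) * sz x)"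
    by (rule scan_loop[where r = r and u = "3 # \<sigma> 2" and e = e]) (use b 3 s eq in auto)
  have 5: "sx (pop 2) ?\<sigma>3 ?\<sigma>4 3"
    by (rule sx_cong[OF sx_pop]) (auto simp: fun_eq_iff)
  show ?thesis unfolding scan_def
    by (rule sx_mono[OF sx_Sq[OF 1 sx_Sq[OF 2 sx_Sq[OF 4 5]]]]) simp
qed

definition discard :: com where "discard = scan (pop 0)"

lemma sx_discard:
  assumes "\<sigma> 0 = code x @ r"
  shows "sx discard \<sigma> (\<sigma>(0 := r)) (11 * sz x + 15)"
proof -
  have f: "fold (\<lambda>a s. s) w s = s" for w :: "nat list" and s :: "nat list" by (induction w) auto
  have b: "sx (pop 0) \<sigma> (\<sigma>(0 := r, 1 := \<sigma> 1)) 3" if "\<sigma> 0 = a # r" for \<sigma> and a :: nat and r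
    by (rule sx_cong[OF sx_pop]) (use that in \<open>auto simp: fun_eq_iff\<close>)
  show ?thesis unfolding discard_def
    by (rule sx_cong[OF sx_scan[where e = "\<lambda>a s. s" and kb = 3 and x = x and r = r]], erule b)
       (use f assms in \<open>auto simp: fun_eq_iff\<close>)
qed

definition save :: com where "save = Sq (push 1 3) (scan (Sq (cpy 4 0 1) (pop 0)))"

lemma sx_save:
  assumes "\<sigma> 0 = code x @ r"
  shows "sx save \<sigma> (\<sigma>(0 := r, 1 := rev (code x) @ 3 # \<sigma> 1)) (15 * sz x + 20)"
proof -
  have b: "sx (Sq (cpy 4 0 1) (pop 0)) \<sigma> (\<sigma>(0 := r, 1 := a # \<sigma> 1)) 7" if "\<sigma> 0 = a # r" "a < 3"
    for \<sigma> a r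
    by (rule sx_cong[OF sx_Sq[OF sx_cpy sx_pop]]) (use that in \<open>auto simp: fun_eq_iff\<close>)
  have f: "fold (#) w s = rev w @ s" for w s :: "nat list" by (induction w arbitrary: s) auto
  have 1: "sx (push 1 3) \<sigma> (\<sigma>(1 := 3 # \<sigma> 1)) 3" by (rule sx_push)
  have 2: "sx (scan (Sq (cpy 4 0 1) (pop 0))) (\<sigma>(1 := 3 # \<sigma> 1))
     (\<sigma>(0 := r, 1 := rev (code x) @ 3 # \<sigma> 1)) (15 * sz x + 15)"
    by (rule sx_cong[OF sx_scan[where e = "(#)" and kb = 7]])
       (use assms f b in \<open>auto simp: fun_eq_iff\<close>)
  show ?thesis unfolding save_def by (rule sx_mono[OF sx_Sq[OF 1 2]]) simp
qed

lemma sx_move_loop: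
  assumes "\<sigma> i = w @ 3 # s" "\<And>a. a \<in> set w \<Longrightarrow> a < 3" "i \<noteq> j"
  shows "sx (Ws i (\<lambda>s. s \<noteq> 3) (Sq (cpy 4 i j) (pop i))) \<sigma> (\<sigma>(i := 3 # s, j := rev w @ \<sigma> j))
           (8 * length w + 1)"
  using assms
proof (induction w arbitrary: \<sigma>)
  case Nil
  have eq: "\<sigma>(i := 3 # s, j := rev [] @ \<sigma> j) = \<sigma>" using Nil by (auto simp: fun_eq_iff)
  show ?case unfolding eq by (rule sx_mono[OF sx_WsF]) (use Nil in auto)
next
  case (Cons a w)
  let ?\<sigma>1 = "\<sigma>(j := a # \<sigma> j, i := w @ 3 # s)"
  have a4: "a < 4" using Cons.prems(2)[of a] by simp
  have 1: "sx (Sq (cpy 4 i j) (pop i)) \<sigma> ?\<sigma>1 7"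
    by (rule sx_cong[OF sx_Sq[OF sx_cpy sx_pop]]) (use a4 Cons.prems(1,3) in \<open>auto simp: fun_eq_iff\<close>)
  have 2: "sx (Ws i (\<lambda>s. s \<noteq> 3) (Sq (cpy 4 i j) (pop i))) ?\<sigma>1
     (\<sigma>(i := 3 # s, j := rev (a # w) @ \<sigma> j)) (8 * length w + 1)"
    by (rule sx_cong[OF Cons.IH]) (use Cons.prems in \<open>auto simp: fun_eq_iff\<close>)
  show ?case by (rule sx_mono[OF sx_WsT[OF _ 1 2]]) (use Cons.prems(1) Cons.prems(2)[of a] in auto)
qed

definition restore :: com where
  "restore = Sq (Ws 1 (\<lambda>s. s \<noteq> 3) (Sq (cpy 4 1 0) (pop 1))) (pop 1)"

lemma code_lt: "a \<in> set (rev (code x)) \<Longrightarrow> a < 3" "a \<in> set (code x) \<Longrightarrow> a < 3"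
  using code_symbols[of a x] by auto

lemma sx_restore:
  assumes "\<sigma> 1 = rev (code x) @ 3 # s"
  shows "sx restore \<sigma> (\<sigma>(0 := code x @ \<sigma> 0, 1 := s)) (8 * sz x + 5)"
  unfolding restore_def
  by (rule sx_cong[OF sx_Sq[OF sx_move_loop[where w = "rev (code x)" and s = s] sx_pop]])
     (use assms code_lt(1) in \<open>auto simp: fun_eq_iff sz_def\<close>)

text \<open>Brings the saved tree back to stack 0 and keeps it saved. Reading stack 1 destroys it,
  so a second copy is collected on stack 3 and then returned.\<close>

definition peek :: com where
  "peek = Sq (push 3 3) (Sq (Ws 1 (\<lambda>s. s \<noteq> 3) (Sq (cpy 4 1 3) (Sq (cpy 4 1 0) (pop 1))))
     (Sq (Ws 3 (\<lambda>s. s \<noteq> 3) (Sq (cpy 4 3 1) (pop 3))) (pop 3)))"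

lemma sx_copy_loop:
  assumes "\<sigma> 1 = w @ 3 # s" "\<And>a. a \<in> set w \<Longrightarrow> a < 3"
  shows "sx (Ws 1 (\<lambda>s. s \<noteq> 3) (Sq (cpy 4 1 3) (Sq (cpy 4 1 0) (pop 1)))) \<sigma>
     (\<sigma>(1 := 3 # s, 3 := rev w @ \<sigma> 3, 0 := rev w @ \<sigma> 0)) (12 * length w + 1)"
  using assms
proof (induction w arbitrary: \<sigma>)
  case Nil
  have eq: "\<sigma>(1 := 3 # s, 3 := rev [] @ \<sigma> 3, 0 := rev [] @ \<sigma> 0) = \<sigma>" using Nil by (auto simp: fun_eq_iff)
  show ?case unfolding eq by (rule sx_mono[OF sx_WsF]) (use Nil in auto)
next
  case (Cons a w)
  let ?\<sigma>1 = "\<sigma>(3 := a # \<sigma> 3, 0 := a # \<sigma> 0, 1 := w @ 3 # s)"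
  have a4: "a < 4" using Cons.prems(2)[of a] by simp
  have 1: "sx (Sq (cpy 4 1 3) (Sq (cpy 4 1 0) (pop 1))) \<sigma> ?\<sigma>1 11"
    by (rule sx_cong[OF sx_Sq[OF sx_cpy sx_Sq[OF sx_cpy sx_pop]]])
       (use a4 Cons.prems(1) in \<open>auto simp: fun_eq_iff\<close>)
  have 2: "sx (Ws 1 (\<lambda>s. s \<noteq> 3) (Sq (cpy 4 1 3) (Sq (cpy 4 1 0) (pop 1)))) ?\<sigma>1
     (\<sigma>(1 := 3 # s, 3 := rev (a # w) @ \<sigma> 3, 0 := rev (a # w) @ \<sigma> 0)) (12 * length w + 1)"
    by (rule sx_cong[OF Cons.IH]) (use Cons.prems in \<open>auto simp: fun_eq_iff\<close>)
  show ?case by (rule sx_mono[OF sx_WsT[OF _ 1 2]]) (use Cons.prems(1) Cons.prems(2)[of a] in auto)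
qed

lemma sx_peek:
  assumes "\<sigma> 1 = rev (code x) @ 3 # s"
  shows "sx peek \<sigma> (\<sigma>(0 := code x @ \<sigma> 0)) (20 * sz x + 20)"
proof -
  let ?\<sigma>1 = "\<sigma>(3 := 3 # \<sigma> 3)"
  let ?\<sigma>2 = "\<sigma>(1 := 3 # s, 3 := code x @ 3 # \<sigma> 3, 0 := code x @ \<sigma> 0)"
  let ?\<sigma>3 = "\<sigma>(3 := 3 # \<sigma> 3, 0 := code x @ \<sigma> 0)"
  have 1: "sx (push 3 3) \<sigma> ?\<sigma>1 3" by (rule sx_push)
  have 2: "sx (Ws 1 (\<lambda>s. s \<noteq> 3) (Sq (cpy 4 1 3) (Sq (cpy 4 1 0) (pop 1)))) ?\<sigma>1 ?\<sigma>2 (12 * sz x + 1)"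
    by (rule sx_cong[OF sx_copy_loop[where w = "rev (code x)" and s = s]])
       (use assms code_lt(1) in \<open>auto simp: fun_eq_iff sz_def\<close>)
  have 3: "sx (Ws 3 (\<lambda>s. s \<noteq> 3) (Sq (cpy 4 3 1) (pop 3))) ?\<sigma>2 ?\<sigma>3 (8 * sz x + 1)"
    by (rule sx_cong[OF sx_move_loop[where w = "code x" and s = "\<sigma> 3"]])
       (use assms code_lt(2) in \<open>auto simp: fun_eq_iff sz_def\<close>)
  have 4: "sx (pop 3) ?\<sigma>3 (\<sigma>(0 := code x @ \<sigma> 0)) 3"
    by (rule sx_cong[OF sx_pop]) (auto simp: fun_eq_iff)
  show ?thesis unfolding peek_def
    by (rule sx_mono[OF sx_Sq[OF 1 sx_Sq[OF 2 sx_Sq[OF 3 4]]]]) simp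
qed

definition dup :: com where "dup = Sq save (Sq peek restore)"

lemma sx_dup:
  assumes "\<sigma> 0 = code x @ r"
  shows "sx dup \<sigma> (\<sigma>(0 := code x @ code x @ r)) (50 * sz x + 50)"
proof -
  let ?\<sigma>1 = "\<sigma>(0 := r, 1 := rev (code x) @ 3 # \<sigma> 1)"
  let ?\<sigma>2 = "?\<sigma>1(0 := code x @ ?\<sigma>1 0)"
  have 1: "sx save \<sigma> ?\<sigma>1 (15 * sz x + 20)" by (rule sx_save, rule assms)
  have 2: "sx peek ?\<sigma>1 ?\<sigma>2 (20 * sz x + 20)" by (rule sx_peek) simp
  have 3: "sx restore ?\<sigma>2 (?\<sigma>2(0 := code x @ ?\<sigma>2 0, 1 := \<sigma> 1)) (8 * sz x + 5)"
    by (rule sx_restore) simp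
  show ?thesis unfolding dup_def
    by (rule sx_cong[OF sx_Sq[OF 1 sx_Sq[OF 2 3]]]) (auto simp: fun_eq_iff)
qed

text \<open>
  \<open>cr c x y t\<close>: the program \<open>c\<close> replaces the tree \<open>x\<close> on top of stack 0 by \<open>y\<close> in time \<open>t\<close>, without
  any other effect. The stacks from 4 on are reserved for the simulation of a given machine.
\<close>

definition cr :: "com \<Rightarrow> tree \<Rightarrow> tree \<Rightarrow> nat \<Rightarrow> bool" where
  "cr c x y t \<longleftrightarrow> (\<forall>\<sigma> r. \<sigma> 0 = code x @ r \<and> (\<forall>j\<ge>4. \<sigma> j = []) \<longrightarrow> sx c \<sigma> (\<sigma>(0 := code y @ r)) t)"

lemma crI:
  "(\<And>\<sigma> r. \<sigma> 0 = code x @ r \<Longrightarrow> \<forall>j\<ge>4. \<sigma> j = [] \<Longrightarrow> sx c \<sigma> (\<sigma>(0 := code y @ r)) t) \<Longrightarrow> cr c x y t"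
  by (auto simp: cr_def)

lemma crD:
  assumes "cr c x y t" "\<sigma> 0 = code x @ r" "\<forall>j\<ge>4. \<sigma> j = []" "\<sigma>(0 := code y @ r) = \<sigma>'"
  shows "sx c \<sigma> \<sigma>' t"
  using assms by (auto simp: cr_def)

lemma cr_mono: "cr c x y t \<Longrightarrow> t \<le> t' \<Longrightarrow> cr c x y t'"
  unfolding cr_def using sx_mono by blast

lemma cr_Sq: "cr a x y t \<Longrightarrow> cr b y z u \<Longrightarrow> cr (Sq a b) x z (Suc (t + u))"
  by (rule crI, rule sx_Sq[where ?\<sigma>1.0 = "_(0 := code y @ _)"])
     (auto intro!: crD[of a] crD[of b])

lemma cr_skip: "cr skip x x 1"
  by (rule crI, rule sx_cong[OF sx_skip]) auto

definition pairc :: "com \<Rightarrow> com \<Rightarrow> com" where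
  "pairc f g = Sq dup (Sq f (Sq save (Sq g (Sq restore (push 0 2)))))"

text \<open>The result of \<open>f\<close> waits on stack 1 while \<open>g\<close> runs on the
  duplicate; \<open>cr\<close> allows arbitrary contents there, so \<open>g\<close> cannot disturb
  it.\<close>

lemma cr_pairc:
  assumes "cr f x y t" "cr g x z u"
  shows "cr (pairc f g) x (Cn y z) (t + u + 100 * (sz x + sz y))"
proof (rule crI)
  fix \<sigma> :: "nat \<Rightarrow> nat list" and r assume s: "\<sigma> 0 = code x @ r" "\<forall>j\<ge>4. \<sigma> j = []"
  let ?\<sigma>1 = "\<sigma>(0 := code x @ code x @ r)"
  let ?\<sigma>2 = "\<sigma>(0 := code y @ code x @ r)"
  let ?\<sigma>3 = "\<sigma>(0 := code x @ r, 1 := rev (code y) @ 3 # \<sigma> 1)"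
  let ?\<sigma>4 = "\<sigma>(0 := code z @ r, 1 := rev (code y) @ 3 # \<sigma> 1)"
  let ?\<sigma>5 = "\<sigma>(0 := code y @ code z @ r)"
  have 1: "sx dup \<sigma> ?\<sigma>1 (50 * sz x + 50)" by (rule sx_dup, rule s(1))
  have 2: "sx f ?\<sigma>1 ?\<sigma>2 t" by (rule crD[OF assms(1)]) (use s in auto)
  have 3: "sx save ?\<sigma>2 ?\<sigma>3 (15 * sz y + 20)" by (rule sx_cong[OF sx_save]) auto
  have 4: "sx g ?\<sigma>3 ?\<sigma>4 u" by (rule crD[OF assms(2)]) (use s in auto)
  have 5: "sx restore ?\<sigma>4 ?\<sigma>5 (8 * sz y + 5)" by (rule sx_cong[OF sx_restore]) (auto simp: fun_eq_iff)
  have 6: "sx (push 0 2) ?\<sigma>5 (\<sigma>(0 := code (Cn y z) @ r)) 3" by (rule sx_cong[OF sx_push]) auto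
  show "sx (pairc f g) \<sigma> (\<sigma>(0 := code (Cn y z) @ r)) (t + u + 100 * (sz x + sz y))"
    unfolding pairc_def
    by (rule sx_mono[OF sx_Sq[OF 1 sx_Sq[OF 2 sx_Sq[OF 3 sx_Sq[OF 4 sx_Sq[OF 5 6]]]]]])
       (use sz_pos[of x] sz_pos[of y] in simp)
qed

fun tfst :: "tree \<Rightarrow> tree" where "tfst Nl = Nl" | "tfst (Cn x y) = x"
fun tsnd :: "tree \<Rightarrow> tree" where "tsnd Nl = Nl" | "tsnd (Cn x y) = y"

definition fstc :: com where
  "fstc = Bs 0 (\<lambda>s. s = 2) (Sq (pop 0) (Sq save (Sq discard restore))) skip"
definition sndc :: com where
  "sndc = Bs 0 (\<lambda>s. s = 2) (Sq (pop 0) discard) skip"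

lemma cr_fstc: "cr fstc x (tfst x) (100 * sz x)"
proof (rule crI)
  fix \<sigma> :: "nat \<Rightarrow> nat list" and r assume s: "\<sigma> 0 = code x @ r" "\<forall>j\<ge>4. \<sigma> j = []"
  show "sx fstc \<sigma> (\<sigma>(0 := code (tfst x) @ r)) (100 * sz x)"
  proof (cases x)
    case Nl
    then have "\<sigma>(0 := code (tfst x) @ r) = \<sigma>" using s by (auto simp: fun_eq_iff)
    then show ?thesis unfolding fstc_def
      by (intro sx_cong[OF sx_BsF[OF _ sx_skip]]) (use s Nl in auto)
  next
    case (Cn a b)
    let ?\<sigma>1 = "\<sigma>(0 := code a @ code b @ r)"
    let ?\<sigma>2 = "\<sigma>(0 := code b @ r, 1 := rev (code a) @ 3 # \<sigma> 1)"
    let ?\<sigma>3 = "\<sigma>(0 := r, 1 := rev (code a) @ 3 # \<sigma> 1)"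
    have 1: "sx (pop 0) \<sigma> ?\<sigma>1 3" by (rule sx_cong[OF sx_pop]) (use s Cn in auto)
    have 2: "sx save ?\<sigma>1 ?\<sigma>2 (15 * sz a + 20)" by (rule sx_cong[OF sx_save]) auto
    have 3: "sx discard ?\<sigma>2 ?\<sigma>3 (11 * sz b + 15)" by (rule sx_cong[OF sx_discard]) (auto simp: fun_eq_iff)
    have 4: "sx restore ?\<sigma>3 (\<sigma>(0 := code a @ r)) (8 * sz a + 5)"
      by (rule sx_cong[OF sx_restore]) (auto simp: fun_eq_iff)
    show ?thesis unfolding fstc_def
      by (rule sx_cong[OF sx_BsT[OF _ sx_Sq[OF 1 sx_Sq[OF 2 sx_Sq[OF 3 4]]]]]) (use s Cn in auto)
  qed
qed

lemma cr_sndc: "cr sndc x (tsnd x) (100 * sz x)"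
proof (rule crI)
  fix \<sigma> :: "nat \<Rightarrow> nat list" and r assume s: "\<sigma> 0 = code x @ r" "\<forall>j\<ge>4. \<sigma> j = []"
  show "sx sndc \<sigma> (\<sigma>(0 := code (tsnd x) @ r)) (100 * sz x)"
  proof (cases x)
    case Nl
    then have "\<sigma>(0 := code (tsnd x) @ r) = \<sigma>" using s by (auto simp: fun_eq_iff)
    then show ?thesis unfolding sndc_def
      by (intro sx_cong[OF sx_BsF[OF _ sx_skip]]) (use s Nl in auto)
  next
    case (Cn a b)
    let ?\<sigma>1 = "\<sigma>(0 := code a @ code b @ r)"
    have 1: "sx (pop 0) \<sigma> ?\<sigma>1 3" by (rule sx_cong[OF sx_pop]) (use s Cn in auto)
    have 3: "sx discard ?\<sigma>1 (\<sigma>(0 := code b @ r)) (11 * sz a + 15)"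
      by (rule sx_cong[OF sx_discard]) auto
    show ?thesis unfolding sndc_def
      by (rule sx_cong[OF sx_BsT[OF _ sx_Sq[OF 1 3]]]) (use s Cn in auto)
  qed
qed

definition cndc :: "com \<Rightarrow> com \<Rightarrow> com \<Rightarrow> com" where
  "cndc p f g = Sq dup (Sq p (Bs 0 (\<lambda>s. s = 2) (Sq discard f) (Sq discard g)))"

lemma cr_cndc:
  assumes "cr p x b tp" "cr (if b \<noteq> Nl then f else g) x y t"
  shows "cr (cndc p f g) x y (tp + t + 200 * (sz x + sz b))"
proof (rule crI)
  fix \<sigma> :: "nat \<Rightarrow> nat list" and r assume s: "\<sigma> 0 = code x @ r" "\<forall>j\<ge>4. \<sigma> j = []"
  let ?\<sigma>1 = "\<sigma>(0 := code x @ code x @ r)"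
  let ?\<sigma>2 = "\<sigma>(0 := code b @ code x @ r)"
  have 1: "sx dup \<sigma> ?\<sigma>1 (50 * sz x + 50)" by (rule sx_dup, rule s(1))
  have 2: "sx p ?\<sigma>1 ?\<sigma>2 tp" by (rule crD[OF assms(1)]) (use s in auto)
  have 3: "sx discard ?\<sigma>2 \<sigma> (11 * sz b + 15)"
    by (rule sx_cong[OF sx_discard]) (use s in \<open>auto simp: fun_eq_iff\<close>)
  have 4: "sx (if b \<noteq> Nl then f else g) \<sigma> (\<sigma>(0 := code y @ r)) t"
    by (rule crD[OF assms(2)]) (use s in auto)
  have 5: "sx (Bs 0 (\<lambda>s. s = 2) (Sq discard f) (Sq discard g)) ?\<sigma>2 (\<sigma>(0 := code y @ r))
      (Suc (Suc (11 * sz b + 15 + t)))"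
  proof (cases "b = Nl")
    case True
    then show ?thesis by (intro sx_BsF sx_Sq[OF 3]) (use 4 in auto)
  next
    case False
    then have "top_sym (?\<sigma>2 0) = 2" by (cases b) auto
    with False show ?thesis by (intro sx_BsT sx_Sq[OF 3]) (use 4 in auto)
  qed
  show "sx (cndc p f g) \<sigma> (\<sigma>(0 := code y @ r)) (tp + t + 200 * (sz x + sz b))"
    unfolding cndc_def by (rule sx_mono[OF sx_Sq[OF 1 sx_Sq[OF 2 5]]]) (use sz_pos[of x] in simp)
qed

definition whc :: "com \<Rightarrow> com \<Rightarrow> com" where
  "whc p f = Sq dup (Sq p (Sq (Ws 0 (\<lambda>s. s = 2) (Sq discard (Sq f (Sq dup p)))) discard))"

text \<open>The run is given by its states \<open>y i\<close>, and its cost is a sum over the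
  rounds, so that nothing is assumed about how many rounds there are; some later loops have
  exponentially many.\<close>

lemma cr_whc:
  assumes p: "\<And>i. i \<le> n \<Longrightarrow> cr p (y i) (b i) (tp i)"
    and b: "\<And>i. i < n \<Longrightarrow> b i \<noteq> Nl" "b n = Nl"
    and f: "\<And>i. i < n \<Longrightarrow> cr f (y i) (y (Suc i)) (tf i)"
    and sb: "\<And>i. i \<le> n \<Longrightarrow> sz (b i) \<le> sz (y i)"
  shows "cr (whc p f) (y 0) (y n) ((\<Sum>i\<le>n. tp i + 200 * sz (y i)) + (\<Sum>i<n. tf i))"
proof (rule crI)
  fix \<sigma> :: "nat \<Rightarrow> nat list" and r assume s: "\<sigma> 0 = code (y 0) @ r" "\<forall>j\<ge>4. \<sigma> j = []"
  define st where "st i = \<sigma>(0 := code (b i) @ code (y i) @ r)" for i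
  let ?W = "Ws 0 (\<lambda>s. s = 2) (Sq discard (Sq f (Sq dup p)))"
  have enter: "sx (Sq dup p) (\<sigma>(0 := code (y i) @ r)) (st i) (50 * sz (y i) + 51 + tp i)"
    if "i \<le> n" for i
  proof -
    have 1: "sx dup (\<sigma>(0 := code (y i) @ r)) (\<sigma>(0 := code (y i) @ code (y i) @ r)) (50 * sz (y i) + 50)"
      by (rule sx_cong[OF sx_dup]) auto
    have 2: "sx p (\<sigma>(0 := code (y i) @ code (y i) @ r)) (st i) (tp i)"
      by (rule crD[OF p[OF that]]) (use s in \<open>auto simp: st_def\<close>)
    show ?thesis by (rule sx_mono[OF sx_Sq[OF 1 2]]) simp
  qed
  \<comment> \<open>Backwards from the exit: \<open>j\<close> is the number of rounds that
    remain.\<close>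
  have loop: "sx ?W (st (n - j)) (st n) (1 + (\<Sum>i\<in>{n-j..<n}. tf i + tp (Suc i) + 50 * sz (y (Suc i)) + 11 * sz (y i) + 100))"
    if "j \<le> n" for j using that
  proof (induction j)
    case 0
    show ?case by (rule sx_cong[OF sx_WsF]) (use b(2) in \<open>auto simp: st_def\<close>)
  next
    case (Suc j)
    define i where "i = n - Suc j"
    have i: "i < n" "n - j = Suc i" using Suc.prems by (auto simp: i_def)
    have 1: "sx discard (st i) (\<sigma>(0 := code (y i) @ r)) (11 * sz (b i) + 15)"
      by (rule sx_cong[OF sx_discard]) (auto simp: st_def)
    have 2: "sx f (\<sigma>(0 := code (y i) @ r)) (\<sigma>(0 := code (y (Suc i)) @ r)) (tf i)"
      by (rule crD[OF f]) (use s i in auto)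
    have 3: "sx (Sq discard (Sq f (Sq dup p))) (st i) (st (Suc i))
       (11 * sz (b i) + 15 + (tf i + (50 * sz (y (Suc i)) + 51 + tp (Suc i)) + 1) + 1)"
      by (rule sx_mono[OF sx_Sq[OF 1 sx_Sq[OF 2 enter]]]) (use i in auto)
    have t: "(\<lambda>s. s = 2) (top_sym (st i 0))" using b(1)[OF i(1)] by (cases "b i") (auto simp: st_def)
    have 4: "{i..<n} = insert i {Suc i..<n}" using i by auto
    show ?case unfolding i_def[symmetric] 4
      by (rule sx_mono[OF sx_WsT[OF t 3 Suc.IH[unfolded i(2)]]]) (use Suc.prems sb[of i] i in auto)
  qed
  have fin: "sx discard (st n) (\<sigma>(0 := code (y n) @ r)) (11 * sz (b n) + 15)"
    by (rule sx_cong[OF sx_discard]) (auto simp: st_def)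
  have s0: "\<sigma>(0 := code (y 0) @ r) = \<sigma>" using s by (auto simp: fun_eq_iff)
  have e1: "sx dup \<sigma> (\<sigma>(0 := code (y 0) @ code (y 0) @ r)) (50 * sz (y 0) + 50)" by (rule sx_dup, rule s(1))
  have e2: "sx p (\<sigma>(0 := code (y 0) @ code (y 0) @ r)) (st 0) (tp 0)"
    by (rule crD[OF p]) (use s in \<open>auto simp: st_def\<close>)
  have l: "sx ?W (st 0) (st n) (1 + (\<Sum>i<n. tf i + tp (Suc i) + 50 * sz (y (Suc i)) + 11 * sz (y i) + 100))"
    using loop[of n] by (simp add: atLeast0LessThan)
  have a: "sum tp {..n} = tp 0 + (\<Sum>i<n. tp (Suc i))"
    "(\<Sum>i\<le>n. sz (y i)) = sz (y 0) + (\<Sum>i<n. sz (y (Suc i)))"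
    by (simp_all add: sum.atMost_shift)
  have c: "(\<Sum>i<n. sz (y i)) \<le> sz (y 0) + (\<Sum>i<n. sz (y (Suc i)))"
    using sum.lessThan_Suc_shift[of "\<lambda>i. sz (y i)" n] by simp
  have d: "(\<Sum>i<n. 1) \<le> (\<Sum>i<n. sz (y (Suc i)))" by (rule sum_mono) (use sz_pos in auto)
  show "sx (whc p f) \<sigma> (\<sigma>(0 := code (y n) @ r)) ((\<Sum>i\<le>n. tp i + 200 * sz (y i)) + (\<Sum>i<n. tf i))"
    unfolding whc_def
    by (rule sx_mono[OF sx_Sq[OF e1 sx_Sq[OF e2 sx_Sq[OF l fin]]]])
       (use c d sz_pos[of "y 0"] b(2) in \<open>simp add: a sum.distrib sum_distrib_left[symmetric]\<close>)
qed

fun ltree :: "tree list \<Rightarrow> tree" where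
  "ltree [] = Nl" | "ltree (x # xs) = Cn x (ltree xs)"

definition foldc :: "com \<Rightarrow> com" where
  "foldc f = Sq (whc fstc (pairc (Sq fstc sndc) (Sq (pairc (Sq fstc fstc) sndc) f))) sndc"

text \<open>Every round copies the remaining list and the accumulator, hence the sum of their sizes
  over all rounds on top of the cost of \<open>f\<close>.\<close>

lemma cr_foldc:
  assumes f: "\<And>i. i < length xs \<Longrightarrow> cr f (Cn (xs ! i) (s i)) (s (Suc i)) (tf i)"
  shows "cr (foldc f) (Cn (ltree xs) (s 0)) (s (length xs))
     ((\<Sum>i<length xs. tf i) + 3000 * (\<Sum>i\<le>length xs. sz (ltree xs) + sz (s i) + 1))"
proof -
  define n where "n = length xs"
  define y where "y i = Cn (ltree (drop i xs)) (s i)" for i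
  have le: "sz (ltree (drop i xs)) \<le> sz (ltree xs)" for i
  proof (induction i)
    case (Suc i)
    have "sz (ltree (drop (Suc i) xs)) \<le> sz (ltree (drop i xs))"
      by (simp add: drop_Suc drop_tl) (cases "drop i xs"; simp)
    then show ?case using Suc by simp
  qed simp
  have dr: "drop i xs = xs ! i # drop (Suc i) xs" if "i < n" for i
    using that by (simp add: n_def Cons_nth_drop_Suc)
  define u where "u i = sz (ltree xs) + sz (s i) + 1" for i
  have f': "cr (pairc (Sq fstc sndc) (Sq (pairc (Sq fstc fstc) sndc) f)) (y i) (y (Suc i))
       (tf i + 1500 * u i)" if i: "i < n" for i
  proof -
    let ?d = "ltree (drop (Suc i) xs)"
    have yi: "y i = Cn (Cn (xs ! i) ?d) (s i)" using dr[OF i] by (simp add: y_def)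
    have szy: "sz (y i) \<le> u i" using le[of i] by (simp add: y_def u_def)
    have 1: "cr (Sq fstc sndc) (y i) ?d (Suc (100 * sz (y i) + 100 * sz (tfst (y i))))"
      using cr_Sq[OF cr_fstc cr_sndc, of "y i"] by (simp add: yi)
    have 2: "cr (Sq fstc fstc) (y i) (xs ! i) (Suc (100 * sz (y i) + 100 * sz (tfst (y i))))"
      using cr_Sq[OF cr_fstc cr_fstc, of "y i"] by (simp add: yi)
    have 3: "cr sndc (y i) (s i) (100 * sz (y i))" using cr_sndc[of "y i"] by (simp add: yi)
    note 4 = cr_pairc[OF 1 cr_Sq[OF cr_pairc[OF 2 3] f[OF i[unfolded n_def]]]]
    have 5: "sz (tfst (y i)) \<le> sz (y i)" "sz (xs ! i) \<le> sz (y i)" "sz ?d \<le> sz (y i)" by (auto simp: yi)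
    show ?thesis
      by (rule cr_mono[OF 4[folded y_def[of "Suc i"]]]) (insert 5 szy sz_pos[of "y i"], simp)
  qed
  have "cr (whc fstc (pairc (Sq fstc sndc) (Sq (pairc (Sq fstc fstc) sndc) f))) (y 0) (y n)
     ((\<Sum>i\<le>n. 100 * sz (y i) + 200 * sz (y i)) + (\<Sum>i<n. tf i + 1500 * u i))"
  proof (rule cr_whc[where b = "\<lambda>i. tfst (y i)"])
    show "tfst (y i) \<noteq> Nl" if "i < n" for i using dr[OF that] by (simp add: y_def)
    show "cr fstc (y i) (tfst (y i)) (100 * sz (y i))" for i by (rule cr_fstc)
  qed (use f' in \<open>auto simp: y_def n_def\<close>)
  from cr_Sq[OF this cr_sndc]
  have 6: "cr (foldc f) (y 0) (s n) (Suc ((\<Sum>i\<le>n. 100 * sz (y i) + 200 * sz (y i)) +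
      (\<Sum>i<n. tf i + 1500 * u i) + 100 * sz (y n)))"
    by (simp add: foldc_def y_def)
  have szy: "sz (y i) \<le> u i" for i using le[of i] by (simp add: y_def u_def)
  have a: "(\<Sum>i\<le>n. sz (y i)) \<le> (\<Sum>i\<le>n. u i)" by (rule sum_mono) (rule szy)
  have c: "(\<Sum>i<n. u i) \<le> (\<Sum>i\<le>n. u i)" by (rule sum_mono2) auto
  have d: "u n \<le> (\<Sum>i\<le>n. u i)" by (rule member_le_sum) auto
  have e: "u n \<ge> 1" by (simp add: u_def)
  have "cr (foldc f) (y 0) (s n) ((\<Sum>i<n. tf i) + 3000 * (\<Sum>i\<le>n. u i))"
    by (rule cr_mono[OF 6]) (use a c d e szy[of n] in \<open>simp add: sum.distrib sum_distrib_left[symmetric]\<close>)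
  then show ?thesis by (simp add: y_def n_def u_def)
qed

section \<open>Polynomial-time functions\<close>

text \<open>One number serves as coefficient and as exponent. Up to enlarging \<open>d\<close>, the
  family is closed under sums, products and composition.\<close>

definition pl :: "nat \<Rightarrow> nat \<Rightarrow> nat" where "pl d n = d * (n + 1) ^ d"

lemma pl_mono: "d \<le> e \<Longrightarrow> m \<le> n \<Longrightarrow> pl d m \<le> pl e n"
proof -
  assume "d \<le> e" "m \<le> n"
  have "(m + 1) ^ d \<le> (n + 1) ^ d" using \<open>m \<le> n\<close> by (intro power_mono) auto
  also have "\<dots> \<le> (n + 1) ^ e" using \<open>d \<le> e\<close> by (intro power_increasing) auto
  finally show ?thesis unfolding pl_def using \<open>d \<le> e\<close> by (intro mult_le_mono)
qed

definition PB :: "(nat \<Rightarrow> nat) \<Rightarrow> bool" where "PB f \<longleftrightarrow> (\<exists>d. \<forall>n. f n \<le> pl d n)"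

lemma PB_const: "PB (\<lambda>n. c)"
  unfolding PB_def pl_def by (rule exI[of _ c]) simp

lemma PB_id: "PB (\<lambda>n. n)"
  unfolding PB_def pl_def by (rule exI[of _ 1]) simp

lemma PB_pl: "PB (pl d)"
  unfolding PB_def by blast

lemma PB_le: "PB g \<Longrightarrow> (\<And>n. f n \<le> g n) \<Longrightarrow> PB f"
  unfolding PB_def by (meson order_trans)

lemma PB_add: assumes "PB f" "PB g" shows "PB (\<lambda>n. f n + g n)"
proof -
  obtain d e where d: "\<And>n. f n \<le> pl d n" and e: "\<And>n. g n \<le> pl e n" using assms unfolding PB_def by blast
  have "pl d n + pl e n \<le> pl (d + e) n" for n
  proof -
    have "d * (n + 1) ^ d \<le> d * (n + 1) ^ (d + e)" "e * (n + 1) ^ e \<le> e * (n + 1) ^ (d + e)"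
      by (auto intro: mult_le_mono2 power_increasing)
    then show ?thesis unfolding pl_def add_mult_distrib by (rule add_mono)
  qed
  then show ?thesis unfolding PB_def by (meson add_mono d e order_trans)
qed

lemma PB_mult: assumes "PB f" "PB g" shows "PB (\<lambda>n. f n * g n)"
proof -
  obtain d e where d: "\<And>n. f n \<le> pl d n" and e: "\<And>n. g n \<le> pl e n" using assms unfolding PB_def by blast
  have "pl d n * pl e n \<le> pl (d * e + d + e) n" for n
  proof -
    have "pl d n * pl e n = (d * e) * (n + 1) ^ (d + e)" by (simp add: pl_def power_add)
    also have "\<dots> \<le> (d * e + d + e) * (n + 1) ^ (d * e + d + e)"
      by (intro mult_le_mono power_increasing) auto
    finally show ?thesis by (simp add: pl_def)
  qed
  then show ?thesis unfolding PB_def by (meson mult_le_mono d e order_trans)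
qed

lemma PB_comp_pl: assumes "PB g" shows "PB (\<lambda>n. pl d (g n))"
proof -
  obtain e where e: "\<And>n. g n \<le> pl e n" using assms unfolding PB_def by blast
  have pw: "PB (\<lambda>n. (pl e n + 1) ^ k)" for k
    by (induction k) (auto intro!: PB_mult PB_add PB_pl PB_const)
  have "pl d (g n) \<le> d * (pl e n + 1) ^ d" for n
    unfolding pl_def[of d] by (intro mult_le_mono2 power_mono add_mono e) auto
  from PB_le[OF PB_mult[OF PB_const pw] this] show ?thesis .
qed

lemmas PB_intros = PB_const PB_id PB_pl PB_add PB_mult PB_comp_pl

lemma PB_obtain: assumes "PB f" obtains d where "\<And>n. f n \<le> pl d n"
  using assms unfolding PB_def by blast

text \<open>Injectivity makes equality of values testable by comparing codes.\<close>

class enc =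
  fixes enc :: "'a \<Rightarrow> tree"
  assumes enc_inj: "enc x = enc y \<Longrightarrow> x = y"

abbreviation es :: "'a::enc \<Rightarrow> nat" where "es x \<equiv> sz (enc x)"

instantiation unit :: enc begin
definition "enc (x::unit) = Nl"
instance by standard auto
end

instantiation bool :: enc begin
definition "enc b = (if b then Cn Nl Nl else Nl)"
instance by standard (auto simp: enc_bool_def split: if_splits)
end

text \<open>Unary: numbers of this type are indices, lengths and constants. Large numbers are
  handled as binary words of type \<open>nat list\<close>.\<close>

instantiation nat :: enc begin
primrec enc_nat :: "nat \<Rightarrow> tree" where
  "enc_nat 0 = Nl" | "enc_nat (Suc n) = Cn Nl (enc_nat n)"
instance
proof
  fix x y :: nat show "enc x = enc y \<Longrightarrow> x = y"
  proof (induction x arbitrary: y)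
    case 0 then show ?case by (cases y) auto
  next
    case (Suc x) then show ?case by (cases y) auto
  qed
qed
end

instantiation prod :: (enc, enc) enc begin
definition "enc p = Cn (enc (fst p)) (enc (snd p))"
instance by standard (auto simp: enc_prod_def prod_eq_iff dest: enc_inj)
end

instantiation list :: (enc) enc begin
primrec enc_list :: "'a list \<Rightarrow> tree" where
  "enc_list [] = Nl" | "enc_list (x # xs) = Cn (enc x) (enc_list xs)"
instance
proof
  fix x y :: "'a list" show "enc x = enc y \<Longrightarrow> x = y"
  proof (induction x arbitrary: y)
    case Nil then show ?case by (cases y) auto
  next
    case (Cons a x) then show ?case by (cases y) (auto dest: enc_inj)
  qed
qed
end

lemma enc_pair [simp]: "enc (x, y) = Cn (enc x) (enc y)"
  by (simp add: enc_prod_def)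

lemma enc_bool_simps [simp]: "enc True = Cn Nl Nl" "enc False = Nl"
  by (simp_all add: enc_bool_def)

lemma enc_unit [simp]: "enc () = Nl" by (simp add: enc_unit_def)

lemma es_bool: "es (b::bool) \<le> 3" by (simp add: enc_bool_def)

lemma enc_list_ltree: "enc xs = ltree (map enc xs)"
  by (induction xs) auto

lemma length_le_es: "length xs \<le> es xs"
  by (induction xs) auto

lemma es_nat [simp]: "es (n::nat) = 2 * n + 1"
  by (induction n) auto

lemma es_append: "es (xs @ ys) + 1 = es xs + es ys"
  by (induction xs) auto

lemma es_rev [simp]: "es (rev xs) = es xs"
proof (induction xs)
  case (Cons x xs)
  then show ?case using es_append[of "rev xs" "[x]"] by simp
qed simp

lemma es_member: "x \<in> set xs \<Longrightarrow> es x < es xs"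
  by (induction xs) auto

lemma es_le: "(\<And>x. x \<in> set xs \<Longrightarrow> es x \<le> B) \<Longrightarrow> es xs \<le> 1 + length xs * (1 + B)"
proof (induction xs)
  case (Cons a xs)
  then have "es a \<le> B" "es xs \<le> 1 + length xs * (1 + B)" by simp_all
  then show ?case by simp
qed simp

lemma es_take: "es (take i xs) \<le> es xs"
proof (induction xs arbitrary: i)
  case (Cons x xs) then show ?case by (cases i) auto
qed simp

text \<open>The size of the result is bounded separately, so that composition needs no argument that
  the running time bounds the output.\<close>

definition pt :: "('a::enc \<Rightarrow> 'b::enc) \<Rightarrow> bool" where
  "pt f \<longleftrightarrow> (\<exists>c d. \<forall>x. cr c (enc x) (enc (f x)) (pl d (es x)) \<and> es (f x) \<le> pl d (es x))"

lemma ptI: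
  assumes "\<And>x. cr c (enc x) (enc (f x)) (p (es x))" "\<And>x. es (f x) \<le> q (es x)" "PB p" "PB q"
  shows "pt f"
proof -
  obtain d where d: "\<And>n. p n + q n \<le> pl d n"
    using PB_obtain[OF PB_add[OF assms(3,4)]] by metis
  have "cr c (enc x) (enc (f x)) (pl d (es x)) \<and> es (f x) \<le> pl d (es x)" for x
    using d[of "es x"] assms(2)[of x] by (auto intro: cr_mono[OF assms(1)])
  then show ?thesis unfolding pt_def by blast
qed

lemma ptE:
  assumes "pt f"
  obtains c d where "\<And>x. cr c (enc x) (enc (f x)) (pl d (es x))" "\<And>x. es (f x) \<le> pl d (es x)"
  using assms unfolding pt_def by blast

lemma pt_id: "pt (\<lambda>x. x)"
  by (rule ptI[where c = skip and p = "\<lambda>_. 1" and q = "\<lambda>n. n"]) (auto intro: cr_skip[unfolded One_nat_def] PB_intros)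

lemma pt_comp: assumes "pt f" "pt g" shows "pt (\<lambda>x. g (f x))"
proof -
  obtain c d where f: "\<And>x. cr c (enc x) (enc (f x)) (pl d (es x))" "\<And>x. es (f x) \<le> pl d (es x)"
    using ptE[OF assms(1)] by metis
  obtain c' d' where g: "\<And>x. cr c' (enc x) (enc (g x)) (pl d' (es x))" "\<And>x. es (g x) \<le> pl d' (es x)"
    using ptE[OF assms(2)] by metis
  have le: "pl d' (es (f x)) \<le> pl d' (pl d (es x))" for x by (rule pl_mono[OF _ f(2)]) simp
  show ?thesis
  proof (rule ptI[where c = "Sq c c'" and p = "\<lambda>n. 1 + (pl d n + pl d' (pl d n))" and q = "\<lambda>n. pl d' (pl d n)"])
    show "cr (Sq c c') (enc x) (enc (g (f x))) (1 + (pl d (es x) + pl d' (pl d (es x))))" for x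
      by (rule cr_mono[OF cr_Sq[OF f(1) g(1)]]) (use le[of x] in simp)
    show "es (g (f x)) \<le> pl d' (pl d (es x))" for x using g(2)[of "f x"] le[of x] by simp
  qed (intro PB_intros)+
qed

lemma pt_pair: assumes "pt f" "pt g" shows "pt (\<lambda>x. (f x, g x))"
proof -
  obtain c d where f: "\<And>x. cr c (enc x) (enc (f x)) (pl d (es x))" "\<And>x. es (f x) \<le> pl d (es x)"
    using ptE[OF assms(1)] by metis
  obtain c' d' where g: "\<And>x. cr c' (enc x) (enc (g x)) (pl d' (es x))" "\<And>x. es (g x) \<le> pl d' (es x)"
    using ptE[OF assms(2)] by metis
  show ?thesis
  proof (rule ptI[where c = "pairc c c'" and p = "\<lambda>n. pl d n + pl d' n + 100 * (n + pl d n)"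
        and q = "\<lambda>n. 1 + (pl d n + pl d' n)"])
    show "cr (pairc c c') (enc x) (enc (f x, g x)) (pl d (es x) + pl d' (es x) + 100 * (es x + pl d (es x)))" for x
      using cr_mono[OF cr_pairc[OF f(1) g(1)], of x] f(2)[of x] by simp
    show "es (f x, g x) \<le> 1 + (pl d (es x) + pl d' (es x))" for x
      using f(2)[of x] g(2)[of x] by simp
  qed (intro PB_intros)+
qed

lemma pt_fst0: "pt fst"
proof (rule ptI[where c = fstc and p = "\<lambda>n. 100 * n" and q = "\<lambda>n. n"])
  show "cr fstc (enc x) (enc (fst x)) (100 * es x)" for x :: "'a \<times> 'b"
    using cr_fstc[of "enc x"] by (simp add: enc_prod_def)
qed (auto simp: enc_prod_def intro!: PB_intros)

lemma pt_snd0: "pt snd"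
proof (rule ptI[where c = sndc and p = "\<lambda>n. 100 * n" and q = "\<lambda>n. n"])
  show "cr sndc (enc x) (enc (snd x)) (100 * es x)" for x :: "'a \<times> 'b"
    using cr_sndc[of "enc x"] by (simp add: enc_prod_def)
qed (auto simp: enc_prod_def intro!: PB_intros)

lemmas pt_fst = pt_comp[OF _ pt_fst0]
lemmas pt_snd = pt_comp[OF _ pt_snd0]

fun push_word :: "nat list \<Rightarrow> com" where
  "push_word [] = skip"
| "push_word (a # w) = Sq (push_word w) (push 0 a)"

lemma sx_push_word: "sx (push_word w) \<sigma> (\<sigma>(0 := w @ \<sigma> 0)) (4 * length w + 1)"
proof (induction w)
  case Nil then show ?case using sx_skip[of \<sigma>] by simp
next
  case (Cons a w)
  show ?case unfolding push_word.simps
    by (rule sx_cong[OF sx_Sq[OF Cons.IH sx_push]]) auto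
qed

lemma pt_const: "pt (\<lambda>x. k)"
proof (rule ptI[where c = "Sq discard (push_word (code (enc k)))" and p = "\<lambda>n. 11 * n + (17 + 4 * es k)"
      and q = "\<lambda>_. es k"])
  fix x :: 'a
  show "cr (Sq discard (push_word (code (enc k)))) (enc x) (enc k) (11 * es x + (17 + 4 * es k))"
  proof (rule crI)
    fix \<sigma> :: "nat \<Rightarrow> nat list" and r assume s: "\<sigma> 0 = code (enc x) @ r"
    have "sx discard \<sigma> (\<sigma>(0 := r)) (11 * es x + 15)" by (rule sx_discard, rule s)
    from sx_Sq[OF this sx_push_word[of "code (enc k)"]]
    show "sx (Sq discard (push_word (code (enc k)))) \<sigma> (\<sigma>(0 := code (enc k) @ r)) (11 * es x + (17 + 4 * es k))"
      by (rule sx_cong) (auto simp: sz_def)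
  qed
qed (auto intro!: PB_intros)

lemma pt_cond0:
  assumes "pt p" "pt f" "pt g" "\<And>x. b x \<longleftrightarrow> enc (p x) \<noteq> Nl"
  shows "pt (\<lambda>x. if b x then f x else g x)"
proof -
  obtain c0 d0 where p: "\<And>x. cr c0 (enc x) (enc (p x)) (pl d0 (es x))" "\<And>x. es (p x) \<le> pl d0 (es x)"
    using ptE[OF assms(1)] by metis
  obtain c d where f: "\<And>x. cr c (enc x) (enc (f x)) (pl d (es x))" "\<And>x. es (f x) \<le> pl d (es x)"
    using ptE[OF assms(2)] by metis
  obtain c' d' where g: "\<And>x. cr c' (enc x) (enc (g x)) (pl d' (es x))" "\<And>x. es (g x) \<le> pl d' (es x)"
    using ptE[OF assms(3)] by metis
  show ?thesis
  proof (rule ptI[where c = "cndc c0 c c'" and p = "\<lambda>n. pl d0 n + (pl d n + pl d' n) + 200 * (n + pl d0 n)"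
        and q = "\<lambda>n. pl d n + pl d' n"])
    fix x
    have 1: "cr (if enc (p x) \<noteq> Nl then c else c') (enc x) (enc (if b x then f x else g x))
        (pl d (es x) + pl d' (es x))"
      using cr_mono[OF f(1)[of x]] cr_mono[OF g(1)[of x]] assms(4)[of x] by auto
    show "cr (cndc c0 c c') (enc x) (enc (if b x then f x else g x))
       (pl d0 (es x) + (pl d (es x) + pl d' (es x)) + 200 * (es x + pl d0 (es x)))"
      by (rule cr_mono[OF cr_cndc[OF p(1) 1]]) (use p(2)[of x] in simp)
    show "es (if b x then f x else g x) \<le> pl d (es x) + pl d' (es x)"
      using f(2)[of x] g(2)[of x] by auto
  qed (intro PB_intros)+
qed

lemma pt_if: "pt b \<Longrightarrow> pt f \<Longrightarrow> pt g \<Longrightarrow> pt (\<lambda>x. if b x then f x else g x)"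
  by (rule pt_cond0[where p = b]) (auto simp: enc_bool_def)

text \<open>Different types share codes: a nonempty list has the code of the pair of its head and
  tail, a number that of a list of units. Changing the type is then free.\<close>

lemma pt_recast: "(\<And>x. enc (f x) = enc x) \<Longrightarrow> pt f"
  by (rule ptI[where c = skip and p = "\<lambda>_. 1" and q = "\<lambda>n. n"]) (auto intro: cr_skip[unfolded One_nat_def] PB_intros)

lemma pt_Cons: assumes "pt f" "pt g" shows "pt (\<lambda>x. f x # g x)"
proof -
  have "pt (\<lambda>p :: 'b \<times> 'b list. fst p # snd p)" by (rule pt_recast) (simp add: enc_prod_def)
  from pt_comp[OF pt_pair[OF assms] this] show ?thesis by simp
qed

lemma pt_Suc: assumes "pt f" shows "pt (\<lambda>x. Suc (f x))"
proof -
  have "pt (\<lambda>p :: unit \<times> nat. Suc (snd p))" by (rule pt_recast) (auto simp: enc_prod_def)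
  from pt_comp[OF pt_pair[OF pt_const[of "()"] assms] this] show ?thesis by simp
qed

text \<open>If \<open>l\<close> is nonempty, the code of \<open>(x, l)\<close> is at the same time
  the code of \<open>(x, y, ys)\<close>, so it is handed to the program for \<open>g\<close>
  unchanged.\<close>

lemma pt_case_list:
  fixes l :: "'a::enc \<Rightarrow> 'b::enc list"
  assumes "pt l" "pt f" "pt (\<lambda>p. g (fst p) (fst (snd p)) (snd (snd p)))"
  shows "pt (\<lambda>x. case l x of [] \<Rightarrow> f x | y # ys \<Rightarrow> g x y ys)"
proof -
  define G where "G = (\<lambda>p :: 'a \<times> 'b \<times> 'b list. g (fst p) (fst (snd p)) (snd (snd p)))"
  define H where "H = (\<lambda>q :: 'a \<times> 'b list. case snd q of [] \<Rightarrow> f (fst q) | y # ys \<Rightarrow> g (fst q) y ys)"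
  obtain c d where f: "\<And>x. cr c (enc x) (enc (f x)) (pl d (es x))" "\<And>x. es (f x) \<le> pl d (es x)"
    using ptE[OF assms(2)] by metis
  obtain c' d' where g: "\<And>x. cr c' (enc x) (enc (G x)) (pl d' (es x))" "\<And>x. es (G x) \<le> pl d' (es x)"
    using ptE[OF assms(3)[folded G_def]] by metis
  have H: "pt H"
  proof (rule ptI[where c = "cndc sndc c' (Sq fstc c)"
        and p = "\<lambda>n. 100 * n + (1 + (100 * n + pl d n) + pl d' n) + 200 * (n + n)"
        and q = "\<lambda>n. pl d n + pl d' n"])
    fix q :: "'a \<times> 'b list"
    obtain x l where q: "q = (x, l)" by (cases q)
    have dn: "pl d (es x) \<le> pl d (es q)" by (rule pl_mono) (simp_all add: q)
    have 0: "cr sndc (enc q) (enc l) (100 * es q)" using cr_sndc[of "enc q"] by (simp add: q)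
    have 1: "cr (if enc l \<noteq> Nl then c' else Sq fstc c) (enc q) (enc (H q)) (1 + (100 * es q + pl d (es q)) + pl d' (es q))"
    proof (cases l)
      case Nil
      have "cr fstc (enc q) (enc x) (100 * es q)" using cr_fstc[of "enc q"] by (simp add: q)
      from cr_Sq[OF this f(1)] show ?thesis
        by (simp add: Nil H_def q del: sz_simps) (rule cr_mono, assumption, use dn in \<open>simp add: q Nil\<close>)
    next
      case (Cons y ys)
      have "enc q = enc (x, y, ys)" "H q = G (x, y, ys)" by (simp_all add: q Cons G_def H_def)
      then show ?thesis using cr_mono[OF g(1)[of "(x, y, ys)"]] by (simp add: Cons)
    qed
    show "cr (cndc sndc c' (Sq fstc c)) (enc q) (enc (H q))
        (100 * es q + (1 + (100 * es q + pl d (es q)) + pl d' (es q)) + 200 * (es q + es q))"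
      by (rule cr_mono[OF cr_cndc[OF 0 1]]) (simp add: q)
    show "es (H q) \<le> pl d (es q) + pl d' (es q)"
    proof (cases l)
      case Nil then show ?thesis using f(2)[of x] dn by (simp add: H_def q)
    next
      case (Cons y ys)
      have "enc q = enc (x, y, ys)" "H q = G (x, y, ys)" by (simp_all add: q Cons G_def H_def)
      then show ?thesis using g(2)[of "(x, y, ys)"] by simp
    qed
  qed (intro PB_intros)+
  have "pt (\<lambda>x. H (x, l x))" by (rule pt_comp[OF pt_pair[OF pt_id assms(1)] H])
  then show ?thesis by (simp only: H_def fst_conv snd_conv)
qed

lemma pt_units: assumes "pt n" shows "pt (\<lambda>x. replicate (n x) ())"
proof -
  have "enc (replicate k ()) = enc k" for k by (induction k) auto
  then have "pt (\<lambda>k. replicate k ())" by (rule pt_recast)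
  from pt_comp[OF assms this] show ?thesis .
qed

lemma pt_case_nat:
  assumes "pt n" "pt f" "pt (\<lambda>p. g (fst p) (snd p))"
  shows "pt (\<lambda>x. case n x of 0 \<Rightarrow> f x | Suc m \<Rightarrow> g x m)"
proof -
  have enc_len: "enc (length us) = enc us" for us :: "unit list" by (induction us) auto
  have "pt (\<lambda>us :: unit list. length us)" by (rule pt_recast[OF enc_len])
  then have "pt (\<lambda>p :: 'a \<times> unit \<times> unit list. g (fst p) (length (snd (snd p))))"
    using pt_comp[OF pt_pair[OF pt_fst0 pt_comp[OF pt_snd0 pt_comp[OF pt_snd0]]] assms(3)]
    by (simp add: )
  from pt_case_list[OF pt_units[OF assms(1)] assms(2), where g = "\<lambda>x y ys. g x (length ys)", OF this]
  have "pt (\<lambda>x. case replicate (n x) () of [] \<Rightarrow> f x | y # ys \<Rightarrow> g x (length ys))" .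
  moreover have "(case replicate (n x) () of [] \<Rightarrow> f x | y # ys \<Rightarrow> g x (length ys)) =
     (case n x of 0 \<Rightarrow> f x | Suc m \<Rightarrow> g x m)" for x by (cases "n x") auto
  ultimately show ?thesis by simp
qed

text \<open>Iterating a polynomial-time step is not polynomial in general: the accumulator could be
  squared in every round. Hence the premise that bounds its size; it ranges over all
  \<open>ys\<close> in order to apply to the prefixes of the list.\<close>

lemma pt_foldl:
  fixes l :: "'a::enc \<Rightarrow> 'b::enc list" and a :: "'a \<Rightarrow> 'c::enc"
  assumes "pt l" "pt a" "pt (\<lambda>p. f (fst p) (fst (snd p)) (snd (snd p)))"
    and b: "PB q" "\<And>x ys. es (foldl (f x) (a x) ys) \<le> q (es x + es ys)"
  shows "pt (\<lambda>x. foldl (f x) (a x) (l x))"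
proof -
  define g where "g = (\<lambda>p :: 'b \<times> 'a \<times> 'c. (fst (snd p), f (fst (snd p)) (snd (snd p)) (fst p)))"
  have "pt (\<lambda>p :: 'b \<times> 'a \<times> 'c. (fst (snd p), snd (snd p), fst p))"
    by (intro pt_pair pt_fst pt_snd pt_id)
  from pt_comp[OF this assms(3)] have ptg: "pt g"
    unfolding g_def by (intro pt_pair pt_fst pt_snd pt_id) simp
  obtain c d where g: "\<And>x. cr c (enc x) (enc (g x)) (pl d (es x))" using ptE[OF ptg] by metis
  obtain e where e: "\<And>n. q n \<le> pl e n" using PB_obtain[OF b(1)] by metis
  define H where "H = (\<lambda>q :: 'b list \<times> 'a. foldl (f (snd q)) (a (snd q)) (fst q))"
  define K where "K = (\<lambda>n. n * pl d (n + (n + pl e n) + 2) + 3000 * ((n + 1) * (n + (n + pl e n + 1) + 1)))"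
  have pti: "pt (\<lambda>x :: 'b list \<times> 'a. (fst x, snd x, a (snd x)))"
    by (intro pt_pair pt_fst pt_snd pt_id pt_comp[OF _ assms(2)])
  obtain c1 d1 where
    init: "\<And>x :: 'b list \<times> 'a. cr c1 (enc x) (enc (fst x, snd x, a (snd x))) (pl d1 (es x))"
    using ptE[OF pti] by metis
  have "pt H"
  proof (rule ptI[where c = "Sq c1 (Sq (foldc c) sndc)" and
        p = "\<lambda>n. 1 + (pl d1 n + (1 + (K n + 100 * (n + pl e n + 1))))" and q = "pl e"])
    fix z :: "'b list \<times> 'a"
    obtain ys x where z: "z = (ys, x)" by (cases z)
    define N where "N = es z"
    have N: "es x + es ys \<le> N" by (simp add: N_def z)
    define acc where "acc i = foldl (f x) (a x) (take i ys)" for i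
    have acc: "es (acc i) \<le> pl e N" for i
    proof -
      have "es (acc i) \<le> q (es x + es (take i ys))" unfolding acc_def by (rule b(2))
      also have "\<dots> \<le> pl e (es x + es (take i ys))" by (rule e)
      also have "\<dots> \<le> pl e N" using es_take[of i ys] N by (intro pl_mono) auto
      finally show ?thesis .
    qed
    have acc': "es (foldl (f x) (a x) ys) \<le> pl e N" using acc[of "length ys"] by (simp add: acc_def)
    then show "es (H z) \<le> pl e (es z)" by (simp add: H_def z N_def)
    let ?xs = "map enc ys"
    have "cr (foldc c) (Cn (ltree ?xs) (enc (x, acc 0))) (enc (x, acc (length ?xs)))
      ((\<Sum>i<length ?xs. pl d (N + (N + pl e N) + 2)) +
        3000 * (\<Sum>i\<le>length ?xs. sz (ltree ?xs) + es (x, acc i) + 1))"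
    proof (rule cr_foldc[where s = "\<lambda>i. enc (x, acc i)"])
      fix i assume i: "i < length ?xs"
      have "acc (Suc i) = f x (acc i) (ys ! i)" using i by (simp add: acc_def take_Suc_conv_app_nth)
      then have gi: "g (ys ! i, x, acc i) = (x, acc (Suc i))" by (simp add: g_def)
      have "es (ys ! i) < es ys" using i by (intro es_member) simp
      then have "es (ys ! i, x, acc i) \<le> N + (N + pl e N) + 2" using N acc[of i] by simp
      from cr_mono[OF g pl_mono[OF order_refl this]]
      show "cr c (Cn (?xs ! i) (enc (x, acc i))) (enc (x, acc (Suc i))) (pl d (N + (N + pl e N) + 2))"
        using i by (simp add: gi)
    qed
    moreover have "(\<Sum>i<length ?xs. pl d (N + (N + pl e N) + 2)) +
        3000 * (\<Sum>i\<le>length ?xs. sz (ltree ?xs) + es (x, acc i) + 1) \<le> K N"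
    proof -
      have len: "length ?xs \<le> N" using length_le_es[of ys] N by simp
      have "(\<Sum>i\<le>length ?xs. sz (ltree ?xs) + es (x, acc i) + 1) \<le>
          (\<Sum>i\<le>length ?xs. N + (N + pl e N + 1) + 1)"
      proof (rule sum_mono)
        fix i
        show "sz (ltree ?xs) + es (x, acc i) + 1 \<le> N + (N + pl e N + 1) + 1"
          using acc[of i] N by (simp add: enc_list_ltree[symmetric])
      qed
      also have "\<dots> = (length ?xs + 1) * (N + (N + pl e N + 1) + 1)" by simp
      also have "\<dots> \<le> (N + 1) * (N + (N + pl e N + 1) + 1)" using len by (intro mult_le_mono) auto
      finally have "3000 * (\<Sum>i\<le>length ?xs. sz (ltree ?xs) + es (x, acc i) + 1) \<le>
          3000 * ((N + 1) * (N + (N + pl e N + 1) + 1))" by simp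
      moreover have "(\<Sum>i<length ?xs. pl d (N + (N + pl e N) + 2)) \<le> N * pl d (N + (N + pl e N) + 2)"
        using len by simp
      ultimately show ?thesis unfolding K_def by linarith
    qed
    ultimately have "cr (foldc c) (Cn (ltree ?xs) (enc (x, acc 0))) (enc (x, acc (length ?xs))) (K N)"
      by (rule cr_mono)
    then have 1: "cr (foldc c) (enc (ys, x, a x)) (enc (x, foldl (f x) (a x) ys)) (K N)"
      by (simp add: acc_def enc_list_ltree)
    have "es (x, foldl (f x) (a x) ys) \<le> N + pl e N + 1" using acc' N by simp
    then have "100 * es (x, foldl (f x) (a x) ys) \<le> 100 * (N + pl e N + 1)" by (rule mult_le_mono2)
    moreover have "cr sndc (enc (x, foldl (f x) (a x) ys)) (enc (H z)) (100 * es (x, foldl (f x) (a x) ys))"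
      using cr_sndc[of "enc (x, foldl (f x) (a x) ys)"] by (simp only: enc_pair tsnd.simps H_def z fst_conv snd_conv)
    ultimately have 2: "cr sndc (enc (x, foldl (f x) (a x) ys)) (enc (H z)) (100 * (N + pl e N + 1))"
      by (rule cr_mono[rotated])
    have 3: "cr c1 (enc z) (enc (ys, x, a x)) (pl d1 (es z))" using init[of z] by (simp add: z)
    show "cr (Sq c1 (Sq (foldc c) sndc)) (enc z) (enc (H z))
       (1 + (pl d1 (es z) + (1 + (K (es z) + 100 * (es z + pl e (es z) + 1)))))"
      using cr_Sq[OF 3 cr_Sq[OF 1 2]] by (simp add: N_def)
  qed (unfold K_def, (intro PB_intros)+)
  from pt_comp[OF pt_pair[OF assms(1) pt_id] this] show ?thesis by (simp add: H_def)
qed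

text \<open>A sufficient condition: each step adds an amount that does not depend on the
  accumulator.\<close>

lemma pt_foldl_add:
  fixes l :: "'a::enc \<Rightarrow> 'b::enc list" and a :: "'a \<Rightarrow> 'c::enc"
  assumes "pt l" "pt a" "pt (\<lambda>p. f (fst p) (fst (snd p)) (snd (snd p)))"
    and b: "PB q" "\<And>x y s. es (f x s y) \<le> es s + q (es x + es y)"
  shows "pt (\<lambda>x. foldl (f x) (a x) (l x))"
proof -
  obtain c d where a: "\<And>x. es (a x) \<le> pl d (es x)" using ptE[OF assms(2)] by metis
  obtain e where e: "\<And>n. q n \<le> pl e n" using PB_obtain[OF b(1)] by metis
  have *: "es (foldl (f x) s ys) \<le> es s + length ys * pl e (es x + es ys)" for x s ys
  proof (induction ys arbitrary: s)
    case (Cons y ys)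
    have 1: "es (f x s y) \<le> es s + pl e (es x + es y)" using b(2)[of x s y] e[of "es x + es y"] by simp
    have 2: "pl e (es x + es y) \<le> pl e (es x + es (y # ys))" by (rule pl_mono) auto
    have 3: "length ys * pl e (es x + es ys) \<le> length ys * pl e (es x + es (y # ys))"
      by (intro mult_le_mono2 pl_mono) auto
    have 4: "length (y # ys) * k = k + length ys * k" for k :: nat by simp
    show ?case using Cons[of "f x s y"] 1 2 3 unfolding 4 foldl_Cons by linarith
  qed simp
  have "es (foldl (f x) (a x) ys) \<le> pl d (es x + es ys) + (es x + es ys) * pl e (es x + es ys)" for x ys
    by (rule order_trans[OF *])
       (intro add_mono mult_le_mono order_refl order_trans[OF a] pl_mono order_trans[OF length_le_es], auto)
  then show ?thesis
    by (rule pt_foldl[OF assms(1-3), rotated]) (intro PB_intros)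
qed

lemma PB_Suc: "PB f \<Longrightarrow> PB (\<lambda>n. Suc (f n))"
  using PB_add[of f "\<lambda>_. 1"] PB_const by simp

lemma PB_Suc_id: "PB Suc"
  using PB_Suc[OF PB_id] by simp

lemmas PB_intros' = PB_intros PB_Suc PB_Suc_id

section \<open>Equality of trees; operations on lists and numbers\<close>

lemma code_inj: "code x @ r = code y @ s \<Longrightarrow> x = y \<and> r = s"
proof (induction x arbitrary: y r s)
  case Nl
  then show ?case by (cases y) simp_all
next
  case (Cn a b)
  obtain c d where y: "y = Cn c d" using Cn.prems by (cases y) simp_all
  with Cn.prems have "code a @ (code b @ r) = code c @ (code d @ s)" by simp
  note 1 = Cn.IH(1)[OF this]
  then have "code b @ r = code d @ s" by simp
  note 2 = Cn.IH(2)[OF this]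
  show ?case using 1 2 y by simp
qed

definition eq_mark :: "nat list \<Rightarrow> nat" where
  "eq_mark xs = (if xs ! 0 = 2 \<and> xs ! 1 = xs ! 2 then 2 else 1)"

definition eq_body :: com where
  "eq_body = Sq (set_top [0, 2, 3] 0 3 eq_mark) (Sq (pop 2) (Bs 3 (\<lambda>s. s \<noteq> 3) (pop 3) skip))"

definition eqc :: com where
  "eqc = Sq (pop 0) (Sq save (Sq (push 2 3) (Sq (Ws 1 (\<lambda>s. s \<noteq> 3) (Sq (cpy 4 1 2) (pop 1))) (Sq (pop 1)
     (Sq save (Sq (push 3 3) (Sq (Ws 1 (\<lambda>s. s \<noteq> 3) (Sq (cpy 4 1 3) (pop 1))) (Sq (pop 1)
     (Sq (push 0 2) (Sq (Ws 2 (\<lambda>s. s \<noteq> 3) eq_body) (Sq (pop 2)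
     (Sq (Ws 3 (\<lambda>s. s \<noteq> 3) (pop 3)) (Sq (pop 3)
     (Bs 0 (\<lambda>s. s = 2) (Sq (pop 0) (push_word [2, 1, 1])) skip))))))))))))))"

text \<open>The top of stack 0 is a flag that stays 2 as long as all symbols agree. If
  \<open>v\<close> ends early, the marker 3 stays on top of stack 3 and differs from every remaining
  symbol of \<open>u\<close>.\<close>

lemma sx_eq_loop:
  assumes "\<sigma> 0 = f # r" "\<sigma> 2 = u @ 3 # s2" "\<sigma> 3 = v @ 3 # s3"
    "\<And>a. a \<in> set u \<Longrightarrow> a < 3" "\<And>a. a \<in> set v \<Longrightarrow> a < 3" "f \<in> {1, 2}"
  shows "sx (Ws 2 (\<lambda>s. s \<noteq> 3) eq_body) \<sigma>
     (\<sigma>(0 := (if f = 2 \<and> take (length u) v = u then 2 else 1) # r, 2 := 3 # s2, 3 := drop (length u) v @ 3 # s3))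
     (11 * length u + 1)"
  using assms
proof (induction u arbitrary: \<sigma> f v)
  case Nil
  show ?case by (rule sx_cong[OF sx_WsF]) (use Nil in \<open>auto simp: fun_eq_iff\<close>)
next
  case (Cons a u)
  let ?f = "if f = 2 \<and> take 1 v = [a] then 2 else 1 :: nat"
  let ?\<sigma>1 = "\<sigma>(0 := ?f # r)"
  let ?\<sigma>2 = "?\<sigma>1(2 := u @ 3 # s2)"
  let ?\<sigma>3 = "?\<sigma>2(3 := drop 1 v @ 3 # s3)"
  have a: "a < 3" using Cons.prems(4)[of a] by simp
  have v: "\<And>b v'. v = b # v' \<Longrightarrow> b < 3" using Cons.prems(5) by auto
  have g: "eq_mark (map (\<lambda>i. top_sym (\<sigma> i)) [0, 2, 3]) = ?f"
    using Cons.prems(1-3) a by (cases v) (auto simp: eq_mark_def)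
  have 1: "sx (set_top [0, 2, 3] 0 3 eq_mark) \<sigma> ?\<sigma>1 1"
    by (rule sx_cong[OF sx_set_top]) (use g Cons.prems in \<open>auto simp del: list.map\<close>)
  have 2: "sx (pop 2) ?\<sigma>1 ?\<sigma>2 3" by (rule sx_cong[OF sx_pop]) (use Cons.prems in auto)
  have 3: "sx (Bs 3 (\<lambda>s. s \<noteq> 3) (pop 3) skip) ?\<sigma>2 ?\<sigma>3 4"
  proof (cases v)
    case Nil
    have "?\<sigma>3 = ?\<sigma>2" using Nil Cons.prems by (auto simp: fun_eq_iff)
    then show ?thesis by (intro sx_cong[OF sx_BsF[OF _ sx_skip]]) (use Nil Cons.prems in auto)
  next
    case (Cons b v')
    show ?thesis
      by (rule sx_cong[OF sx_BsT[OF _ sx_pop]]) (use Cons Cons.prems(3) v[OF Cons] in auto)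
  qed
  note body = sx_Sq[OF 1 sx_Sq[OF 2 3], folded eq_body_def]
  have 4: "sx (Ws 2 (\<lambda>s. s \<noteq> 3) eq_body) ?\<sigma>3
     (?\<sigma>3(0 := (if ?f = 2 \<and> take (length u) (drop 1 v) = u then 2 else 1) # r, 2 := 3 # s2,
          3 := drop (length u) (drop 1 v) @ 3 # s3)) (11 * length u + 1)"
    by (rule Cons.IH) (use Cons.prems in \<open>auto dest: in_set_dropD\<close>)
  have e: "?\<sigma>3(0 := (if ?f = 2 \<and> take (length u) (drop 1 v) = u then 2 else 1) # r, 2 := 3 # s2,
          3 := drop (length u) (drop 1 v) @ 3 # s3) =
     \<sigma>(0 := (if f = 2 \<and> take (length (a # u)) v = a # u then 2 else 1) # r, 2 := 3 # s2,
       3 := drop (length (a # u)) v @ 3 # s3)"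
    by (cases v) (auto simp: fun_eq_iff)
  show ?case
    by (rule sx_cong[OF sx_WsT[OF _ body 4] e]) (use Cons.prems(2) a in auto)
qed

lemma sx_drain:
  assumes "\<sigma> 3 = v @ 3 # s" "\<And>a. a \<in> set v \<Longrightarrow> a < 3"
  shows "sx (Ws 3 (\<lambda>s. s \<noteq> 3) (pop 3)) \<sigma> (\<sigma>(3 := 3 # s)) (4 * length v + 1)"
  using assms
proof (induction v arbitrary: \<sigma>)
  case Nil
  show ?case by (rule sx_cong[OF sx_WsF]) (use Nil in \<open>auto simp: fun_eq_iff\<close>)
next
  case (Cons a v)
  have 1: "sx (pop 3) \<sigma> (\<sigma>(3 := v @ 3 # s)) 3" by (rule sx_cong[OF sx_pop]) (use Cons.prems in auto)
  have 2: "sx (Ws 3 (\<lambda>s. s \<noteq> 3) (pop 3)) (\<sigma>(3 := v @ 3 # s)) (\<sigma>(3 := 3 # s)) (4 * length v + 1)"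
    by (rule sx_cong[OF Cons.IH]) (use Cons.prems in auto)
  show ?case by (rule sx_mono[OF sx_WsT[OF _ 1 2]]) (use Cons.prems(1) Cons.prems(2)[of a] in auto)
qed

lemma cr_eqc: "cr eqc (Cn a b) (enc (a = b)) (200 * (sz a + sz b))"
proof (rule crI)
  fix \<sigma> :: "nat \<Rightarrow> nat list" and r assume s: "\<sigma> 0 = code (Cn a b) @ r"
  let ?\<sigma>1 = "\<sigma>(0 := code a @ code b @ r)"
  let ?\<sigma>2 = "\<sigma>(0 := code b @ r, 1 := rev (code a) @ 3 # \<sigma> 1)"
  let ?\<sigma>3 = "?\<sigma>2(2 := 3 # \<sigma> 2)"
  let ?\<sigma>4 = "\<sigma>(0 := code b @ r, 1 := 3 # \<sigma> 1, 2 := code a @ 3 # \<sigma> 2)"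
  let ?\<sigma>5 = "\<sigma>(0 := code b @ r, 2 := code a @ 3 # \<sigma> 2)"
  let ?\<sigma>6 = "\<sigma>(0 := r, 1 := rev (code b) @ 3 # \<sigma> 1, 2 := code a @ 3 # \<sigma> 2)"
  let ?\<sigma>7 = "?\<sigma>6(3 := 3 # \<sigma> 3)"
  let ?\<sigma>8 = "\<sigma>(0 := r, 1 := 3 # \<sigma> 1, 2 := code a @ 3 # \<sigma> 2, 3 := code b @ 3 # \<sigma> 3)"
  let ?\<sigma>9 = "\<sigma>(0 := r, 2 := code a @ 3 # \<sigma> 2, 3 := code b @ 3 # \<sigma> 3)"
  let ?\<sigma>10 = "?\<sigma>9(0 := 2 # r)"
  let ?f = "if (2::nat) = 2 \<and> take (length (code a)) (code b) = code a then 2 else 1 :: nat"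
  let ?v = "drop (length (code a)) (code b)"
  let ?\<sigma>11 = "?\<sigma>10(0 := ?f # r, 2 := 3 # \<sigma> 2, 3 := ?v @ 3 # \<sigma> 3)"
  let ?\<sigma>12 = "\<sigma>(0 := ?f # r, 3 := ?v @ 3 # \<sigma> 3)"
  let ?\<sigma>13 = "?\<sigma>12(3 := 3 # \<sigma> 3)"
  let ?\<sigma>14 = "\<sigma>(0 := ?f # r)"
  \<comment> \<open>Only a prefix of \<open>code b\<close> is compared; as the code is prefix-free,
    agreement with \<open>code a\<close> already gives \<open>a = b\<close>.\<close>
  have f: "?f = 2 \<longleftrightarrow> a = b"
  proof
    assume "?f = 2"
    then have "code a @ ?v = code b @ []" by (metis append_Nil2 append_take_drop_id numeral_eq_one_iff semiring_norm(85))
    then show "a = b" using code_inj by blast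
  qed simp
  have 1: "sx (pop 0) \<sigma> ?\<sigma>1 3" by (rule sx_cong[OF sx_pop]) (use s in auto)
  have 2: "sx save ?\<sigma>1 ?\<sigma>2 (15 * sz a + 20)" by (rule sx_cong[OF sx_save]) auto
  have 3: "sx (push 2 3) ?\<sigma>2 ?\<sigma>3 3" by (rule sx_cong[OF sx_push]) auto
  have 4: "sx (Ws 1 (\<lambda>s. s \<noteq> 3) (Sq (cpy 4 1 2) (pop 1))) ?\<sigma>3 ?\<sigma>4 (8 * sz a + 1)"
    by (rule sx_cong[OF sx_move_loop[where w = "rev (code a)" and s = "\<sigma> 1"]])
       (use code_lt(1) in \<open>auto simp: fun_eq_iff sz_def\<close>)
  have 5: "sx (pop 1) ?\<sigma>4 ?\<sigma>5 3" by (rule sx_cong[OF sx_pop]) (auto simp: fun_eq_iff)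
  have 6: "sx save ?\<sigma>5 ?\<sigma>6 (15 * sz b + 20)" by (rule sx_cong[OF sx_save]) (auto simp: fun_eq_iff)
  have 7: "sx (push 3 3) ?\<sigma>6 ?\<sigma>7 3" by (rule sx_cong[OF sx_push]) auto
  have 8: "sx (Ws 1 (\<lambda>s. s \<noteq> 3) (Sq (cpy 4 1 3) (pop 1))) ?\<sigma>7 ?\<sigma>8 (8 * sz b + 1)"
    by (rule sx_cong[OF sx_move_loop[where w = "rev (code b)" and s = "\<sigma> 1"]])
       (use code_lt(1) in \<open>auto simp: fun_eq_iff sz_def\<close>)
  have 9: "sx (pop 1) ?\<sigma>8 ?\<sigma>9 3" by (rule sx_cong[OF sx_pop]) (auto simp: fun_eq_iff)
  have 10: "sx (push 0 2) ?\<sigma>9 ?\<sigma>10 3" by (rule sx_cong[OF sx_push]) (auto simp: fun_eq_iff)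
  have 11: "sx (Ws 2 (\<lambda>s. s \<noteq> 3) eq_body) ?\<sigma>10 ?\<sigma>11 (11 * length (code a) + 1)"
    by (rule sx_eq_loop) (auto dest: code_symbols)
  have 12: "sx (pop 2) ?\<sigma>11 ?\<sigma>12 3" by (rule sx_cong[OF sx_pop]) (auto simp: fun_eq_iff)
  have 13: "sx (Ws 3 (\<lambda>s. s \<noteq> 3) (pop 3)) ?\<sigma>12 ?\<sigma>13 (4 * length ?v + 1)"
    by (rule sx_drain) (auto dest!: in_set_dropD code_symbols)
  have 14: "sx (pop 3) ?\<sigma>13 ?\<sigma>14 3" by (rule sx_cong[OF sx_pop]) (auto simp: fun_eq_iff)
  have 15: "sx (Bs 0 (\<lambda>s. s = 2) (Sq (pop 0) (push_word [2, 1, 1])) skip) ?\<sigma>14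
     (\<sigma>(0 := code (enc (a = b)) @ r)) 30"
  proof (cases "a = b")
    case True
    have "sx (pop 0) ?\<sigma>14 (\<sigma>(0 := r)) 3" by (rule sx_cong[OF sx_pop]) auto
    from sx_Sq[OF this sx_push_word[of "[2, 1, 1]"]] show ?thesis
      by (intro sx_cong[OF sx_BsT]) (use True f in auto)
  next
    case False
    then show ?thesis by (intro sx_cong[OF sx_BsF[OF _ sx_skip]]) (use f in auto)
  qed
  note all = sx_Sq[OF 1 sx_Sq[OF 2 sx_Sq[OF 3 sx_Sq[OF 4 sx_Sq[OF 5 sx_Sq[OF 6 sx_Sq[OF 7
     sx_Sq[OF 8 sx_Sq[OF 9 sx_Sq[OF 10 sx_Sq[OF 11 sx_Sq[OF 12 sx_Sq[OF 13 sx_Sq[OF 14 15]]]]]]]]]]]]]]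
  have "length ?v \<le> sz b" by (simp add: sz_def)
  then show "sx eqc \<sigma> (\<sigma>(0 := code (enc (a = b)) @ r)) (200 * (sz a + sz b))" unfolding eqc_def
    by (intro sx_mono[OF all]) (use sz_pos[of a] sz_pos[of b] in \<open>simp add: sz_def[symmetric] del: length_drop\<close>)
qed

lemma pt_eq: assumes "pt f" "pt g" shows "pt (\<lambda>x. f x = g x)"
proof -
  have "pt (\<lambda>p :: 'b \<times> 'b. fst p = snd p)"
  proof (rule ptI[where c = eqc and p = "\<lambda>n. 200 * n" and q = "\<lambda>_. 3"])
    fix p :: "'b \<times> 'b"
    have "(enc (fst p) = enc (snd p)) = (fst p = snd p)" by (auto dest: enc_inj)
    then show "cr eqc (enc p) (enc (fst p = snd p)) (200 * es p)"
      using cr_mono[OF cr_eqc[of "enc (fst p)" "enc (snd p)"], of "200 * es p"] by (simp add: enc_prod_def)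
  qed (auto simp: es_bool intro!: PB_intros')
  from pt_comp[OF pt_pair[OF assms] this] show ?thesis by simp
qed

lemma pt_not: assumes "pt f" shows "pt (\<lambda>x. \<not> f x)"
proof -
  have "(\<lambda>x. \<not> f x) = (\<lambda>x. if f x then False else True)" by auto
  then show ?thesis by (simp only:) (rule pt_if[OF assms pt_const pt_const])
qed

lemma pt_conj: assumes "pt f" "pt g" shows "pt (\<lambda>x. f x \<and> g x)"
proof -
  have "(\<lambda>x. f x \<and> g x) = (\<lambda>x. if f x then g x else False)" by auto
  then show ?thesis by (simp only:) (rule pt_if[OF assms pt_const])
qed

lemma pt_imp: assumes "pt f" "pt g" shows "pt (\<lambda>x. f x \<longrightarrow> g x)"
proof -
  have "(\<lambda>x. f x \<longrightarrow> g x) = (\<lambda>x. if f x then g x else True)" by auto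
  then show ?thesis by (simp only:) (rule pt_if[OF assms pt_const])
qed

lemma pt_case_prod:
  assumes "pt p" "pt (\<lambda>q. f (fst q) (fst (snd q)) (snd (snd q)))"
  shows "pt (\<lambda>x. case p x of (a, b) \<Rightarrow> f x a b)"
  using pt_comp[OF pt_pair[OF pt_id assms(1)] assms(2)] by (simp add: case_prod_unfold)

lemma pt_rev: assumes "pt l" shows "pt (\<lambda>x. rev (l x))"
proof -
  have r: "foldl (\<lambda>a y. y # a) s ys = rev ys @ s" for s ys :: "'b list" by (induction ys arbitrary: s) auto
  have "pt (\<lambda>x. foldl (\<lambda>a y. y # a) [] (l x))"
    by (rule pt_foldl_add[OF assms pt_const, where q = "\<lambda>n. n + 1"])
       (auto intro!: pt_Cons pt_fst pt_snd pt_id PB_intros')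
  then show ?thesis by (simp add: r)
qed

lemma pt_append: assumes "pt f" "pt g" shows "pt (\<lambda>x. f x @ g x)"
proof -
  have r: "foldl (\<lambda>a y. y # a) s ys = rev ys @ s" for s ys :: "'b list" by (induction ys arbitrary: s) auto
  have "pt (\<lambda>x. foldl (\<lambda>a y. y # a) (g x) (rev (f x)))"
    by (rule pt_foldl_add[OF pt_rev[OF assms(1)] assms(2), where q = "\<lambda>n. n + 1"])
       (auto intro!: pt_Cons pt_fst pt_snd pt_id PB_intros')
  then show ?thesis by (simp add: r)
qed

lemma pt_map:
  assumes "pt (\<lambda>p. f (fst p) (snd p))" "pt l"
  shows "pt (\<lambda>x. map (\<lambda>y. f x y) (l x))"
proof -
  obtain d where d: "\<And>p. es (f (fst p) (snd p)) \<le> pl d (es p)" using ptE[OF assms(1)] by metis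
  have r: "foldl (\<lambda>a y. f x y # a) s ys = rev (map (f x) ys) @ s" for s ys x by (induction ys arbitrary: s) auto
  have "pt (\<lambda>x. foldl (\<lambda>a y. f x y # a) [] (l x))"
  proof (rule pt_foldl_add[OF assms(2) pt_const, where q = "\<lambda>n. pl d (n + 1) + 1"])
    show "pt (\<lambda>p. f (fst p) (snd (snd p)) # fst (snd p))"
      by (intro pt_Cons pt_fst pt_snd pt_id)
         (use pt_comp[OF pt_pair[OF pt_fst[OF pt_id] pt_snd[OF pt_snd[OF pt_id]]] assms(1)] in simp)
    show "es (f x y # s) \<le> es s + (pl d (es x + es y + 1) + 1)" for x y s
      using d[of "(x, y)"] by simp
  qed (intro PB_intros')
  from pt_rev[OF this] show ?thesis by (simp add: r)
qed

lemma pt_filter: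
  assumes "pt (\<lambda>p. f (fst p) (snd p))" "pt l"
  shows "pt (\<lambda>x. filter (\<lambda>y. f x y) (l x))"
proof -
  have r: "foldl (\<lambda>a y. if f x y then y # a else a) s ys = rev (filter (f x) ys) @ s" for s ys x
    by (induction ys arbitrary: s) auto
  have "pt (\<lambda>x. foldl (\<lambda>a y. if f x y then y # a else a) [] (l x))"
  proof (rule pt_foldl_add[OF assms(2) pt_const, where q = "\<lambda>n. n + 1"])
    show "pt (\<lambda>p. if f (fst p) (snd (snd p)) then snd (snd p) # fst (snd p) else fst (snd p))"
      by (intro pt_if pt_Cons pt_fst pt_snd pt_id)
         (use pt_comp[OF pt_pair[OF pt_fst[OF pt_id] pt_snd[OF pt_snd[OF pt_id]]] assms(1)] in simp)
  qed (auto intro!: PB_intros')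
  from pt_rev[OF this] show ?thesis by (simp add: r)
qed

lemma pt_bex:
  assumes "pt l" "pt (\<lambda>p. f (fst p) (snd p))"
  shows "pt (\<lambda>x. \<exists>y\<in>set (l x). f x y)"
proof -
  have "pt (\<lambda>x. filter (\<lambda>y. f x y) (l x) \<noteq> [])"
    by (intro pt_not pt_eq pt_filter pt_const assms)
  then show ?thesis by (simp add: filter_empty_conv)
qed

lemma pt_ball:
  assumes "pt l" "pt (\<lambda>p. f (fst p) (snd p))"
  shows "pt (\<lambda>x. \<forall>y\<in>set (l x). f x y)"
  using pt_not[OF pt_bex[OF assms(1) pt_not[OF assms(2)]]] by simp

lemma pt_mem: assumes "pt f" "pt l" shows "pt (\<lambda>x. f x \<in> set (l x))"
proof -
  have "pt (\<lambda>x. \<exists>y\<in>set (l x). y = f x)"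
    by (rule pt_bex[OF assms(2)]) (intro pt_eq pt_snd pt_id pt_comp[OF _ assms(1)] pt_fst)
  then show ?thesis by simp
qed

lemma pt_concat: assumes "pt l" shows "pt (\<lambda>x. concat (l x))"
proof -
  have r: "foldl (\<lambda>a y. a @ y) s ys = s @ concat ys" for s and ys :: "'b list list"
    by (induction ys arbitrary: s) auto
  have "es (s @ y) \<le> es s + (es x + es y)" for s y :: "'b list" and x :: 'a using es_append[of s y] by simp
  then have "pt (\<lambda>x. foldl (\<lambda>a y. a @ y) [] (l x))"
    by (intro pt_foldl_add[OF assms pt_const, where q = "\<lambda>n. n"])
       (auto intro!: pt_append pt_fst pt_snd pt_id PB_intros')
  then show ?thesis by (simp add: r)
qed

lemma pt_length: assumes "pt l" shows "pt (\<lambda>x. length (l x))"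
proof -
  have r: "foldl (\<lambda>a y. Suc a) n ys = n + length ys" for n and ys :: "'b list"
    by (induction ys arbitrary: n) auto
  have "pt (\<lambda>x. foldl (\<lambda>a y. Suc a) 0 (l x))"
    by (rule pt_foldl_add[OF assms pt_const, where q = "\<lambda>n. n + 2"])
       (auto intro!: pt_Suc pt_fst pt_snd pt_id PB_intros')
  then show ?thesis by (simp add: r)
qed

lemma pt_add: assumes "pt f" "pt g" shows "pt (\<lambda>x. f x + g x :: nat)"
proof -
  have r: "foldl (\<lambda>a y. Suc a) n ys = n + length ys" for n and ys :: "unit list"
    by (induction ys arbitrary: n) auto
  have "pt (\<lambda>x. foldl (\<lambda>a y. Suc a) (f x) (replicate (g x) ()))"
    by (rule pt_foldl_add[OF pt_units[OF assms(2)] assms(1), where q = "\<lambda>n. n + 2"])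
       (auto intro!: pt_Suc pt_fst pt_snd pt_id PB_intros')
  then show ?thesis by (simp add: r)
qed

lemma pt_mult: assumes "pt f" "pt g" shows "pt (\<lambda>x. f x * g x :: nat)"
proof -
  have r: "foldl (\<lambda>a y. a + f x) n ys = n + f x * length ys" for n x and ys :: "unit list"
    by (induction ys arbitrary: n) auto
  obtain d where d: "\<And>x. es (f x) \<le> pl d (es x)" using ptE[OF assms(1)] by metis
  have "pl d (es x) \<le> pl d (es x + es y)" for x :: 'a and y :: unit by (rule pl_mono) auto
  from order_trans[OF d this] have "es (f x) \<le> pl d (es x + es y)" for x and y :: unit .
  note le = this
  have "es (s + f x) \<le> es s + pl d (es x + es y)" for s x and y :: unit
    using le[of x y] by simp
  then have "pt (\<lambda>x. foldl (\<lambda>a y. a + f x) 0 (replicate (g x) ()))"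
    by (intro pt_foldl_add[OF pt_units[OF assms(2)] pt_const, where q = "pl d"])
       (auto intro!: pt_add pt_comp[OF _ assms(1)] pt_fst pt_snd pt_id PB_intros')
  then show ?thesis by (simp add: r)
qed

lemma pt_diff: assumes "pt f" "pt g" shows "pt (\<lambda>x. f x - g x :: nat)"
proof -
  have r: "foldl (\<lambda>a y. case a of 0 \<Rightarrow> 0 | Suc k \<Rightarrow> k) n ys = n - length ys" for n and ys :: "unit list"
    by (induction ys arbitrary: n) (auto split: nat.split)
  have "pt (\<lambda>x. foldl (\<lambda>a y. case a of 0 \<Rightarrow> 0 | Suc k \<Rightarrow> k) (f x) (replicate (g x) ()))"
    by (rule pt_foldl_add[OF pt_units[OF assms(2)] assms(1), where q = "\<lambda>n. n"])
       (auto intro!: pt_case_nat pt_const pt_fst pt_snd pt_id PB_intros' split: nat.split)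
  then show ?thesis by (simp add: r)
qed

lemma pt_le: assumes "pt f" "pt g" shows "pt (\<lambda>x. f x \<le> (g x :: nat))"
proof -
  have "pt (\<lambda>x. f x - g x = 0)" by (intro pt_eq pt_diff pt_const assms)
  then show ?thesis by simp
qed

text \<open>Counts up with quotient and remainder as accumulator. For divisor 0 the remainder is
  never reset, in accordance with \<open>div\<close> and \<open>mod\<close> by 0.\<close>

lemma pt_div: assumes "pt f" "pt g" shows "pt (\<lambda>x. f x div (g x :: nat))"
proof -
  define st where "st k p = (if Suc (snd p) = k then (Suc (fst p), 0) else (fst p, Suc (snd p)))"
    for k and p :: "nat \<times> nat"
  have r: "foldl (\<lambda>a y. st k a) (0, 0) ys = (length ys div k, length ys mod k)"
    for k and ys :: "unit list"
  proof (induction ys rule: rev_induct)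
    case (snoc y ys)
    then show ?case by (simp add: st_def div_Suc mod_Suc)
  qed simp
  have "pt (\<lambda>x. foldl (\<lambda>a y. st (g x) a) (0, 0) (replicate (f x) ()))"
    unfolding st_def
    by (rule pt_foldl_add[OF pt_units[OF assms(1)] pt_const, where q = "\<lambda>n. n + 4"])
       (auto intro!: pt_if pt_eq pt_pair pt_Suc pt_const pt_comp[OF _ assms(2)] pt_fst pt_snd pt_id PB_intros'
         simp: enc_prod_def)
  from pt_fst[OF this] show ?thesis by (simp add: r)
qed

lemma pt_tl: assumes "pt l" shows "pt (\<lambda>x. tl (l x))"
proof -
  have "pt (\<lambda>x. case l x of [] \<Rightarrow> [] | y # ys \<Rightarrow> ys)"
    by (intro pt_case_list assms pt_const pt_snd pt_id)
  then show ?thesis by (simp add: tl_def)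
qed

lemma es_tl: "es (tl xs) \<le> es xs" by (cases xs) auto

lemma pt_drop: assumes "pt n" "pt l" shows "pt (\<lambda>x. drop (n x) (l x))"
proof -
  have r: "foldl (\<lambda>a y. tl a) xs ys = drop (length ys) xs" for xs :: "'b list" and ys :: "unit list"
    by (induction ys arbitrary: xs) (auto simp: drop_Suc)
  have "pt (\<lambda>x. foldl (\<lambda>a y. tl a) (l x) (replicate (n x) ()))"
    by (rule pt_foldl_add[OF pt_units[OF assms(1)] assms(2), where q = "\<lambda>n. n"])
       (intro pt_tl pt_fst pt_snd pt_id PB_intros' trans_le_add1[OF es_tl])+
  then show ?thesis by (simp add: r)
qed

lemma pt_take: assumes "pt n" "pt l" shows "pt (\<lambda>x. take (n x) (l x))"
proof -
  have "pt (\<lambda>x. rev (drop (length (l x) - n x) (rev (l x))))"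
    by (intro pt_rev pt_drop pt_diff pt_length assms)
  moreover have "rev (drop (length xs - k) (rev xs)) = take k xs" for k and xs :: "'b list"
    by (cases "k \<le> length xs") (simp_all add: rev_drop)
  ultimately show ?thesis by simp
qed

lemmas pt_intros = pt_id pt_const pt_pair pt_fst pt_snd pt_if pt_Cons pt_Suc pt_case_list pt_case_nat
  pt_eq pt_not pt_conj pt_imp pt_case_prod pt_rev pt_append pt_map pt_filter pt_bex pt_ball pt_mem
  pt_concat pt_length pt_add pt_mult pt_diff pt_le pt_div pt_tl pt_drop pt_take

section \<open>Simulation of a given machine\<close>

text \<open>
  Cells are shifted by one, so that a blank cell of the simulated machine differs from the blank
  shown by an empty stack. The list \<open>R\<close> starts at the head; \<open>L\<close> runs leftwards from the cell before it.
\<close>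

definition tape_rep :: "(int \<Rightarrow> nat) \<Rightarrow> int \<Rightarrow> nat list \<Rightarrow> nat list \<Rightarrow> bool" where
  "tape_rep f h L R \<longleftrightarrow> R \<noteq> [] \<and>
     (\<forall>i. (if i < length R then R ! i else 1) = f (h + int i) + 1) \<and>
     (\<forall>i. (if i < length L then L ! i else 1) = f (h - 1 - int i) + 1)"

lemma tape_rep_head: "tape_rep f h L (a # R) \<Longrightarrow> a = f h + 1"
  unfolding tape_rep_def by (auto dest: spec[of _ 0])

lemma tape_rep_stay: "tape_rep f h L (a # R) \<Longrightarrow> tape_rep (f(h := b)) h L (Suc b # R)"
  unfolding tape_rep_def by (auto simp: nth_Cons' split: if_splits) (metis Suc_less_eq Suc_pred not_gr_zero)+

lemma tape_rep_right:
  assumes "tape_rep f h L (a # R)"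
  shows "tape_rep (f(h := b)) (h + 1) (Suc b # L) (if R = [] then [1] else R)"
proof -
  have r: "(if Suc i < length (a # R) then (a # R) ! Suc i else 1) = f (h + int (Suc i)) + 1" for i
    using assms unfolding tape_rep_def by blast
  have l: "(if i < length L then L ! i else 1) = f (h - 1 - int i) + 1" for i
    using assms unfolding tape_rep_def by blast
  have "(if i < length (if R = [] then [1] else R) then (if R = [] then [1] else R) ! i else 1) =
      (f(h := b)) (h + 1 + int i) + 1" for i
    using r[of i] by (auto simp: algebra_simps split: if_splits)
  moreover have "(if i < length (Suc b # L) then (Suc b # L) ! i else 1) = (f(h := b)) (h + 1 - 1 - int i) + 1" for i
  proof (cases i)
    case (Suc j)
    then show ?thesis using l[of j] by (auto simp: algebra_simps)
  qed simp
  ultimately show ?thesis unfolding tape_rep_def by simp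
qed

lemma tape_rep_left:
  assumes "tape_rep f h L (a # R)"
  shows "tape_rep (f(h := b)) (h - 1) (tl L) ((if L = [] then 1 else hd L) # Suc b # R)"
proof -
  have r: "(if Suc i < length (a # R) then (a # R) ! Suc i else 1) = f (h + int (Suc i)) + 1" for i
    using assms unfolding tape_rep_def by blast
  have l: "(if i < length L then L ! i else 1) = f (h - 1 - int i) + 1" for i
    using assms unfolding tape_rep_def by blast
  have "(if i < length ((if L = [] then 1 else hd L) # Suc b # R)
      then ((if L = [] then 1 else hd L) # Suc b # R) ! i else 1) = (f(h := b)) (h - 1 + int i) + 1" for i
  proof (cases i)
    case 0
    then show ?thesis using l[of 0] by (cases L) auto
  next
    case (Suc j)
    show ?thesis
    proof (cases j)
      case (Suc k)
      then show ?thesis using r[of k] \<open>i = Suc j\<close> by (auto simp: algebra_simps)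
    qed (use Suc in simp)
  qed
  moreover have "(if i < length (tl L) then tl L ! i else 1) = (f(h := b)) (h - 1 - 1 - int i) + 1" for i
    using l[of "Suc i"] by (cases L) (auto simp: algebra_simps)
  ultimately show ?thesis unfolding tape_rep_def by simp
qed

text \<open>Stack 4 holds the simulated state plus one and stack 5 a temporary symbol; the two
  halves of tape \<open>j\<close> occupy a pair of stacks from 6 on.\<close>

definition Lst :: "nat \<Rightarrow> nat" where "Lst j = 6 + 2 * j"
definition Rst :: "nat \<Rightarrow> nat" where "Rst j = 7 + 2 * j"

lemma LR_neq [simp]: "Lst i \<noteq> Rst j" "Rst j \<noteq> Lst i" "Lst i = Lst j \<longleftrightarrow> i = j" "Rst i = Rst j \<longleftrightarrow> i = j"
  "Lst j \<ge> 6" "Rst j \<ge> 6"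
  by (auto simp: Lst_def Rst_def) presburger+

lemma LR_neq' [simp]: "i < 6 \<Longrightarrow> i \<noteq> Lst j" "i < 6 \<Longrightarrow> i \<noteq> Rst j" "i < 6 \<Longrightarrow> Lst j \<noteq> i" "i < 6 \<Longrightarrow> Rst j \<noteq> i"
  by (auto simp: Lst_def Rst_def)

text \<open>The transition of \<open>M\<close>, read off a symbol that encodes its state and all scanned symbols.\<close>
definition looked_up :: "tm \<Rightarrow> nat list \<Rightarrow> nat \<times> (nat \<times> move) list" where
  "looked_up M xs = (let ys = list_decode (hd xs - 1) in
     delta M (hd ys - 1) (map (\<lambda>y. y - 1) (tl ys)))"

text \<open>A head that leaves the visited part meets an empty stack, whose top reads 0; a blank
  cell, stored as 1, is created there.\<close>

definition sim_tape :: "tm \<Rightarrow> nat \<Rightarrow> com" where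
  "sim_tape M j = Sq (set_top [5] (Rst j) (Suc (alph M)) (\<lambda>xs. Suc (fst (snd (looked_up M xs) ! j))))
     (Bs 5 (\<lambda>s. snd (snd (looked_up M [s]) ! j) = Move_Right)
        (Sq (cpy (Suc (alph M)) (Rst j) (Lst j)) (Sq (pop (Rst j))
           (Bs (Rst j) (\<lambda>s. s = 0) (push (Rst j) 1) skip)))
        (Bs 5 (\<lambda>s. snd (snd (looked_up M [s]) ! j) = Move_Left)
           (Bs (Lst j) (\<lambda>s. s = 0) (push (Rst j) 1) (Sq (cpy (Suc (alph M)) (Lst j) (Rst j)) (pop (Lst j))))
           skip))"

fun seqs :: "(nat \<Rightarrow> com) \<Rightarrow> nat \<Rightarrow> com" where
  "seqs c 0 = skip"
| "seqs c (Suc n) = Sq (seqs c n) (c n)"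

text \<open>A branch looks at one tape only. The state and all scanned symbols are therefore packed
  into a single symbol on stack 5, which the treatment of every tape consults after the state and
  other tapes have changed.\<close>

definition sim_step :: "tm \<Rightarrow> nat \<Rightarrow> com" where
  "sim_step M A = Sq (push_fun (4 # map Rst [0..<tapes M]) 5 A (\<lambda>xs. Suc (list_encode xs)))
     (Sq (set_top [5] 4 (states M + 2) (\<lambda>xs. Suc (fst (looked_up M xs))))
        (Sq (seqs (sim_tape M) (tapes M)) (pop 5)))"

definition tape_ok :: "tm \<Rightarrow> nat \<Rightarrow> (int \<Rightarrow> nat) \<Rightarrow> int \<Rightarrow> (nat \<Rightarrow> nat list) \<Rightarrow> nat \<Rightarrow> bool" where
  "tape_ok M N f h \<sigma> j \<longleftrightarrow> tape_rep f h (\<sigma> (Lst j)) (\<sigma> (Rst j)) \<and>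
     length (\<sigma> (Lst j)) + length (\<sigma> (Rst j)) \<le> N \<and> (\<forall>i. f i < alph M)"

lemma sx_sim_tape:
  assumes ok: "tape_ok M N f h \<sigma> j" and s5: "\<sigma> 5 = [s]"
    and act: "snd (looked_up M [s]) ! j = (b, m)" "b < alph M"
  shows "\<exists>\<sigma>'. sx (sim_tape M j) \<sigma> \<sigma>' 20 \<and> tape_ok M (Suc N) (f(h := b)) (h + shift m) \<sigma>' j \<and>
     (\<forall>i. i \<noteq> Lst j \<and> i \<noteq> Rst j \<longrightarrow> \<sigma>' i = \<sigma> i)"
proof -
  from ok have rep: "tape_rep f h (\<sigma> (Lst j)) (\<sigma> (Rst j))"
    and len: "length (\<sigma> (Lst j)) + length (\<sigma> (Rst j)) \<le> N" and al: "\<And>i. f i < alph M"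
    by (auto simp: tape_ok_def)
  obtain a R where R: "\<sigma> (Rst j) = a # R" using rep by (cases "\<sigma> (Rst j)") (auto simp: tape_rep_def)
  note rep' = rep[unfolded R]
  define L where "L = \<sigma> (Lst j)"
  let ?\<sigma>1 = "\<sigma>(Rst j := Suc b # R)"
  have al': "(f(h := b)) i < alph M" for i using al act(2) by simp
  have 1: "sx (set_top [5] (Rst j) (Suc (alph M)) (\<lambda>xs. Suc (fst (snd (looked_up M xs) ! j)))) \<sigma> ?\<sigma>1 1"
    by (rule sx_cong[OF sx_set_top]) (use R s5 act in auto)
  show ?thesis
  proof (cases m)
    case Move_Right
    let ?\<sigma>2 = "?\<sigma>1(Lst j := Suc b # L)"
    let ?\<sigma>3 = "?\<sigma>2(Rst j := R)"
    let ?\<sigma>4 = "?\<sigma>3(Rst j := (if R = [] then [1] else R))"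
    have 2: "sx (cpy (Suc (alph M)) (Rst j) (Lst j)) ?\<sigma>1 ?\<sigma>2 3"
      by (rule sx_cong[OF sx_cpy]) (use act in \<open>auto simp: L_def\<close>)
    have 3: "sx (pop (Rst j)) ?\<sigma>2 ?\<sigma>3 3" by (rule sx_cong[OF sx_pop]) auto
    have 4: "sx (Bs (Rst j) (\<lambda>s. s = 0) (push (Rst j) 1) skip) ?\<sigma>3 ?\<sigma>4 4"
    proof (cases R)
      case Nil
      show ?thesis by (rule sx_cong[OF sx_BsT[OF _ sx_push]]) (use Nil in auto)
    next
      case (Cons x R')
      have "R ! 0 = f (h + 1) + 1" using rep' unfolding tape_rep_def Cons by (auto dest!: spec[of _ 1])
      then show ?thesis by (intro sx_cong[OF sx_BsF[OF _ sx_skip]]) (use Cons in auto)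
    qed
    have "sx (sim_tape M j) \<sigma> ?\<sigma>4 20" unfolding sim_tape_def
      by (rule sx_mono[OF sx_Sq[OF 1 sx_BsT[OF _ sx_Sq[OF 2 sx_Sq[OF 3 4]]]]])
         (use s5 act Move_Right in auto)
    moreover have "tape_ok M (Suc N) (f(h := b)) (h + shift m) ?\<sigma>4 j"
      using tape_rep_right[OF rep', of b] len al' Move_Right R unfolding tape_ok_def by (auto simp: L_def)
    ultimately show ?thesis by (intro exI[of _ ?\<sigma>4]) auto
  next
    case Move_Left
    let ?\<sigma>4 = "?\<sigma>1(Rst j := (if L = [] then 1 else hd L) # Suc b # R, Lst j := tl L)"
    have 4: "sx (Bs (Lst j) (\<lambda>s. s = 0) (push (Rst j) 1)
        (Sq (cpy (Suc (alph M)) (Lst j) (Rst j)) (pop (Lst j)))) ?\<sigma>1 ?\<sigma>4 8"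
    proof (cases L)
      case Nil
      show ?thesis by (rule sx_cong[OF sx_BsT[OF _ sx_push]]) (use Nil in \<open>auto simp: L_def fun_eq_iff\<close>)
    next
      case (Cons x L')
      have x: "x = f (h - 1) + 1" using rep' Cons unfolding tape_rep_def L_def by (auto dest!: spec[of _ 0])
      have 5: "sx (cpy (Suc (alph M)) (Lst j) (Rst j)) ?\<sigma>1 (?\<sigma>1(Rst j := x # Suc b # R)) 3"
        by (rule sx_cong[OF sx_cpy]) (use Cons x al in \<open>auto simp: L_def\<close>)
      have 6: "sx (pop (Lst j)) (?\<sigma>1(Rst j := x # Suc b # R)) ?\<sigma>4 3"
        by (rule sx_cong[OF sx_pop]) (use Cons in \<open>auto simp: L_def fun_eq_iff\<close>)
      show ?thesis by (rule sx_mono[OF sx_BsF[OF _ sx_Sq[OF 5 6]]]) (use Cons x in \<open>auto simp: L_def\<close>)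
    qed
    have "sx (sim_tape M j) \<sigma> ?\<sigma>4 20" unfolding sim_tape_def
      by (rule sx_mono[OF sx_Sq[OF 1 sx_BsF[OF _ sx_BsT[OF _ 4]]]])
         (use s5 act Move_Left in auto)
    moreover have "tape_ok M (Suc N) (f(h := b)) (h + shift m) ?\<sigma>4 j"
      using tape_rep_left[OF rep', of b] len al' Move_Left R unfolding tape_ok_def by (auto simp: L_def)
    ultimately show ?thesis by (intro exI[of _ ?\<sigma>4]) auto
  next
    case Move_Stay
    have "sx (sim_tape M j) \<sigma> ?\<sigma>1 20" unfolding sim_tape_def
      by (rule sx_mono[OF sx_Sq[OF 1 sx_BsF[OF _ sx_BsF[OF _ sx_skip]]]])
         (use s5 act Move_Stay in auto)
    moreover have "tape_ok M (Suc N) (f(h := b)) (h + shift m) ?\<sigma>1 j"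
      using tape_rep_stay[OF rep', of b] len al' Move_Stay R unfolding tape_ok_def by auto
    ultimately show ?thesis by (intro exI[of _ ?\<sigma>1]) auto
  qed
qed

text \<open>\<open>\<rho>\<close> records the contents of the stacks 0 to 3 that belong to the
  surrounding program; \<open>N\<close> bounds the visited part of each tape and grows by one per
  step.\<close>

definition sim_rel :: "tm \<Rightarrow> (nat \<Rightarrow> nat list) \<Rightarrow> nat \<Rightarrow> config \<Rightarrow> (nat \<Rightarrow> nat list) \<Rightarrow> bool" where
  "sim_rel M \<rho> N cf \<sigma> \<longleftrightarrow> (\<forall>i<4. \<sigma> i = \<rho> i) \<and> \<sigma> 4 = [Suc (state cf)] \<and> \<sigma> 5 = [] \<and>
     (\<forall>i\<ge>6 + 2 * tapes M. \<sigma> i = []) \<and> state cf \<le> states M \<and>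
     (\<forall>j<tapes M. tape_ok M N (contents cf j) (heads cf j) \<sigma> j)"

lemma tape_ok_cong:
  "tape_ok M N f h \<sigma> j \<Longrightarrow> \<sigma>' (Lst j) = \<sigma> (Lst j) \<Longrightarrow> \<sigma>' (Rst j) = \<sigma> (Rst j) \<Longrightarrow> tape_ok M N f h \<sigma>' j"
  by (simp add: tape_ok_def)

lemma sx_sim_tapes:
  assumes "\<forall>j<tapes M. tape_ok M N (f j) (h j) \<sigma> j" "\<sigma> 5 = [s]"
    and "\<And>j. j < tapes M \<Longrightarrow> fst (snd (looked_up M [s]) ! j) < alph M" "n \<le> tapes M"
  shows "\<exists>\<sigma>'. sx (seqs (sim_tape M) n) \<sigma> \<sigma>' (1 + 21 * n) \<and>
     (\<forall>j<n. tape_ok M (Suc N) ((f j)(h j := fst (snd (looked_up M [s]) ! j)))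
        (h j + shift (snd (snd (looked_up M [s]) ! j))) \<sigma>' j) \<and>
     (\<forall>i. (\<forall>j<n. i \<noteq> Lst j \<and> i \<noteq> Rst j) \<longrightarrow> \<sigma>' i = \<sigma> i)"
  using assms(4)
proof (induction n)
  case 0
  then show ?case using sx_skip by auto
next
  case (Suc n)
  then have "n \<le> tapes M" by simp
  from Suc.IH[OF this] obtain \<sigma>1 where \<sigma>1: "sx (seqs (sim_tape M) n) \<sigma> \<sigma>1 (1 + 21 * n) \<and>
     (\<forall>j<n. tape_ok M (Suc N) ((f j)(h j := fst (snd (looked_up M [s]) ! j)))
        (h j + shift (snd (snd (looked_up M [s]) ! j))) \<sigma>1 j) \<and>
     (\<forall>i. (\<forall>j<n. i \<noteq> Lst j \<and> i \<noteq> Rst j) \<longrightarrow> \<sigma>1 i = \<sigma> i)" ..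
  note 1 = conjunct1[OF \<sigma>1] and ok = conjunct1[OF conjunct2[OF \<sigma>1]]
  have fr: "\<sigma>1 i = \<sigma> i" if "\<forall>j<n. i \<noteq> Lst j \<and> i \<noteq> Rst j" for i
    using conjunct2[OF conjunct2[OF \<sigma>1]] that by simp
  have n: "n < tapes M" using Suc.prems by simp
  have okn: "tape_ok M N (f n) (h n) \<sigma>1 n"
  proof (rule tape_ok_cong)
    show "tape_ok M N (f n) (h n) \<sigma> n" using assms(1) n by blast
    show "\<sigma>1 (Lst n) = \<sigma> (Lst n)" "\<sigma>1 (Rst n) = \<sigma> (Rst n)" by (rule fr; simp)+
  qed
  have s5: "\<sigma>1 5 = [s]" unfolding assms(2)[symmetric] by (rule fr) simp
  obtain \<sigma>2 where \<sigma>2: "sx (sim_tape M n) \<sigma>1 \<sigma>2 20 \<and>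
    tape_ok M (Suc N) ((f n)(h n := fst (snd (looked_up M [s]) ! n)))
       (h n + shift (snd (snd (looked_up M [s]) ! n))) \<sigma>2 n \<and>
    (\<forall>i. i \<noteq> Lst n \<and> i \<noteq> Rst n \<longrightarrow> \<sigma>2 i = \<sigma>1 i)"
    using sx_sim_tape[OF okn s5 prod.collapse[symmetric] assms(3)[OF n]] ..
  note 2 = conjunct1[OF \<sigma>2] and ok2 = conjunct1[OF conjunct2[OF \<sigma>2]]
  have fr2: "\<sigma>2 i = \<sigma>1 i" if "i \<noteq> Lst n" "i \<noteq> Rst n" for i
    using conjunct2[OF conjunct2[OF \<sigma>2]] that by simp
  show ?case
  proof (intro exI[of _ \<sigma>2] conjI allI impI)
    show "sx (seqs (sim_tape M) (Suc n)) \<sigma> \<sigma>2 (1 + 21 * Suc n)"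
      unfolding seqs.simps by (rule sx_mono[OF sx_Sq[OF 1 2]]) simp
    fix i assume "\<forall>j<Suc n. i \<noteq> Lst j \<and> i \<noteq> Rst j"
    then show "\<sigma>2 i = \<sigma> i" using fr[of i] fr2[of i] by simp
  next
    fix j assume "j < Suc n"
    then consider "j < n" | "j = n" by linarith
    then show "tape_ok M (Suc N) ((f j)(h j := fst (snd (looked_up M [s]) ! j)))
        (h j + shift (snd (snd (looked_up M [s]) ! j))) \<sigma>2 j"
    proof cases
      case 1
      show ?thesis
      proof (rule tape_ok_cong)
        show "tape_ok M (Suc N) ((f j)(h j := fst (snd (looked_up M [s]) ! j)))
        (h j + shift (snd (snd (looked_up M [s]) ! j))) \<sigma>1 j" using ok 1 by blast
        show "\<sigma>2 (Lst j) = \<sigma>1 (Lst j)" "\<sigma>2 (Rst j) = \<sigma>1 (Rst j)" using 1 by (auto intro: fr2)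
      qed
    qed (use ok2 in blast)
  qed
qed

lemma sx_sim_step:
  assumes tm: "is_tm M" and rel: "sim_rel M \<rho> N cf \<sigma>" and st: "state cf < states M"
    and A: "\<And>xs. length xs = Suc (tapes M) \<Longrightarrow> set xs \<subseteq> {..states M + alph M} \<Longrightarrow> Suc (list_encode xs) < A"
  shows "\<exists>\<sigma>'. sx (sim_step M A) \<sigma> \<sigma>' (20 + 21 * tapes M) \<and> sim_rel M \<rho> (Suc N) (step M cf) \<sigma>'"
proof -
  define f where "f = contents cf" define h where "h = heads cf" define q where "q = state cf"
  define K where "K = tapes M"
  have ok: "\<forall>j<K. tape_ok M N (f j) (h j) \<sigma> j" using rel by (simp add: sim_rel_def f_def h_def K_def)
  have sc: "top_sym (\<sigma> (Rst j)) = f j (h j) + 1" if "j < K" for j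
  proof -
    have r: "tape_rep (f j) (h j) (\<sigma> (Lst j)) (\<sigma> (Rst j))" using ok that by (simp add: tape_ok_def)
    then obtain a R where R: "\<sigma> (Rst j) = a # R" by (cases "\<sigma> (Rst j)") (auto simp: tape_rep_def)
    with tape_rep_head[of "f j" "h j"] r show ?thesis by simp
  qed
  have al: "f j i < alph M" if "j < K" for j i using ok that by (simp add: tape_ok_def)
  define xs where "xs = Suc q # map (\<lambda>j. Suc (f j (h j))) [0..<K]"
  define s where "s = Suc (list_encode xs)"
  have tops: "map (\<lambda>i. top_sym (\<sigma> i)) (4 # map Rst [0..<K]) = xs"
    using rel sc by (simp add: xs_def sim_rel_def q_def)
  have sA: "s < A" unfolding s_def
  proof (rule A)
    have "Suc (f j (h j)) \<le> states M + alph M" if "j < K" for j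
      using al[OF that, of "h j"] by simp
    then show "set xs \<subseteq> {..states M + alph M}" using st by (auto simp: xs_def q_def)
  qed (simp add: xs_def K_def)
  have scn: "scanned M cf = map (\<lambda>j. f j (h j)) [0..<K]" by (simp add: scanned_def f_def h_def K_def)
  have lu: "looked_up M [s] = delta M q (scanned M cf)"
    by (simp add: looked_up_def s_def xs_def scn comp_def)
  obtain q' as where d: "delta M q (scanned M cf) = (q', as)" by (cases "delta M q (scanned M cf)")
  have tm': "q' \<le> states M \<and> length as = tapes M \<and> fst ` set as \<subseteq> {..<alph M}"
    if "q < states M" "length xs = tapes M" "set xs \<subseteq> {..<alph M}" "delta M q xs = (q', as)" for q xs q' as
    using tm that unfolding is_tm_def by blast
  have "length (scanned M cf) = tapes M" by (simp add: scn K_def)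
  moreover have "set (scanned M cf) \<subseteq> {..<alph M}" using al by (auto simp: scn)
  ultimately have d': "q' \<le> states M" "length as = tapes M" "fst ` set as \<subseteq> {..<alph M}"
    using tm'[of q "scanned M cf" q' as] d st by (simp_all add: q_def)
  let ?\<sigma>1 = "\<sigma>(5 := [s])" let ?\<sigma>2 = "?\<sigma>1(4 := [Suc q'])"
  have sig: "\<sigma> 5 = []" "\<sigma> 4 = [Suc q]" "\<forall>i\<ge>6 + 2 * K. \<sigma> i = []" "\<forall>i<4. \<sigma> i = \<rho> i"
    using rel by (simp_all add: sim_rel_def q_def K_def)
  have "sx (push_fun (4 # map Rst [0..<K]) 5 A (\<lambda>xs. Suc (list_encode xs))) \<sigma>
      (\<sigma>(5 := Suc (list_encode (map (\<lambda>i. top_sym (\<sigma> i)) (4 # map Rst [0..<K]))) # \<sigma> 5)) 3"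
    by (rule sx_push_fun) (unfold tops s_def[symmetric], use sA in auto)
  then have 1: "sx (push_fun (4 # map Rst [0..<K]) 5 A (\<lambda>xs. Suc (list_encode xs))) \<sigma> ?\<sigma>1 3"
    unfolding tops s_def[symmetric] sig(1) .
  have 2: "sx (set_top [5] 4 (states M + 2) (\<lambda>xs. Suc (fst (looked_up M xs)))) ?\<sigma>1 ?\<sigma>2 1"
    by (rule sx_cong[OF sx_set_top]) (use sig d d' in \<open>simp_all add: lu\<close>)
  have bd: "fst (snd (looked_up M [s]) ! j) < alph M" if "j < tapes M" for j
  proof -
    have "as ! j \<in> set as" using d' that by simp
    then show ?thesis using d'(3) by (auto simp: lu d)
  qed
  have ok2: "\<forall>j<tapes M. tape_ok M N (f j) (h j) ?\<sigma>2 j"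
  proof (intro allI impI)
    fix j assume "j < tapes M"
    then have "tape_ok M N (f j) (h j) \<sigma> j" using ok by (simp add: K_def)
    then show "tape_ok M N (f j) (h j) ?\<sigma>2 j" by (rule tape_ok_cong) simp_all
  qed
  have s52: "?\<sigma>2 5 = [s]" by simp
  have Kle: "K \<le> tapes M" by (simp add: K_def)
  obtain \<sigma>3 where \<sigma>3: "sx (seqs (sim_tape M) K) ?\<sigma>2 \<sigma>3 (1 + 21 * K) \<and>
    (\<forall>j<K. tape_ok M (Suc N) ((f j)(h j := fst (snd (looked_up M [s]) ! j)))
        (h j + shift (snd (snd (looked_up M [s]) ! j))) \<sigma>3 j) \<and>
    (\<forall>i. (\<forall>j<K. i \<noteq> Lst j \<and> i \<noteq> Rst j) \<longrightarrow> \<sigma>3 i = ?\<sigma>2 i)"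
    using sx_sim_tapes[where n = K and s = s, OF ok2 s52 bd Kle] ..
  note 3 = conjunct1[OF \<sigma>3] and ok3 = conjunct1[OF conjunct2[OF \<sigma>3], unfolded lu d snd_conv]
  have fr: "\<sigma>3 i = ?\<sigma>2 i" if "\<forall>j<K. i \<noteq> Lst j \<and> i \<noteq> Rst j" for i
    using conjunct2[OF conjunct2[OF \<sigma>3]] that by blast
  let ?\<sigma>4 = "\<sigma>3(5 := [])"
  have 4: "sx (pop 5) \<sigma>3 ?\<sigma>4 3" by (rule sx_cong[OF sx_pop]) (use fr[of 5] in auto)
  have "sx (sim_step M A) \<sigma> ?\<sigma>4 (20 + 21 * tapes M)"
    unfolding sim_step_def
    by (rule sx_mono[OF sx_Sq[OF 1[unfolded K_def] sx_Sq[OF 2 sx_Sq[OF 3[unfolded K_def] 4]]]]) simp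
  moreover have "sim_rel M \<rho> (Suc N) (step M cf) ?\<sigma>4"
  proof -
    have s': "step M cf = \<lparr>state = q', heads = (\<lambda>j. if j < K then h j + shift (snd (as ! j)) else h j),
       contents = (\<lambda>j. if j < K then (f j)(h j := fst (as ! j)) else f j)\<rparr>"
      using st d by (simp add: step_def q_def h_def f_def K_def cong: if_cong)
    have big: "\<sigma>3 i = []" if i: "i \<ge> 6 + 2 * K" for i
    proof -
      have "\<sigma>3 i = ?\<sigma>2 i" by (rule fr) (use i in \<open>auto simp: Lst_def Rst_def\<close>)
      then show ?thesis using i sig(3) by simp
    qed
    have low: "\<sigma>3 i = ?\<sigma>2 i" if "i < 6" for i by (rule fr) (use that in auto)
    show ?thesis unfolding sim_rel_def
    proof (intro conjI allI impI)
      fix j assume "j < tapes M"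
      then have "tape_ok M (Suc N) ((f j)(h j := fst (as ! j))) (h j + shift (snd (as ! j))) \<sigma>3 j"
        using ok3 by (simp add: K_def)
      then have "tape_ok M (Suc N) ((f j)(h j := fst (as ! j))) (h j + shift (snd (as ! j))) ?\<sigma>4 j"
        by (rule tape_ok_cong) simp_all
      then show "tape_ok M (Suc N) (contents (step M cf) j) (heads (step M cf) j) ?\<sigma>4 j"
        using \<open>j < tapes M\<close> by (simp add: s' K_def)
    qed (use low big sig d'(1) in \<open>simp_all add: s' K_def\<close>)
  qed
  ultimately show ?thesis by blast
qed

text \<open>There are finitely many combinations of a state and scanned symbols, so their packed
  symbols fit into a finite alphabet.\<close>

lemma sim_finish:
  assumes "is_tm M"
  obtains A where "\<And>xs. length xs = Suc (tapes M) \<Longrightarrow> set xs \<subseteq> {..states M + alph M} \<Longrightarrow> Suc (list_encode xs) < A"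
proof -
  let ?X = "{xs :: nat list. set xs \<subseteq> {..states M + alph M} \<and> length xs = Suc (tapes M)}"
  have fin: "finite ((\<lambda>xs. Suc (list_encode xs)) ` ?X)" by (intro finite_imageI finite_lists_length_eq) simp
  from that[of "Suc (Max ((\<lambda>xs. Suc (list_encode xs)) ` ?X))"] show ?thesis
    using Max_ge[OF fin] by (auto simp: less_Suc_eq_le)
qed

definition sim_loop :: "tm \<Rightarrow> nat \<Rightarrow> com" where
  "sim_loop M A = Ws 4 (\<lambda>s. s \<noteq> Suc (states M)) (sim_step M A)"

lemma sx_sim_loop:
  assumes tm: "is_tm M"
    and A: "\<And>xs. length xs = Suc (tapes M) \<Longrightarrow> set xs \<subseteq> {..states M + alph M} \<Longrightarrow> Suc (list_encode xs) < A"
    and "sim_rel M \<rho> N cf \<sigma>" "\<forall>s<t. state ((step M ^^ s) cf) < states M" "state ((step M ^^ t) cf) = states M"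
  shows "\<exists>\<sigma>'. sx (sim_loop M A) \<sigma> \<sigma>' (t * (21 + 21 * tapes M) + 1) \<and> sim_rel M \<rho> (N + t) ((step M ^^ t) cf) \<sigma>'"
  using assms(3-)
proof (induction t arbitrary: N cf \<sigma>)
  case 0
  have "sx (sim_loop M A) \<sigma> \<sigma> 1" unfolding sim_loop_def
    by (rule sx_WsF) (use 0 in \<open>auto simp: sim_rel_def\<close>)
  then show ?case using 0 by auto
next
  case (Suc t)
  have st: "state cf < states M" using Suc.prems(2) by (metis funpow_0 zero_less_Suc)
  obtain \<sigma>1 where 1: "sx (sim_step M A) \<sigma> \<sigma>1 (20 + 21 * tapes M)" "sim_rel M \<rho> (Suc N) (step M cf) \<sigma>1"
    using sx_sim_step[OF tm Suc.prems(1) st A] by blast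
  have sh: "(step M ^^ s) (step M cf) = (step M ^^ Suc s) cf" for s by (simp add: funpow_Suc_right del: funpow.simps)
  have "\<exists>\<sigma>'. sx (sim_loop M A) \<sigma>1 \<sigma>' (t * (21 + 21 * tapes M) + 1) \<and>
     sim_rel M \<rho> (Suc N + t) ((step M ^^ t) (step M cf)) \<sigma>'"
  proof (rule Suc.IH[OF 1(2)])
    show "\<forall>s<t. state ((step M ^^ s) (step M cf)) < states M" unfolding sh using Suc.prems(2) by auto
    show "state ((step M ^^ t) (step M cf)) = states M" unfolding sh by (rule Suc.prems(3))
  qed
  then obtain \<sigma>' where 2: "sx (sim_loop M A) \<sigma>1 \<sigma>' (t * (21 + 21 * tapes M) + 1)"
    "sim_rel M \<rho> (Suc N + t) ((step M ^^ Suc t) cf) \<sigma>'" unfolding sh by blast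
  have "sx (sim_loop M A) \<sigma> \<sigma>' (Suc t * (21 + 21 * tapes M) + 1)" unfolding sim_loop_def
    by (rule sx_mono[OF sx_WsT[OF _ 1(1) 2(1)[unfolded sim_loop_def]]])
       (use Suc.prems(1) st in \<open>auto simp: sim_rel_def\<close>)
  then show ?case using 2(2) by auto
qed

text \<open>Reads one list cell off stack 0, that is, its leading 2 and the unary code of 1, 2 or 3,
  and pushes the symbol shifted by one. Pushing reverses the order, which is why words cross this
  interface reversed.\<close>

definition load_body :: com where
  "load_body = Sq (pop 0) (Sq (pop 0) (Sq (pop 0) (Bs 0 (\<lambda>s. s = 1) (Sq (pop 0) (push (Rst 0) 2))
     (Sq (pop 0) (Sq (pop 0) (Bs 0 (\<lambda>s. s = 1) (Sq (pop 0) (push (Rst 0) 3))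
        (Sq (pop 0) (Sq (pop 0) (Sq (pop 0) (push (Rst 0) 4))))))))))"

text \<open>\<open>tape_rep\<close> wants a cell under the head, so a tape without input starts with
  one blank cell.\<close>

definition init_tape :: "nat \<Rightarrow> com" where
  "init_tape j = Bs (Rst j) (\<lambda>s. s = 0) (push (Rst j) 1) skip"

definition load :: "tm \<Rightarrow> com" where
  "load M = Sq (Ws 0 (\<lambda>s. s = 2) load_body) (Sq (pop 0) (Sq (seqs init_tape (tapes M)) (push 4 1)))"

lemma sx_load_body:
  assumes "\<sigma> 0 = 2 # code (enc a) @ r" "a \<in> {1, 2, 3 :: nat}"
  shows "sx load_body \<sigma> (\<sigma>(0 := r, Rst 0 := Suc a # \<sigma> (Rst 0))) 60"
proof -
  have p: "sx (pop 0) (\<sigma>(0 := x # s)) (\<sigma>(0 := s)) 3" for x s by (rule sx_cong[OF sx_pop]) auto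
  have P: "sx (push (Rst 0) x) (\<sigma>(0 := s)) (\<sigma>(0 := s, Rst 0 := x # \<sigma> (Rst 0))) 3" for x s
    by (rule sx_cong[OF sx_push]) auto
  have s: "\<sigma> = \<sigma>(0 := 2 # code (enc a) @ r)" using assms(1) by (auto simp: fun_eq_iff)
  have t: "P (top_sym ((\<sigma>(0 := x # u)) 0)) = P x" for P x u by simp
  have c: "code (enc (1 :: nat)) = [2, 1, 1]" "code (enc (2 :: nat)) = [2, 1, 2, 1, 1]"
    "code (enc (3 :: nat)) = [2, 1, 2, 1, 2, 1, 1]"
    by (simp_all add: eval_nat_numeral)
  have Sa: "Suc 1 = 2" "Suc 2 = 3" "Suc 3 = 4" by simp_all
  from assms(2) consider "a = 1" | "a = 2" | "a = 3" by blast
  then have "sx load_body (\<sigma>(0 := 2 # code (enc a) @ r)) (\<sigma>(0 := r, Rst 0 := Suc a # \<sigma> (Rst 0))) 60"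
  proof cases
    case 1
    show ?thesis unfolding load_body_def 1 c append.simps Sa
      by (rule sx_mono, (rule sx_Sq[OF p])+, rule sx_BsT, simp, rule sx_Sq[OF p P], simp)
  next
    case 2
    show ?thesis unfolding load_body_def 2 c append.simps Sa
      by (rule sx_mono, (rule sx_Sq[OF p])+, rule sx_BsF, simp, (rule sx_Sq[OF p])+, rule sx_BsT, simp,
          rule sx_Sq[OF p P], simp)
  next
    case 3
    show ?thesis unfolding load_body_def 3 c append.simps Sa
      by (rule sx_mono, (rule sx_Sq[OF p])+, rule sx_BsF, simp, (rule sx_Sq[OF p])+, rule sx_BsF, simp,
          (rule sx_Sq[OF p])+, rule P, simp)
  qed
  then show ?thesis using s by metis
qed

lemma sx_load_loop:
  assumes "\<sigma> 0 = code (enc u) @ r" "set u \<subseteq> {1, 2, 3 :: nat}"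
  shows "sx (Ws 0 (\<lambda>s. s = 2) load_body) \<sigma>
     (\<sigma>(0 := 1 # r, Rst 0 := map Suc (rev u) @ \<sigma> (Rst 0))) (61 * length u + 1)"
  using assms
proof (induction u arbitrary: \<sigma>)
  case Nil
  show ?case by (rule sx_cong[OF sx_WsF]) (use Nil in \<open>auto simp: fun_eq_iff\<close>)
next
  case (Cons a u)
  let ?\<sigma>1 = "\<sigma>(0 := code (enc u) @ r, Rst 0 := Suc a # \<sigma> (Rst 0))"
  have 1: "sx load_body \<sigma> ?\<sigma>1 60" by (rule sx_load_body) (use Cons.prems in auto)
  have 2: "sx (Ws 0 (\<lambda>s. s = 2) load_body) ?\<sigma>1
     (\<sigma>(0 := 1 # r, Rst 0 := map Suc (rev (a # u)) @ \<sigma> (Rst 0))) (61 * length u + 1)"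
    by (rule sx_cong[OF Cons.IH]) (use Cons.prems in \<open>auto simp: fun_eq_iff\<close>)
  show ?case by (rule sx_mono[OF sx_WsT[OF _ 1 2]]) (use Cons.prems in auto)
qed

lemma sx_init_tapes:
  "sx (seqs init_tape n) \<sigma> (\<lambda>i. if (\<exists>j<n. i = Rst j) \<and> \<sigma> i = [] then [1] else \<sigma> i) (1 + 5 * n)"
  if "\<forall>j. \<sigma> (Rst j) = [] \<or> top_sym (\<sigma> (Rst j)) \<noteq> 0"
proof (induction n)
  case 0
  show ?case unfolding seqs.simps by (rule sx_cong[OF sx_skip]) auto
next
  case (Suc n)
  let ?\<sigma>1 = "\<lambda>i. if (\<exists>j<n. i = Rst j) \<and> \<sigma> i = [] then [1] else \<sigma> i"
  let ?\<sigma>2 = "\<lambda>i. if (\<exists>j<Suc n. i = Rst j) \<and> \<sigma> i = [] then [1] else \<sigma> i"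
  have 1: "sx (init_tape n) ?\<sigma>1 ?\<sigma>2 4"
  proof (cases "\<sigma> (Rst n) = []")
    case True
    show ?thesis unfolding init_tape_def
      by (rule sx_cong[OF sx_BsT[OF _ sx_push]]) (use True in \<open>auto simp: fun_eq_iff less_Suc_eq\<close>)
  next
    case False
    show ?thesis unfolding init_tape_def
      by (rule sx_cong[OF sx_BsF[OF _ sx_skip]]) (use False that in \<open>auto simp: fun_eq_iff less_Suc_eq\<close>)
  qed
  show ?case using sx_Sq[OF Suc.IH 1] by (simp add: algebra_simps)
qed

lemma sx_load:
  assumes "\<sigma> 0 = code (enc (rev w)) @ r" "set w \<subseteq> {1, 2, 3 :: nat}" "\<forall>i\<ge>4. \<sigma> i = []" "is_tm M"
  shows "\<exists>\<sigma>'. sx (load M) \<sigma> \<sigma>' (61 * length w + 5 * tapes M + 20) \<and>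
     sim_rel M (\<sigma>(0 := r)) (length w + 1) (init w) \<sigma>'"
proof -
  let ?\<sigma>1 = "\<sigma>(0 := 1 # r, Rst 0 := map Suc w)"
  let ?\<sigma>2 = "\<sigma>(0 := r, Rst 0 := map Suc w)"
  let ?\<sigma>3 = "\<lambda>i. if (\<exists>j<tapes M. i = Rst j) \<and> ?\<sigma>2 i = [] then [1] else ?\<sigma>2 i"
  let ?\<sigma>4 = "?\<sigma>3(4 := [1])"
  have tps: "2 \<le> tapes M" "4 \<le> alph M" using assms(4) by (auto simp: is_tm_def)
  have z: "\<sigma> (Rst j) = []" "\<sigma> (Lst j) = []" for j using assms(3) by (auto simp: Rst_def Lst_def)
  have 1: "sx (Ws 0 (\<lambda>s. s = 2) load_body) \<sigma> ?\<sigma>1 (61 * length w + 1)"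
    by (rule sx_cong[OF sx_load_loop[where u = "rev w" and r = r]]) (use assms z in \<open>auto simp: fun_eq_iff\<close>)
  have 2: "sx (pop 0) ?\<sigma>1 ?\<sigma>2 3" by (rule sx_cong[OF sx_pop]) (auto simp: fun_eq_iff)
  have 3: "sx (seqs init_tape (tapes M)) ?\<sigma>2 ?\<sigma>3 (1 + 5 * tapes M)"
    by (rule sx_init_tapes) (use z in \<open>cases w; auto\<close>)
  have 4: "sx (push 4 1) ?\<sigma>3 ?\<sigma>4 3"
    by (rule sx_cong[OF sx_push]) (use assms in \<open>auto simp: fun_eq_iff\<close>)
  have "sx (load M) \<sigma> ?\<sigma>4 (61 * length w + 5 * tapes M + 20)" unfolding load_def
    by (rule sx_mono[OF sx_Sq[OF 1 sx_Sq[OF 2 sx_Sq[OF 3 4]]]]) simp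
  moreover have "sim_rel M (\<sigma>(0 := r)) (length w + 1) (init w) ?\<sigma>4"
  proof -
    have "tape_ok M (length w + 1) (contents (init w) j) (heads (init w) j) ?\<sigma>4 j" if j: "j < tapes M" for j
    proof -
      have L: "?\<sigma>4 (Lst j) = []" using z by auto
      have R: "?\<sigma>4 (Rst j) = (if j = 0 \<and> w \<noteq> [] then map Suc w else [1])" using z j by auto
      have "tape_rep (contents (init w) j) 0 [] (if j = 0 \<and> w \<noteq> [] then map Suc w else [1])"
        by (auto simp: tape_rep_def init_def word_tape_def)
      moreover have "word_tape w i < alph M" for i
      proof -
        have "w ! nat i \<le> 3" if "0 \<le> i" "i < int (length w)"
          using that assms(2) nth_mem[of "nat i" w] by fastforce
        then show ?thesis using tps by (force simp: word_tape_def)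
      qed
      then have "contents (init w) j i < alph M" for i using tps by (auto simp: init_def word_tape_def)
      ultimately show ?thesis unfolding tape_ok_def L R by (auto simp: init_def Suc_le_eq)
    qed
    moreover have "?\<sigma>4 i = []" if "i \<ge> 6 + 2 * tapes M" for i
      using that assms(3) tps by (auto simp: Rst_def)
    ultimately show ?thesis using assms(3) unfolding sim_rel_def by (auto simp: init_def)
  qed
  ultimately show ?thesis by blast
qed

definition unload_body :: com where
  "unload_body = Sq (Bs (Rst 1) (\<lambda>s. s = 2) (push_word (2 # code (enc (1::nat))))
     (Bs (Rst 1) (\<lambda>s. s = 3) (push_word (2 # code (enc (2::nat)))) (push_word (2 # code (enc (3::nat))))))
     (pop (Rst 1))"

definition clear_tape :: "nat \<Rightarrow> com" where
  "clear_tape j = Sq (Ws (Lst j) (\<lambda>s. s \<noteq> 0) (pop (Lst j))) (Ws (Rst j) (\<lambda>s. s \<noteq> 0) (pop (Rst j)))"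

text \<open>Output words contain no blank: after rewinding to the left end of the visited part,
  skipping blanks leads to the first symbol, and the next blank ends the word. Clearing everything
  restores the empty stacks from 4 on that \<open>cr\<close> demands.\<close>

definition unload :: "tm \<Rightarrow> com" where
  "unload M = Sq (Ws (Lst 1) (\<lambda>s. s \<noteq> 0) (Sq (cpy (Suc (alph M)) (Lst 1) (Rst 1)) (pop (Lst 1))))
     (Sq (Ws (Rst 1) (\<lambda>s. s = 1) (pop (Rst 1))) (Sq (push 0 1)
     (Sq (Ws (Rst 1) (\<lambda>s. s > 1) unload_body) (Sq (seqs clear_tape (tapes M)) (pop 4)))))"

lemma sx_collect:
  assumes "\<forall>a\<in>set (\<sigma> (Lst 1)). 0 < a \<and> a \<le> alph M"
  shows "sx (Ws (Lst 1) (\<lambda>s. s \<noteq> 0) (Sq (cpy (Suc (alph M)) (Lst 1) (Rst 1)) (pop (Lst 1)))) \<sigma>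
     (\<sigma>(Lst 1 := [], Rst 1 := rev (\<sigma> (Lst 1)) @ \<sigma> (Rst 1))) (8 * length (\<sigma> (Lst 1)) + 1)"
  using assms
proof (induction "\<sigma> (Lst 1)" arbitrary: \<sigma>)
  case Nil
  show ?case by (rule sx_cong[OF sx_WsF]) (use Nil(1)[symmetric] in \<open>auto simp: fun_eq_iff\<close>)
next
  case (Cons a u)
  note L = Cons.hyps(2)[symmetric]
  let ?\<sigma>1 = "\<sigma>(Rst 1 := a # \<sigma> (Rst 1), Lst 1 := u)"
  have a: "0 < a" "a \<le> alph M" using Cons.prems L by auto
  have 1: "sx (Sq (cpy (Suc (alph M)) (Lst 1) (Rst 1)) (pop (Lst 1))) \<sigma> ?\<sigma>1 7"
    by (rule sx_cong[OF sx_Sq[OF sx_cpy sx_pop]]) (use L a in \<open>auto simp: fun_eq_iff\<close>)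
  have "sx (Ws (Lst 1) (\<lambda>s. s \<noteq> 0) (Sq (cpy (Suc (alph M)) (Lst 1) (Rst 1)) (pop (Lst 1)))) ?\<sigma>1
     (?\<sigma>1(Lst 1 := [], Rst 1 := rev (?\<sigma>1 (Lst 1)) @ ?\<sigma>1 (Rst 1))) (8 * length (?\<sigma>1 (Lst 1)) + 1)"
    by (rule Cons.hyps(1)) (use Cons.prems L in auto)
  note 2 = sx_cong[OF this, of "\<sigma>(Lst 1 := [], Rst 1 := rev (\<sigma> (Lst 1)) @ \<sigma> (Rst 1))" "8 * length u + 1"]
  show ?case by (rule sx_mono[OF sx_WsT[OF _ 1 2]]) (use L a in \<open>auto simp: fun_eq_iff\<close>)
qed

lemma sx_skip_blanks:
  assumes "\<sigma> (Rst 1) = replicate n 1 @ u" "top_sym u \<noteq> 1"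
  shows "sx (Ws (Rst 1) (\<lambda>s. s = 1) (pop (Rst 1))) \<sigma> (\<sigma>(Rst 1 := u)) (4 * n + 1)"
  using assms(1)
proof (induction n arbitrary: \<sigma>)
  case 0
  show ?case by (rule sx_cong[OF sx_WsF]) (use 0 assms(2) in \<open>auto simp: fun_eq_iff\<close>)
next
  case (Suc n)
  have 1: "sx (pop (Rst 1)) \<sigma> (\<sigma>(Rst 1 := replicate n 1 @ u)) 3"
    by (rule sx_cong[OF sx_pop]) (use Suc.prems in auto)
  have 2: "sx (Ws (Rst 1) (\<lambda>s. s = 1) (pop (Rst 1))) (\<sigma>(Rst 1 := replicate n 1 @ u)) (\<sigma>(Rst 1 := u)) (4 * n + 1)"
    by (rule sx_cong[OF Suc.IH]) auto
  show ?case by (rule sx_mono[OF sx_WsT[OF _ 1 2]]) (use Suc.prems in auto)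
qed

lemma sx_unload_body:
  assumes "\<sigma> (Rst 1) = Suc a # u" "a \<in> {1, 2, 3}"
  shows "sx unload_body \<sigma> (\<sigma>(0 := 2 # code (enc a) @ \<sigma> 0, Rst 1 := u)) 50"
proof -
  have w: "sx (push_word (2 # code (enc k))) \<sigma> (\<sigma>(0 := 2 # code (enc k) @ \<sigma> 0)) 37" if "k \<le> 3" for k :: nat
  proof -
    have "length (code (enc k)) \<le> 7" using that es_nat[of k] by (simp add: sz_def)
    then show ?thesis by (intro sx_cong[OF sx_push_word]) auto
  qed
  have 1: "sx (Bs (Rst 1) (\<lambda>s. s = 2) (push_word (2 # code (enc (1::nat))))
     (Bs (Rst 1) (\<lambda>s. s = 3) (push_word (2 # code (enc (2::nat)))) (push_word (2 # code (enc (3::nat))))))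
     \<sigma> (\<sigma>(0 := 2 # code (enc a) @ \<sigma> 0)) 39"
  proof -
    from assms(2) consider "a = 1" | "a = 2" | "a = 3" by blast
    then show ?thesis
    proof cases
      case 1
      show ?thesis unfolding 1 by (rule sx_mono[OF sx_BsT[OF _ w[of 1]]]) (use assms 1 in auto)
    next
      case 2
      show ?thesis unfolding 2 by (rule sx_mono[OF sx_BsF[OF _ sx_BsT[OF _ w[of 2]]]]) (use assms 2 in auto)
    next
      case 3
      show ?thesis unfolding 3 by (rule sx_mono[OF sx_BsF[OF _ sx_BsF[OF _ w[of 3]]]]) (use assms 3 in auto)
    qed
  qed
  have 2: "sx (pop (Rst 1)) (\<sigma>(0 := 2 # code (enc a) @ \<sigma> 0)) (\<sigma>(0 := 2 # code (enc a) @ \<sigma> 0, Rst 1 := u)) 3"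
    by (rule sx_cong[OF sx_pop]) (use assms in auto)
  show ?thesis unfolding unload_body_def by (rule sx_mono[OF sx_Sq[OF 1 2]]) simp
qed

lemma sx_unload_loop:
  assumes "\<sigma> 0 = code (enc s) @ r" "\<sigma> (Rst 1) = map Suc v @ u" "set v \<subseteq> {1, 2, 3 :: nat}" "top_sym u \<le> 1"
  shows "sx (Ws (Rst 1) (\<lambda>s. s > 1) unload_body) \<sigma> (\<sigma>(0 := code (enc (rev v @ s)) @ r, Rst 1 := u)) (51 * length v + 1)"
  using assms(1-3)
proof (induction v arbitrary: \<sigma> s)
  case Nil
  show ?case by (rule sx_cong[OF sx_WsF]) (use Nil assms(4) in \<open>auto simp: fun_eq_iff\<close>)
next
  case (Cons a v)
  let ?\<sigma>1 = "\<sigma>(0 := code (enc (a # s)) @ r, Rst 1 := map Suc v @ u)"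
  have 1: "sx unload_body \<sigma> ?\<sigma>1 50"
    by (rule sx_cong[OF sx_unload_body[of \<sigma> a "map Suc v @ u"]]) (use Cons.prems in auto)
  have 2: "sx (Ws (Rst 1) (\<lambda>s. s > 1) unload_body) ?\<sigma>1
     (\<sigma>(0 := code (enc (rev (a # v) @ s)) @ r, Rst 1 := u)) (51 * length v + 1)"
    by (rule sx_cong[OF Cons.IH[of _ "a # s"]]) (use Cons.prems in \<open>auto simp: fun_eq_iff\<close>)
  show ?case by (rule sx_mono[OF sx_WsT[OF _ 1 2]]) (use Cons.prems in auto)
qed

lemma sx_clear:
  assumes "\<forall>a\<in>set (\<sigma> i). 0 < a"
  shows "sx (Ws i (\<lambda>s. s \<noteq> 0) (pop i)) \<sigma> (\<sigma>(i := [])) (4 * length (\<sigma> i) + 1)"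
  using assms
proof (induction "\<sigma> i" arbitrary: \<sigma>)
  case Nil
  show ?case by (rule sx_cong[OF sx_WsF]) (use Nil(1)[symmetric] in \<open>auto simp: fun_eq_iff\<close>)
next
  case (Cons a u)
  note L = Cons.hyps(2)[symmetric]
  have 1: "sx (pop i) \<sigma> (\<sigma>(i := u)) 3" by (rule sx_cong[OF sx_pop]) (use L in auto)
  have "sx (Ws i (\<lambda>s. s \<noteq> 0) (pop i)) (\<sigma>(i := u)) ((\<sigma>(i := u))(i := [])) (4 * length ((\<sigma>(i := u)) i) + 1)"
    by (rule Cons.hyps(1)) (use Cons.prems L in auto)
  then have 2: "sx (Ws i (\<lambda>s. s \<noteq> 0) (pop i)) (\<sigma>(i := u)) (\<sigma>(i := [])) (4 * length u + 1)" by simp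
  show ?case by (rule sx_mono[OF sx_WsT[OF _ 1 2]]) (use L Cons.prems in auto)
qed

lemma sx_clear_tapes:
  assumes "\<forall>j<n. (\<forall>a\<in>set (\<sigma> (Lst j)) \<union> set (\<sigma> (Rst j)). 0 < a) \<and> length (\<sigma> (Lst j)) + length (\<sigma> (Rst j)) \<le> N"
  shows "sx (seqs clear_tape n) \<sigma> (\<lambda>i. if \<exists>j<n. i = Lst j \<or> i = Rst j then [] else \<sigma> i) (1 + n * (4 * N + 4))"
  using assms
proof (induction n)
  case 0
  show ?case unfolding seqs.simps by (rule sx_cong[OF sx_skip]) auto
next
  case (Suc n)
  let ?\<sigma>1 = "\<lambda>i. if \<exists>j<n. i = Lst j \<or> i = Rst j then [] else \<sigma> i"
  let ?\<sigma>2 = "?\<sigma>1(Lst n := [])"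
  have l: "?\<sigma>1 (Lst n) = \<sigma> (Lst n)" "?\<sigma>2 (Rst n) = \<sigma> (Rst n)" by auto
  have q: "(\<forall>a\<in>set (\<sigma> (Lst n)) \<union> set (\<sigma> (Rst n)). 0 < a) \<and> length (\<sigma> (Lst n)) + length (\<sigma> (Rst n)) \<le> N"
    using Suc.prems by blast
  have p: "\<forall>a\<in>set (?\<sigma>1 (Lst n)). 0 < a" "\<forall>a\<in>set (?\<sigma>2 (Rst n)). 0 < a" using q unfolding l by simp_all
  have 3: "sx (clear_tape n) ?\<sigma>1 (?\<sigma>2(Rst n := [])) (4 * N + 3)"
    unfolding clear_tape_def
    by (rule sx_mono[OF sx_Sq[OF sx_clear[of ?\<sigma>1, OF p(1)] sx_clear[of ?\<sigma>2, OF p(2)]]])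
       (unfold l, use q in simp)
  have e: "?\<sigma>2(Rst n := []) = (\<lambda>i. if \<exists>j<Suc n. i = Lst j \<or> i = Rst j then [] else \<sigma> i)"
    by (auto simp: fun_eq_iff less_Suc_eq)
  have 1: "sx (seqs clear_tape n) \<sigma> ?\<sigma>1 (1 + n * (4 * N + 4))" by (rule Suc.IH, intro allI impI, rule mp[OF spec[OF Suc.prems]], simp)
  show ?case unfolding seqs.simps by (rule sx_cong[OF sx_Sq[OF 1 3]]) (unfold e, simp_all)
qed

lemma tape_rep_positive:
  assumes "tape_rep f h L R" "a \<in> set L \<union> set R"
  shows "0 < a \<and> (\<exists>i. a = Suc (f i))"
proof -
  have r: "(if i < length R then R ! i else 1) = f (h + int i) + 1"
    and l: "(if i < length L then L ! i else 1) = f (h - 1 - int i) + 1" for i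
    using assms(1) unfolding tape_rep_def by blast+
  from assms(2) consider i where "i < length L" "a = L ! i" | i where "i < length R" "a = R ! i"
    by (auto simp: in_set_conv_nth)
  then show ?thesis
  proof cases
    case 1 then show ?thesis using l[of i] by auto
  next
    case 2 then show ?thesis using r[of i] by auto
  qed
qed

text \<open>Cells outside the represented part are blank, while the first and the last symbol of
  \<open>v\<close> are not; so the word lies inside and is merely padded with blanks, which are
  stored as 1.\<close>

lemma tape_rep_word:
  assumes "tape_rep (word_tape v) h L R" "v \<noteq> []" "\<forall>a\<in>set v. 0 < a"
  shows "\<exists>m n. rev L @ R = replicate m 1 @ map Suc v @ replicate n 1"
proof -
  define ys where "ys = rev L @ R"
  define p where "p = h - int (length L)"
  have r: "(if i < length R then R ! i else 1) = word_tape v (h + int i) + 1"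
    and l: "(if i < length L then L ! i else 1) = word_tape v (h - 1 - int i) + 1" for i
    using assms(1) unfolding tape_rep_def by blast+
  have ys: "ys ! i = word_tape v (p + int i) + 1" if "i < length ys" for i
  proof (cases "i < length L")
    case True
    have e: "h - 1 - int (length L - Suc i) = p + int i" using True by (simp add: p_def)
    have "length L - Suc i < length L" using True by simp
    then have "L ! (length L - Suc i) = word_tape v (p + int i) + 1"
      using l[of "length L - Suc i", unfolded e] by (simp only: if_True)
    then show ?thesis using True by (simp add: ys_def nth_append rev_nth)
  next
    case False
    have e: "h + int (i - length L) = p + int i" using False by (simp add: p_def)
    have "i - length L < length R" using False that by (simp add: ys_def)
    then have "R ! (i - length L) = word_tape v (p + int i) + 1"
      using r[of "i - length L", unfolded e] by (simp only: if_True)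
    then show ?thesis using False by (simp add: ys_def nth_append)
  qed
  have out: "word_tape v i = 0" if "i < p \<or> p + int (length ys) \<le> i" for i
  proof (cases "i < p")
    case True
    then have "\<not> nat (h - 1 - i) < length L" "h - 1 - int (nat (h - 1 - i)) = i" by (auto simp: p_def)
    then show ?thesis using l[of "nat (h - 1 - i)"] by simp
  next
    case False
    then have "h + int (length R) \<le> i" using that by (simp add: p_def ys_def)
    then have "\<not> nat (i - h) < length R" "h + int (nat (i - h)) = i" by auto
    then show ?thesis using r[of "nat (i - h)"] by simp
  qed
  have "word_tape v 0 \<noteq> 0" "word_tape v (int (length v) - 1) \<noteq> 0"
  proof -
    have "0 < v ! 0" "0 < v ! (length v - 1)" using assms(2,3) by auto
    then show "word_tape v 0 \<noteq> 0" "word_tape v (int (length v) - 1) \<noteq> 0"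
      using assms(2) by (auto simp: word_tape_def nat_diff_distrib' of_nat_diff)
  qed
  with out[of 0] out[of "int (length v) - 1"]
  have p: "p \<le> 0" "int (length v) \<le> p + int (length ys)" by linarith+
  define m where "m = nat (- p)" define n where "n = length ys - m - length v"
  have "ys = replicate m 1 @ map Suc v @ replicate n 1"
  proof (rule nth_equalityI)
    show "length ys = length (replicate m 1 @ map Suc v @ replicate n 1)" using p by (simp add: m_def n_def)
    fix i assume i: "i < length ys"
    have "(replicate m 1 @ map Suc v @ replicate n 1) ! i = word_tape v (p + int i) + 1"
    proof -
      consider "i < m" | "m \<le> i" "i < m + length v" | "m + length v \<le> i" by linarith
      then show ?thesis
      proof cases
        case 1
        then have "p + int i < 0" by (simp add: m_def)
        then show ?thesis using 1 by (simp add: nth_append word_tape_def)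
      next
        case 2
        then have "p + int i = int (i - m)" using p by (simp add: m_def)
        moreover have "i - m < length v" using 2 by linarith
        ultimately show ?thesis using 2 by (simp add: nth_append word_tape_def del: of_nat_diff)
      next
        case 3
        then have "p + int i \<ge> int (length v)" "i - m - length v < n" using p i by (simp_all add: m_def n_def)
        moreover have "\<not> i - m < length v" "\<not> i < m" using 3 by linarith+
        ultimately show ?thesis by (simp add: nth_append word_tape_def)
      qed
    qed
    then show "ys ! i = (replicate m 1 @ map Suc v @ replicate n 1) ! i" using ys[OF i] by simp
  qed
  then show ?thesis unfolding ys_def by blast
qed

text \<open>The word lies within the visited cells, which also bounds its length; this later bounds
  the size of the answers to queries.\<close>

lemma sx_unload:
  assumes tm: "is_tm M" and rel: "sim_rel M \<rho> N cf \<sigma>" and v: "contents cf 1 = word_tape v" "v \<noteq> []" "set v \<subseteq> {1, 2, 3}"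
  shows "sx (unload M) \<sigma> (\<lambda>i. if i = 0 then code (enc (rev v)) @ \<rho> 0 else if i < 4 then \<rho> i else [])
     ((100 + 5 * tapes M) * (N + 1)) \<and> length v \<le> N"
proof -
  have K: "1 < tapes M" using tm by (auto simp: is_tm_def)
  have ok: "tape_ok M N (contents cf j) (heads cf j) \<sigma> j" if "j < tapes M" for j
    using rel that by (simp add: sim_rel_def)
  have pos: "0 < a" "a \<le> alph M" if "j < tapes M" "a \<in> set (\<sigma> (Lst j)) \<union> set (\<sigma> (Rst j))" for j a
  proof -
    have o: "tape_rep (contents cf j) (heads cf j) (\<sigma> (Lst j)) (\<sigma> (Rst j))" "\<forall>i. contents cf j i < alph M"
      using ok[OF that(1)] by (simp_all add: tape_ok_def)
    from tape_rep_positive[OF o(1) that(2)] show "0 < a" "a \<le> alph M" using o(2) by (auto simp: Suc_le_eq)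
  qed
  have len: "length (\<sigma> (Lst j)) + length (\<sigma> (Rst j)) \<le> N" if "j < tapes M" for j
    using ok[OF that] by (simp add: tape_ok_def)
  have r1: "tape_rep (word_tape v) (heads cf 1) (\<sigma> (Lst 1)) (\<sigma> (Rst 1))"
    using ok[OF K] v(1) by (simp add: tape_ok_def)
  have vpos: "\<forall>a\<in>set v. 0 < a" using v(3) by auto
  obtain m n where mn: "rev (\<sigma> (Lst 1)) @ \<sigma> (Rst 1) = replicate m 1 @ map Suc v @ replicate n 1"
    using tape_rep_word[OF r1 v(2) vpos] by blast
  have mnN: "m + length v + n \<le> N" using arg_cong[OF mn, of length] len[OF K] by simp
  let ?u = "map Suc v @ replicate n 1"
  let ?\<sigma>1 = "\<sigma>(Lst 1 := [], Rst 1 := replicate m 1 @ ?u)"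
  let ?\<sigma>2 = "\<sigma>(Lst 1 := [], Rst 1 := ?u)"
  let ?\<sigma>3 = "?\<sigma>2(0 := code (enc ([] :: nat list)) @ \<sigma> 0)"
  let ?\<sigma>4 = "\<sigma>(Lst 1 := [], Rst 1 := replicate n 1, 0 := code (enc (rev v)) @ \<sigma> 0)"
  let ?\<sigma>5 = "\<lambda>i. if \<exists>j<tapes M. i = Lst j \<or> i = Rst j then [] else ?\<sigma>4 i"
  let ?\<sigma>6 = "\<lambda>i. if i = 0 then code (enc (rev v)) @ \<rho> 0 else if i < 4 then \<rho> i else []"
  have 1: "sx (Ws (Lst 1) (\<lambda>s. s \<noteq> 0) (Sq (cpy (Suc (alph M)) (Lst 1) (Rst 1)) (pop (Lst 1)))) \<sigma> ?\<sigma>1 (8 * N + 1)"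
    unfolding mn[symmetric] by (rule sx_mono[OF sx_collect]) (use pos[OF K] len[OF K] in auto)
  have 2: "sx (Ws (Rst 1) (\<lambda>s. s = 1) (pop (Rst 1))) ?\<sigma>1 ?\<sigma>2 (4 * m + 1)"
  proof (rule sx_cong[OF sx_skip_blanks[where n = m and u = ?u]])
    show "top_sym ?u \<noteq> 1" using v(2) vpos by (cases v) auto
  qed auto
  have 3: "sx (push 0 1) ?\<sigma>2 ?\<sigma>3 3" by (rule sx_cong[OF sx_push]) auto
  have tr: "top_sym (replicate n 1) \<le> 1" by (cases n) auto
  have 4: "sx (Ws (Rst 1) (\<lambda>s. s > 1) unload_body) ?\<sigma>3 ?\<sigma>4 (51 * length v + 1)"
    by (rule sx_cong[OF sx_unload_loop[where s = "[]" and v = v and u = "replicate n 1" and r = "\<sigma> 0"]])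
       (use v(3) tr in \<open>auto simp: fun_eq_iff\<close>)
  have 5: "sx (seqs clear_tape (tapes M)) ?\<sigma>4 ?\<sigma>5 (1 + tapes M * (4 * N + 4))"
  proof (rule sx_clear_tapes, intro allI impI conjI)
    fix j assume j: "j < tapes M"
    have "0 < a" if "a \<in> set (?\<sigma>4 (Lst j)) \<union> set (?\<sigma>4 (Rst j))" for a
      using pos(1)[OF j, of a] that by (cases "j = 1") auto
    then show "\<forall>a\<in>set (?\<sigma>4 (Lst j)) \<union> set (?\<sigma>4 (Rst j)). 0 < a" by blast
    show "length (?\<sigma>4 (Lst j)) + length (?\<sigma>4 (Rst j)) \<le> N"
      using len[OF j] mnN by (cases "j = 1") auto
  qed
  have 6: "sx (pop 4) ?\<sigma>5 ?\<sigma>6 3"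
  proof (rule sx_cong[OF sx_pop])
    have s4: "\<sigma> 4 = [Suc (state cf)]" "\<sigma> 5 = []" "\<And>i. i < 4 \<Longrightarrow> \<sigma> i = \<rho> i" "\<And>i. i \<ge> 6 + 2 * tapes M \<Longrightarrow> \<sigma> i = []"
      using rel by (auto simp: sim_rel_def)
    show "?\<sigma>5 4 \<noteq> []" using s4(1) by auto
    show "?\<sigma>5(4 := tl (?\<sigma>5 4)) = ?\<sigma>6"
    proof
      fix i
      consider "i < 4" | "i = 4" | "i = 5" | "6 \<le> i" "i < 6 + 2 * tapes M" | "i \<ge> 6 + 2 * tapes M" by linarith
      then show "(?\<sigma>5(4 := tl (?\<sigma>5 4))) i = ?\<sigma>6 i"
      proof cases
        case 1
        then have "\<not> (\<exists>j<tapes M. i = Lst j \<or> i = Rst j)" "i \<noteq> Lst 1" "i \<noteq> Rst 1" by (auto simp: Lst_def Rst_def)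
        then show ?thesis using 1 s4(3)[of i] s4(3)[of 0] by auto
      next
        case 4
        then have "i = Lst ((i - 6) div 2) \<or> i = Rst ((i - 6) div 2)" "(i - 6) div 2 < tapes M"
          by (auto simp: Lst_def Rst_def)
        then have "\<exists>j<tapes M. i = Lst j \<or> i = Rst j" by blast
        then show ?thesis using 4 by auto
      next
        case 5
        then have "i \<noteq> Lst 1" "i \<noteq> Rst 1" "i \<noteq> 0" using K by (auto simp: Lst_def Rst_def)
        then show ?thesis using 5 s4(4)[of i] by auto
      qed (use s4(1,2) in auto)
    qed
  qed simp
  have e: "(100 + 5 * tapes M) * (N + 1) = 100 * N + 100 + tapes M * (4 * N + 4) + tapes M * (N + 1)"
    by (simp add: algebra_simps)
  have "sx (unload M) \<sigma> ?\<sigma>6 ((100 + 5 * tapes M) * (N + 1))" unfolding unload_def e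
    by (rule sx_mono[OF sx_Sq[OF 1 sx_Sq[OF 2 sx_Sq[OF 3 sx_Sq[OF 4 sx_Sq[OF 5 6]]]]]]) (use mnN in linarith)
  then show ?thesis using mnN by simp
qed

text \<open>The overhead is linear: only the factor \<open>\<kappa>\<close> depends on
  \<open>M\<close>. This is what keeps the exponents of the reduction independent of the given
  machine.\<close>

theorem cr_simulation:
  assumes tm: "is_tm M"
  shows "\<exists>c \<kappa>. \<forall>w v t. set w \<subseteq> {1, 2, 3} \<and> v \<noteq> [] \<and> set v \<subseteq> {1, 2, 3} \<and> halts_with M w t v \<longrightarrow>
     cr c (enc (rev w)) (enc (rev v)) (\<kappa> * (t + length w + 1)) \<and> length v \<le> length w + 1 + t"
proof -
  obtain A where A: "\<And>xs. length xs = Suc (tapes M) \<Longrightarrow> set xs \<subseteq> {..states M + alph M} \<Longrightarrow> Suc (list_encode xs) < A"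
    using sim_finish[OF tm] by blast
  define c where "c = Sq (load M) (Sq (sim_loop M A) (unload M))"
  define \<kappa> where "\<kappa> = 500 + 100 * tapes M"
  have "cr c (enc (rev w)) (enc (rev v)) (\<kappa> * (t + length w + 1)) \<and> length v \<le> length w + 1 + t"
    if w: "set w \<subseteq> {1, 2, 3}" and v: "v \<noteq> []" "set v \<subseteq> {1, 2, 3}" and h: "halts_with M w t v" for w v t
  proof -
    have "sx c \<sigma> (\<sigma>(0 := code (enc (rev v)) @ r)) (\<kappa> * (t + length w + 1)) \<and> length v \<le> length w + 1 + t"
      if s: "\<sigma> 0 = code (enc (rev w)) @ r" "\<forall>j\<ge>4. \<sigma> j = []" for \<sigma> :: "nat \<Rightarrow> nat list" and r
  proof -
    obtain \<sigma>1 where 1: "sx (load M) \<sigma> \<sigma>1 (61 * length w + 5 * tapes M + 20)"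
      "sim_rel M (\<sigma>(0 := r)) (length w + 1) (init w) \<sigma>1"
      using sx_load[OF s(1) w s(2) tm] by blast
    have hlt: "\<forall>s<t. state ((step M ^^ s) (init w)) < states M" "state ((step M ^^ t) (init w)) = states M"
      "contents ((step M ^^ t) (init w)) 1 = word_tape v"
      using h by (simp_all add: halts_with_def config_at_def)
    obtain \<sigma>2 where 2: "sx (sim_loop M A) \<sigma>1 \<sigma>2 (t * (21 + 21 * tapes M) + 1)"
      "sim_rel M (\<sigma>(0 := r)) (length w + 1 + t) ((step M ^^ t) (init w)) \<sigma>2"
      using sx_sim_loop[OF tm A 1(2) hlt(1,2)] by blast
    note 3 = conjunct1[OF sx_unload[OF tm 2(2) hlt(3) v]] and len = conjunct2[OF sx_unload[OF tm 2(2) hlt(3) v]]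
    have e: "(\<lambda>i. if i = 0 then code (enc (rev v)) @ (\<sigma>(0 := r)) 0 else if i < 4 then (\<sigma>(0 := r)) i else []) =
        \<sigma>(0 := code (enc (rev v)) @ r)" using s by (auto simp: fun_eq_iff)
    have "61 * length w + 5 * tapes M + 20 + (t * (21 + 21 * tapes M) + 1 + (100 + 5 * tapes M) * (length w + 1 + t + 1) + 1) + 1
        \<le> \<kappa> * (t + length w + 1)"
    proof -
      have "\<kappa> * (t + length w + 1) = 500 * t + 500 * length w + 500 + 100 * (tapes M * t) + 100 * (tapes M * length w) + 100 * tapes M"
        by (simp add: \<kappa>_def algebra_simps)
      moreover have "t * (21 + 21 * tapes M) = 21 * t + 21 * (tapes M * t)" by (simp add: algebra_simps)
      moreover have "(100 + 5 * tapes M) * (length w + 1 + t + 1) = 100 * length w + 100 * t + 200 + 5 * (tapes M * length w) + 5 * (tapes M * t) + 10 * tapes M"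
        by (simp add: algebra_simps)
      ultimately show ?thesis by linarith
    qed
    then have "sx c \<sigma> (\<sigma>(0 := code (enc (rev v)) @ r)) (\<kappa> * (t + length w + 1))"
      unfolding c_def by (intro sx_cong[OF sx_Sq[OF 1(1) sx_Sq[OF 2(1) 3]] e]) simp
    then show ?thesis using len by simp
    qed
    note * = this
    have "length v \<le> length w + 1 + t"
      using *[of "(\<lambda>_. [])(0 := code (enc (rev w)))" "[]"] by simp
    with * show ?thesis by (auto intro!: crI)
  qed
  then show ?thesis by blast
qed

section \<open>Sparsification\<close>

definition add_clause :: "'l set \<Rightarrow> 'l set set \<Rightarrow> 'l set set" where
  "add_clause C \<Phi> = (if \<exists>D\<in>\<Phi>. D \<subseteq> C then \<Phi> else insert C {D \<in> \<Phi>. \<not> C \<subseteq> D})"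

text \<open>Negation is ignored here. Splitting preserves the hitting sets one by one, so
  consistency can be demanded of \<open>T\<close> afterwards.\<close>

definition hits :: "'l set \<Rightarrow> 'l set set \<Rightarrow> bool" where
  "hits T \<Phi> \<longleftrightarrow> (\<forall>D\<in>\<Phi>. T \<inter> D \<noteq> {})"

definition antichain :: "'l set set \<Rightarrow> bool" where
  "antichain \<Phi> \<longleftrightarrow> (\<forall>D\<in>\<Phi>. \<forall>D'\<in>\<Phi>. D \<subseteq> D' \<longrightarrow> D = D')"

lemma hits_add_clause: "hits T (add_clause C \<Phi>) \<longleftrightarrow> T \<inter> C \<noteq> {} \<and> hits T \<Phi>"
  unfolding add_clause_def hits_def by auto

lemma antichain_add_clause: "antichain \<Phi> \<Longrightarrow> antichain (add_clause C \<Phi>)"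
  unfolding add_clause_def antichain_def by auto

definition ones :: "'l set set \<Rightarrow> 'l set set" where "ones \<Phi> = {D \<in> \<Phi>. card D = 1}"
definition twos :: "'l set set \<Rightarrow> 'l set set" where "twos \<Phi> = {D \<in> \<Phi>. card D = 2}"

text \<open>
  \<open>Q\<close> is the set of 2-clauses of the input: only the 2-clauses created by branching are bounded in
  degree, and only they enter the potential.
\<close>

definition sparse_inv :: "'l set set \<Rightarrow> nat \<Rightarrow> 'l set \<Rightarrow> 'l set set \<Rightarrow> bool" where
  "sparse_inv Q t L \<Phi> \<longleftrightarrow> finite L \<and> antichain \<Phi> \<and> (\<forall>D\<in>\<Phi>. D \<subseteq> L \<and> card D \<le> 3) \<and>
     (\<forall>a. card {D \<in> twos \<Phi> - Q. a \<in> D} \<le> 2 * t) \<and> (\<forall>D\<in>Q. \<exists>D'\<in>\<Phi>. D' \<subseteq> D)"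

text \<open>A new unit clause may remove up to \<open>2 * t\<close> created 2-clauses, namely those
  through its literal; weight \<open>4 * t\<close> leaves a gain of \<open>2 * t\<close>.\<close>

definition potential :: "'l set set \<Rightarrow> nat \<Rightarrow> 'l set set \<Rightarrow> nat" where
  "potential Q t \<Phi> = 4 * t * card (ones \<Phi>) + card (twos \<Phi> - Q)"

definition replace_supersets :: "'l set set \<Rightarrow> 'l set set \<Rightarrow> 'l set set" where
  "replace_supersets P \<Phi> = P \<union> {D \<in> \<Phi>. \<forall>p\<in>P. \<not> p \<subseteq> D}"

lemma sparse_inv_finite: "sparse_inv Q t L \<Phi> \<Longrightarrow> finite \<Phi>"
  unfolding sparse_inv_def by (rule finite_subset[of _ "Pow L"]) auto

text \<open>Every member of \<open>X\<close> is counted at some element of \<open>L\<close>; the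
  sharper count that divides by the clause size is not attempted.\<close>

lemma card_le_degrees:
  assumes "finite L" "finite X" "\<And>D. D \<in> X \<Longrightarrow> D \<subseteq> L \<and> D \<noteq> {}" "\<And>a. a \<in> L \<Longrightarrow> card {D \<in> X. a \<in> D} \<le> k"
  shows "card X \<le> card L * k"
proof -
  have "X \<subseteq> (\<Union>a\<in>L. {D \<in> X. a \<in> D})" using assms(3) by blast
  then have "card X \<le> card (\<Union>a\<in>L. {D \<in> X. a \<in> D})" using assms(1,2) by (intro card_mono) auto
  also have "\<dots> \<le> (\<Sum>a\<in>L. card {D \<in> X. a \<in> D})" by (rule card_UN_le[OF assms(1)])
  also have "\<dots> \<le> (\<Sum>a\<in>L. k)" by (rule sum_mono) (rule assms(4))
  finally show ?thesis by simp
qed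

lemma card_ones_le:
  assumes "finite L" "\<And>D. D \<in> \<Phi> \<Longrightarrow> D \<subseteq> L"
  shows "card (ones \<Phi>) \<le> card L"
proof -
  have "ones \<Phi> \<subseteq> (\<lambda>a. {a}) ` L" using assms(2) by (auto simp: ones_def card_1_singleton_iff)
  then have "card (ones \<Phi>) \<le> card ((\<lambda>a. {a}) ` L)" using assms(1) by (intro card_mono) auto
  also have "\<dots> \<le> card L" by (rule card_image_le[OF assms(1)])
  finally show ?thesis .
qed

text \<open>There are at most \<open>card L\<close> unit clauses of weight \<open>4 * t\<close> and,
  by the degree bound, at most \<open>2 * t * card L\<close> created 2-clauses. This limits the
  total gain along a branch of the splitting.\<close>

lemma potential_le:
  assumes "sparse_inv Q t L \<Phi>"
  shows "potential Q t \<Phi> \<le> 6 * t * card L"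
proof -
  have fin: "finite \<Phi>" by (rule sparse_inv_finite[OF assms])
  have 1: "card (ones \<Phi>) \<le> card L" using assms by (intro card_ones_le) (auto simp: sparse_inv_def)
  have "card (twos \<Phi> - Q) \<le> card L * (2 * t)"
    using assms fin by (intro card_le_degrees) (auto simp: sparse_inv_def twos_def)
  with 1 have "4 * t * card (ones \<Phi>) + card (twos \<Phi> - Q) \<le> 4 * t * card L + card L * (2 * t)"
    by (intro add_mono mult_le_mono2)
  then show ?thesis by (simp add: potential_def algebra_simps)
qed

text \<open>For \<open>s = 1\<close> each new unit clause removes at most \<open>2 * t\<close>
  created 2-clauses, by the degree bound. For \<open>s = 2\<close> no clause of size at most 2 is
  removed, so every new clause counts fully, and only the degrees have to be watched, which is the
  premise \<open>deg\<close>.\<close>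

lemma replace_inv:
  assumes inv: "sparse_inv Q t L \<Phi>" and P: "finite P" "\<And>p. p \<in> P \<Longrightarrow> card p = s" "s \<in> {1, 2}"
    and sub: "\<And>p. p \<in> P \<Longrightarrow> \<exists>D\<in>\<Phi>. p \<subset> D"
    and deg: "s = 2 \<Longrightarrow> \<forall>a. card {D \<in> twos \<Phi> - Q. a \<in> D} + card {p \<in> P. a \<in> p} \<le> 2 * t"
  shows "sparse_inv Q t L (replace_supersets P \<Phi>)"
    and "potential Q t (replace_supersets P \<Phi>) \<ge> potential Q t \<Phi> + (if s = 1 then 2 * t else 1) * card P"
proof -
  let ?\<Phi>' = "replace_supersets P \<Phi>"
  have ac: "antichain \<Phi>" and L: "finite L" "\<And>D. D \<in> \<Phi> \<Longrightarrow> D \<subseteq> L \<and> card D \<le> 3"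
    and dg: "\<And>a. card {D \<in> twos \<Phi> - Q. a \<in> D} \<le> 2 * t" and Q: "\<And>D. D \<in> Q \<Longrightarrow> \<exists>D'\<in>\<Phi>. D' \<subseteq> D"
    using inv by (auto simp: sparse_inv_def)
  have fin: "finite \<Phi>" by (rule sparse_inv_finite[OF inv])
  \<comment> \<open>\<open>p\<close> lies properly inside some clause of \<open>\<Phi>\<close>, and
    a clause inside \<open>p\<close> would contradict the antichain.\<close>
  have fresh: "\<not> D \<subseteq> p" if "p \<in> P" "D \<in> \<Phi>" for p D
    using sub[OF that(1)] that ac unfolding antichain_def by blast
  have PL: "p \<subseteq> L" if "p \<in> P" for p using sub[OF that] L by blast
  have finp: "finite p" if "p \<in> P" for p using PL[OF that] L(1) by (rule finite_subset)
  have PP: "p = p'" if "p \<in> P" "p' \<in> P" "p \<subseteq> p'" for p p'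
    using card_subset_eq[OF finp[OF that(2)] that(3)] P(2) that by simp
  have ac': "antichain ?\<Phi>'" unfolding antichain_def
  proof (intro ballI impI)
    fix D D' assume D: "D \<in> ?\<Phi>'" "D' \<in> ?\<Phi>'" "D \<subseteq> D'"
    show "D = D'"
    proof (cases "D \<in> P")
      case True
      then show ?thesis using D PP[of D D'] by (auto simp: replace_supersets_def)
    next
      case False
      then have "D \<in> \<Phi>" using D(1) by (auto simp: replace_supersets_def)
      moreover from this have "D' \<notin> P" using fresh D(3) by blast
      ultimately show ?thesis using D ac by (auto simp: replace_supersets_def antichain_def)
    qed
  qed
  have L': "D \<subseteq> L \<and> card D \<le> 3" if "D \<in> ?\<Phi>'" for D
    using that L(2) PL P(2,3) by (auto simp: replace_supersets_def)
  have Q': "\<exists>D'\<in>?\<Phi>'. D' \<subseteq> D" if DQ: "D \<in> Q" for D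
  proof -
    obtain D' where "D' \<in> \<Phi>" "D' \<subseteq> D" using Q[OF DQ] by blast
    then show ?thesis by (cases "\<exists>p\<in>P. p \<subseteq> D'") (auto simp: replace_supersets_def)
  qed
  \<comment> \<open>An input 2-clause always contains a current clause, a member of \<open>P\<close>
    never does; so new 2-clauses are not mistaken for input ones.\<close>
  have PQ: "P \<inter> Q = {}" using Q fresh by blast
  have Pn: "P \<inter> \<Phi> = {}" using fresh by blast
  have "(\<forall>a. card {D \<in> twos ?\<Phi>' - Q. a \<in> D} \<le> 2 * t) \<and>
    potential Q t ?\<Phi>' \<ge> potential Q t \<Phi> + (if s = 1 then 2 * t else 1) * card P"
  proof (cases "s = 1")
    case True
    have tw: "twos ?\<Phi>' = {D \<in> twos \<Phi>. \<forall>p\<in>P. \<not> p \<subseteq> D}"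
      using P(2) True by (auto simp: twos_def replace_supersets_def)
    have "ones ?\<Phi>' = ones \<Phi> \<union> P"
    proof -
      have "\<not> p \<subseteq> D" if "p \<in> P" "D \<in> \<Phi>" "card D = 1" for p D
      proof
        assume "p \<subseteq> D"
        then have "p = D" using that P(2)[OF that(1)] True by (auto simp: card_1_singleton_iff)
        then show False using fresh that by blast
      qed
      then show ?thesis using P(2) True by (auto simp: ones_def replace_supersets_def)
    qed
    moreover have "card (ones \<Phi> \<union> P) = card (ones \<Phi>) + card P"
      using fin P(1) Pn by (intro card_Un_disjoint) (auto simp: ones_def)
    ultimately have o: "card (ones ?\<Phi>') = card (ones \<Phi>) + card P" by simp
    \<comment> \<open>A 2-clause that disappears contains one of the new unit clauses and is charged
      to it.\<close>
    have "twos \<Phi> - Q \<subseteq> (twos ?\<Phi>' - Q) \<union> (\<Union>p\<in>P. {D \<in> twos \<Phi> - Q. p \<subseteq> D})" unfolding tw by blast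
    then have "card (twos \<Phi> - Q) \<le> card ((twos ?\<Phi>' - Q) \<union> (\<Union>p\<in>P. {D \<in> twos \<Phi> - Q. p \<subseteq> D}))"
      using fin P(1) tw by (intro card_mono) (auto simp: twos_def)
    also have "\<dots> \<le> card (twos ?\<Phi>' - Q) + card (\<Union>p\<in>P. {D \<in> twos \<Phi> - Q. p \<subseteq> D})" by (rule card_Un_le)
    also have "card (\<Union>p\<in>P. {D \<in> twos \<Phi> - Q. p \<subseteq> D}) \<le> (\<Sum>p\<in>P. card {D \<in> twos \<Phi> - Q. p \<subseteq> D})"
      by (rule card_UN_le[OF P(1)])
    also have "\<dots> \<le> (\<Sum>p\<in>P. 2 * t)"
    proof (rule sum_mono)
      fix p assume "p \<in> P"
      then obtain a where "p = {a}" using P(2) True by (auto simp: card_1_singleton_iff)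
      then show "card {D \<in> twos \<Phi> - Q. p \<subseteq> D} \<le> 2 * t" using dg[of a] by simp
    qed
    finally have c: "card (twos \<Phi> - Q) \<le> card (twos ?\<Phi>' - Q) + 2 * t * card P" by (simp add: algebra_simps)
    have "card {D \<in> twos ?\<Phi>' - Q. a \<in> D} \<le> 2 * t" for a
    proof -
      have "{D \<in> twos ?\<Phi>' - Q. a \<in> D} \<subseteq> {D \<in> twos \<Phi> - Q. a \<in> D}" unfolding tw by blast
      then have "card {D \<in> twos ?\<Phi>' - Q. a \<in> D} \<le> card {D \<in> twos \<Phi> - Q. a \<in> D}"
        using fin by (intro card_mono) (auto simp: twos_def)
      then show ?thesis using dg[of a] by simp
    qed
    moreover have "potential Q t ?\<Phi>' \<ge> potential Q t \<Phi> + 2 * t * card P"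
      using c by (simp add: potential_def o algebra_simps)
    ultimately show ?thesis using True by simp
  next
    case False
    then have s2: "s = 2" using P(3) by simp
    have nb: "\<not> p \<subseteq> D" if "p \<in> P" "D \<in> \<Phi>" "card D \<le> 2" for p D
    proof
      assume s: "p \<subseteq> D"
      have "finite D" using L(1) L(2)[OF that(2)] finite_subset by blast
      then have "p = D" using card_mono[OF _ s] card_subset_eq[OF _ s] P(2)[OF that(1)] s2 that(3) by force
      then show False using fresh that by blast
    qed
    have o: "ones ?\<Phi>' = ones \<Phi>" using P(2) s2 nb by (auto simp: ones_def replace_supersets_def)
    have tw: "twos ?\<Phi>' - Q = (twos \<Phi> - Q) \<union> P"
      using P(2) s2 nb PQ by (auto simp: twos_def replace_supersets_def)
    have "card ((twos \<Phi> - Q) \<union> P) = card (twos \<Phi> - Q) + card P"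
      using fin P(1) Pn by (intro card_Un_disjoint) (auto simp: twos_def)
    then have "potential Q t ?\<Phi>' = potential Q t \<Phi> + card P" by (simp add: potential_def o tw)
    moreover have "card {D \<in> twos ?\<Phi>' - Q. a \<in> D} \<le> 2 * t" for a
    proof -
      have "{D \<in> twos ?\<Phi>' - Q. a \<in> D} = {D \<in> twos \<Phi> - Q. a \<in> D} \<union> {p \<in> P. a \<in> p}" unfolding tw by blast
      then have "card {D \<in> twos ?\<Phi>' - Q. a \<in> D} \<le> card {D \<in> twos \<Phi> - Q. a \<in> D} + card {p \<in> P. a \<in> p}"
        by (simp add: card_Un_le)
      then show ?thesis using deg[OF s2] order_trans by blast
    qed
    ultimately show ?thesis using s2 by simp
  qed
  then show "sparse_inv Q t L ?\<Phi>'" "potential Q t ?\<Phi>' \<ge> potential Q t \<Phi> + (if s = 1 then 2 * t else 1) * card P"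
    using ac' L(1) L' Q' by (auto simp: sparse_inv_def)
qed

text \<open>The weak sunflowers of the sparsification lemma: \<open>H\<close> is the heart, and the
  petals need not be disjoint.\<close>

definition flower :: "'l set \<Rightarrow> nat \<Rightarrow> 'l set set \<Rightarrow> 'l set set" where
  "flower H s \<Phi> = {D \<in> \<Phi>. card D = s \<and> H \<subseteq> D}"

definition petals :: "'l set \<Rightarrow> nat \<Rightarrow> 'l set set \<Rightarrow> 'l set set" where
  "petals H s \<Phi> = (\<lambda>D. D - H) ` flower H s \<Phi>"

lemma hits_replace: 
  assumes "hits T (replace_supersets P \<Phi>)"
  shows "hits T \<Phi>"
  unfolding hits_def
proof
  fix D assume D: "D \<in> \<Phi>"
  show "T \<inter> D \<noteq> {}"
  proof (cases "\<exists>p\<in>P. p \<subseteq> D")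
    case True
    then obtain p where p: "p \<in> P" "p \<subseteq> D" by blast
    then have "p \<in> replace_supersets P \<Phi>" by (simp add: replace_supersets_def)
    then have "T \<inter> p \<noteq> {}" using assms by (simp add: hits_def)
    then show ?thesis using p(2) by blast
  next
    case False
    then have "D \<in> replace_supersets P \<Phi>" using D by (simp add: replace_supersets_def)
    then show ?thesis using assms by (simp add: hits_def)
  qed
qed

text \<open>A hitting set either meets the heart, or it meets every clause of the flower outside the
  heart, that is, every petal.\<close>

lemma hits_branch:
  "hits T \<Phi> \<longleftrightarrow> hits T (replace_supersets {H} \<Phi>) \<or> hits T (replace_supersets (petals H s \<Phi>) \<Phi>)"
proof
  assume h: "hits T \<Phi>"
  show "hits T (replace_supersets {H} \<Phi>) \<or> hits T (replace_supersets (petals H s \<Phi>) \<Phi>)"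
  proof (cases "T \<inter> H = {}")
    case True
    have "T \<inter> (E - H) \<noteq> {}" if "E \<in> \<Phi>" for E
    proof -
      have "T \<inter> E \<noteq> {}" using h that by (simp add: hits_def)
      then show ?thesis using True by blast
    qed
    then have "T \<inter> D \<noteq> {}" if "D \<in> petals H s \<Phi>" for D
      using that by (auto simp: petals_def flower_def)
    then have "hits T (replace_supersets (petals H s \<Phi>) \<Phi>)"
      using h unfolding hits_def replace_supersets_def by blast
    then show ?thesis ..
  next
    case False
    then have "hits T (replace_supersets {H} \<Phi>)"
      using h unfolding hits_def replace_supersets_def by blast
    then show ?thesis ..
  qed
qed (use hits_replace in blast)

lemma card_petals: "card (petals H s \<Phi>) = card (flower H s \<Phi>)"
proof -
  have "inj_on (\<lambda>D. D - H) (flower H s \<Phi>)"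
  proof (rule inj_onI)
    fix D D' assume "D \<in> flower H s \<Phi>" "D' \<in> flower H s \<Phi>" "D - H = D' - H"
    then have "D = (D - H) \<union> H" "D' = (D' - H) \<union> H" "D - H = D' - H" unfolding flower_def by blast+
    then show "D = D'" by metis
  qed
  then show ?thesis unfolding petals_def by (rule card_image)
qed

text \<open>The hearts are tried in the order in which the three disjuncts are listed.\<close>

definition heart_ok :: "nat \<Rightarrow> 'l set set \<Rightarrow> 'l set \<Rightarrow> nat \<Rightarrow> bool" where
  "heart_ok t \<Phi> H s \<longleftrightarrow>
     card H = 1 \<and> s = 2 \<and> t \<le> card (flower H 2 \<Phi>) \<or>
     (\<forall>H. card H = 1 \<longrightarrow> card (flower H 2 \<Phi>) < t) \<and>
       (card H = 2 \<and> s = 3 \<and> t \<le> card (flower H 3 \<Phi>) \<or>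
        (\<forall>H. card H = 2 \<longrightarrow> card (flower H 3 \<Phi>) < t) \<and>
        card H = 1 \<and> s = 3 \<and> 2 * t\<^sup>2 \<le> card (flower H 3 \<Phi>))"

text \<open>The thresholds make every petal branch gain \<open>2 * t\<^sup>2\<close>: in the first
  two cases at least \<open>t\<close> unit petals with gain \<open>2 * t\<close> each, in the third
  at least \<open>2 * t\<^sup>2\<close> petals of size 2 with gain 1 each. The order of the cases
  protects the degrees: when 2-clauses are created, no literal lies in \<open>t\<close> or more
  2-clauses and, for 2-element petals, no pair lies in \<open>t\<close> or more 3-clauses, so fewer
  than \<open>t\<close> and at most \<open>t\<close> meet in a literal.\<close>

lemma branch_inv:
  assumes inv: "sparse_inv Q t L \<Phi>" and ok: "heart_ok t \<Phi> H s" and t: "t > 0"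
  shows "flower H s \<Phi> \<noteq> {}"
    and "sparse_inv Q t L (replace_supersets {H} \<Phi>)"
    and "potential Q t (replace_supersets {H} \<Phi>) \<ge> potential Q t \<Phi> + 1"
    and "sparse_inv Q t L (replace_supersets (petals H s \<Phi>) \<Phi>)"
    and "potential Q t (replace_supersets (petals H s \<Phi>) \<Phi>) \<ge> potential Q t \<Phi> + 2 * t\<^sup>2"
proof -
  have fin: "finite \<Phi>" by (rule sparse_inv_finite[OF inv])
  have dg: "card {D \<in> twos \<Phi> - Q. a \<in> D} \<le> 2 * t" for a using inv by (simp add: sparse_inv_def)
  have finD: "finite D" if "D \<in> \<Phi>" for D using inv that finite_subset by (auto simp: sparse_inv_def)
  have t2: "2 * t\<^sup>2 > 0" using t by simp
  have cs: "card H < s" "card H \<in> {1, 2}" "s \<le> 3" using ok by (auto simp: heart_ok_def)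
  have "t \<le> card (flower H s \<Phi>) \<or> 2 * t\<^sup>2 \<le> card (flower H s \<Phi>)" using ok by (auto simp: heart_ok_def)
  then have "card (flower H s \<Phi>) > 0" using t t2 by linarith
  then show ne: "flower H s \<Phi> \<noteq> {}" by force
  have Hsub: "H \<subset> D" if "D \<in> flower H s \<Phi>" for D using that cs(1) by (auto simp: flower_def)
  have finH: "finite H" using cs(2) card.infinite by fastforce
  have low: "card {D \<in> twos \<Phi> - Q. a \<in> D} < t" if "\<forall>H. card H = 1 \<longrightarrow> card (flower H 2 \<Phi>) < t" for a
  proof -
    have "card {D \<in> twos \<Phi> - Q. a \<in> D} \<le> card (flower {a} 2 \<Phi>)"
      using fin by (intro card_mono) (auto simp: flower_def twos_def)
    then show ?thesis using that[rule_format, of "{a}"] by simp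
  qed
  have hs: "\<exists>D\<in>\<Phi>. p \<subset> D" if "p \<in> {H}" for p using that ne Hsub by (auto simp: flower_def)
  have hd: "\<forall>a. card {D \<in> twos \<Phi> - Q. a \<in> D} + card {p \<in> {H}. a \<in> p} \<le> 2 * t" if "card H = 2"
  proof
    fix a
    have "card {D \<in> twos \<Phi> - Q. a \<in> D} < t" by (rule low) (use ok that in \<open>auto simp: heart_ok_def\<close>)
    moreover have "card {p \<in> {H}. a \<in> p} \<le> card {H}" by (intro card_mono) auto
    ultimately show "card {D \<in> twos \<Phi> - Q. a \<in> D} + card {p \<in> {H}. a \<in> p} \<le> 2 * t" using t by simp
  qed
  note h = replace_inv[OF inv _ _ cs(2) hs hd, simplified]
  show "sparse_inv Q t L (replace_supersets {H} \<Phi>)" by (rule h(1))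
  show "potential Q t (replace_supersets {H} \<Phi>) \<ge> potential Q t \<Phi> + 1" using h(2) t by (auto split: if_splits)
  let ?P = "petals H s \<Phi>"
  have finP: "finite ?P" using fin by (simp add: petals_def flower_def)
  have cP: "card p = s - card H" if "p \<in> ?P" for p
    using that finH by (auto simp: petals_def flower_def card_Diff_subset)
  have s12: "s - card H \<in> {1, 2}" using ok by (auto simp: heart_ok_def)
  have ps: "\<exists>D\<in>\<Phi>. p \<subset> D" if "p \<in> ?P" for p
  proof -
    obtain D where D: "D \<in> flower H s \<Phi>" "p = D - H" using \<open>p \<in> ?P\<close> by (auto simp: petals_def)
    moreover have "H \<noteq> {}" using cs(2) by auto
    ultimately show ?thesis using Hsub[OF D(1)] by (intro bexI[of _ D]) (auto simp: flower_def)
  qed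
  have pd: "\<forall>a. card {D \<in> twos \<Phi> - Q. a \<in> D} + card {p \<in> ?P. a \<in> p} \<le> 2 * t" if "s - card H = 2"
  proof
    fix a
    have c: "card H = 1" "s = 3" and nA: "\<forall>H. card H = 1 \<longrightarrow> card (flower H 2 \<Phi>) < t"
      and nB: "\<forall>H. card H = 2 \<longrightarrow> card (flower H 3 \<Phi>) < t"
      using ok that by (auto simp: heart_ok_def)
    obtain b where b: "H = {b}" using c(1) by (auto simp: card_1_singleton_iff)
    have "card {p \<in> ?P. a \<in> p} < t"
    proof (cases "a = b")
      case True
      then have "{p \<in> ?P. a \<in> p} = {}" by (auto simp: petals_def b)
      then show ?thesis using t by (simp only: card.empty)
    next
      case False
      \<comment> \<open>A petal through \<open>a\<close> comes from a 3-clause through the pair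
        \<open>{a, b}\<close>, and there are fewer than \<open>t\<close> of these because the second
        kind of heart is absent.\<close>
      have "{p \<in> ?P. a \<in> p} \<subseteq> (\<lambda>D. D - H) ` flower {a, b} 3 \<Phi>" by (auto simp: petals_def flower_def b c)
      then have "card {p \<in> ?P. a \<in> p} \<le> card ((\<lambda>D. D - H) ` flower {a, b} 3 \<Phi>)"
        using fin by (intro card_mono) (auto simp: flower_def)
      also have "\<dots> \<le> card (flower {a, b} 3 \<Phi>)" using fin by (intro card_image_le) (auto simp: flower_def)
      also have "\<dots> < t" using nB[rule_format, of "{a, b}"] False by simp
      finally show ?thesis .
    qed
    then show "card {D \<in> twos \<Phi> - Q. a \<in> D} + card {p \<in> ?P. a \<in> p} \<le> 2 * t" using low[OF nA, of a] by simp
  qed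
  note p = replace_inv[OF inv finP cP s12 ps pd]
  show "sparse_inv Q t L (replace_supersets ?P \<Phi>)" by (rule p(1))
  have "2 * t\<^sup>2 \<le> (if s - card H = 1 then 2 * t else 1) * card ?P"
    using ok by (auto simp: heart_ok_def card_petals power2_eq_square)
  then show "potential Q t (replace_supersets ?P \<Phi>) \<ge> potential Q t \<Phi> + 2 * t\<^sup>2" using p(2) by linarith
qed

text \<open>Without hearts every literal lies in fewer than \<open>t\<close> clauses of size 2,
  input clauses included, and in fewer than \<open>2 * t\<^sup>2\<close> of size 3. The leading 1
  accounts for a possible empty clause.\<close>

lemma leaf_sparse:
  assumes inv: "sparse_inv Q t L \<Phi>" and "\<And>H s. \<not> heart_ok t \<Phi> H s"
  shows "card \<Phi> \<le> 1 + card L * (1 + t + 2 * t\<^sup>2)"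
proof -
  have fin: "finite \<Phi>" by (rule sparse_inv_finite[OF inv])
  have L: "finite L" "\<And>D. D \<in> \<Phi> \<Longrightarrow> D \<subseteq> L \<and> card D \<le> 3" using inv by (auto simp: sparse_inv_def)
  have finD: "finite D" if "D \<in> \<Phi>" for D using L(1) L(2)[OF that] finite_subset by blast
  have A: "card (flower H 2 \<Phi>) < t" if "card H = 1" for H using assms(2)[of H 2] that by (auto simp: heart_ok_def)
  have B: "card (flower H 3 \<Phi>) < t" if "card H = 2" for H using assms(2)[of H 3] that A by (auto simp: heart_ok_def)
  have C: "card (flower H 3 \<Phi>) < 2 * t\<^sup>2" if "card H = 1" for H
    using assms(2)[of H 3] that A B by (auto simp: heart_ok_def)
  let ?X = "\<lambda>s. {D \<in> \<Phi>. card D = s}"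
  have "\<Phi> \<subseteq> {{}} \<union> ones \<Phi> \<union> ?X 2 \<union> ?X 3"
  proof
    fix D assume D: "D \<in> \<Phi>"
    have "card D = 0 \<or> card D = 1 \<or> card D = 2 \<or> card D = 3" using L(2)[OF D] by linarith
    then show "D \<in> {{}} \<union> ones \<Phi> \<union> ?X 2 \<union> ?X 3" using D finD[OF D] by (auto simp: ones_def)
  qed
  then have "card \<Phi> \<le> card ({{}} \<union> ones \<Phi> \<union> ?X 2 \<union> ?X 3)" using fin by (intro card_mono) (auto simp: ones_def)
  also have "\<dots> \<le> card {{} :: 'a set} + card (ones \<Phi>) + card (?X 2) + card (?X 3)"
    using card_Un_le[of "{{}} \<union> ones \<Phi> \<union> ?X 2" "?X 3"] card_Un_le[of "{{}} \<union> ones \<Phi>" "?X 2"]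
      card_Un_le[of "{{}}" "ones \<Phi>"] by linarith
  also have "card (ones \<Phi>) \<le> card L" using L by (intro card_ones_le) auto
  also have "card (?X 2) \<le> card L * t"
  proof (rule card_le_degrees[OF L(1)])
    fix a
    have "{D \<in> ?X 2. a \<in> D} = flower {a} 2 \<Phi>" by (auto simp: flower_def)
    then show "card {D \<in> ?X 2. a \<in> D} \<le> t" using A[of "{a}"] by simp
  qed (use fin L in auto)
  also have "card (?X 3) \<le> card L * (2 * t\<^sup>2)"
  proof (rule card_le_degrees[OF L(1)])
    fix a
    have "{D \<in> ?X 3. a \<in> D} = flower {a} 3 \<Phi>" by (auto simp: flower_def)
    then show "card {D \<in> ?X 3. a \<in> D} \<le> 2 * t\<^sup>2" using C[of "{a}"] by simp
  qed (use fin L in auto)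
  finally show ?thesis by (simp add: algebra_simps)
qed

section \<open>Splitting on lists of clauses\<close>

definition add_list :: "'l list \<Rightarrow> 'l list list \<Rightarrow> 'l list list" where
  "add_list c \<phi> = (if \<exists>d\<in>set \<phi>. set d \<subseteq> set c then \<phi> else c # filter (\<lambda>d. \<not> set c \<subseteq> set d) \<phi>)"

definition flower_list :: "'l list \<Rightarrow> nat \<Rightarrow> 'l list list \<Rightarrow> 'l list list" where
  "flower_list H s \<phi> = filter (\<lambda>d. length d = s \<and> set H \<subseteq> set d) \<phi>"

definition petal_branch :: "'l list \<Rightarrow> nat \<Rightarrow> 'l list list \<Rightarrow> 'l list list" where
  "petal_branch H s \<phi> = foldl (\<lambda>\<psi> p. add_list p \<psi>) \<phi>
     (map (\<lambda>d. filter (\<lambda>l. l \<notin> set H) d) (flower_list H s \<phi>))"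

text \<open>Triples of a heart, the clause size of its flower and the threshold.\<close>

definition candidates :: "nat \<Rightarrow> 'l list \<Rightarrow> ('l list \<times> nat \<times> nat) list" where
  "candidates t L = map (\<lambda>a. ([a], 2, t)) L @
     concat (map (\<lambda>a. map (\<lambda>b. ([a, b], 3, t)) (filter (\<lambda>b. b \<noteq> a) L)) L) @
     map (\<lambda>a. ([a], 3, 2 * (t * t))) L"

definition good_hearts :: "nat \<Rightarrow> 'l list \<Rightarrow> 'l list list \<Rightarrow> ('l list \<times> nat \<times> nat) list" where
  "good_hearts t L \<phi> = filter (\<lambda>x. snd (snd x) \<le> length (flower_list (fst x) (fst (snd x)) \<phi>)) (candidates t L)"

text \<open>A state consists of the formulas still to be split and of the sparse formulas found so far.\<close>
definition split_step :: "nat \<Rightarrow> 'l list \<Rightarrow> 'l list list list \<times> 'l list list list \<Rightarrow> 'l list list list \<times> 'l list list list" where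
  "split_step t L w = (case fst w of [] \<Rightarrow> w | \<phi> # ws \<Rightarrow>
     (case good_hearts t L \<phi> of [] \<Rightarrow> (ws, \<phi> # snd w) |
        x # _ \<Rightarrow> (add_list (fst x) \<phi> # petal_branch (fst x) (fst (snd x)) \<phi> # ws, snd w)))"

definition clauses :: "'l list list \<Rightarrow> 'l set set" where "clauses \<phi> = set ` set \<phi>"

text \<open>Under this invariant lengths of lists are cardinalities, so the thresholds can be tested
  by counting.\<close>

definition list_inv :: "'l list list \<Rightarrow> bool" where
  "list_inv \<phi> \<longleftrightarrow> distinct (map set \<phi>) \<and> (\<forall>d\<in>set \<phi>. distinct d)"

lemma clauses_add_list: "clauses (add_list c \<phi>) = add_clause (set c) (clauses \<phi>)"
proof -
  have "set ` {d \<in> set \<phi>. \<not> set c \<subseteq> set d} = {D \<in> set ` set \<phi>. \<not> set c \<subseteq> D}" by blast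
  then show ?thesis by (simp add: clauses_def add_list_def add_clause_def)
qed

lemma list_inv_add_list:
  assumes "list_inv \<phi>" "distinct c" shows "list_inv (add_list c \<phi>)"
proof (cases "\<exists>d\<in>set \<phi>. set d \<subseteq> set c")
  case False
  then have "set c \<notin> set ` set \<phi>" by blast
  moreover have "distinct (map set (filter P \<phi>))" for P
    using assms(1) unfolding list_inv_def by (simp add: distinct_map_filter)
  ultimately show ?thesis using assms False unfolding list_inv_def add_list_def by auto
qed (use assms in \<open>simp add: add_list_def\<close>)

lemma length_filter_clauses:
  assumes "list_inv \<phi>"
  shows "length (filter (\<lambda>d. P (set d)) \<phi>) = card {D \<in> clauses \<phi>. P D}"
proof -
  have d: "distinct (map set (filter (\<lambda>d. P (set d)) \<phi>))"
    using assms unfolding list_inv_def by (simp add: distinct_map_filter)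
  have "{D \<in> clauses \<phi>. P D} = set (map set (filter (\<lambda>d. P (set d)) \<phi>))" by (auto simp: clauses_def)
  then show ?thesis using distinct_card[OF d] by simp
qed

lemma length_flower_list:
  assumes "list_inv \<phi>"
  shows "length (flower_list H s \<phi>) = card (flower (set H) s (clauses \<phi>))"
proof -
  have "flower_list H s \<phi> = filter (\<lambda>d. card (set d) = s \<and> set H \<subseteq> set d) \<phi>"
    unfolding flower_list_def using assms by (intro filter_cong) (auto simp: list_inv_def distinct_card)
  then show ?thesis unfolding flower_def
    using length_filter_clauses[OF assms, of "\<lambda>D. card D = s \<and> set H \<subseteq> D"] by simp
qed

lemma length_clauses: "list_inv \<phi> \<Longrightarrow> length \<phi> = card (clauses \<phi>)"
  unfolding list_inv_def clauses_def using distinct_card[of "map set \<phi>"] by simp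

lemma add_list_fresh:
  "\<forall>d\<in>set \<phi>. \<not> set d \<subseteq> set c \<Longrightarrow> clauses (add_list c \<phi>) = replace_supersets {set c} (clauses \<phi>)"
  by (auto simp: clauses_def add_list_def replace_supersets_def)

text \<open>The new clauses are pairwise incomparable and contain no old clause; inserting them one
  at a time then has the effect of a simultaneous replacement.\<close>

lemma foldl_add_list:
  assumes "list_inv \<phi>" "\<forall>p\<in>set ps. distinct p \<and> (\<forall>d\<in>set \<phi>. \<not> set d \<subseteq> set p)"
    and "\<forall>p\<in>set ps. \<forall>q\<in>set ps. set p \<subseteq> set q \<longrightarrow> set p = set q" "distinct (map set ps)"
  shows "list_inv (foldl (\<lambda>\<psi> p. add_list p \<psi>) \<phi> ps) \<and>
     clauses (foldl (\<lambda>\<psi> p. add_list p \<psi>) \<phi> ps) = replace_supersets (set ` set ps) (clauses \<phi>)"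
  using assms
proof (induction ps arbitrary: \<phi>)
  case Nil
  then show ?case by (simp add: replace_supersets_def)
next
  case (Cons p ps)
  let ?\<phi> = "add_list p \<phi>"
  have fr: "\<forall>d\<in>set \<phi>. \<not> set d \<subseteq> set p" using Cons.prems(2) by simp
  have inv: "list_inv ?\<phi>" using Cons.prems by (intro list_inv_add_list) auto
  have sub: "set ?\<phi> \<subseteq> insert p (set \<phi>)" by (auto simp: add_list_def)
  have "\<forall>q\<in>set ps. distinct q \<and> (\<forall>d\<in>set ?\<phi>. \<not> set d \<subseteq> set q)"
  proof (intro ballI conjI)
    fix q d assume q: "q \<in> set ps" and d: "d \<in> set ?\<phi>"
    have "set p \<noteq> set q" using Cons.prems(4) q by auto
    moreover have "set p \<subseteq> set q \<longrightarrow> set p = set q" using Cons.prems(3) q by simp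
    ultimately have "\<not> set p \<subseteq> set q" by blast
    then show "\<not> set d \<subseteq> set q" using d sub q Cons.prems(2) by auto
  qed (use Cons.prems in simp)
  from Cons.IH[OF inv this] Cons.prems(3,4)
  have IH: "list_inv (foldl (\<lambda>\<psi> p. add_list p \<psi>) ?\<phi> ps)"
    "clauses (foldl (\<lambda>\<psi> p. add_list p \<psi>) ?\<phi> ps) = replace_supersets (set ` set ps) (clauses ?\<phi>)" by simp_all
  have "replace_supersets (set ` set ps) (replace_supersets {set p} (clauses \<phi>)) =
      replace_supersets (set ` set (p # ps)) (clauses \<phi>)"
  proof -
    have "\<not> set q \<subseteq> set p" if "q \<in> set ps" for q
    proof
      assume "set q \<subseteq> set p"
      then have "set q = set p" using Cons.prems(3) that by simp
      then show False using Cons.prems(4) that by auto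
    qed
    then show ?thesis by (auto simp: replace_supersets_def)
  qed
  then show ?case using IH add_list_fresh[OF fr] by simp
qed

text \<open>All petals have the same size, hence they are incomparable, and an old clause inside a
  petal would be properly contained in the clause of that petal.\<close>

lemma petal_branch_correct:
  assumes inv: "list_inv \<phi>" and ac: "antichain (clauses \<phi>)" and H: "set H \<noteq> {}" "card (set H) < s"
  shows "list_inv (petal_branch H s \<phi>)"
    "clauses (petal_branch H s \<phi>) = replace_supersets (petals (set H) s (clauses \<phi>)) (clauses \<phi>)"
proof -
  define ps where "ps = map (\<lambda>d. filter (\<lambda>l. l \<notin> set H) d) (flower_list H s \<phi>)"
  have sp: "set (filter (\<lambda>l. l \<notin> set H) d) = set d - set H" for d by auto
  have D: "d \<in> set \<phi>" "distinct d" "length d = s" "set H \<subseteq> set d" "card (set d) = s" if "d \<in> set (flower_list H s \<phi>)" for d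
    using that inv by (auto simp: flower_list_def list_inv_def distinct_card)
  have pet: "set ` set ps = petals (set H) s (clauses \<phi>)"
  proof -
    have "flower (set H) s (clauses \<phi>) = set ` set (flower_list H s \<phi>)"
      using inv by (force simp: flower_def clauses_def flower_list_def list_inv_def distinct_card)
    then show ?thesis by (simp add: petals_def ps_def image_image set_diff_eq)
  qed
  have cp: "card (set p) = s - card (set H)" if p: "p \<in> set ps" for p
  proof -
    obtain d where d: "d \<in> set (flower_list H s \<phi>)" "set p = set d - set H" using p sp by (auto simp: ps_def)
    then show ?thesis using D[OF d(1)] by (simp add: card_Diff_subset)
  qed
  have 1: "\<forall>p\<in>set ps. distinct p \<and> (\<forall>d\<in>set \<phi>. \<not> set d \<subseteq> set p)"
  proof (intro ballI conjI notI)
    fix p assume p: "p \<in> set ps"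
    then obtain d where d: "d \<in> set (flower_list H s \<phi>)" "p = filter (\<lambda>l. l \<notin> set H) d" by (auto simp: ps_def)
    then show "distinct p" using D[OF d(1)] by simp
    fix e assume e: "e \<in> set \<phi>" "set e \<subseteq> set p"
    then have "set e \<subseteq> set d" using d(2) by auto
    then have "set e = set d" using ac e(1) D[OF d(1)] by (auto simp: antichain_def clauses_def)
    then have "set d \<subseteq> set d - set H" using e(2) d(2) by auto
    moreover have "hd H \<in> set H" using H(1) by (cases H) auto
    ultimately show False using D(4)[OF d(1)] by blast
  qed
  have 2: "\<forall>p\<in>set ps. \<forall>q\<in>set ps. set p \<subseteq> set q \<longrightarrow> set p = set q"
    using cp by (metis List.finite_set card_subset_eq)
  have 3: "distinct (map set ps)"
  proof -
    have "map set ps = map (\<lambda>D. D - set H) (map set (flower_list H s \<phi>))" by (auto simp: ps_def)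
    moreover have "inj_on (\<lambda>D. D - set H) (set (map set (flower_list H s \<phi>)))"
    proof (rule inj_onI)
      fix X Y assume XY: "X \<in> set (map set (flower_list H s \<phi>))" "Y \<in> set (map set (flower_list H s \<phi>))" "X - set H = Y - set H"
      then have "set H \<subseteq> X" "set H \<subseteq> Y" using D(4) by auto
      then show "X = Y" using XY(3) by blast
    qed
    moreover have "distinct (map set (flower_list H s \<phi>))"
      using inv unfolding list_inv_def flower_list_def by (simp add: distinct_map_filter)
    ultimately show ?thesis by (simp only: distinct_map set_map)
  qed
  show "list_inv (petal_branch H s \<phi>)"
    "clauses (petal_branch H s \<phi>) = replace_supersets (petals (set H) s (clauses \<phi>)) (clauses \<phi>)"
    using foldl_add_list[OF inv 1 2 3] unfolding petal_branch_def ps_def[symmetric] pet by simp_all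
qed

lemma candidates_heads:
  "x \<in> set (candidates t L) \<Longrightarrow> set (fst x) \<subseteq> set L \<and> set (fst x) \<noteq> {} \<and> distinct (fst x) \<and> length (fst x) \<le> 2 \<and>
     card (set (fst x)) < fst (snd x) \<and> fst (snd x) \<le> 3"
  by (auto simp: candidates_def)

lemma append3_head:
  "A @ B @ C = x # xs \<Longrightarrow> x \<in> set A \<or> A = [] \<and> x \<in> set B \<or> A = [] \<and> B = [] \<and> x \<in> set C"
  by (cases A; cases B) auto

text \<open>Since the hearts are listed in order of priority, the first good one meets \<open>heart_ok\<close>.\<close>

lemma first_heart_ok:
  assumes inv: "list_inv \<phi>" and sub: "\<And>D. D \<in> clauses \<phi> \<Longrightarrow> D \<subseteq> set L" and t: "t > 0"
    and g: "good_hearts t L \<phi> = x # xs"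
  shows "heart_ok t (clauses \<phi>) (set (fst x)) (fst (snd x))"
proof -
  let ?P = "\<lambda>x. snd (snd x) \<le> length (flower_list (fst x) (fst (snd x)) \<phi>)"
  let ?A = "map (\<lambda>a. ([a], 2, t)) L"
  let ?B = "concat (map (\<lambda>a. map (\<lambda>b. ([a, b], 3, t)) (filter (\<lambda>b. b \<noteq> a) L)) L)"
  let ?C = "map (\<lambda>a. ([a], 3 :: nat, 2 * (t * t))) L"
  have c: "candidates t L = ?A @ ?B @ ?C" by (simp add: candidates_def)
  have len: "length (flower_list H s \<phi>) = card (flower (set H) s (clauses \<phi>))" for H s
    by (rule length_flower_list[OF inv])
  have out: "flower H s (clauses \<phi>) = {}" if "\<not> H \<subseteq> set L" for H s using sub that by (auto simp: flower_def)
  have nA: "card (flower H 2 (clauses \<phi>)) < t" if "filter ?P ?A = []" "card H = 1" for H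
  proof -
    obtain a where a: "H = {a}" using \<open>card H = 1\<close> by (auto simp: card_1_singleton_iff)
    show ?thesis
    proof (cases "a \<in> set L")
      case True
      then show ?thesis using that(1) len[of "[a]" 2] by (auto simp: filter_empty_conv a not_le)
    qed (use out[of H 2] a t in auto)
  qed
  have nB: "card (flower H 3 (clauses \<phi>)) < t" if "filter ?P ?B = []" "card H = 2" for H
  proof -
    obtain a b where a: "H = {a, b}" "a \<noteq> b" using \<open>card H = 2\<close> by (auto simp: card_2_iff)
    show ?thesis
    proof (cases "a \<in> set L \<and> b \<in> set L")
      case True
      then have "([a, b], 3, t) \<in> set ?B" using a(2) by auto
      then have "\<not> ?P ([a, b], 3, t)" using that(1) unfolding filter_empty_conv by blast
      then show ?thesis using len[of "[a, b]" 3] by (auto simp: a not_le)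
    qed (use out[of H 3] a t in auto)
  qed
  have gx: "filter ?P ?A @ filter ?P ?B @ filter ?P ?C = x # xs" using g by (simp add: good_hearts_def c)
  from append3_head[OF gx] show ?thesis
  proof (elim disjE conjE)
    assume "x \<in> set (filter ?P ?A)"
    then obtain a where "x = ([a], 2, t)" "?P x" by auto
    then show ?thesis using len[of "[a]" 2] by (simp add: heart_ok_def)
  next
    assume e: "filter ?P ?A = []" and "x \<in> set (filter ?P ?B)"
    then obtain a b where "x = ([a, b], 3, t)" "?P x" "b \<noteq> a" by auto
    then show ?thesis using len[of "[a, b]" 3] nA[OF e] by (simp add: heart_ok_def)
  next
    assume e: "filter ?P ?A = []" "filter ?P ?B = []" and "x \<in> set (filter ?P ?C)"
    then obtain a where "x = ([a], 3, 2 * (t * t))" "?P x" by auto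
    then show ?thesis using len[of "[a]" 3] nA[OF e(1)] nB[OF e(2)] by (simp add: heart_ok_def power2_eq_square)
  qed
qed

lemma no_heart:
  assumes inv: "list_inv \<phi>" and sub: "\<And>D. D \<in> clauses \<phi> \<Longrightarrow> D \<subseteq> set L" and t: "t > 0"
    and g: "good_hearts t L \<phi> = []"
  shows "\<not> heart_ok t (clauses \<phi>) H s"
proof
  assume ok: "heart_ok t (clauses \<phi>) H s"
  have len: "length (flower_list H s \<phi>) = card (flower (set H) s (clauses \<phi>))" for H s
    by (rule length_flower_list[OF inv])
  have no: "\<not> snd (snd x) \<le> length (flower_list (fst x) (fst (snd x)) \<phi>)" if "x \<in> set (candidates t L)" for x
    using g that by (auto simp: good_hearts_def filter_empty_conv)
  have t2: "0 < 2 * t\<^sup>2" using t by simp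
  have "t \<le> card (flower H s (clauses \<phi>)) \<or> 2 * t\<^sup>2 \<le> card (flower H s (clauses \<phi>))"
    using ok by (auto simp: heart_ok_def)
  then have "card (flower H s (clauses \<phi>)) > 0" using t t2 by linarith
  then have "flower H s (clauses \<phi>) \<noteq> {}" by force
  then have HL: "H \<subseteq> set L" using sub by (auto simp: flower_def)
  from ok consider a where "H = {a}" "s = 2" "t \<le> card (flower H 2 (clauses \<phi>))"
    | a b where "H = {a, b}" "a \<noteq> b" "s = 3" "t \<le> card (flower H 3 (clauses \<phi>))"
    | a where "H = {a}" "s = 3" "2 * t\<^sup>2 \<le> card (flower H 3 (clauses \<phi>))"
    by (auto simp: heart_ok_def card_1_singleton_iff card_2_iff)
  then show False
  proof cases
    case 1
    then have "([a], 2, t) \<in> set (candidates t L)" using HL by (auto simp: candidates_def)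
    from no[OF this] show False using 1 len[of "[a]" 2] by simp
  next
    case 2
    then have "([a, b], 3, t) \<in> set (candidates t L)" using HL by (auto simp: candidates_def)
    from no[OF this] show False using 2 len[of "[a, b]" 3] by simp
  next
    case 3
    then have "([a], 3, 2 * (t * t)) \<in> set (candidates t L)" using HL by (auto simp: candidates_def)
    from no[OF this] show False using 3 len[of "[a]" 3] by (simp add: power2_eq_square)
  qed
qed

section \<open>The number of splitting steps\<close>

definition formula_ok :: "'l set set \<Rightarrow> nat \<Rightarrow> 'l list \<Rightarrow> 'l list list \<Rightarrow> bool" where
  "formula_ok Q t L \<phi> \<longleftrightarrow> list_inv \<phi> \<and> sparse_inv Q t (set L) (clauses \<phi>)"

lemma formula_ok_branch:
  assumes ok: "formula_ok Q t L \<phi>" and t: "t > 0" and g: "good_hearts t L \<phi> = x # xs"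
  defines "\<phi>1 \<equiv> add_list (fst x) \<phi>" and "\<phi>2 \<equiv> petal_branch (fst x) (fst (snd x)) \<phi>"
  shows "formula_ok Q t L \<phi>1" "formula_ok Q t L \<phi>2"
    "potential Q t (clauses \<phi>1) \<ge> potential Q t (clauses \<phi>) + 1"
    "potential Q t (clauses \<phi>2) \<ge> potential Q t (clauses \<phi>) + 2 * t\<^sup>2"
    "hits T (clauses \<phi>) \<longleftrightarrow> hits T (clauses \<phi>1) \<or> hits T (clauses \<phi>2)"
proof -
  have inv: "list_inv \<phi>" "sparse_inv Q t (set L) (clauses \<phi>)" using ok by (auto simp: formula_ok_def)
  have sub: "D \<subseteq> set L" if "D \<in> clauses \<phi>" for D using inv(2) that by (simp add: sparse_inv_def)
  have ac: "antichain (clauses \<phi>)" using inv(2) by (simp add: sparse_inv_def)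
  have "x \<in> set (candidates t L)" proof -
    have "x \<in> set (good_hearts t L \<phi>)" using g by simp
    then show ?thesis by (simp add: good_hearts_def)
  qed
  note x = candidates_heads[OF this]
  have h: "heart_ok t (clauses \<phi>) (set (fst x)) (fst (snd x))" by (rule first_heart_ok[OF inv(1) sub t g])
  note b = branch_inv[OF inv(2) h t]
  obtain D where D: "D \<in> flower (set (fst x)) (fst (snd x)) (clauses \<phi>)" using b(1) by blast
  have "\<forall>d\<in>set \<phi>. \<not> set d \<subseteq> set (fst x)"
  proof (intro ballI notI)
    fix d assume d: "d \<in> set \<phi>" "set d \<subseteq> set (fst x)"
    have D': "D \<in> clauses \<phi>" "set (fst x) \<subseteq> D" "card D = fst (snd x)" using D by (auto simp: flower_def)
    have "set d \<in> clauses \<phi>" "set d \<subseteq> D" using d D'(2) by (auto simp: clauses_def)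
    then have "set d = D" using ac D'(1) unfolding antichain_def by simp
    then have "D = set (fst x)" using d(2) D'(2) by simp
    then show False using D'(3) x by simp
  qed
  note e1 = add_list_fresh[OF this, folded \<phi>1_def]
  note e2 = petal_branch_correct[OF inv(1) ac, of "fst x" "fst (snd x)", folded \<phi>2_def]
  have x': "set (fst x) \<noteq> {}" "card (set (fst x)) < fst (snd x)" using x by auto
  show "formula_ok Q t L \<phi>1" using b(2) e1 list_inv_add_list[OF inv(1)] x by (simp add: formula_ok_def \<phi>1_def)
  show "formula_ok Q t L \<phi>2" using b(4) e2[OF x'] by (simp add: formula_ok_def)
  show "potential Q t (clauses \<phi>1) \<ge> potential Q t (clauses \<phi>) + 1" using b(3) e1 by simp
  show "potential Q t (clauses \<phi>2) \<ge> potential Q t (clauses \<phi>) + 2 * t\<^sup>2" using b(5) e2(2)[OF x'] by simp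
  show "hits T (clauses \<phi>) \<longleftrightarrow> hits T (clauses \<phi>1) \<or> hits T (clauses \<phi>2)"
    unfolding e1 e2(2)[OF x'] by (rule hits_branch)
qed

text \<open>Bounds the number of nodes of the splitting tree below \<open>\<phi>\<close>: if the
  potential can still grow by \<open>r\<close>, there are at most \<open>\<mu> ^ r\<close> leaves,
  and a binary tree with \<open>m\<close> leaves has \<open>2 * m - 1\<close> nodes.\<close>

definition tree_weight :: "real \<Rightarrow> 'l set set \<Rightarrow> nat \<Rightarrow> 'l list \<Rightarrow> 'l list list \<Rightarrow> real" where
  "tree_weight \<mu> Q t L \<phi> = 2 * \<mu> ^ (6 * t * card (set L) - potential Q t (clauses \<phi>)) - 1"

definition split_inv :: "'l set set \<Rightarrow> nat \<Rightarrow> 'l list \<Rightarrow> ('l set \<Rightarrow> bool) \<Rightarrow> 'l list list list \<times> 'l list list list \<Rightarrow> bool" where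
  "split_inv Q t L A w \<longleftrightarrow> (\<forall>\<phi>\<in>set (fst w). formula_ok Q t L \<phi>) \<and>
     (\<forall>\<phi>\<in>set (snd w). formula_ok Q t L \<phi> \<and> length \<phi> \<le> 1 + card (set L) * (1 + t + 2 * t\<^sup>2)) \<and>
     (\<forall>T. A T \<longleftrightarrow> (\<exists>\<phi>\<in>set (fst w) \<union> set (snd w). hits T (clauses \<phi>)))"

text \<open>One step handles one node of the splitting tree, so the total weight of the pending
  formulas drops by at least 1: a leaf has weight at least 1, and an inner node outweighs its two
  children by 1.\<close>

lemma split_step_inv:
  assumes inv: "split_inv Q t L A w" and t: "t > 0" and ne: "fst w \<noteq> []"
    and lam: "\<mu> > 1" "\<mu> ^ (2 * t\<^sup>2 - 1) + 1 \<le> \<mu> ^ (2 * t\<^sup>2) "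
  shows "split_inv Q t L A (split_step t L w)"
    "sum_list (map (tree_weight \<mu> Q t L) (fst (split_step t L w))) + 1 \<le> sum_list (map (tree_weight \<mu> Q t L) (fst w))"
proof -
  obtain \<phi> ws where w: "fst w = \<phi> # ws" using ne by (cases "fst w") auto
  have ok: "formula_ok Q t L \<phi>" using inv w by (simp add: split_inv_def)
  have A: "A T \<longleftrightarrow> hits T (clauses \<phi>) \<or> (\<exists>\<psi>\<in>set ws \<union> set (snd w). hits T (clauses \<psi>))" for T
    using inv w unfolding split_inv_def by auto
  have p: "potential Q t (clauses \<psi>) \<le> 6 * t * card (set L)" if "formula_ok Q t L \<psi>" for \<psi>
    using that potential_le[of Q t "set L"] by (auto simp: formula_ok_def)
  have "split_inv Q t L A (split_step t L w) \<and>
    sum_list (map (tree_weight \<mu> Q t L) (fst (split_step t L w))) + 1 \<le> sum_list (map (tree_weight \<mu> Q t L) (fst w))"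
  proof (cases "good_hearts t L \<phi>")
    case Nil
    have e: "split_step t L w = (ws, \<phi> # snd w)" by (simp add: split_step_def w Nil)
    have li: "list_inv \<phi>" and si: "sparse_inv Q t (set L) (clauses \<phi>)" using ok by (auto simp: formula_ok_def)
    have sub: "D \<subseteq> set L" if "D \<in> clauses \<phi>" for D using si that by (simp add: sparse_inv_def)
    have "length \<phi> \<le> 1 + card (set L) * (1 + t + 2 * t\<^sup>2)"
      unfolding length_clauses[OF li] by (rule leaf_sparse[OF si no_heart[OF li sub t Nil]])
    moreover have "1 \<le> tree_weight \<mu> Q t L \<phi>" using lam(1) by (simp add: tree_weight_def one_le_power)
    ultimately show ?thesis using inv ok A by (auto simp: e w split_inv_def)
  next
    case (Cons x xs)
    let ?\<phi>1 = "add_list (fst x) \<phi>" let ?\<phi>2 = "petal_branch (fst x) (fst (snd x)) \<phi>"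
    have e: "split_step t L w = (?\<phi>1 # ?\<phi>2 # ws, snd w)" by (simp add: split_step_def w Cons)
    note b = formula_ok_branch[OF ok t Cons]
    define R where "R = 6 * t * card (set L)"
    define r where "r = R - potential Q t (clauses \<phi>)"
    define g where "g = 2 * t\<^sup>2"
    have g1: "g \<ge> 1" using t by (simp add: g_def Suc_le_eq)
    have r: "R - potential Q t (clauses ?\<phi>1) \<le> r - 1" "R - potential Q t (clauses ?\<phi>2) \<le> r - g" "g \<le> r"
      using b(3,4) p[OF b(2)] unfolding r_def R_def g_def by linarith+
    have "\<mu> ^ (R - potential Q t (clauses ?\<phi>1)) \<le> \<mu> ^ (r - 1)" "\<mu> ^ (R - potential Q t (clauses ?\<phi>2)) \<le> \<mu> ^ (r - g)"
      using r lam(1) by (auto intro: power_increasing)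
    \<comment> \<open>The recurrence premise on \<open>\<mu>\<close>, multiplied by
      \<open>\<mu> ^ (r - g)\<close>.\<close>
    moreover have "\<mu> ^ (r - 1) + \<mu> ^ (r - g) \<le> \<mu> ^ r"
    proof -
      have "r - 1 = (g - 1) + (r - g)" "r = g + (r - g)" using r(3) g1 by auto
      then have "\<mu> ^ (r - 1) + \<mu> ^ (r - g) = (\<mu> ^ (g - 1) + 1) * \<mu> ^ (r - g)" "\<mu> ^ r = \<mu> ^ g * \<mu> ^ (r - g)"
        by (metis distrib_right mult_1 power_add, metis power_add)
      then show ?thesis using lam by (simp add: g_def mult_right_mono)
    qed
    ultimately have "tree_weight \<mu> Q t L ?\<phi>1 + tree_weight \<mu> Q t L ?\<phi>2 + 1 \<le> tree_weight \<mu> Q t L \<phi>"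
      unfolding tree_weight_def R_def[symmetric] r_def[symmetric] by linarith
    moreover have "split_inv Q t L A (?\<phi>1 # ?\<phi>2 # ws, snd w)"
      unfolding split_inv_def
    proof (intro conjI allI)
      fix T
      show "A T \<longleftrightarrow> (\<exists>\<psi>\<in>set (fst (?\<phi>1 # ?\<phi>2 # ws, snd w)) \<union> set (snd (?\<phi>1 # ?\<phi>2 # ws, snd w)). hits T (clauses \<psi>))"
        unfolding A b(5)[of T] by auto
    qed (use inv b(1,2) w in \<open>auto simp: split_inv_def\<close>)
    ultimately show ?thesis by (simp add: e w)
  qed
  then show "split_inv Q t L A (split_step t L w)"
    "sum_list (map (tree_weight \<mu> Q t L) (fst (split_step t L w))) + 1 \<le> sum_list (map (tree_weight \<mu> Q t L) (fst w))"
    by auto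
qed

lemma tree_weight_nonneg:
  assumes "\<mu> > 1" shows "tree_weight \<mu> Q t L \<phi> \<ge> 0"
proof -
  have "1 \<le> \<mu> ^ (6 * t * card (set L) - potential Q t (clauses \<phi>))" using assms by (intro one_le_power) simp
  then show ?thesis unfolding tree_weight_def by linarith
qed

lemma split_steps:
  assumes inv: "split_inv Q t L A w" and t: "t > 0"
    and lam: "\<mu> > 1" "\<mu> ^ (2 * t\<^sup>2 - 1) + 1 \<le> \<mu> ^ (2 * t\<^sup>2)"
  shows "split_inv Q t L A ((split_step t L ^^ n) w) \<and>
    (fst ((split_step t L ^^ n) w) = [] \<or>
     sum_list (map (tree_weight \<mu> Q t L) (fst ((split_step t L ^^ n) w))) + real n \<le> sum_list (map (tree_weight \<mu> Q t L) (fst w)))"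
proof (induction n)
  case 0
  then show ?case using inv by simp
next
  case (Suc n)
  let ?w = "(split_step t L ^^ n) w"
  show ?case
  proof (cases "fst ?w = []")
    case True
    then have "split_step t L ?w = ?w" by (simp add: split_step_def)
    then show ?thesis using Suc True by simp
  next
    case False
    note s = split_step_inv[OF conjunct1[OF Suc] t False lam]
    show ?thesis using s Suc False by auto
  qed
qed

text \<open>The initial weight is below \<open>n\<close>, so no formula is pending after
  \<open>n\<close> steps. Surplus steps are harmless, since \<open>split_step\<close> is the
  identity once nothing is pending.\<close>

lemma split_finishes:
  assumes inv: "split_inv Q t L A ([\<phi>], [])" and t: "t > 0"
    and lam: "\<mu> > 1" "\<mu> ^ (2 * t\<^sup>2 - 1) + 1 \<le> \<mu> ^ (2 * t\<^sup>2)" and n: "2 * \<mu> ^ (6 * t * card (set L)) \<le> real n"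
  shows "fst ((split_step t L ^^ n) ([\<phi>], [])) = []"
    "\<And>T. A T \<longleftrightarrow> (\<exists>\<psi>\<in>set (snd ((split_step t L ^^ n) ([\<phi>], []))). hits T (clauses \<psi>))"
    "\<forall>\<psi>\<in>set (snd ((split_step t L ^^ n) ([\<phi>], []))). length \<psi> \<le> 1 + card (set L) * (1 + t + 2 * t\<^sup>2)"
proof -
  note s = split_steps[OF inv t lam, of n]
  show f: "fst ((split_step t L ^^ n) ([\<phi>], [])) = []"
  proof (rule ccontr)
    assume "fst ((split_step t L ^^ n) ([\<phi>], [])) \<noteq> []"
    then have "sum_list (map (tree_weight \<mu> Q t L) (fst ((split_step t L ^^ n) ([\<phi>], [])))) + real n \<le> tree_weight \<mu> Q t L \<phi>"
      using s by simp
    moreover have "0 \<le> sum_list (map (tree_weight \<mu> Q t L) (fst ((split_step t L ^^ n) ([\<phi>], []))))"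
      using tree_weight_nonneg[OF lam(1)] by (intro sum_list_nonneg) auto
    moreover have "\<mu> ^ (6 * t * card (set L) - potential Q t (clauses \<phi>)) \<le> \<mu> ^ (6 * t * card (set L))"
      using lam(1) by (intro power_increasing) auto
    ultimately show False using n by (simp add: tree_weight_def)
  qed
  show "A T \<longleftrightarrow> (\<exists>\<psi>\<in>set (snd ((split_step t L ^^ n) ([\<phi>], []))). hits T (clauses \<psi>))" for T
    using s f by (simp add: split_inv_def)
  show "\<forall>\<psi>\<in>set (snd ((split_step t L ^^ n) ([\<phi>], []))). length \<psi> \<le> 1 + card (set L) * (1 + t + 2 * t\<^sup>2)"
    using s f by (simp add: split_inv_def)
qed

text \<open>The number \<open>\<mu>\<close> satisfies the recurrence of branches that gain \<open>1\<close> and \<open>2 * t\<^sup>2\<close> of a potential at most \<open>6 * t * n\<close>.\<close>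

lemma threshold_exists:
  assumes "q > (0::nat)"
  shows "\<exists>t \<mu>. t > 0 \<and> \<mu> > (1::real) \<and> \<mu> ^ (2 * t\<^sup>2 - 1) + 1 \<le> \<mu> ^ (2 * t\<^sup>2) \<and>
     (\<forall>n q'. n \<le> q * q' \<longrightarrow> \<mu> ^ (6 * t * n) \<le> 3 ^ q')"
proof -
  obtain b :: nat where b: "b > 0" "18 * q\<^sup>2 * b + 1 \<le> 2 ^ b"
  proof -
    \<comment> \<open>The witness is \<open>b = 2 * B\<close>: squaring
      \<open>2 ^ B \<ge> B + 1\<close> yields a quadratic lower bound for \<open>2 ^ b\<close>,
      which beats the linear \<open>18 * q\<^sup>2 * b + 1\<close>.\<close>
    define B where "B = 36 * q\<^sup>2 + 2"
    have "(2::nat) ^ B \<ge> B + 1" by (metis Suc_eq_plus1 Suc_leI less_exp)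
    then have "(B + 1) * (B + 1) \<le> 2 ^ B * 2 ^ B" by (intro mult_le_mono)
    also have "\<dots> = (2::nat) ^ (2 * B)" by (simp add: mult_2 power_add)
    finally have "(2::nat) ^ (2 * B) \<ge> (B + 1) * (B + 1)" .
    moreover have "18 * q\<^sup>2 * (2 * B) + 1 \<le> (B + 1) * (B + 1)" by (simp add: B_def algebra_simps)
    ultimately show ?thesis using that[of "2 * B"] by (simp add: B_def)
  qed
  \<comment> \<open>Chosen so that \<open>2 * t\<^sup>2 = a * b\<close> and
    \<open>6 * t * q = a\<close>. Since \<open>\<mu> ^ a\<close> lies between 2 and 3 for
    \<open>\<mu> = 1 + 1 / a\<close>, the first equation gives
    \<open>\<mu> ^ (2 * t\<^sup>2) \<ge> 2 ^ b \<ge> a + 1\<close>, and the second bounds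
    \<open>\<mu> ^ (6 * t * n)\<close> by \<open>3 ^ q'\<close>.\<close>
  define t where "t = 3 * q * b"
  define a where "a = 18 * q\<^sup>2 * b"
  define \<mu> :: real where "\<mu> = 1 + 1 / real a"
  have t: "t > 0" and a: "a > 0" using assms b by (auto simp: t_def a_def)
  have g: "2 * t\<^sup>2 = a * b" by (simp add: t_def a_def power2_eq_square algebra_simps)
  have "- 1 \<le> 1 / real a" by (rule order_trans[of _ 0]) simp_all
  then have la: "\<mu> ^ a \<ge> 2" using Bernoulli_inequality[of "1 / real a" a] a by (simp add: \<mu>_def)
  have "real (a + 1) \<le> real (2 ^ b)" using b(2) unfolding a_def by (simp only: of_nat_le_iff)
  then have "real a + 1 \<le> 2 ^ b" by simp
  also have "\<dots> \<le> (\<mu> ^ a) ^ b" using la by (intro power_mono) auto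
  finally have lg: "real a + 1 \<le> \<mu> ^ (2 * t\<^sup>2)" by (simp add: g power_mult)
  have l1: "\<mu> > 1" using a by (simp add: \<mu>_def)
  have "\<mu> ^ (2 * t\<^sup>2 - 1) + 1 \<le> \<mu> ^ (2 * t\<^sup>2)"
  proof -
    define X where "X = \<mu> ^ (2 * t\<^sup>2 - 1)"
    have e: "\<mu> ^ (2 * t\<^sup>2) = \<mu> * X" 
    proof -
      obtain k where k: "2 * t\<^sup>2 = Suc k" using t by (cases "2 * t\<^sup>2") auto
      show ?thesis unfolding X_def k by simp
    qed
    \<comment> \<open>\<open>X + 1 \<le> \<mu> * X\<close> says \<open>X \<ge> a\<close>, and this
      follows by dividing by \<open>\<mu>\<close>, because \<open>a * \<mu> = a + 1\<close>.\<close>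
    have "real a + 1 \<le> \<mu> * X" using lg unfolding e .
    then have "real a * (real a + 1) \<le> real a * (\<mu> * X)" by (intro mult_left_mono) auto
    also have "\<dots> = X * (real a + 1)" using a by (simp add: \<mu>_def field_simps)
    finally have "real a \<le> X" by (rule mult_right_le_imp_le) simp
    then have "X / real a \<ge> 1" using a by simp
    moreover have "\<mu> * X = X + X / real a" by (simp add: \<mu>_def algebra_simps)
    ultimately show ?thesis using e X_def by simp
  qed
  moreover have "\<mu> ^ (6 * t * n) \<le> 3 ^ q'" if "n \<le> q * q'" for n q'
  proof -
    have "6 * t * n \<le> 6 * t * (q * q')" using that by simp
    also have "\<dots> = a * q'" by (simp add: t_def a_def power2_eq_square)
    finally have "\<mu> ^ (6 * t * n) \<le> \<mu> ^ (a * q')" using l1 by (intro power_increasing) auto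
    also have "\<mu> ^ a \<le> 3"
    proof -
      have "\<mu> \<le> exp (1 / real a)" unfolding \<mu>_def by (rule exp_ge_add_one_self)
      then have "\<mu> ^ a \<le> exp (1 / real a) ^ a" using l1 by (intro power_mono) auto
      also have "\<dots> = exp 1" using a by (simp add: exp_of_nat_mult[symmetric])
      finally show ?thesis using exp_le by linarith
    qed
    then have "\<mu> ^ (a * q') \<le> 3 ^ q'" using l1 by (simp add: power_mult power_mono)
    finally show ?thesis .
  qed
  ultimately show ?thesis using t l1 by blast
qed

section \<open>Graphs of partial choices\<close>

text \<open>Toggling an element outside \<open>B\<close> changes the sign of a term but not the
  value of \<open>f\<close>, so the terms cancel in pairs.\<close>

lemma sum_Pow_restrict_zero:
  fixes f :: "'a set \<Rightarrow> rat"
  assumes "finite E" "B \<subseteq> E" "B \<noteq> E"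
  shows "(\<Sum>S\<in>Pow E. f (S \<inter> B) * (-1) ^ card S) = 0"
proof -
  obtain e where e: "e \<in> E" "e \<notin> B" using assms by blast
  define E' where "E' = E - {e}"
  have E: "E = insert e E'" "e \<notin> E'" "finite E'" using e assms(1) by (auto simp: E'_def)
  have inj: "inj_on (insert e) (Pow E')" using E(2) by (auto simp: inj_on_def)
  have "(\<Sum>S\<in>Pow E. f (S \<inter> B) * (-1) ^ card S) =
      (\<Sum>S\<in>Pow E'. f (S \<inter> B) * (-1) ^ card S) + (\<Sum>S\<in>insert e ` Pow E'. f (S \<inter> B) * (-1) ^ card S)"
    unfolding E(1) Pow_insert using E by (intro sum.union_disjoint) auto
  also have "(\<Sum>S\<in>insert e ` Pow E'. f (S \<inter> B) * (-1) ^ card S) =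
      (\<Sum>S\<in>Pow E'. f (insert e S \<inter> B) * (-1) ^ card (insert e S))"
    by (simp add: sum.reindex[OF inj])
  also have "\<dots> = (\<Sum>S\<in>Pow E'. - (f (S \<inter> B) * (-1) ^ card S))"
  proof (rule sum.cong)
    fix S assume "S \<in> Pow E'"
    then have "finite S" "e \<notin> S" using E finite_subset by auto
    moreover have "insert e S \<inter> B = S \<inter> B" using e(2) by blast
    ultimately show "f (insert e S \<inter> B) * (-1) ^ card (insert e S) = - (f (S \<inter> B) * (-1) ^ card S)" by simp
  qed simp
  finally show ?thesis by (simp add: sum_negf)
qed

definition colored_graph :: "nat \<Rightarrow> (nat \<Rightarrow> nat) \<Rightarrow> (nat \<Rightarrow> nat \<Rightarrow> bool) \<Rightarrow> nat set set \<Rightarrow> graph" where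
  "colored_graph n c R S = Graph {..<n} {{i, j} | i j. i < n \<and> j < n \<and> {c i, c j} \<in> S \<and> R i j}"

lemma colored_graph_edge:
  assumes "\<And>i j. R i j \<Longrightarrow> R j i" "u < n" "v < n"
  shows "{u, v} \<in> edges (colored_graph n c R S) \<longleftrightarrow> {c u, c v} \<in> S \<and> R u v"
proof
  assume "{u, v} \<in> edges (colored_graph n c R S)"
  then obtain i j where "{u, v} = {i, j}" "{c i, c j} \<in> S" "R i j" by (auto simp: colored_graph_def)
  then show "{c u, c v} \<in> S \<and> R u v" using assms(1) by (auto simp: doubleton_eq_iff insert_commute)
next
  assume "{c u, c v} \<in> S \<and> R u v"
  then show "{u, v} \<in> edges (colored_graph n c R S)" using assms(2,3) unfolding colored_graph_def graph.sel by blast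
qed

lemma simple_colored_graph:
  assumes "\<And>e. e \<in> S \<Longrightarrow> card e = 2"
  shows "simple_graph (colored_graph n c R S)"
proof -
  have "card {i, j} = 2" if "{c i, c j} \<in> S" for i j
    using assms[OF that] by (cases "i = j") auto
  then show ?thesis by (auto simp: simple_graph_def colored_graph_def)
qed

lemma hom_colored_graph:
  assumes "verts F = {..<k}" "S \<subseteq> edges F" "\<And>i. i < n \<Longrightarrow> c i < k" "\<And>i j. R i j \<Longrightarrow> R j i"
  shows "graph_hom c (colored_graph n c R S) F"
  unfolding graph_hom_def
proof (intro conjI ballI impI)
  fix u v assume "u \<in> verts (colored_graph n c R S)" "v \<in> verts (colored_graph n c R S)"
  then have "u < n" "v < n" by (simp_all add: colored_graph_def)
  moreover assume "{u, v} \<in> edges (colored_graph n c R S)"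
  ultimately show "{c u, c v} \<in> edges F" using colored_graph_edge[where R = R and u = u and n = n and v = v and c = c and S = S, OF assms(4)] assms(2) by auto
qed (use assms in \<open>auto simp: colored_graph_def\<close>)

definition full_copy :: "graph \<Rightarrow> (nat \<Rightarrow> nat) \<Rightarrow> (nat \<Rightarrow> nat \<Rightarrow> bool) \<Rightarrow> nat set \<Rightarrow> bool" where
  "full_copy F c R A \<longleftrightarrow> (\<forall>e\<in>edges F. \<exists>i\<in>A. \<exists>j\<in>A. {c i, c j} = e \<and> R i j)"

text \<open>On a colourful set \<open>A\<close> the colouring is injective, and it is an isomorphism
  from the induced subgraph onto the graph with edge set \<open>S \<inter> EA A\<close>, where
  \<open>EA A\<close> consists of the edges of \<open>F\<close> that \<open>A\<close> realizes.
  After exchanging the sums, the alternating sum for a fixed \<open>A\<close> vanishes unless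
  \<open>EA A\<close> is all of \<open>edges F\<close>, and then it is
  \<open>ae \<Phi> F\<close>.\<close>

lemma alternating_sum_cpIndSub:
  assumes iso: "iso_invariant \<Phi>" and F: "simple_graph F" "verts F = {..<k}"
    and R: "\<And>i j. R i j \<Longrightarrow> R j i"
  shows "(\<Sum>S\<in>Pow (edges F). cpIndSub \<Phi> F (colored_graph n c R S) c * (-1) ^ card S) =
     ae \<Phi> F * of_nat (card {A. A \<subseteq> {..<n} \<and> card A = k \<and> c ` A = {..<k} \<and> full_copy F c R A})"
proof -
  define X where "X = {A. A \<subseteq> {..<n} \<and> card A = k \<and> c ` A = {..<k}}"
  define EA where "EA A = {e \<in> edges F. \<exists>i\<in>A. \<exists>j\<in>A. {c i, c j} = e \<and> R i j}" for A
  have finX: "finite X" unfolding X_def by (rule finite_subset[of _ "Pow {..<n}"]) auto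
  have finE: "finite (edges F)"
    using F(1) by (intro finite_subset[of "edges F" "Pow (verts F)"]) (auto simp: simple_graph_def)
  have cp: "cpIndSub \<Phi> F (colored_graph n c R S) c = (\<Sum>A\<in>X. \<Phi> (Graph {..<k} (S \<inter> EA A)))"
    if S: "S \<subseteq> edges F" for S
  proof -
    have "{A. colorful F (colored_graph n c R S) c A} = X"
      by (auto simp: colorful_def X_def F(2) colored_graph_def)
    moreover have "\<Phi> (induced_subgraph (colored_graph n c R S) A) = \<Phi> (Graph {..<k} (S \<inter> EA A))" if A: "A \<in> X" for A
    proof -
      have finA: "finite A" and An: "A \<subseteq> {..<n}" using A finite_subset by (auto simp: X_def)
      have inj: "inj_on c A" using A finA by (intro eq_card_imp_inj_on) (auto simp: X_def)
      have S2: "card e = 2" if "e \<in> S" for e using that S F(1) by (auto simp: simple_graph_def)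
      have "simple_graph (induced_subgraph (colored_graph n c R S) A)"
        using simple_colored_graph[OF S2] finA by (auto simp: simple_graph_def induced_subgraph_def)
      moreover have "simple_graph (Graph {..<k} (S \<inter> EA A))" using S F by (auto simp: simple_graph_def)
      moreover have "graph_iso c (induced_subgraph (colored_graph n c R S) A) (Graph {..<k} (S \<inter> EA A))"
        unfolding graph_iso_def
      proof (intro conjI ballI)
        show "bij_betw c (verts (induced_subgraph (colored_graph n c R S) A)) (verts (Graph {..<k} (S \<inter> EA A)))"
          using inj A by (simp add: bij_betw_def induced_subgraph_def X_def)
        fix u v assume "u \<in> verts (induced_subgraph (colored_graph n c R S) A)" "v \<in> verts (induced_subgraph (colored_graph n c R S) A)"
        then have uv: "u \<in> A" "v \<in> A" by (simp_all add: induced_subgraph_def)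
        then have "{u, v} \<in> edges (induced_subgraph (colored_graph n c R S) A) \<longleftrightarrow> {c u, c v} \<in> S \<and> R u v"
          using colored_graph_edge[where R = R and u = u and n = n and v = v and c = c and S = S, OF R] An by (auto simp: induced_subgraph_def)
        also have "\<dots> \<longleftrightarrow> {c u, c v} \<in> S \<inter> EA A"
        proof
          assume "{c u, c v} \<in> S \<inter> EA A"
          then obtain i j where ij: "{c u, c v} \<in> S" "i \<in> A" "j \<in> A" "{c i, c j} = {c u, c v}" "R i j" by (auto simp: EA_def)
          then have "c i = c u \<and> c j = c v \<or> c i = c v \<and> c j = c u" by (auto simp: doubleton_eq_iff)
          then have "i = u \<and> j = v \<or> i = v \<and> j = u" using inj_onD[OF inj] ij uv by blast
          then show "{c u, c v} \<in> S \<and> R u v" using ij R by blast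
        next
          assume "{c u, c v} \<in> S \<and> R u v"
          then show "{c u, c v} \<in> S \<inter> EA A" using S uv unfolding EA_def by blast
        qed
        finally show "{u, v} \<in> edges (induced_subgraph (colored_graph n c R S) A) \<longleftrightarrow> {c u, c v} \<in> edges (Graph {..<k} (S \<inter> EA A))" by simp
      qed
      ultimately show ?thesis using iso unfolding iso_invariant_def by blast
    qed
    ultimately show ?thesis unfolding cpIndSub_def by (simp cong: sum.cong)
  qed
  have "(\<Sum>S\<in>Pow (edges F). cpIndSub \<Phi> F (colored_graph n c R S) c * (-1) ^ card S) =
     (\<Sum>S\<in>Pow (edges F). \<Sum>A\<in>X. \<Phi> (Graph {..<k} (S \<inter> EA A)) * (-1) ^ card S)"
    by (intro sum.cong refl) (simp add: cp sum_distrib_right)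
  also have "\<dots> = (\<Sum>A\<in>X. \<Sum>S\<in>Pow (edges F). \<Phi> (Graph {..<k} (S \<inter> EA A)) * (-1) ^ card S)" by (rule sum.swap)
  also have "\<dots> = (\<Sum>A\<in>X. if full_copy F c R A then ae \<Phi> F else 0)"
  proof (rule sum.cong[OF refl])
    fix A
    have fc: "full_copy F c R A \<longleftrightarrow> EA A = edges F" unfolding full_copy_def EA_def by blast
    show "(\<Sum>S\<in>Pow (edges F). \<Phi> (Graph {..<k} (S \<inter> EA A)) * (-1) ^ card S) = (if full_copy F c R A then ae \<Phi> F else 0)"
    proof (cases "full_copy F c R A")
      case True
      then have "EA A = edges F" using fc by simp
      then have "S \<inter> EA A = S" if "S \<in> Pow (edges F)" for S using that by blast
      then have "(\<Sum>S\<in>Pow (edges F). \<Phi> (Graph {..<k} (S \<inter> EA A)) * (-1) ^ card S) = ae \<Phi> F"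
        unfolding ae_def F(2) by (intro sum.cong) auto
      then show ?thesis using True by simp
    next
      case False
      then show ?thesis
        using sum_Pow_restrict_zero[OF finE, of "EA A" "\<lambda>S. \<Phi> (Graph {..<k} S)"] fc by (auto simp: EA_def)
    qed
  qed
  also have "\<dots> = ae \<Phi> F * of_nat (card {A \<in> X. full_copy F c R A})"
    using finX by (simp add: sum.If_cases Int_def)
  also have "{A \<in> X. full_copy F c R A} = {A. A \<subseteq> {..<n} \<and> card A = k \<and> c ` A = {..<k} \<and> full_copy F c R A}"
    by (auto simp: X_def)
  finally show ?thesis .
qed

lemma alternating_sum_nonzero:
  assumes "iso_invariant \<Phi>" "simple_graph F" "verts F = {..<k}" "\<And>i j. R i j \<Longrightarrow> R j i" "ae \<Phi> F \<noteq> 0"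
  shows "(\<Sum>S\<in>Pow (edges F). cpIndSub \<Phi> F (colored_graph n c R S) c * (-1) ^ card S) \<noteq> 0 \<longleftrightarrow>
     (\<exists>A. A \<subseteq> {..<n} \<and> card A = k \<and> c ` A = {..<k} \<and> full_copy F c R A)"
proof -
  define X where "X = {A. A \<subseteq> {..<n} \<and> card A = k \<and> c ` A = {..<k} \<and> full_copy F c R A}"
  have fin: "finite X" unfolding X_def by (rule finite_subset[of _ "Pow {..<n}"]) auto
  have "(\<Sum>S\<in>Pow (edges F). cpIndSub \<Phi> F (colored_graph n c R S) c * (-1) ^ card S) = ae \<Phi> F * of_nat (card X)"
    unfolding X_def by (rule alternating_sum_cpIndSub[OF assms(1-3)]) (rule assms(4))
  then have "(\<Sum>S\<in>Pow (edges F). cpIndSub \<Phi> F (colored_graph n c R S) c * (-1) ^ card S) \<noteq> 0 \<longleftrightarrow> X \<noteq> {}"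
    using assms(5) fin by simp
  then show ?thesis unfolding X_def by blast
qed

text \<open>
  A vertex of the constructed graph is a colour together with a list of literals that hits the
  clauses of the chunk \<open>\<chi> u\<close> of its colour \<open>u\<close>. The edges of the complete bipartite subgraph, which sees
  every chunk on both sides, enforce that the chosen lists are pairwise compatible.
\<close>

definition compatible :: "('l \<Rightarrow> 'l \<Rightarrow> bool) \<Rightarrow> (nat \<Rightarrow> nat) \<Rightarrow> nat \<times> 'l list \<Rightarrow> nat \<times> 'l list \<Rightarrow> bool" where
  "compatible con \<chi> x y \<longleftrightarrow> (\<chi> (fst x) = \<chi> (fst y) \<longrightarrow> snd x = snd y) \<and>
     (\<forall>l\<in>set (snd x). \<forall>l'\<in>set (snd y). \<not> con l l')"

text \<open>A conflict-free hitting set \<open>T\<close> contains a selection for every chunk, and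
  these form a copy. Conversely, \<open>T\<close> is read off one side of the complete bipartite
  graph. That side need not contain edges, so two chunks \<open>i\<close> and \<open>j\<close> are
  compared along the edge from \<open>g i\<close> to \<open>g (h + j)\<close>, after the lists at
  \<open>g j\<close> and \<open>g (h + j)\<close> have been identified.\<close>

lemma full_copy_iff:
  assumes F: "simple_graph F" "verts F = {..<k}"
    and g: "\<And>i. i < 2 * h \<Longrightarrow> g i < k" "\<And>i j. i < h \<Longrightarrow> h \<le> j \<Longrightarrow> j < 2 * h \<Longrightarrow> {g i, g j} \<in> edges F"
      "\<And>i. i < h \<Longrightarrow> \<chi> (g i) = i" "\<And>i. i < h \<Longrightarrow> \<chi> (g (h + i)) = i"
    and vs: "set vs = {(u, s). u < k \<and> s \<in> Sel (\<chi> u)}"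
    and Sel: "\<And>i s D. s \<in> Sel i \<Longrightarrow> D \<in> chunk i \<Longrightarrow> set s \<inter> D \<noteq> {}"
      "\<And>i T. hits T (\<Union>i. chunk i) \<Longrightarrow> \<exists>s\<in>Sel i. set s \<subseteq> T"
    and chunk: "\<And>i. i \<ge> h \<Longrightarrow> chunk i = {}" and con: "\<And>l l'. con l l' \<Longrightarrow> con l' l"
  shows "(\<exists>A. A \<subseteq> {..<length vs} \<and> card A = k \<and> (\<lambda>i. fst (vs ! i)) ` A = {..<k} \<and>
       full_copy F (\<lambda>i. fst (vs ! i)) (\<lambda>i j. compatible con \<chi> (vs ! i) (vs ! j)) A) \<longleftrightarrow>
     (\<exists>T. (\<forall>l\<in>T. \<forall>l'\<in>T. \<not> con l l') \<and> hits T (\<Union>i. chunk i))"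
proof
  assume "\<exists>T. (\<forall>l\<in>T. \<forall>l'\<in>T. \<not> con l l') \<and> hits T (\<Union>i. chunk i)"
  then obtain T where T: "\<And>l l'. l \<in> T \<Longrightarrow> l' \<in> T \<Longrightarrow> \<not> con l l'" "hits T (\<Union>i. chunk i)" by blast
  have "\<forall>i. \<exists>s. s \<in> Sel i \<and> set s \<subseteq> T" using Sel(2)[OF T(2)] by blast
  from choice[OF this] obtain s where "\<forall>i. s i \<in> Sel i \<and> set (s i) \<subseteq> T" ..
  then have s: "\<And>i. s i \<in> Sel i" "\<And>i. set (s i) \<subseteq> T" by simp_all
  have "\<forall>u\<in>{..<k}. \<exists>i. i < length vs \<and> vs ! i = (u, s (\<chi> u))"
  proof
    fix u assume "u \<in> {..<k}"
    then have "(u, s (\<chi> u)) \<in> set vs" unfolding vs using s(1) by simp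
    then show "\<exists>i. i < length vs \<and> vs ! i = (u, s (\<chi> u))" by (simp add: in_set_conv_nth)
  qed
  from bchoice[OF this] obtain p where "\<forall>u\<in>{..<k}. p u < length vs \<and> vs ! p u = (u, s (\<chi> u))" ..
  then have p: "\<And>u. u < k \<Longrightarrow> p u < length vs \<and> vs ! p u = (u, s (\<chi> u))" by simp
  define A where "A = p ` {..<k}"
  have inj: "inj_on p {..<k}"
  proof (rule inj_onI)
    fix x y assume xy: "x \<in> {..<k}" "y \<in> {..<k}" "p x = p y"
    have "x = fst (vs ! p x)" using p[of x] xy(1) by simp
    also have "\<dots> = fst (vs ! p y)" by (simp only: xy(3))
    also have "\<dots> = y" using p[of y] xy(2) by simp
    finally show "x = y" .
  qed
  have "A \<subseteq> {..<length vs}"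
    unfolding A_def by (rule image_subsetI) (simp add: p)
  moreover have "card A = k" unfolding A_def by (simp add: card_image[OF inj])
  moreover have "(\<lambda>i. fst (vs ! i)) ` A = {..<k}"
  proof -
    have "(\<lambda>u. fst (vs ! p u)) ` {..<k} = (\<lambda>u. u) ` {..<k}" by (rule image_cong[OF refl]) (simp add: p)
    then show ?thesis by (simp add: A_def image_image)
  qed
  moreover have "full_copy F (\<lambda>i. fst (vs ! i)) (\<lambda>i j. compatible con \<chi> (vs ! i) (vs ! j)) A"
    unfolding full_copy_def
  proof
    fix e assume e: "e \<in> edges F"
    have "e \<subseteq> {..<k}" "card e = 2" using F(1) e unfolding simple_graph_def F(2) by simp_all
    then obtain u v where uv: "e = {u, v}" "u < k" "v < k" unfolding card_2_iff by auto
    have "compatible con \<chi> (u, s (\<chi> u)) (v, s (\<chi> v))"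
      unfolding compatible_def fst_conv snd_conv
    proof (intro conjI impI ballI)
      fix l l' assume "l \<in> set (s (\<chi> u))" "l' \<in> set (s (\<chi> v))"
      then show "\<not> con l l'" using subsetD[OF s(2)] by (intro T(1))
    qed simp
    moreover have "vs ! p u = (u, s (\<chi> u))" "vs ! p v = (v, s (\<chi> v))" using p uv by simp_all
    ultimately have "{fst (vs ! p u), fst (vs ! p v)} = e \<and> compatible con \<chi> (vs ! p u) (vs ! p v)"
      by (simp only: uv(1) fst_conv)
    moreover have "p u \<in> A" "p v \<in> A" using uv by (simp_all add: A_def)
    ultimately show "\<exists>i\<in>A. \<exists>j\<in>A. {fst (vs ! i), fst (vs ! j)} = e \<and> compatible con \<chi> (vs ! i) (vs ! j)"
      by (intro bexI[of _ "p u"] bexI[of _ "p v"])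
  qed
  ultimately show "\<exists>A. A \<subseteq> {..<length vs} \<and> card A = k \<and> (\<lambda>i. fst (vs ! i)) ` A = {..<k} \<and>
       full_copy F (\<lambda>i. fst (vs ! i)) (\<lambda>i j. compatible con \<chi> (vs ! i) (vs ! j)) A"
    by (intro exI[of _ A] conjI)
next
  let ?c = "\<lambda>i. fst (vs ! i)" let ?R = "\<lambda>i j. compatible con \<chi> (vs ! i) (vs ! j)"
  assume "\<exists>A. A \<subseteq> {..<length vs} \<and> card A = k \<and> ?c ` A = {..<k} \<and> full_copy F ?c ?R A"
  then obtain A where A: "A \<subseteq> {..<length vs}" "card A = k" "?c ` A = {..<k}" "full_copy F ?c ?R A" by blast
  have finA: "finite A" using A(1) finite_subset by blast
  have inj: "inj_on ?c A" using A finA by (intro eq_card_imp_inj_on) auto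
  have "\<forall>u\<in>{..<k}. \<exists>p. p \<in> A \<and> ?c p = u"
  proof
    fix u assume "u \<in> {..<k}"
    then have "u \<in> ?c ` A" unfolding A(3) .
    then show "\<exists>p. p \<in> A \<and> ?c p = u" by blast
  qed
  from bchoice[OF this] obtain p where "\<forall>u\<in>{..<k}. p u \<in> A \<and> ?c (p u) = u" ..
  then have p: "\<And>u. u < k \<Longrightarrow> p u \<in> A \<and> ?c (p u) = u" by simp
  define s where "s u = snd (vs ! p u)" for u
  have vp: "vs ! p u = (u, s u)" if "u < k" for u using p[OF that] by (simp add: s_def prod_eq_iff)
  have sS: "s u \<in> Sel (\<chi> u)" if "u < k" for u
  proof -
    have "vs ! p u \<in> set vs" using p[OF that] A(1) by auto
    then show ?thesis unfolding vp[OF that] vs by simp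
  qed
  have edge: "compatible con \<chi> (u, s u) (v, s v) \<or> compatible con \<chi> (v, s v) (u, s u)"
    if E: "{u, v} \<in> edges F" "u < k" "v < k" for u v
  proof -
    obtain i j where ij: "i \<in> A" "j \<in> A" "{?c i, ?c j} = {u, v}" "?R i j"
      using bspec[OF A(4)[unfolded full_copy_def] E(1)] by (elim bexE conjE)
    have un: "i = p w" if w: "?c i = w" "w < k" "i \<in> A" for i w
    proof (rule inj_onD[OF inj])
      show "?c i = ?c (p w)" using p[OF w(2)] w(1) by (simp only:)
    qed (use p[OF w(2)] w(3) in \<open>simp_all only:\<close>)
    from ij(3) have "?c i = u \<and> ?c j = v \<or> ?c i = v \<and> ?c j = u" by (simp add: doubleton_eq_iff)
    then show ?thesis
    proof
      assume c: "?c i = u \<and> ?c j = v"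
      have "i = p u" "j = p v" using un[OF conjunct1[OF c] E(2) ij(1)] un[OF conjunct2[OF c] E(3) ij(2)] .
      then show ?thesis using ij(4) by (simp only: vp[OF E(2)] vp[OF E(3)] simp_thms)
    next
      assume c: "?c i = v \<and> ?c j = u"
      have "i = p v" "j = p u" using un[OF conjunct1[OF c] E(3) ij(1)] un[OF conjunct2[OF c] E(2) ij(2)] .
      then show ?thesis using ij(4) by (simp only: vp[OF E(2)] vp[OF E(3)] simp_thms)
    qed
  qed
  define T where "T = (\<Union>i<h. set (s (g i)))"
  have gk: "g i < k" "g (h + i) < k" if "i < h" for i using g(1) that by simp_all
  \<comment> \<open>Both ends of this edge carry chunk \<open>i\<close>, and compatibility then
    demands equal lists.\<close>
  have same: "s (g (h + i)) = s (g i)" if i: "i < h" for i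
  proof -
    have "{g i, g (h + i)} \<in> edges F" using g(2)[of i "h + i"] i by simp
    from edge[OF this gk[OF i]] show ?thesis using g(3,4) i by (auto simp: compatible_def)
  qed
  have "\<not> con l l'" if l: "l \<in> T" "l' \<in> T" for l l'
  proof -
    obtain i j where ij: "i < h" "j < h" "l \<in> set (s (g i))" "l' \<in> set (s (g j))" using l by (auto simp: T_def)
    \<comment> \<open>The case \<open>i = j\<close> is included and shows that a single list is
      consistent in itself.\<close>
    have "{g i, g (h + j)} \<in> edges F" using g(2)[of i "h + j"] ij by simp
    from edge[OF this] gk ij same[of j] show ?thesis using con[of l l'] by (auto simp: compatible_def)
  qed
  moreover have "hits T (\<Union>i. chunk i)"
    unfolding hits_def
  proof
    fix D assume "D \<in> (\<Union>i. chunk i)"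
    then obtain i where i: "D \<in> chunk i" by blast
    then have ih: "i < h" using chunk[of i] by (cases "i < h") auto
    have "s (g i) \<in> Sel i" using sS[OF gk(1)[OF ih]] g(3)[OF ih] by simp
    from Sel(1)[OF this i] have "set (s (g i)) \<inter> D \<noteq> {}" .
    then show "T \<inter> D \<noteq> {}" using ih unfolding T_def by blast
  qed
  ultimately show "\<exists>T. (\<forall>l\<in>T. \<forall>l'\<in>T. \<not> con l l') \<and> hits T (\<Union>i. chunk i)" by blast
qed

section \<open>Binary arithmetic and parsing\<close>

lemma pt_lift2: "pt (\<lambda>p. foo (fst p) (snd p)) \<Longrightarrow> pt f \<Longrightarrow> pt g \<Longrightarrow> pt (\<lambda>x. foo (f x) (g x))"
  using pt_comp[OF pt_pair[of f g], of "\<lambda>p. foo (fst p) (snd p)"] by simp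

lemma pt_lift3: "pt (\<lambda>p. foo (fst p) (fst (snd p)) (snd (snd p))) \<Longrightarrow> pt f \<Longrightarrow> pt g \<Longrightarrow> pt h \<Longrightarrow>
    pt (\<lambda>x. foo (f x) (g x) (h x))"
  using pt_comp[OF pt_pair[OF _ pt_pair, of f g h], of "\<lambda>p. foo (fst p) (fst (snd p)) (snd (snd p))"] by simp

lemma pt_zip: assumes "pt f" "pt g" shows "pt (\<lambda>x. zip (f x) (g x))"
proof -
  define st where "st p x = (case fst p of [] \<Rightarrow> p | y # ys \<Rightarrow> (ys, (x, y) # snd p))"
    for p :: "'c list \<times> ('b \<times> 'c) list" and x
  have r: "rev (snd (foldl st (ys, acc) xs)) = rev acc @ zip xs ys" for xs ys acc
  proof (induction xs arbitrary: ys acc)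
    case (Cons a xs)
    have "foldl st ([], acc) xs = ([], acc)" for xs by (induction xs) (auto simp: st_def)
    then show ?case using Cons by (cases ys) (auto simp: st_def)
  qed simp
  have "es (st p y) \<le> es p + (es x + es y + 2)" for p y and x :: 'a
    by (cases p; cases "fst p") (auto simp: st_def)
  then have "pt (\<lambda>x. foldl (\<lambda>p y. st p y) (g x, []) (f x))"
    by (intro pt_foldl_add[where q = "\<lambda>n. n + 2"] assms pt_pair pt_const PB_intros)
       (auto simp: st_def intro!: pt_intros)
  from pt_rev[OF pt_snd[OF this]] show ?thesis by (simp add: r)
qed

text \<open>Least significant bit first, as in \<open>bin\<close>; any symbol other than 2 counts as
  zero.\<close>

fun bval :: "nat list \<Rightarrow> nat" where
  "bval [] = 0"
| "bval (b # w) = (if b = 2 then 1 else 0) + 2 * bval w"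

lemma bin_double: "bin (2 * n + (if b then 1 else 0)) = (if n = 0 \<and> \<not> b then [] else enc_bit b # bin n)"
  by (subst bin.simps) auto

lemma bin_0 [simp]: "bin 0 = []" by (simp add: bin.simps)

lemma bval_bin [simp]: "bval (bin n) = n"
proof (induction n rule: less_induct)
  case (less n)
  show ?case
  proof (cases "n = 0")
    case False
    then show ?thesis using less[of "n div 2"] by (subst bin.simps) (auto simp: enc_bit_def; presburger)
  qed simp
qed

lemma bin_inj: "bin m = bin n \<Longrightarrow> m = n"
  by (metis bval_bin)

lemma bin_symbols: "set (bin n) \<subseteq> {1, 2}"
proof (induction n rule: less_induct)
  case (less n)
  then show ?case by (subst bin.simps) (auto simp: enc_bit_def)
qed

lemma length_bin: "n < 2 ^ m \<Longrightarrow> length (bin n) \<le> m"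
proof (induction m arbitrary: n)
  case (Suc m)
  show ?case
  proof (cases "n = 0")
    case False
    then show ?thesis using Suc.IH[of "n div 2"] Suc.prems by (subst bin.simps) auto
  qed simp
qed simp

lemma bval_less: "bval w < 2 ^ length w"
  by (induction w) auto

text \<open>Strips zeros at the most significant end. Numbers then have unique words, and equality
  of numbers is equality of words.\<close>

definition norm_bits :: "nat list \<Rightarrow> nat list" where
  "norm_bits w = foldl (\<lambda>acc b. if acc = [] \<and> b \<noteq> 2 then [] else (if b = 2 then 2 else 1) # acc) [] (rev w)"

lemma norm_bits: "norm_bits w = bin (bval w)"
proof (induction w)
  case (Cons b w)
  have e: "bval (b # w) = 2 * bval w + (if b = 2 then 1 else 0)" by simp
  have z: "bin (bval w) = [] \<longleftrightarrow> bval w = 0" by (metis bin_0 bin_inj)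
  show ?case using Cons unfolding e norm_bits_def bin_double by (auto simp: z enc_bit_def)
qed (simp add: norm_bits_def)

fun ripple :: "nat \<Rightarrow> bool \<Rightarrow> nat list \<Rightarrow> nat list \<Rightarrow> nat list" where
  "ripple 0 c u v = []"
| "ripple (Suc n) c u v =
    (let a = take 1 u = [2]; b = take 1 v = [2]
     in (if (a \<noteq> b) \<noteq> c then 2 else 1) # ripple n (if a = b then a else c) (tl u) (tl v))"

lemma bval_take: "bval u = (if take 1 u = [2] then 1 else 0) + 2 * bval (tl u)"
  by (cases u) auto

text \<open>One round more than the length of the longer word, so that the last carry is not
  lost.\<close>

lemma bval_ripple:
  "length u < n \<Longrightarrow> length v < n \<Longrightarrow> bval (ripple n c u v) = (if c then 1 else 0) + bval u + bval v"
proof (induction n arbitrary: c u v)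
  case (Suc n)
  show ?case
  proof (cases n)
    case 0
    then show ?thesis using Suc.prems by (auto simp: Let_def)
  next
    case (Suc m)
    then have "length (tl u) < n" "length (tl v) < n" using Suc.prems by auto
    note IH = Suc.IH[OF this]
    show ?thesis by (simp add: Let_def IH bval_take[of u] bval_take[of v])
  qed
qed simp

definition ripple_step :: "bool \<times> nat list \<times> nat list \<times> nat list \<Rightarrow> bool \<times> nat list \<times> nat list \<times> nat list" where
  "ripple_step s =
     ((if (take 1 (fst (snd s)) = [2]) = (take 1 (fst (snd (snd s))) = [2]) then take 1 (fst (snd s)) = [2] else fst s),
      tl (fst (snd s)), tl (fst (snd (snd s))),
      (if ((take 1 (fst (snd s)) = [2]) \<noteq> (take 1 (fst (snd (snd s))) = [2])) \<noteq> fst s then 2 else 1) # snd (snd (snd s)))"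

lemma foldl_ripple:
  "snd (snd (snd (foldl (\<lambda>s _. ripple_step s) (c, u, v, acc) (us :: unit list)))) = rev (ripple (length us) c u v) @ acc"
  by (induction us arbitrary: c u v acc) (simp_all add: ripple_step_def Let_def)

text \<open>Specified by values, but computed bit by bit: the detour through \<open>bval\<close>
  would produce unary numbers of exponential size.\<close>

definition addw :: "nat list \<Rightarrow> nat list \<Rightarrow> nat list" where
  "addw u v = bin (bval u + bval v)"

lemma pt_norm_bits: "pt (\<lambda>w. norm_bits w)"
  unfolding norm_bits_def
  by (rule pt_foldl_add[where q = "\<lambda>n. n + 6"]) (auto intro!: pt_intros PB_intros')

lemma pt_addw0: "pt (\<lambda>p. addw (fst p) (snd p))"
proof -
  have s: "es (ripple_step s) \<le> es s + (es x + es y + 10)" for s and x :: "nat list \<times> nat list" and y :: unit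
  proof -
    obtain c u v acc where s: "s = (c, u, v, acc)" by (cases s) auto
    define c' where "c' = (if (take 1 u = [2]) = (take 1 v = [2]) then take 1 u = [2] else c)"
    define b :: nat where "b = (if ((take 1 u = [2]) \<noteq> (take 1 v = [2])) \<noteq> c then 2 else 1)"
    have "ripple_step s = (c', tl u, tl v, b # acc)" by (simp add: ripple_step_def s c'_def b_def)
    moreover have "es c' \<le> 3" "es b \<le> 5" by (rule es_bool) (simp add: b_def)
    ultimately show ?thesis using es_tl[of u] es_tl[of v] sz_pos[of "enc c"] by (simp add: s)
  qed
  have st: "pt (\<lambda>s. ripple_step s)" unfolding ripple_step_def by (intro pt_intros)
  have "pt (\<lambda>p. foldl (\<lambda>s _. ripple_step s) (False, fst p, snd p, []) (replicate (length (fst p) + length (snd p) + 1) ()))"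
    by (rule pt_foldl_add[where q = "\<lambda>n. n + 10"])
       (intro pt_intros pt_units, intro pt_intros, intro pt_comp[OF _ st] pt_intros, intro PB_intros, rule s)
  from pt_comp[OF pt_rev[OF pt_snd[OF pt_snd[OF pt_snd[OF this]]]] pt_norm_bits]
  show ?thesis by (simp add: foldl_ripple norm_bits addw_def bval_ripple del: replicate_Suc ripple.simps)
qed

lemmas pt_addw = pt_lift2[OF pt_addw0]

definition mulw :: "nat list \<Rightarrow> nat list \<Rightarrow> nat list" where
  "mulw u v = bin (bval u * bval v)"

lemma es_bits: "set w \<subseteq> {1, 2 :: nat} \<Longrightarrow> es w \<le> 1 + length w * 6"
  using es_le[of w 5] by fastforce

lemma es_bin: "n < 2 ^ m \<Longrightarrow> es (bin n) \<le> 1 + m * 6"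
  using es_bits[OF bin_symbols, of n] length_bin[of n m] by (simp add: order_trans)

text \<open>Horner's scheme from the most significant bit. The partial results are bounded through
  their values, which are below 2 to the sum of the two lengths.\<close>

lemma pt_mulw0: "pt (\<lambda>p. mulw (fst p) (snd p))"
proof -
  define st where "st v acc b = addw (addw acc acc) (if b = 2 then v else [])" for v acc and b :: nat
  have r: "foldl (st v) [] ys = bin (bval (rev ys) * bval v)" for v ys
  proof (induction ys rule: rev_induct)
    case (snoc b ys)
    have "st v (bin (bval (rev ys) * bval v)) b = bin (bval (b # rev ys) * bval v)"
      unfolding st_def addw_def bval_bin by (rule arg_cong[of _ _ bin]) (auto simp: algebra_simps)
    then show ?case using snoc by simp
  qed simp
  have b: "es (foldl (st (snd p)) [] ys) \<le> 1 + (es p + es ys) * 6" for p :: "nat list \<times> nat list" and ys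
  proof -
    have "bval (rev ys) * bval (snd p) < 2 ^ length ys * 2 ^ length (snd p)"
      using bval_less[of "rev ys"] bval_less[of "snd p"] by (intro mult_strict_mono) auto
    then have "es (bin (bval (rev ys) * bval (snd p))) \<le> 1 + (length ys + length (snd p)) * 6"
      by (intro es_bin) (simp add: power_add)
    moreover have "length ys \<le> es ys" "length (snd p) \<le> es p"
      using length_le_es[of ys] length_le_es[of "snd p"] by (auto simp: enc_prod_def)
    ultimately show ?thesis unfolding r by simp
  qed
  have pst: "pt (\<lambda>p :: (nat list \<times> nat list) \<times> nat list \<times> nat. st (snd (fst p)) (fst (snd p)) (snd (snd p)))"
    unfolding st_def by (intro pt_intros pt_addw)
  have "pt (\<lambda>p. foldl (\<lambda>acc b. st (snd p) acc b) [] (rev (fst p)))"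
    by (rule pt_foldl[where q = "\<lambda>n. 1 + n * 6"])
       (intro pt_intros, intro pt_intros, rule pst, intro PB_intros, rule b)
  then show ?thesis by (simp add: r mulw_def)
qed

lemmas pt_mulw = pt_lift2[OF pt_mulw0]

definition length_bin_word :: "'a list \<Rightarrow> nat list" where
  "length_bin_word xs = bin (length xs)"

lemma pt_length_bin_word0: "pt (\<lambda>xs :: 'a::enc list. length_bin_word xs)"
proof -
  have r: "foldl (\<lambda>w _. addw w [2]) [] xs = bin (length xs)" for xs :: "'a list"
    by (induction xs rule: rev_induct) (auto simp: addw_def)
  have b: "es (foldl (\<lambda>w _. addw w [2]) [] ys) \<le> 1 + (es x + es ys) * 6" for x ys :: "'a list"
  proof -
    have "es (bin (length ys)) \<le> 1 + length ys * 6" by (rule es_bin) (rule less_exp)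
    then show ?thesis unfolding r using length_le_es[of ys] by simp
  qed
  have "pt (\<lambda>x :: 'a list. foldl (\<lambda>w _. addw w [2]) [] x)"
  proof (rule pt_foldl[where q = "\<lambda>n. 1 + n * 6"])
    show "pt (\<lambda>p :: 'a list \<times> nat list \<times> 'a. addw (fst (snd p)) [2])" by (intro pt_addw pt_intros)
  qed (rule pt_id, rule pt_const, intro PB_intros, rule b)
  then show ?thesis by (simp add: r length_bin_word_def)
qed

lemmas pt_length_bin_word = pt_comp[OF _ pt_length_bin_word0]

definition split3 :: "nat list \<Rightarrow> nat list list" where
  "split3 s = rev (fst (foldl (\<lambda>p y. if y = 3 then (rev (snd p) # fst p, []) else (fst p, y # snd p)) ([], []) s))"

lemma pt_split3_0: "pt (\<lambda>s. split3 s)"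
proof -
  have b: "es (if y = 3 then (rev (snd p) # fst p, []) else (fst p, y # snd p)) \<le> es p + (es x + es y + 5)"
    for p :: "nat list list \<times> nat list" and y :: nat and x :: "nat list"
    by (cases p) auto
  show ?thesis unfolding split3_def
    by (intro pt_rev pt_fst, rule pt_foldl_add[where q = "\<lambda>n. n + 5"]) (auto intro!: pt_intros PB_intros' b)
qed

lemmas pt_split3 = pt_comp[OF _ pt_split3_0]

lemma split3_word:
  assumes "3 \<notin> set w"
  shows "split3 (w @ 3 # s) = w # split3 s"
proof -
  let ?st = "\<lambda>p y. if y = 3 then (rev (snd p) # fst p, []) else (fst p, y # snd p)"
  have 1: "foldl ?st (ws, c) w = (ws, rev w @ c)" if "3 \<notin> set w" for w ws and c :: "nat list"
    using that by (induction w arbitrary: c) auto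
  have 2: "foldl ?st (ws @ xs, c) s = (fst (foldl ?st (ws, c) s) @ xs, snd (foldl ?st (ws, c) s))" for ws xs c s
    by (induction s arbitrary: ws c) (auto split: if_splits, metis Cons_eq_appendI)
  have "foldl ?st ([], []) (w @ 3 # s) = foldl ?st ([] @ [w], []) s" using 1[OF assms, of "[]" "[]"] by simp
  then show ?thesis unfolding split3_def 2 by simp
qed

lemma split3_Nil [simp]: "split3 [] = []"
  by (simp add: split3_def)

section \<open>Formulas, graphs and queries as words\<close>

definition dedup :: "'a list \<Rightarrow> 'a list" where
  "dedup xs = foldl (\<lambda>acc y. if y \<in> set acc then acc else y # acc) [] xs"

lemma dedup: "set (dedup xs) = set xs" "distinct (dedup xs)" "length (dedup xs) \<le> length xs"
proof -
  have "set (foldl (\<lambda>acc y. if y \<in> set acc then acc else y # acc) acc xs) = set acc \<union> set xs \<and>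
     (distinct acc \<longrightarrow> distinct (foldl (\<lambda>acc y. if y \<in> set acc then acc else y # acc) acc xs)) \<and>
     length (foldl (\<lambda>acc y. if y \<in> set acc then acc else y # acc) acc xs) \<le> length acc + length xs" for acc
  proof (induction xs arbitrary: acc)
    case (Cons a xs)
    show ?case using Cons[of "if a \<in> set acc then acc else a # acc"] by (cases "a \<in> set acc") auto
  qed simp
  from this[of "[]"] show "set (dedup xs) = set xs" "distinct (dedup xs)" "length (dedup xs) \<le> length xs"
    by (auto simp: dedup_def)
qed

lemma pt_dedup0: "pt (\<lambda>xs :: 'a::enc list. dedup xs)"
  unfolding dedup_def
  by (rule pt_foldl_add[where q = "\<lambda>n. n + 1"]) (auto intro!: pt_intros PB_intros')

lemmas pt_dedup = pt_comp[OF _ pt_dedup0]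

text \<open>The first symbol of a literal is its sign, the rest its variable.\<close>

definition conflict :: "nat list \<Rightarrow> nat list \<Rightarrow> bool" where
  "conflict l l' \<longleftrightarrow> tl l = tl l' \<and> l \<noteq> l'"

text \<open>A clause ends with an extra delimiter, which \<open>split3\<close> turns into an empty
  word; a literal is never empty.\<close>

definition parse_clauses :: "nat list \<Rightarrow> nat list list list" where
  "parse_clauses s = fst (foldl (\<lambda>p w. if w = [] then (snd p # fst p, []) else (fst p, w # snd p)) ([], []) (split3 s))"

definition initial_formula :: "nat list list list \<Rightarrow> nat list list list" where
  "initial_formula cs = foldl (\<lambda>\<psi> c. add_list c \<psi>) [] (map (\<lambda>c. dedup c) cs)"

text \<open>Iterated from \<open>[[]]\<close> it lists all ternary words of a given length. They
  serve both as choices among the at most three literals of each clause and as a clock of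
  \<open>3 ^ n\<close> ticks.\<close>

definition expand :: "nat list list \<Rightarrow> nat list list" where
  "expand W = concat (map (\<lambda>w. [0 # w, 1 # w, 2 # w]) W)"

text \<open>A digit beyond the end of a short clause selects nothing; \<open>selections\<close>
  discards such a choice unless the clause is hit by another literal.\<close>

definition choose_lits :: "nat list list list \<Rightarrow> nat list \<Rightarrow> nat list list" where
  "choose_lits ch w = concat (map (\<lambda>x. take 1 (drop (snd x) (fst x))) (zip ch w))"

definition selections :: "nat list list list \<Rightarrow> nat list list \<Rightarrow> nat list list list" where
  "selections ch W = filter (\<lambda>s. \<forall>c\<in>set ch. \<exists>l\<in>set c. l \<in> set s) (map (\<lambda>w. choose_lits ch w) W)"

definition chunk :: "nat \<Rightarrow> nat list list list \<Rightarrow> nat \<Rightarrow> nat list list list" where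
  "chunk L \<psi> i = take L (drop (i * L) \<psi>)"

text \<open>The colour, as the word with which it is output, the index of its chunk, and the chosen
  literals.\<close>

type_synonym gvertex = "nat list \<times> nat \<times> nat list list"

definition gverts :: "(nat list \<times> nat) list \<Rightarrow> nat \<Rightarrow> nat list list \<Rightarrow> nat list list list \<Rightarrow> gvertex list" where
  "gverts cols L W \<psi> = concat (map (\<lambda>x. map (\<lambda>s. (fst x, snd x, s)) (selections (chunk L \<psi> (snd x)) W)) cols)"

definition adjw :: "(nat list \<times> nat list) list \<Rightarrow> gvertex \<Rightarrow> gvertex \<Rightarrow> bool" where
  "adjw S x y \<longleftrightarrow> (fst x, fst y) \<in> set S \<and> (fst (snd x) = fst (snd y) \<longrightarrow> snd (snd x) = snd (snd y)) \<and>
     (\<forall>l\<in>set (snd (snd x)). \<forall>l'\<in>set (snd (snd y)). \<not> conflict l l')"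

definition query :: "nat list \<Rightarrow> (nat list \<times> nat list) list \<Rightarrow> gvertex list \<Rightarrow> nat list" where
  "query encF S vs = encF @ ((length_bin_word vs @ [3]) @
     concat (map (\<lambda>x. map (\<lambda>y. if adjw S x y then 2 else 1) vs) vs)) @ concat (map (\<lambda>x. fst x) vs)"

type_synonym tagged = "(bool \<times> bool) \<times> nat list"
type_synonym subset_list = "(bool \<times> bool \<times> (nat list \<times> nat list) list) list"

text \<open>Queries are stored reversed, the form in which \<open>cr_simulation\<close> takes its
  input.\<close>

definition items :: "subset_list \<Rightarrow> nat list \<Rightarrow> gvertex list \<Rightarrow> tagged list" where
  "items Ss encF vs = map (\<lambda>x. ((fst x, fst (snd x)), rev (query encF (snd (snd x)) vs))) Ss"

section \<open>Polynomial time of the building blocks\<close>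

lemma pt_conflict0: "pt (\<lambda>p. conflict (fst p) (snd p))"
  unfolding conflict_def by (intro pt_intros)

lemmas pt_conflict' = pt_lift2[OF pt_conflict0]

lemma pt_add_list0: "pt (\<lambda>p :: 'l::enc list \<times> 'l list list. add_list (fst p) (snd p))"
  unfolding add_list_def subset_code(1) by (intro pt_intros)

lemmas pt_add_list = pt_lift2[OF pt_add_list0]

lemma es_filter: "es (filter P xs) \<le> es xs"
  by (induction xs) auto

lemma es_add_list: "es (add_list c \<phi>) \<le> es \<phi> + es c + 1"
  using es_filter[of _ \<phi>] by (auto simp: add_list_def)

lemma pt_flower_list0: "pt (\<lambda>p :: 'l::enc list \<times> nat \<times> 'l list list. flower_list (fst p) (fst (snd p)) (snd (snd p)))"
  unfolding flower_list_def subset_code(1) by (intro pt_intros)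

lemmas pt_flower_list = pt_lift3[OF pt_flower_list0]

lemma pt_petal_branch0: "pt (\<lambda>p :: 'l::enc list \<times> nat \<times> 'l list list. petal_branch (fst p) (fst (snd p)) (snd (snd p)))"
  unfolding petal_branch_def
proof (rule pt_foldl_add[where q = "\<lambda>n. n + 1"])
  show "es (add_list y s) \<le> es s + (es x + es y + 1)" for x :: "'l list \<times> nat \<times> 'l list list" and s and y :: "'l list"
    using es_add_list[of y s] by simp
qed (intro pt_intros pt_flower_list pt_add_list PB_intros)+

lemmas pt_petal_branch = pt_lift3[OF pt_petal_branch0]

lemma pt_candidates0: "pt (\<lambda>p :: nat \<times> 'l::enc list. candidates (fst p) (snd p))"
  unfolding candidates_def by (intro pt_intros)

lemmas pt_candidates = pt_lift2[OF pt_candidates0]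

lemma pt_good_hearts0: "pt (\<lambda>p :: nat \<times> 'l::enc list \<times> 'l list list. good_hearts (fst p) (fst (snd p)) (snd (snd p)))"
  unfolding good_hearts_def by (intro pt_intros pt_candidates pt_flower_list)

lemmas pt_good_hearts = pt_lift3[OF pt_good_hearts0]

lemma pt_split_step0: "pt (\<lambda>p :: nat \<times> 'l::enc list \<times> ('l list list list \<times> 'l list list list).
    split_step (fst p) (fst (snd p)) (snd (snd p)))"
  unfolding split_step_def by (intro pt_intros pt_good_hearts pt_add_list pt_petal_branch)

lemmas pt_split_step = pt_lift3[OF pt_split_step0]

lemma pt_parse_clauses0: "pt (\<lambda>s. parse_clauses s)"
proof -
  have b: "es (if w = [] then (snd p # fst p, []) else (fst p, w # snd p)) \<le> es p + (es x + es w + 5)"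
    for p :: "nat list list list \<times> nat list list" and w :: "nat list" and x :: "nat list"
    by (cases p) auto
  show ?thesis unfolding parse_clauses_def
    by (intro pt_fst, rule pt_foldl_add[where q = "\<lambda>n. n + 5"])
       (intro pt_split3 pt_id, intro pt_intros, intro pt_intros, intro PB_intros, rule b)
qed

lemmas pt_parse_clauses = pt_comp[OF _ pt_parse_clauses0]

lemma pt_initial_formula0: "pt (\<lambda>cs. initial_formula cs)"
  unfolding initial_formula_def
proof (rule pt_foldl_add[where q = "\<lambda>n. n + 1"])
  show "es (add_list y s) \<le> es s + (es x + es y + 1)" for x :: "nat list list list" and s and y :: "nat list list"
    using es_add_list[of y s] by simp
qed (intro pt_intros pt_dedup pt_add_list PB_intros)+

lemmas pt_initial_formula = pt_comp[OF _ pt_initial_formula0]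

lemma pt_expand0: "pt (\<lambda>W. expand W)"
  unfolding expand_def by (intro pt_intros)

lemmas pt_expand = pt_comp[OF _ pt_expand0]

lemma pt_choose_lits0: "pt (\<lambda>p. choose_lits (fst p) (snd p))"
  unfolding choose_lits_def by (intro pt_intros pt_zip)

lemmas pt_choose_lits = pt_lift2[OF pt_choose_lits0]

lemma pt_selections0: "pt (\<lambda>p. selections (fst p) (snd p))"
  unfolding selections_def by (intro pt_intros pt_choose_lits)

lemmas pt_selections = pt_lift2[OF pt_selections0]

lemma pt_gverts0: "pt (\<lambda>p. gverts (fst p) (fst (snd p)) (fst (snd (snd p))) (snd (snd (snd p))))"
  unfolding gverts_def chunk_def by (intro pt_intros pt_selections)

lemma pt_gverts: "pt a \<Longrightarrow> pt b \<Longrightarrow> pt c \<Longrightarrow> pt d \<Longrightarrow> pt (\<lambda>x. gverts (a x) (b x) (c x) (d x))"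
  using pt_comp[OF pt_pair[OF _ pt_pair[OF _ pt_pair]] pt_gverts0, of a b c d] by simp

lemma pt_adjw0: "pt (\<lambda>p. adjw (fst p) (fst (snd p)) (snd (snd p)))"
  unfolding adjw_def by (intro pt_intros pt_conflict')

lemmas pt_adjw = pt_lift3[OF pt_adjw0]

lemma pt_query0: "pt (\<lambda>p. query (fst p) (fst (snd p)) (snd (snd p)))"
  unfolding query_def by (intro pt_intros pt_adjw pt_length_bin_word)

lemmas pt_query = pt_lift3[OF pt_query0]

lemma pt_items0: "pt (\<lambda>p. items (fst p) (fst (snd p)) (snd (snd p)))"
  unfolding items_def by (intro pt_intros pt_query)

lemmas pt_items = pt_lift3[OF pt_items0]

type_synonym acc = "bool \<times> nat list \<times> nat list \<times> nat list"

text \<open>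
  The partial sum of the current group is \<open>(A - B) / D\<close> in binary; the first bit of a tag marks the
  last term of a group, the second one a term that is to be subtracted.
\<close>

definition acc_numbers :: "nat list \<times> nat list \<times> nat list \<Rightarrow> bool \<Rightarrow> nat list \<Rightarrow> nat list \<Rightarrow> nat list \<times> nat list \<times> nat list" where
  "acc_numbers s neg p q =
     (addw (mulw (fst s) q) (if neg then [] else mulw (snd (snd s)) p),
      addw (mulw (fst (snd s)) q) (if neg then mulw (snd (snd s)) p else []),
      mulw (snd (snd s)) q)"

definition word_at :: "nat \<Rightarrow> nat list \<Rightarrow> nat list" where
  "word_at i v = concat (take 1 (drop i (split3 v)))"

text \<open>The two words of an encoded rational are numerator and denominator, each preceded by a
  sign bit. The sign of the numerator is combined with that of the tag; the denominator is positive,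
  so its sign bit is dropped.\<close>

definition acc_next :: "nat list \<times> nat list \<times> nat list \<Rightarrow> tagged \<Rightarrow> nat list \<times> nat list \<times> nat list" where
  "acc_next s x = acc_numbers s ((take 1 (word_at 0 (rev (snd x))) = [2]) \<noteq> snd (fst x))
     (tl (word_at 0 (rev (snd x)))) (tl (word_at 1 (rev (snd x))))"

text \<open>The implication is a disjunction: some earlier group, or the present one, has a nonzero
  sum, tested as inequality of \<open>A\<close> and \<open>B\<close>. After a group the sum restarts
  as \<open>(0 - 0) / 1\<close>.\<close>

definition acc_step :: "acc \<Rightarrow> tagged \<Rightarrow> acc" where
  "acc_step st x = (if fst (fst x)
     then ((\<not> fst st \<longrightarrow> fst (acc_next (snd st) x) \<noteq> fst (snd (acc_next (snd st) x))), [], [], [2])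
     else (fst st, acc_next (snd st) x))"

definition final_answer :: "tagged list \<Rightarrow> bool" where
  "final_answer outs = fst (foldl (\<lambda>st x. acc_step st x) (False, [], [], [2]) (rev outs))"

lemma length_split3: "length (concat (split3 v)) \<le> length v"
proof -
  let ?st = "\<lambda>p y. if y = 3 then (rev (snd p) # fst p, []) else (fst p, y # snd p)"
  have "length (concat (fst (foldl ?st (ws, c) v))) \<le> length (concat ws) + length c + length v" for ws and c :: "nat list"
  proof (induction v arbitrary: ws c)
    case (Cons a v)
    show ?case using Cons[of "rev c # ws" "[]"] Cons[of ws "a # c"] by auto
  qed simp
  from this[of "[]" "[]"] have "length (concat (fst (foldl ?st ([], []) v))) \<le> length v" by simp
  moreover have "length (concat (rev xss)) = length (concat xss)" for xss :: "nat list list"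
    by (induction xss) auto
  ultimately show ?thesis by (simp add: split3_def)
qed

lemma length_word_at: "length (word_at i v) \<le> length v"
proof -
  have "length (concat (take 1 (drop i xss))) \<le> length (concat xss)" for xss :: "nat list list"
  proof (induction xss arbitrary: i)
    case (Cons a xss)
    show ?case using Cons[of "i - 1"] by (cases i) auto
  qed simp
  then show ?thesis unfolding word_at_def using length_split3 order_trans by blast
qed

definition bounded_triple :: "nat \<Rightarrow> nat list \<times> nat list \<times> nat list \<Rightarrow> bool" where
  "bounded_triple m s \<longleftrightarrow> (\<exists>a b d. s = (bin a, bin b, bin d) \<and> a < 2 ^ m \<and> b < 2 ^ m \<and> d < 2 ^ m)"

text \<open>Fractions are never reduced. An answer of length \<open>n\<close> adds at most
  \<open>n\<close> bits by multiplication and one by addition, so the bit lengths remain linear in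
  the total size of the answers.\<close>

lemma bounded_acc_next:
  assumes "bounded_triple m s" "length (snd x) \<le> n"
  shows "bounded_triple (Suc (m + n)) (acc_next s x)"
proof -
  obtain a b d where s: "s = (bin a, bin b, bin d)" "a < 2 ^ m" "b < 2 ^ m" "d < 2 ^ m"
    using assms(1) by (auto simp: bounded_triple_def)
  define p q where "p = bval (tl (word_at 0 (rev (snd x))))" and "q = bval (tl (word_at 1 (rev (snd x))))"
  have "bval (tl (word_at i (rev (snd x)))) < 2 ^ n" for i
  proof -
    have "length (tl (word_at i (rev (snd x)))) \<le> n" using length_word_at[of i "rev (snd x)"] assms(2) by simp
    then have "(2::nat) ^ length (tl (word_at i (rev (snd x)))) \<le> 2 ^ n" by (intro power_increasing) auto
    then show ?thesis using bval_less[of "tl (word_at i (rev (snd x)))"] by linarith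
  qed
  then have pq: "p < 2 ^ n" "q < 2 ^ n" by (simp_all add: p_def q_def)
  have pr: "y * z < 2 ^ (m + n)" if "y < 2 ^ m" "z < 2 ^ n" for y z :: nat
    unfolding power_add using that by (intro mult_strict_mono) auto
  have sm: "y + z < 2 ^ Suc (m + n)" if "y < 2 ^ (m + n)" "z < 2 ^ (m + n)" for y z :: nat
    using that by simp
  have z: "(0::nat) < 2 ^ (m + n)" by simp
  show ?thesis
    unfolding acc_next_def acc_numbers_def s addw_def mulw_def bounded_triple_def fst_conv snd_conv bval_bin
      p_def[symmetric] q_def[symmetric]
    by (intro exI conjI, rule refl)
       (use pr[OF s(2) pq(2)] pr[OF s(3) pq(2)] pr[OF s(4) pq(1)] pr[OF s(4) pq(2)] in auto)
qed

lemma bin_Suc_0 [simp]: "bin (Suc 0) = [2]"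
  by (subst bin.simps) (simp add: enc_bit_def)

lemma bounded_foldl_acc_step:
  "bounded_triple (Suc (es ys)) (snd (foldl (\<lambda>st x. acc_step st x) (False, [], [], [2]) ys))"
proof (induction ys rule: rev_induct)
  case Nil
  have "bounded_triple 2 ([], [], [2])" unfolding bounded_triple_def
    by (rule exI[of _ 0], rule exI[of _ 0], rule exI[of _ 1]) simp
  then show ?case by (simp add: eval_nat_numeral)
next
  case (snoc y ys)
  have "es (ys @ [y]) = es ys + es y + 1" using es_append[of ys "[y]"] by simp
  moreover have "length (snd y) \<le> es y" using length_le_es[of "snd y"] by (simp add: enc_prod_def)
  from bounded_acc_next[OF snoc this]
  have "bounded_triple (Suc (Suc (es ys) + es y)) (acc_next (snd (foldl (\<lambda>st x. acc_step st x) (False, [], [], [2]) ys)) y)" .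
  moreover have "bounded_triple (Suc (Suc (es ys) + es y)) ([], [], [2])"
  proof -
    have h: "(1::nat) < 2 ^ Suc (Suc (es ys) + es y)" by (rule one_less_power) simp_all
    show ?thesis unfolding bounded_triple_def
      by (rule exI[of _ 0], rule exI[of _ 0], rule exI[of _ "1::nat"]) (simp only: bin_0 bin_Suc_0[folded One_nat_def] zero_less_power pos2 h simp_thms)
  qed
  ultimately show ?case by (simp add: acc_step_def)
qed

lemma es_bounded_triple:
  assumes "bounded_triple m s" shows "es s \<le> 5 + 18 * m"
proof -
  obtain a b d where s: "s = (bin a, bin b, bin d)" "a < 2 ^ m" "b < 2 ^ m" "d < 2 ^ m"
    using assms by (auto simp: bounded_triple_def)
  then show ?thesis using es_bin[OF s(2)] es_bin[OF s(3)] es_bin[OF s(4)] by simp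
qed

lemma pt_word_at: "pt f \<Longrightarrow> pt (\<lambda>x. word_at i (f x))"
  unfolding word_at_def by (intro pt_intros pt_split3)

lemma pt_acc_next0: "pt (\<lambda>p. acc_next (fst p) (snd p))"
  unfolding acc_next_def acc_numbers_def by (intro pt_intros pt_word_at pt_addw pt_mulw)

lemmas pt_acc_next = pt_lift2[OF pt_acc_next0]

lemma pt_final_answer0: "pt (\<lambda>outs. final_answer outs)"
  unfolding final_answer_def
proof (intro pt_fst, rule pt_foldl[where q = "\<lambda>n. 27 + 18 * n"])
  show "pt (\<lambda>p :: tagged list \<times> acc \<times> tagged. acc_step (fst (snd p)) (snd (snd p)))"
    unfolding acc_step_def by (intro pt_intros pt_acc_next)
  fix x ys :: "tagged list"
  let ?s = "foldl (\<lambda>st x. acc_step st x) (False, [], [], [2]) ys"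
  have "es ?s = 1 + es (fst ?s) + es (snd ?s)" by (simp add: enc_prod_def)
  also have "\<dots> \<le> 1 + 3 + (5 + 18 * Suc (es ys))"
    using es_bool[of "fst ?s"] es_bounded_triple[OF bounded_foldl_acc_step[of ys]] by linarith
  finally show "es ?s \<le> 27 + 18 * (es x + es ys)" by simp
qed (intro pt_intros PB_intros)+

section \<open>Correctness of parsing, selecting, querying and summing\<close>

definition lit_word :: "bool \<times> nat \<Rightarrow> nat list" where
  "lit_word l = enc_bit (fst l) # bin (snd l)"

lemma lit_word_no3: "3 \<notin> set (lit_word l)"
  using bin_symbols[of "snd l"] by (auto simp: lit_word_def enc_bit_def)

lemma lit_word_ne [simp]: "lit_word l \<noteq> []" "[] \<noteq> lit_word l"
  by (simp_all add: lit_word_def)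

lemma lit_word_inj: "lit_word l = lit_word l' \<longleftrightarrow> l = l'"
  using bin_inj[of "snd l" "snd l'"] by (auto simp: lit_word_def enc_bit_def prod_eq_iff split: if_splits)

lemma conflict_lit_word: "conflict (lit_word l) (lit_word l') \<longleftrightarrow> snd l = snd l' \<and> fst l \<noteq> fst l'"
  using bin_inj[of "snd l" "snd l'"] by (auto simp: conflict_def lit_word_inj prod_eq_iff) (auto simp: lit_word_def)

lemma split3_enc_clause: "split3 (enc_clause C @ s) = map lit_word C @ [] # split3 s"
proof (induction C)
  case Nil
  then show ?case using split3_word[of "[]" s] by (simp add: enc_clause_def)
next
  case (Cons l C)
  have "enc_clause (l # C) @ s = lit_word l @ 3 # (enc_clause C @ s)"
    by (simp add: enc_clause_def lit_word_def Defs.enc_nat_def case_prod_unfold)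
  then show ?case using split3_word[OF lit_word_no3] Cons by simp
qed

lemma split3_enc_cnf: "split3 (enc_cnf \<phi>) = concat (map (\<lambda>C. map lit_word C @ [[]]) \<phi>)"
proof (induction \<phi>)
  case (Cons C \<phi>)
  then show ?case using split3_enc_clause[of C "enc_cnf \<phi>"] by (simp add: enc_cnf_def)
qed (simp add: enc_cnf_def)

lemma parse_enc_cnf: "parse_clauses (enc_cnf \<phi>) = rev (map (\<lambda>C. rev (map lit_word C)) \<phi>)"
proof -
  let ?st = "\<lambda>p w. if w = [] then (snd p # fst p, []) else (fst p, w # snd p)"
  have 1: "foldl ?st (cs, c) (map lit_word C) = (cs, rev (map lit_word C) @ c)" for cs c C
    by (induction C arbitrary: c) auto
  have "foldl ?st (cs, []) (concat (map (\<lambda>C. map lit_word C @ [[]]) \<phi>)) =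
      (rev (map (\<lambda>C. rev (map lit_word C)) \<phi>) @ cs, [])" for cs
    by (induction \<phi> arbitrary: cs) (auto simp: 1)
  then show ?thesis by (simp add: parse_clauses_def split3_enc_cnf)
qed

definition consistent :: "nat list set \<Rightarrow> bool" where
  "consistent T \<longleftrightarrow> (\<forall>l\<in>T. \<forall>l'\<in>T. \<not> conflict l l')"

text \<open>From \<open>T\<close> a variable is made true iff its positive literal lies in
  \<open>T\<close>. Consistency guarantees that the negative literals in \<open>T\<close> are true
  as well.\<close>

lemma satisfiable_iff_hits:
  "satisfiable \<phi> \<longleftrightarrow> (\<exists>T. consistent T \<and> (\<forall>C\<in>set \<phi>. T \<inter> lit_word ` set C \<noteq> {}))"
proof
  assume "satisfiable \<phi>"
  then obtain \<sigma> where \<sigma>: "\<forall>C\<in>set \<phi>. \<exists>(b, v)\<in>set C. \<sigma> v = b" by (auto simp: satisfiable_def)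
  let ?T = "range (\<lambda>v. lit_word (\<sigma> v, v))"
  have "consistent ?T" by (auto simp: consistent_def conflict_lit_word)
  moreover have "?T \<inter> lit_word ` set C \<noteq> {}" if C: "C \<in> set \<phi>" for C
  proof -
    obtain b v where "(b, v) \<in> set C" "\<sigma> v = b" using bspec[OF \<sigma> C] by auto
    then have "lit_word (\<sigma> v, v) \<in> ?T \<inter> lit_word ` set C" by auto
    then show ?thesis by blast
  qed
  ultimately show "\<exists>T. consistent T \<and> (\<forall>C\<in>set \<phi>. T \<inter> lit_word ` set C \<noteq> {})" by blast
next
  assume "\<exists>T. consistent T \<and> (\<forall>C\<in>set \<phi>. T \<inter> lit_word ` set C \<noteq> {})"
  then obtain T where T: "consistent T" "\<forall>C\<in>set \<phi>. T \<inter> lit_word ` set C \<noteq> {}" by blast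
  have "\<exists>(b, v)\<in>set C. (lit_word (True, v) \<in> T) = b" if C: "C \<in> set \<phi>" for C
  proof -
    obtain l where l: "l \<in> set C" "lit_word l \<in> T" using T(2) C by blast
    obtain b v where bv: "l = (b, v)" by (cases l)
    have "lit_word (True, v) \<notin> T" if "\<not> b"
    proof
      assume "lit_word (True, v) \<in> T"
      then have "\<not> conflict (lit_word (True, v)) (lit_word l)" using T(1) l(2) by (simp add: consistent_def)
      then show False using that by (simp add: conflict_lit_word bv)
    qed
    then show ?thesis using l bv by (intro bexI[of _ l]) (cases b; simp)+
  qed
  then show "satisfiable \<phi>" unfolding satisfiable_def by (intro exI[of _ "\<lambda>v. lit_word (True, v) \<in> T"]) blast
qed

lemma initial_formula_props:
  "list_inv (initial_formula cs) \<and> antichain (clauses (initial_formula cs)) \<and>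
   (\<forall>D\<in>clauses (initial_formula cs). \<exists>c\<in>set cs. D = set c) \<and>
   (\<forall>T. hits T (clauses (initial_formula cs)) \<longleftrightarrow> (\<forall>c\<in>set cs. T \<inter> set c \<noteq> {}))"
proof (induction cs rule: rev_induct)
  case Nil
  show ?case by (simp add: initial_formula_def list_inv_def antichain_def clauses_def hits_def)
next
  case (snoc c cs)
  have e: "initial_formula (cs @ [c]) = add_list (dedup c) (initial_formula cs)" by (simp add: initial_formula_def)
  have 1: "clauses (initial_formula (cs @ [c])) = add_clause (set c) (clauses (initial_formula cs))"
    unfolding e clauses_add_list dedup(1) ..
  have 2: "add_clause (set c) (clauses (initial_formula cs)) \<subseteq> insert (set c) (clauses (initial_formula cs))"
    by (auto simp: add_clause_def)
  show ?case
  proof (intro conjI allI ballI)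
    show "list_inv (initial_formula (cs @ [c]))" unfolding e using snoc dedup(2) by (intro list_inv_add_list) auto
    show "antichain (clauses (initial_formula (cs @ [c])))" unfolding 1 using snoc by (intro antichain_add_clause) auto
    show "\<exists>c'\<in>set (cs @ [c]). D = set c'" if "D \<in> clauses (initial_formula (cs @ [c]))" for D
    proof (cases "D = set c")
      case False
      then have "D \<in> clauses (initial_formula cs)" using that 2 unfolding 1 by blast
      then show ?thesis using snoc by auto
    qed auto
    show "hits T (clauses (initial_formula (cs @ [c]))) \<longleftrightarrow> (\<forall>c'\<in>set (cs @ [c]). T \<inter> set c' \<noteq> {})" for T
      unfolding 1 hits_add_clause using snoc by auto
  qed
qed

text \<open>\<open>Q\<close> consists of the initial 2-clauses, so no created 2-clause exists yet
  and the degree bound holds however often a literal occurs in 2-clauses of the input.\<close>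

lemma split_inv_initial:
  assumes "\<forall>c\<in>set cs. length c \<le> 3"
  shows "split_inv (twos (clauses (initial_formula cs))) t (dedup (concat cs))
     (\<lambda>T. \<forall>c\<in>set cs. T \<inter> set c \<noteq> {}) ([initial_formula cs], [])"
proof -
  note p = initial_formula_props[of cs]
  have "D \<subseteq> set (concat cs) \<and> card D \<le> 3" if D: "D \<in> clauses (initial_formula cs)" for D
  proof -
    obtain c where c: "c \<in> set cs" "D = set c" using p D by blast
    then have "length c \<le> 3" using assms by simp
    then have "card D \<le> 3" using c(2) card_length[of c] by simp
    then show ?thesis using c by auto
  qed
  then have "sparse_inv (twos (clauses (initial_formula cs))) t (set (concat cs)) (clauses (initial_formula cs))"
    using p unfolding sparse_inv_def by (auto simp: twos_def)
  then show ?thesis using p unfolding split_inv_def formula_ok_def dedup(1) by auto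
qed

lemma set_expand_pow: "set ((expand ^^ n) [[]]) = {w. length w = n \<and> set w \<subseteq> {0, 1, 2}}"
proof (induction n)
  case (Suc n)
  have "set ((expand ^^ Suc n) [[]]) = {d # w | d w. d \<in> {0, 1, 2} \<and> w \<in> set ((expand ^^ n) [[]])}"
    by (auto simp: expand_def)
  also have "\<dots> = {w. length w = Suc n \<and> set w \<subseteq> {0, 1, 2}}"
    unfolding Suc by (auto simp: length_Suc_conv)
  finally show ?case .
qed auto

lemma length_expand_pow: "length ((expand ^^ n) [[]]) = 3 ^ n"
proof -
  have "length (expand W) = 3 * length W" for W by (induction W) (auto simp: expand_def)
  then show ?thesis by (induction n) auto
qed

lemma selections_hit: "s \<in> set (selections ch W) \<Longrightarrow> c \<in> set ch \<Longrightarrow> set s \<inter> set c \<noteq> {}"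
  by (auto simp: selections_def)

text \<open>In every clause of the chunk take the position of a literal of \<open>T\<close>. These
  digits, padded by zeros to length \<open>L\<close>, form one of the ternary words;
  \<open>zip\<close> ignores the padding.\<close>

lemma selections_complete:
  assumes T: "\<forall>c\<in>set ch. T \<inter> set c \<noteq> {}" and c3: "\<forall>c\<in>set ch. length c \<le> 3" and L: "length ch \<le> L"
  shows "\<exists>s\<in>set (selections ch ((expand ^^ L) [[]])). set s \<subseteq> T"
proof -
  have "\<forall>c\<in>set ch. \<exists>d. d < length c \<and> c ! d \<in> T"
  proof
    fix c assume "c \<in> set ch"
    then obtain l where "l \<in> T" "l \<in> set c" using T by blast
    then show "\<exists>d. d < length c \<and> c ! d \<in> T" by (auto simp: in_set_conv_nth)
  qed
  from bchoice[OF this] obtain d where d: "\<forall>c\<in>set ch. d c < length c \<and> c ! d c \<in> T" ..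
  define w where "w = map d ch @ replicate (L - length ch) 0"
  have d3: "d c \<in> {0, 1, 2}" if "c \<in> set ch" for c
  proof -
    have "d c < length c" "length c \<le> 3" using d c3 that by simp_all
    then have "d c < 3" by linarith
    then show ?thesis by auto
  qed
  have w: "w \<in> set ((expand ^^ L) [[]])" 
  proof -
    have "a \<in> {0, 1, 2}" if "a \<in> set w" for a
    proof -
      from that have "a \<in> d ` set ch \<or> a = 0" unfolding w_def set_append set_map by (auto split: if_splits)
      then show ?thesis
      proof
        assume "a \<in> d ` set ch"
        then obtain c where "c \<in> set ch" "a = d c" ..
        then show ?thesis using d3[of c] by simp
      qed simp
    qed
    then have "set w \<subseteq> {0, 1, 2}" by (rule subsetI)
    moreover have "length w = L" using L by (simp add: w_def)
    ultimately show ?thesis unfolding set_expand_pow by (intro CollectI conjI)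
  qed
  have z: "zip xs (map d xs @ r) = map (\<lambda>c. (c, d c)) xs" for xs r by (induction xs) auto
  have "zip ch w = map (\<lambda>c. (c, d c)) ch"
    unfolding w_def by (rule z)
  then have s: "choose_lits ch w = concat (map (\<lambda>c. take 1 (drop (d c) c)) ch)"
    by (simp add: choose_lits_def comp_def)
  also have "map (\<lambda>c. take 1 (drop (d c) c)) ch = map (\<lambda>c. [c ! d c]) ch"
  proof (rule map_cong[OF refl])
    fix c assume "c \<in> set ch"
    then have "drop (d c) c = c ! d c # drop (Suc (d c)) c" using d by (simp add: Cons_nth_drop_Suc)
    then show "take 1 (drop (d c) c) = [c ! d c]" by simp
  qed
  also have "concat (map (\<lambda>c. [c ! d c]) xs) = map (\<lambda>c. c ! d c) xs" for xs by (induction xs) auto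
  finally have s: "choose_lits ch w = map (\<lambda>c. c ! d c) ch" .
  have "\<forall>c\<in>set ch. \<exists>l\<in>set c. l \<in> set (choose_lits ch w)"
  proof
    fix c assume "c \<in> set ch"
    then show "\<exists>l\<in>set c. l \<in> set (choose_lits ch w)" unfolding s using d by (intro bexI[of _ "c ! d c"]) auto
  qed
  then have "choose_lits ch w \<in> set (selections ch ((expand ^^ L) [[]]))" unfolding selections_def using w by simp
  moreover have "set (choose_lits ch w) \<subseteq> T" unfolding s using d by auto
  ultimately show ?thesis by blast
qed

lemma length_chunk: "length (chunk L \<psi> i) \<le> L"
  by (simp add: chunk_def)

lemma chunk_empty:
  assumes "length \<psi> \<le> h * L" "i \<ge> h" shows "chunk L \<psi> i = []"
  using order_trans[OF assms(1) mult_le_mono1[OF assms(2)]] by (simp add: chunk_def)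

lemma Union_chunks: "L > 0 \<Longrightarrow> (\<Union>i. set (chunk L \<psi> i)) = set \<psi>"
proof
  show "(\<Union>i. set (chunk L \<psi> i)) \<subseteq> set \<psi>" by (auto simp: chunk_def dest: in_set_takeD in_set_dropD)
  assume L: "L > 0"
  show "set \<psi> \<subseteq> (\<Union>i. set (chunk L \<psi> i))"
  proof
    fix c assume "c \<in> set \<psi>"
    then obtain j where j: "j < length \<psi>" "\<psi> ! j = c" by (auto simp: in_set_conv_nth)
    let ?i = "j div L"
    have m: "j mod L < L" using L by simp
    have "?i * L + j mod L < length \<psi>" using j(1) by simp
    from this have "j mod L < length \<psi> - ?i * L" by linarith
    then have "j mod L < length (chunk L \<psi> ?i)" using m by (simp add: chunk_def)
    moreover have "chunk L \<psi> ?i ! (j mod L) = c"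
    proof -
      have "?i * L \<le> length \<psi>" using \<open>?i * L + j mod L < length \<psi>\<close> by linarith
      then have "drop (?i * L) \<psi> ! (j mod L) = \<psi> ! (?i * L + j mod L)" by (rule nth_drop)
      then show ?thesis using j(2) m by (simp add: chunk_def)
    qed
    ultimately have "c \<in> set (chunk L \<psi> ?i)" using nth_mem by fastforce
    then show "c \<in> (\<Union>i. set (chunk L \<psi> i))" by blast
  qed
qed

lemma enc_nat_inj: "Defs.enc_nat u = Defs.enc_nat v \<longleftrightarrow> u = v"
  using bin_inj[of u v] by (auto simp: Defs.enc_nat_def)

definition word_vertex :: "(nat \<Rightarrow> nat) \<Rightarrow> nat \<times> nat list list \<Rightarrow> gvertex" where
  "word_vertex \<chi> x = (Defs.enc_nat (fst x), \<chi> (fst x), snd x)"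

text \<open>Vertex \<open>i\<close> of the graph is the position \<open>i\<close> in
  \<open>vs\<close>. The pairs in \<open>A\<close> occur in both orientations and compatibility is
  symmetric, so testing ordered pairs row by row gives the adjacency matrix of the undirected
  graph.\<close>

lemma query_eq:
  fixes vs :: "(nat \<times> nat list list) list" and \<chi> :: "nat \<Rightarrow> nat"
  assumes S: "set A = {(Defs.enc_nat u, Defs.enc_nat v) | u v. {u, v} \<in> S}"
  defines "c \<equiv> \<lambda>i. fst (vs ! i)" and "R \<equiv> \<lambda>i j. compatible conflict \<chi> (vs ! i) (vs ! j)"
  shows "query (enc_graph F) A (map (word_vertex \<chi>) vs) = enc_colored F (colored_graph (length vs) c R S) c"
proof -
  let ?n = "length vs" let ?G = "colored_graph (length vs) c R S"
  have cs: "conflict l l' \<longleftrightarrow> conflict l' l" for l l' by (auto simp: conflict_def)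
  have sym: "R j i" if r: "R i j" for i j
  proof -
    note st = r[unfolded R_def compatible_def]
    have "\<forall>l\<in>set (snd (vs ! j)). \<forall>l'\<in>set (snd (vs ! i)). \<not> conflict l l'"
    proof (intro ballI notI)
      fix l l' assume l: "l \<in> set (snd (vs ! j))" "l' \<in> set (snd (vs ! i))" "conflict l l'"
      then have "conflict l' l" using cs by blast
      then show False using bspec[OF bspec[OF conjunct2[OF st] l(2)] l(1)] by blast
    qed
    then show ?thesis unfolding R_def compatible_def using conjunct1[OF st] by simp
  qed
  have adj: "adjw A (word_vertex \<chi> (vs ! i)) (word_vertex \<chi> (vs ! j)) \<longleftrightarrow> {i, j} \<in> edges ?G"
    if "i < ?n" "j < ?n" for i j
  proof -
    have "(Defs.enc_nat (c i), Defs.enc_nat (c j)) \<in> set A \<longleftrightarrow> {c i, c j} \<in> S"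
      unfolding S by (auto simp: enc_nat_inj)
    then have "adjw A (word_vertex \<chi> (vs ! i)) (word_vertex \<chi> (vs ! j)) \<longleftrightarrow> {c i, c j} \<in> S \<and> R i j"
      by (simp add: adjw_def word_vertex_def R_def c_def compatible_def)
    also have "\<dots> \<longleftrightarrow> {i, j} \<in> edges ?G" using colored_graph_edge[where R = R, OF sym that, of c S] by blast
    finally show ?thesis .
  qed
  have vs: "vs = map (\<lambda>i. vs ! i) [0..<?n]" by (rule map_nth[symmetric])
  have vG: "card (verts ?G) = ?n" by (simp add: colored_graph_def)
  have rows: "map (\<lambda>x. map (\<lambda>y. if adjw A x y then 2 else 1) (map (word_vertex \<chi>) vs)) (map (word_vertex \<chi>) vs) =
      map (\<lambda>i. map (\<lambda>j. enc_bit ({i, j} \<in> edges ?G)) [0..<?n]) [0..<?n]"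
    by (rule nth_equalityI) (auto simp: adj enc_bit_def intro!: nth_equalityI)
  have cols: "map (fst \<circ> word_vertex \<chi>) vs = map (\<lambda>v. Defs.enc_nat (c v)) [0..<?n]"
    by (rule nth_equalityI) (auto simp: word_vertex_def c_def)
  show ?thesis
    unfolding query_def enc_colored_def vG rows
    by (simp add: enc_graph_def vG Let_def length_bin_word_def Defs.enc_nat_def[of ?n] cols)
qed

lemma split3_enc_rat:
  assumes "quotient_of x = (p, q)"
  shows "split3 (enc_rat x) = [enc_bit (p < 0) # bin (nat \<bar>p\<bar>), enc_bit False # bin (nat q)]"
proof -
  have q: "q > 0" using assms quotient_of_denom_pos by blast
  have n3: "3 \<notin> set (enc_bit b # bin n)" for b n using lit_word_no3[of "(b, n)"] by (simp add: lit_word_def)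
  have e: "enc_rat x = (enc_bit (p < 0) # bin (nat \<bar>p\<bar>)) @ 3 # ((enc_bit False # bin (nat q)) @ 3 # [])"
    using q by (simp add: enc_rat_def assms enc_int_def Defs.enc_nat_def)
  show ?thesis unfolding e split3_word[OF n3] by simp
qed

definition triple_value :: "nat list \<times> nat list \<times> nat list \<Rightarrow> rat \<Rightarrow> bool" where
  "triple_value s y \<longleftrightarrow> (\<exists>a b d. s = (bin a, bin b, bin d) \<and> d > 0 \<and> y = (of_nat a - of_nat b) / of_nat d)"

lemma acc_next_value:
  assumes "triple_value s y"
  shows "triple_value (acc_next s ((e, sg), rev (enc_rat x))) (y + (if sg then - x else x))"
proof -
  obtain a b d where s: "s = (bin a, bin b, bin d)" "d > 0" "y = (of_nat a - of_nat b) / of_nat d"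
    using assms by (auto simp: triple_value_def)
  obtain p q where pq: "quotient_of x = (p, q)" by (cases "quotient_of x")
  have q: "q > 0" using pq quotient_of_denom_pos by blast
  have x: "x = of_int p / of_int q" by (rule quotient_of_div[OF pq])
  have w: "word_at 0 (enc_rat x) = enc_bit (p < 0) # bin (nat \<bar>p\<bar>)" "word_at 1 (enc_rat x) = enc_bit False # bin (nat q)"
    by (simp_all add: word_at_def split3_enc_rat[OF pq])
  define neg where "neg = ((p < 0) \<noteq> sg)"
  define P where "P = nat \<bar>p\<bar>" define Q where "Q = nat q"
  have Q: "Q > 0" "(of_int q :: rat) = of_nat Q" using q by (simp_all add: Q_def)
  have X: "(if sg then - x else x) = (if neg then - of_nat P else of_nat P) / of_nat Q"
    by (simp add: x Q(2) neg_def P_def)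
  have n: "acc_next s ((e, sg), rev (enc_rat x)) =
      (bin (a * Q + (if neg then 0 else d * P)), bin (b * Q + (if neg then d * P else 0)), bin (d * Q))"
    by (cases sg; cases "p < 0")
       (simp_all add: acc_next_def acc_numbers_def w[simplified] s addw_def mulw_def neg_def P_def Q_def enc_bit_def)
  have v: "y + (if neg then - of_nat P else of_nat P) / of_nat Q =
     (of_nat (a * Q + (if neg then 0 else d * P)) - of_nat (b * Q + (if neg then d * P else 0))) / of_nat (d * Q)"
    using Q(1) s(2) by (simp add: s(3) field_simps)
  have dq: "0 < d * Q" using s(2) Q(1) by simp
  show ?thesis unfolding n X triple_value_def by (intro exI conjI, rule refl, rule dq, rule v)
qed

lemma triple_value_zero:
  assumes "triple_value s y"
  shows "fst s = fst (snd s) \<longleftrightarrow> y = 0"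
  using assms bin_inj by (auto simp: triple_value_def)

lemma triple_value_start: "triple_value ([], [], [2]) 0"
  unfolding triple_value_def by (rule exI[of _ 0], rule exI[of _ 0], rule exI[of _ 1]) simp

lemma foldl_acc_group:
  assumes "triple_value s y" "zs \<noteq> []" "\<And>z. z \<in> set (butlast zs) \<Longrightarrow> \<not> e z" "e (last zs)"
  shows "foldl (\<lambda>st x. acc_step st x) (ans, s) (map (\<lambda>z. ((e z, sg z), rev (enc_rat (X z)))) zs) =
     (ans \<or> y + (\<Sum>z\<leftarrow>zs. if sg z then - X z else X z) \<noteq> 0, [], [], [2])"
  using assms
proof (induction zs arbitrary: s y)
  case (Cons z zs)
  let ?t = "((e z, sg z), rev (enc_rat (X z)))"
  note v = acc_next_value[OF Cons.prems(1), of "e z" "sg z" "X z"]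
  show ?case
  proof (cases "zs = []")
    case True
    then have "e z" using Cons.prems(4) by simp
    then show ?thesis using True triple_value_zero[OF v] by (auto simp: acc_step_def)
  next
    case False
    then have "\<not> e z" using Cons.prems(3)[of z] by simp
    then have st: "acc_step (ans, s) ?t = (ans, acc_next s ?t)" by (simp add: acc_step_def)
    have "foldl (\<lambda>st x. acc_step st x) (ans, acc_next s ?t) (map (\<lambda>z. ((e z, sg z), rev (enc_rat (X z)))) zs) =
       (ans \<or> (y + (if sg z then - X z else X z)) + (\<Sum>z\<leftarrow>zs. if sg z then - X z else X z) \<noteq> 0, [], [], [2])"
      by (rule Cons.IH[OF v False]) (use Cons.prems False in auto)
    then show ?thesis by (simp add: st add.assoc)
  qed
qed simp

lemma final_answer_groups:
  assumes "zs \<noteq> []" "\<And>z. z \<in> set (butlast zs) \<Longrightarrow> \<not> e z" "e (last zs)"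
  shows "final_answer (rev (concat (map (\<lambda>\<psi>. map (\<lambda>z. ((e z, sg z), rev (enc_rat (X \<psi> z)))) zs) \<psi>s))) \<longleftrightarrow>
     (\<exists>\<psi>\<in>set \<psi>s. (\<Sum>z\<leftarrow>zs. if sg z then - X \<psi> z else X \<psi> z) \<noteq> 0)"
proof -
  have "foldl (\<lambda>st x. acc_step st x) (ans, [], [], [2]) (concat (map (\<lambda>\<psi>. map (\<lambda>z. ((e z, sg z), rev (enc_rat (X \<psi> z)))) zs) \<psi>s)) =
     (ans \<or> (\<exists>\<psi>\<in>set \<psi>s. (\<Sum>z\<leftarrow>zs. if sg z then - X \<psi> z else X \<psi> z) \<noteq> 0), [], [], [2])" for ans
  proof (induction \<psi>s arbitrary: ans)
    case (Cons \<psi> \<psi>s)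
    have 1: "foldl (\<lambda>st x. acc_step st x) (ans, [], [], [2]) (map (\<lambda>z. ((e z, sg z), rev (enc_rat (X \<psi> z)))) zs) =
      (ans \<or> (\<Sum>z\<leftarrow>zs. if sg z then - X \<psi> z else X \<psi> z) \<noteq> 0, [], [], [2])"
      using foldl_acc_group[where zs = zs and e = e and sg = sg and X = "X \<psi>" and ans = ans, OF triple_value_start assms]
      by simp
    show ?case by (simp only: list.map concat.simps foldl_append 1 Cons) auto
  qed simp
  then show ?thesis by (simp add: final_answer_def)
qed

section \<open>The reduction\<close>

definition loop_time :: "nat \<Rightarrow> nat \<Rightarrow> nat" where
  "loop_time d B = B * pl d (2 * B + 1) + 3000 * ((B + 1) * (2 * B + 1))"

lemma cr_loop:
  fixes xs :: "'a::enc list" and s :: "nat \<Rightarrow> 'b::enc"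
  assumes f: "\<And>i. i < length xs \<Longrightarrow> cr f (enc (xs ! i, s i)) (enc (s (Suc i))) T"
    and B: "es xs \<le> B" "\<And>i. i \<le> length xs \<Longrightarrow> es (s i) \<le> B"
  shows "cr (foldc f) (enc (xs, s 0)) (enc (s (length xs))) (B * T + 3000 * ((B + 1) * (2 * B + 1)))"
proof -
  have len: "length xs \<le> B" using length_le_es[of xs] B(1) by simp
  have "cr (foldc f) (Cn (ltree (map enc xs)) (enc (s 0))) (enc (s (length (map enc xs))))
    ((\<Sum>i<length (map enc xs). T) + 3000 * (\<Sum>i\<le>length (map enc xs). sz (ltree (map enc xs)) + es (s i) + 1))"
    by (rule cr_foldc[where s = "\<lambda>i. enc (s i)"]) (use f in simp)
  then have 1: "cr (foldc f) (enc (xs, s 0)) (enc (s (length xs)))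
     (length xs * T + 3000 * (\<Sum>i\<le>length xs. es xs + es (s i) + 1))"
    by (simp add: enc_list_ltree)
  have "(\<Sum>i\<le>length xs. es xs + es (s i) + 1) \<le> (\<Sum>i\<le>length xs. 2 * B + 1)"
  proof (rule sum_mono)
    fix i assume "i \<in> {..length xs}"
    then have "es (s i) \<le> B" using B(2) by simp
    then show "es xs + es (s i) + 1 \<le> 2 * B + 1" using B(1) by simp
  qed
  also have "\<dots> = (length xs + 1) * (2 * B + 1)" by simp
  also have "\<dots> \<le> (B + 1) * (2 * B + 1)" using len by (intro mult_le_mono1) simp
  finally have 2: "3000 * (\<Sum>i\<le>length xs. es xs + es (s i) + 1) \<le> 3000 * ((B + 1) * (2 * B + 1))" by simp
  have "length xs * T \<le> B * T" using len by (rule mult_le_mono1)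
  from cr_mono[OF 1 add_mono[OF this 2]] show ?thesis .
qed

text \<open>In contrast to \<open>pt_foldl\<close>, the accumulator is bounded by a number
  \<open>E\<close> for the run at hand and not by a polynomial in the input. The loops of the
  reduction have exponentially many rounds and are measured in this way.\<close>

lemma cr_loop_context:
  fixes xs :: "'a::enc list" and c :: "'c::enc" and w :: "'b::enc" and f :: "'c \<Rightarrow> 'b \<Rightarrow> 'b"
  assumes f: "\<And>y :: 'a \<times> 'c \<times> 'b. cr p (enc y) (enc (fst (snd y), f (fst (snd y)) (snd (snd y)))) (pl d (es y))"
    and B: "es (xs, c, w) \<le> S" "\<And>i. i \<le> length xs \<Longrightarrow> es ((f c ^^ i) w) \<le> E"
  shows "cr (foldc p) (enc (xs, c, w)) (enc (c, (f c ^^ length xs) w)) (loop_time d (S + 1 + E))"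
    and "es (c, (f c ^^ length xs) w) \<le> S + 1 + E"
proof -
  let ?s = "\<lambda>i. (c, (f c ^^ i) w)"
  have s: "es (?s i) \<le> S + 1 + E" if "i \<le> length xs" for i using B(1) B(2)[OF that] by simp
  then show "es (?s (length xs)) \<le> S + 1 + E" by blast
  have "cr p (enc (xs ! i, ?s i)) (enc (?s (Suc i))) (pl d (2 * (S + 1 + E) + 1))" if i: "i < length xs" for i
  proof -
    have "es (xs ! i) < es xs" using i by (intro es_member) simp
    then have "es (xs ! i, ?s i) \<le> 2 * (S + 1 + E) + 1" using B(1) s[of i] i by simp
    then have "pl d (es (xs ! i, ?s i)) \<le> pl d (2 * (S + 1 + E) + 1)" by (rule pl_mono[OF order_refl])
    from cr_mono[OF f[of "(xs ! i, ?s i)"] this] show ?thesis by simp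
  qed
  moreover have "es xs \<le> S + 1 + E" using B(1) by simp
  ultimately have "cr (foldc p) (enc (xs, ?s 0)) (enc (?s (length xs)))
      ((S + 1 + E) * pl d (2 * (S + 1 + E) + 1) + 3000 * ((S + 1 + E + 1) * (2 * (S + 1 + E) + 1)))"
    using s by (intro cr_loop[where s = ?s])
  then show "cr (foldc p) (enc (xs, c, w)) (enc (c, (f c ^^ length xs) w)) (loop_time d (S + 1 + E))"
    by (simp add: loop_time_def)
qed

text \<open>Everything that depends on the pattern or on \<open>q\<close> is data and not part of
  the program; so one program, with one exponent, serves all patterns.\<close>

type_synonym params = "nat \<times> nat \<times> nat \<times> nat \<times> (nat list \<times> nat) list \<times> nat list \<times> subset_list"

abbreviation par_t :: "params \<Rightarrow> nat" where "par_t P \<equiv> fst P"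
abbreviation par_q :: "params \<Rightarrow> nat" where "par_q P \<equiv> fst (snd P)"
abbreviation par_C :: "params \<Rightarrow> nat" where "par_C P \<equiv> fst (snd (snd P))"
abbreviation par_h :: "params \<Rightarrow> nat" where "par_h P \<equiv> fst (snd (snd (snd P)))"
abbreviation par_cols :: "params \<Rightarrow> (nat list \<times> nat) list" where "par_cols P \<equiv> fst (snd (snd (snd (snd P))))"
abbreviation par_F :: "params \<Rightarrow> nat list" where "par_F P \<equiv> fst (snd (snd (snd (snd (snd P)))))"
abbreviation par_S :: "params \<Rightarrow> subset_list" where "par_S P \<equiv> snd (snd (snd (snd (snd (snd P)))))"

definition input_clauses :: "nat list \<Rightarrow> nat list list list" where "input_clauses rs = parse_clauses (rev rs)"
definition input_lits :: "nat list \<Rightarrow> nat list list" where "input_lits rs = dedup (concat (input_clauses rs))"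
text \<open>With the successor, \<open>h\<close> chunks hold at least \<open>1 + C * nl\<close>
  clauses, the bound of \<open>leaf_sparse\<close>.\<close>

definition chunk_size :: "params \<Rightarrow> nat list \<Rightarrow> nat" where
  "chunk_size P rs = Suc (par_C P * length (input_lits rs) div par_h P)"
text \<open>One successor rounds \<open>nl / q\<close> up; the other yields a factor 3, which covers
  the factor 2 in \<open>tree_weight\<close>.\<close>

definition fuel_size :: "params \<Rightarrow> nat list \<Rightarrow> nat" where
  "fuel_size P rs = Suc (Suc (length (input_lits rs) div par_q P))"

type_synonym ctx1 = "params \<times> nat list list \<times> nat list list list \<times> nat \<times> nat"
type_synonym ctx2 = "(params \<times> nat list list \<times> nat list list list \<times> nat) \<times> nat list list"
type_synonym ctx3 = "params \<times> nat list list \<times> nat \<times> nat list list"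

text \<open>The exponential loops are not \<open>pt\<close>. They are separated from polynomial-time
  stages, each of which prepares the next loop: the list that drives it, a context that stays
  constant, and the initial accumulator.\<close>

definition stageA :: "params \<times> nat list \<Rightarrow> unit list \<times> ctx1 \<times> nat list list" where
  "stageA x = (replicate (chunk_size (fst x) (snd x)) (),
     ((fst x, input_lits (snd x), initial_formula (input_clauses (snd x)), chunk_size (fst x) (snd x), fuel_size (fst x) (snd x)), [[]]))"

definition stageB :: "ctx1 \<times> nat list list \<Rightarrow> unit list \<times> ctx2 \<times> nat list list" where
  "stageB x = (replicate (snd (snd (snd (snd (fst x))))) (),
     (((fst (fst x), fst (snd (fst x)), fst (snd (snd (fst x))), fst (snd (snd (snd (fst x))))), snd x), [[]]))"

definition stageC :: "ctx2 \<times> nat list list \<Rightarrow> nat list list \<times> ctx3 \<times> nat list list list list \<times> nat list list list list" where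
  "stageC x = (snd x, ((fst (fst (fst x)), fst (snd (fst (fst x))), snd (snd (snd (fst (fst x)))), snd (fst x)),
     ([fst (snd (snd (fst (fst x))))], [])))"

definition stageD :: "ctx3 \<times> nat list list list list \<times> nat list list list list \<Rightarrow> tagged list \<times> tagged list" where
  "stageD x = (concat (map (\<lambda>\<psi>. items (par_S (fst (fst x))) (par_F (fst (fst x)))
     (gverts (par_cols (fst (fst x))) (fst (snd (snd (fst x)))) (snd (snd (snd (fst x)))) \<psi>)) (snd (snd x))), [])"

lemma pt_stageA: "pt (\<lambda>x. stageA x)"
  unfolding stageA_def chunk_size_def fuel_size_def input_lits_def input_clauses_def
  by (intro pt_units pt_intros pt_dedup pt_parse_clauses pt_initial_formula)

lemma pt_stageB: "pt (\<lambda>x. stageB x)"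
  unfolding stageB_def by (intro pt_units pt_intros)

lemma pt_stageC: "pt (\<lambda>x. stageC x)"
  unfolding stageC_def by (intro pt_intros)

lemma pt_stageD: "pt (\<lambda>x. stageD x)"
  unfolding stageD_def by (intro pt_intros pt_items pt_gverts)

lemma pt_loop_bodies:
  "pt (\<lambda>y :: unit \<times> ctx1 \<times> nat list list. (fst (snd y), expand (snd (snd y))))"
  "pt (\<lambda>y :: unit \<times> ctx2 \<times> nat list list. (fst (snd y), expand (snd (snd y))))"
  "pt (\<lambda>y :: nat list \<times> ctx3 \<times> nat list list list list \<times> nat list list list list.
     (fst (snd y), split_step (par_t (fst (fst (snd y)))) (fst (snd (fst (snd y)))) (snd (snd y))))"
  by (intro pt_intros pt_expand pt_split_step)+

text \<open>There are \<open>3 ^ i\<close> words of length \<open>i\<close>; with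
  \<open>i < 3 ^ i\<close> the bound becomes polynomial in \<open>3 ^ i\<close>.\<close>

lemma es_expand_pow: "es ((expand ^^ i) [[]]) \<le> 8 * (3 ^ i * 3 ^ i)"
proof -
  have "es w \<le> 1 + 6 * i" if w: "w \<in> set ((expand ^^ i) [[]])" for w
  proof -
    have "length w = i" "set w \<subseteq> {0, 1, 2}" using w unfolding set_expand_pow by auto
    then have "es a \<le> 5" if "a \<in> set w" for a using that by auto
    then have "es w \<le> 1 + length w * (1 + 5)" by (rule es_le)
    then show ?thesis using \<open>length w = i\<close> by simp
  qed
  then have "es ((expand ^^ i) [[]]) \<le> 1 + length ((expand ^^ i) [[]]) * (1 + (1 + 6 * i))" by (rule es_le)
  then have "es ((expand ^^ i) [[]]) \<le> 1 + 3 ^ i * (2 + 6 * i)" by (simp add: length_expand_pow)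
  also have "i < 3 ^ i" by (induction i) auto
  then have "1 + 3 ^ i * (2 + 6 * i) \<le> 3 ^ i * 3 ^ i + 3 ^ i * (6 * 3 ^ i + 1)"
  proof -
    assume i: "i < 3 ^ i"
    have "3 ^ i * (2 + 6 * i) + 1 \<le> 3 ^ i * (2 + 6 * i) + 3 ^ i * 1" by simp
    also have "\<dots> = 3 ^ i * (3 + 6 * i)" by (simp add: algebra_simps)
    also have "\<dots> \<le> 3 ^ i * (7 * 3 ^ i)"
    proof (cases i)
      case (Suc j)
      then show ?thesis using i by (intro mult_le_mono2) simp
    qed simp
    finally show ?thesis by (simp add: algebra_simps)
  qed
  also have "\<dots> \<le> 8 * (3 ^ i * 3 ^ i)" by (simp add: algebra_simps)
  finally show ?thesis .
qed

definition formula_bound :: "nat \<Rightarrow> nat" where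
  "formula_bound n = 1 + (4 * (n + 1) ^ 3) * (1 + (1 + 3 * (1 + n)))"

text \<open>The clauses are distinct lists of at most three literals from \<open>L\<close>, so a
  pending formula has polynomial size no matter how many steps have led to it.\<close>

lemma es_formula:
  assumes "formula_ok Q t L \<psi>" "es L \<le> n"
  shows "es \<psi> \<le> formula_bound n"
proof -
  have li: "list_inv \<psi>" and si: "sparse_inv Q t (set L) (clauses \<psi>)" using assms(1) by (auto simp: formula_ok_def)
  have cl: "set c \<subseteq> set L \<and> length c \<le> 3" if c: "c \<in> set \<psi>" for c
  proof -
    have "set c \<in> clauses \<psi>" using c by (simp add: clauses_def)
    then have "set c \<subseteq> set L" "card (set c) \<le> 3" using si by (simp_all add: sparse_inv_def)
    moreover have "distinct c" using li c by (simp add: list_inv_def)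
    ultimately show ?thesis by (simp add: distinct_card)
  qed
  let ?X = "{xs. set xs \<subseteq> set L \<and> length xs \<le> 3}"
  have "distinct \<psi>" using li by (simp add: list_inv_def distinct_map)
  then have "length \<psi> = card (set \<psi>)" by (simp add: distinct_card)
  also have "\<dots> \<le> card ?X" by (rule card_mono[OF finite_lists_length_le]) (use cl in auto)
  also have "\<dots> = (\<Sum>i\<le>3. card (set L) ^ i)" by (rule card_lists_length_le) simp
  also have "\<dots> \<le> (\<Sum>i\<le>(3::nat). (n + 1) ^ 3)"
  proof (rule sum_mono)
    fix i :: nat assume "i \<in> {..3}"
    have "card (set L) \<le> n + 1" using card_length[of L] length_le_es[of L] assms(2) by linarith
    then have "card (set L) ^ i \<le> (n + 1) ^ i" by (rule power_mono) simp
    also have "\<dots> \<le> (n + 1) ^ 3" using \<open>i \<in> {..3}\<close> by (intro power_increasing) auto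
    finally show "card (set L) ^ i \<le> (n + 1) ^ 3" .
  qed
  finally have len: "length \<psi> \<le> 4 * (n + 1) ^ 3" by simp
  have "es c \<le> 1 + 3 * (1 + n)" if c: "c \<in> set \<psi>" for c
  proof -
    have "es l \<le> n" if l: "l \<in> set c" for l
    proof -
      have "l \<in> set L" using cl[OF c] l by blast
      then show ?thesis using es_member[of l L] assms(2) by simp
    qed
    from es_le[OF this] have "es c \<le> 1 + length c * (1 + n)" .
    also have "\<dots> \<le> 1 + 3 * (1 + n)" using cl[OF c] by (intro add_left_mono mult_le_mono1) simp
    finally show ?thesis .
  qed
  from es_le[OF this] have "es \<psi> \<le> 1 + length \<psi> * (1 + (1 + 3 * (1 + n)))" .
  also have "\<dots> \<le> formula_bound n" unfolding formula_bound_def using len by (intro add_left_mono mult_le_mono1)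
  finally show ?thesis .
qed

lemma length_split_steps:
  "length (fst ((split_step t L ^^ i) w)) + length (snd ((split_step t L ^^ i) w)) \<le> length (fst w) + length (snd w) + i"
proof (induction i)
  case (Suc i)
  have "length (fst (split_step t L v)) + length (snd (split_step t L v)) \<le> length (fst v) + length (snd v) + 1" for v
    by (auto simp: split_step_def split: list.splits)
  from this[of "(split_step t L ^^ i) w"] show ?case using Suc by simp
qed simp

lemma es_split_steps:
  assumes inv: "split_inv Q t L A ([\<phi>], [])" and t: "t > 0" "es L \<le> n"
    and lam: "(\<mu> :: real) > 1" "\<mu> ^ (2 * t\<^sup>2 - 1) + 1 \<le> \<mu> ^ (2 * t\<^sup>2)"
  shows "es ((split_step t L ^^ i) ([\<phi>], [])) \<le> 3 + 2 * ((i + 1) * (1 + formula_bound n))"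
proof -
  let ?w = "(split_step t L ^^ i) ([\<phi>], [])"
  have "split_inv Q t L A ?w" using split_steps[OF inv t(1) lam] by blast
  then have b: "es \<psi> \<le> formula_bound n" if "\<psi> \<in> set (fst ?w) \<union> set (snd ?w)" for \<psi>
    using that es_formula[OF _ t(2)] by (auto simp: split_inv_def)
  have len: "length (fst ?w) + length (snd ?w) \<le> i + 1" using length_split_steps[of i t L "([\<phi>], [])"] by simp
  have "es (fst ?w) \<le> 1 + length (fst ?w) * (1 + formula_bound n)" "es (snd ?w) \<le> 1 + length (snd ?w) * (1 + formula_bound n)"
    by (rule es_le, use b in blast)+
  moreover have "length (fst ?w) * (1 + formula_bound n) \<le> (i + 1) * (1 + formula_bound n)"
    "length (snd ?w) * (1 + formula_bound n) \<le> (i + 1) * (1 + formula_bound n)"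
    using len by (intro mult_le_mono1, simp)+
  moreover have "es ?w = 1 + es (fst ?w) + es (snd ?w)" by (simp add: enc_prod_def)
  ultimately show ?thesis by linarith
qed

section \<open>Reading the input and writing the decision\<close>

definition load_symbol :: com where
  "load_symbol = Br 0 (\<lambda>s. s = 1) (push_word (2 # code (enc (1 :: nat))))
     (Br 0 (\<lambda>s. s = 2) (push_word (2 # code (enc (2 :: nat)))) (push_word (2 # code (enc (3 :: nat)))))"

text \<open>The input is pushed symbol by symbol onto the empty list and thus appears reversed. Tape
  2 carries stack 0, whose top is 2 exactly if the resulting truth value is
  \<open>True\<close>.\<close>

definition main_com :: "com \<Rightarrow> com" where
  "main_com c = Sq (push 0 1) (Sq (Wh 0 (\<lambda>s. s \<noteq> 0) (Sq load_symbol (Mv 0 Move_Right)))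
     (Sq c (Br 2 (\<lambda>s. s = 2) (Wr [] 1 3 (\<lambda>_. 2)) (Wr [] 1 3 (\<lambda>_. 1)))))"

lemma sxE:
  assumes "sx c \<sigma> \<sigma>' n" "stack_rep \<sigma> (h, t)"
  obtains m h' t' where "m \<le> n" "exec c (h, t) m (h', t')" "stack_rep \<sigma>' (h', t')" "h' 0 = h 0" "t' 0 = t 0"
    "h' 1 = h 1" "t' 1 = t 1"
  using assms unfolding sx_def by (metis one_less_numeral_iff semiring_norm(76) zero_less_numeral)

lemma load_loop:
  assumes "stack_rep \<sigma> (h, t)" "t 0 = word_tape s" "h 0 = int i" "i \<le> length s" "set s \<subseteq> {1, 2, 3}"
    and "\<sigma> 0 = code (enc (rev (take i s)))"
  shows "\<exists>m h' t'. m \<le> 60 * (length s - i) + 1 \<and>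
     exec (Wh 0 (\<lambda>s. s \<noteq> 0) (Sq load_symbol (Mv 0 Move_Right))) (h, t) m (h', t') \<and>
     stack_rep (\<sigma>(0 := code (enc (rev s)))) (h', t') \<and> h' 1 = h 1 \<and> t' 1 = t 1"
  using assms
proof (induction "length s - i" arbitrary: i h t \<sigma>)
  case 0
  have i: "i = length s" using 0(1) 0(5) by simp
  have "t 0 (h 0) = 0" using 0(3,4) i by (simp add: word_tape_def)
  then have "exec (Wh 0 (\<lambda>s. s \<noteq> 0) (Sq load_symbol (Mv 0 Move_Right))) (h, t) 1 (h, t)"
    by (intro exec_WhF) simp
  moreover have "\<sigma>(0 := code (enc (rev s))) = \<sigma>" using 0(7) i by (simp add: fun_eq_iff)
  ultimately show ?case using 0(2) by (intro exI[of _ 1] exI[of _ h] exI[of _ t]) simp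
next
  case (Suc k)
  have i: "i < length s" using Suc.hyps(2) by simp
  define a where "a = s ! i"
  have "s ! i \<in> set s" using i by simp
  then have a: "a \<in> {1, 2, 3}" using Suc.prems(5) by (auto simp: a_def)
  have sc: "t 0 (h 0) = a" using Suc.prems(2,3) i by (simp add: word_tape_def a_def)
  let ?\<sigma> = "\<sigma>(0 := (2 # code (enc a)) @ \<sigma> 0)"
  have "sx (push_word (2 # code (enc a))) \<sigma> ?\<sigma> 40"
  proof (rule sx_mono[OF sx_push_word])
    have "length (code (enc a)) = 2 * a + 1" using es_nat[of a] unfolding sz_def .
    moreover have "a \<le> 3" using a by auto
    ultimately show "4 * length (2 # code (enc a)) + 1 \<le> 40" by simp
  qed
  from sxE[OF this Suc.prems(1)]
  obtain m h1 t1 where 1: "m \<le> 40" "exec (push_word (2 # code (enc a))) (h, t) m (h1, t1)"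
    "stack_rep ?\<sigma> (h1, t1)" "h1 0 = h 0" "t1 0 = t 0" "h1 1 = h 1" "t1 1 = t 1" .
  have "\<exists>m'\<le>42. exec load_symbol (h, t) m' (h1, t1)"
  proof -
    from a consider "a = 1" | "a = 2" | "a = 3" by blast
    then show ?thesis
    proof cases
      case b: 1
      have "exec load_symbol (h, t) (Suc m) (h1, t1)" unfolding load_symbol_def
        by (rule exec_BrT) (use sc 1(2) b in auto)
      then show ?thesis using 1(1) by (intro exI[of _ "Suc m"]) simp
    next
      case b: 2
      have "exec load_symbol (h, t) (Suc (Suc m)) (h1, t1)" unfolding load_symbol_def
        by (rule exec_BrF[OF _ exec_BrT]) (use sc 1(2) b in auto)
      then show ?thesis using 1(1) by (intro exI[of _ "Suc (Suc m)"]) simp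
    next
      case b: 3
      have "exec load_symbol (h, t) (Suc (Suc m)) (h1, t1)" unfolding load_symbol_def
        by (rule exec_BrF[OF _ exec_BrF]) (use sc 1(2) b in auto)
      then show ?thesis using 1(1) by (intro exI[of _ "Suc (Suc m)"]) simp
    qed
  qed
  then obtain m' where m': "m' \<le> 42" "exec load_symbol (h, t) m' (h1, t1)" by blast
  let ?h2 = "h1(0 := h1 0 + shift Move_Right)"
  have body: "exec (Sq load_symbol (Mv 0 Move_Right)) (h, t) (Suc (m' + 1)) (?h2, t1)"
    by (rule exec_Sq[OF m'(2) exec_Mv])
  have rep2: "stack_rep ?\<sigma> (?h2, t1)" using 1(3) by (simp add: stack_rep_def)
  have "\<exists>n h' t'. n \<le> 60 * (length s - Suc i) + 1 \<and>
    exec (Wh 0 (\<lambda>s. s \<noteq> 0) (Sq load_symbol (Mv 0 Move_Right))) (?h2, t1) n (h', t') \<and>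
    stack_rep (?\<sigma>(0 := code (enc (rev s)))) (h', t') \<and> h' 1 = ?h2 1 \<and> t' 1 = t1 1"
  proof (rule Suc.hyps(1)[OF _ rep2])
    show "k = length s - Suc i" using Suc.hyps(2) by simp
    show "t1 0 = word_tape s" using 1(5) Suc.prems(2) by simp
    show "?h2 0 = int (Suc i)" using 1(4) Suc.prems(3) by simp
    show "Suc i \<le> length s" using i by simp
    show "set s \<subseteq> {1, 2, 3}" by (rule Suc.prems(5))
    show "?\<sigma> 0 = code (enc (rev (take (Suc i) s)))"
      using Suc.prems(6) i by (simp add: take_Suc_conv_app_nth a_def)
  qed
  then obtain n h' t' where 2: "n \<le> 60 * (length s - Suc i) + 1"
    "exec (Wh 0 (\<lambda>s. s \<noteq> 0) (Sq load_symbol (Mv 0 Move_Right))) (?h2, t1) n (h', t')"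
    "stack_rep (?\<sigma>(0 := code (enc (rev s)))) (h', t')" "h' 1 = ?h2 1" "t' 1 = t1 1"
    by blast
  have "exec (Wh 0 (\<lambda>s. s \<noteq> 0) (Sq load_symbol (Mv 0 Move_Right))) (h, t) (Suc (Suc (m' + 1) + n)) (h', t')"
    by (rule exec_WhT[OF _ body 2(2)]) (use sc a in auto)
  moreover have "Suc (Suc (m' + 1) + n) \<le> 60 * (length s - i) + 1" using 2(1) m'(1) i by simp
  moreover have "?\<sigma>(0 := code (enc (rev s))) = \<sigma>(0 := code (enc (rev s)))" by simp
  moreover have "h' 1 = h 1" using 2(4) 1(6) by simp
  moreover have "t' 1 = t 1" using 2(5) 1(7) by simp
  ultimately show ?case using 2(3) by metis
qed

theorem machine_of_com:
  "\<exists>M. is_tm M \<and> (\<forall>s b T. set s \<subseteq> {1, 2, 3} \<and> cr c (enc (rev s)) (enc (b :: bool)) T \<longrightarrow>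
     (\<exists>t\<le>T + 100 * (length s + 1). halts_with M s t [enc_bit b]))"
proof -
  obtain M where M: "is_tm M" "\<And>w n h' t' v. exec (main_com c) (\<lambda>_. 0, contents (init w)) n (h', t') \<Longrightarrow>
     t' 1 = word_tape v \<Longrightarrow> \<exists>t\<le>n. halts_with M w t v"
    using compile_com[of "main_com c"] by blast
  have "\<exists>t\<le>T + 100 * (length s + 1). halts_with M s t [enc_bit b]"
    if s: "set s \<subseteq> {1, 2, 3}" and cr: "cr c (enc (rev s)) (enc b) T" for s T and b :: bool
  proof -
    have "tape_of [] = word_tape []" by (auto simp: fun_eq_iff word_tape_def)
    then have r0: "stack_rep (\<lambda>_. []) (\<lambda>_. 0, contents (init s))" by (auto simp: stack_rep_def init_def)
    obtain m1 h1 t1 where 1: "m1 \<le> 3" "exec (push 0 1) (\<lambda>_. 0, contents (init s)) m1 (h1, t1)"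
      "stack_rep ((\<lambda>_. [])(0 := [1])) (h1, t1)" "h1 0 = 0" "t1 0 = contents (init s) 0" "h1 1 = 0" "t1 1 = contents (init s) 1"
      using sxE[OF sx_push r0, of 0 1] by blast
    have "t1 0 = word_tape s" "h1 0 = int 0" using 1 by (simp_all add: init_def)
    then obtain m2 h2 t2 where 2: "m2 \<le> 60 * (length s - 0) + 1"
      "exec (Wh 0 (\<lambda>s. s \<noteq> 0) (Sq load_symbol (Mv 0 Move_Right))) (h1, t1) m2 (h2, t2)"
      "stack_rep (((\<lambda>_. [])(0 := [1]))(0 := code (enc (rev s)))) (h2, t2)" "h2 1 = h1 1" "t2 1 = t1 1"
      using load_loop[OF 1(3), of s 0] s by auto
    let ?\<sigma> = "((\<lambda>_. [])(0 := [1]))(0 := code (enc (rev s)))"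
    have "sx c ?\<sigma> (?\<sigma>(0 := code (enc b) @ [])) T" by (rule crD[OF cr]) auto
    then obtain m3 h3 t3 where 3: "m3 \<le> T" "exec c (h2, t2) m3 (h3, t3)"
      "stack_rep (?\<sigma>(0 := code (enc b) @ [])) (h3, t3)" "h3 1 = h2 1" "t3 1 = t2 1"
      using sxE[OF _ 2(3)] by blast
    have top: "t3 2 (h3 2) = (if b then 2 else 1)"
      using stack_repD[OF 3(3), of 0] by (simp add: numeral_2_eq_2)
    let ?v = "enc_bit b"
    let ?t4 = "t3(1 := (t3 1)(h3 1 := ?v))"
    have 4: "exec (Br 2 (\<lambda>s. s = 2) (Wr [] 1 3 (\<lambda>_. 2)) (Wr [] 1 3 (\<lambda>_. 1))) (h3, t3) (Suc 1) (h3, ?t4)"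
    proof (cases b)
      case True
      have "exec (Wr [] 1 3 (\<lambda>_. 2)) (h3, t3) 1 (h3, ?t4)"
        using exec_Wr[of "[]" 1 3 "\<lambda>_. 2" h3 t3] True by (simp add: clip_def enc_bit_def)
      then show ?thesis by (intro exec_BrT) (use top True in auto)
    next
      case False
      have "exec (Wr [] 1 3 (\<lambda>_. 1)) (h3, t3) 1 (h3, ?t4)"
        using exec_Wr[of "[]" 1 3 "\<lambda>_. 1" h3 t3] False by (simp add: clip_def enc_bit_def)
      then show ?thesis by (intro exec_BrF) (use top False in auto)
    qed
    have "exec (main_com c) (\<lambda>_. 0, contents (init s)) (Suc (m1 + Suc (m2 + Suc (m3 + Suc 1)))) (h3, ?t4)"
      unfolding main_com_def by (rule exec_Sq[OF 1(2) exec_Sq[OF 2(2) exec_Sq[OF 3(2) 4]]])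
    moreover have "?t4 1 = word_tape [?v]"
      using 3(4,5) 2(4,5) 1(6,7) by (auto simp: init_def word_tape_def fun_eq_iff)
    ultimately obtain t where t: "t \<le> Suc (m1 + Suc (m2 + Suc (m3 + Suc 1)))" "halts_with M s t [?v]"
      using M(2) by blast
    have "t \<le> T + 100 * (length s + 1)" using t(1) 1(1) 2(1) 3(1) by simp
    then show ?thesis using t(2) by blast
  qed
  then show ?thesis using M(1) by blast
qed

definition final_formulas :: "params \<Rightarrow> nat list \<Rightarrow> nat list list list list" where
  "final_formulas P rs = snd ((split_step (par_t P) (input_lits rs) ^^ 3 ^ fuel_size P rs) ([initial_formula (input_clauses rs)], []))"

definition all_queries :: "params \<Rightarrow> nat list \<Rightarrow> tagged list" where
  "all_queries P rs = concat (map (\<lambda>\<psi>. items (par_S P) (par_F P)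
     (gverts (par_cols P) (chunk_size P rs) ((expand ^^ chunk_size P rs) [[]]) \<psi>)) (final_formulas P rs))"

lemma PB_loop_time: "PB b \<Longrightarrow> PB (\<lambda>n. loop_time d (b n))"
  unfolding loop_time_def by (intro PB_intros)

text \<open>\<open>c\<close> and \<open>p\<close> precede \<open>P\<close>. The measure
  \<open>N\<close> includes \<open>3 ^ chunk_size\<close> and \<open>3 ^ fuel_size\<close> besides
  the input, so the exponential loops are polynomial in it.\<close>

lemma query_pipeline:
  "\<exists>c p. PB p \<and> (\<forall>P rs N. es P + es rs + 1 \<le> N \<longrightarrow> 3 ^ chunk_size P rs \<le> N \<longrightarrow> 3 ^ fuel_size P rs \<le> N \<longrightarrow>
     (\<forall>i. es ((split_step (par_t P) (input_lits rs) ^^ i) ([initial_formula (input_clauses rs)], [])) \<le> N + N * i) \<longrightarrow>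
     cr c (enc (P, rs)) (enc (all_queries P rs, [] :: tagged list)) (p N) \<and> es (all_queries P rs) \<le> p N)"
proof -
  obtain cA dA where A: "\<And>x. cr cA (enc x) (enc (stageA x)) (pl dA (es x))" "\<And>x. es (stageA x) \<le> pl dA (es x)"
    using ptE[OF pt_stageA] by metis
  obtain cB dB where B: "\<And>x. cr cB (enc x) (enc (stageB x)) (pl dB (es x))" "\<And>x. es (stageB x) \<le> pl dB (es x)"
    using ptE[OF pt_stageB] by metis
  obtain cC dC where C: "\<And>x. cr cC (enc x) (enc (stageC x)) (pl dC (es x))" "\<And>x. es (stageC x) \<le> pl dC (es x)"
    using ptE[OF pt_stageC] by metis
  obtain cD dD where D: "\<And>x. cr cD (enc x) (enc (stageD x)) (pl dD (es x))" "\<And>x. es (stageD x) \<le> pl dD (es x)"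
    using ptE[OF pt_stageD] by metis
  obtain f1 d1 where f1: "\<And>y :: unit \<times> ctx1 \<times> nat list list. cr f1 (enc y) (enc (fst (snd y), expand (snd (snd y)))) (pl d1 (es y))"
    using ptE[OF pt_loop_bodies(1)] by metis
  obtain f2 d2 where f2: "\<And>y :: unit \<times> ctx2 \<times> nat list list. cr f2 (enc y) (enc (fst (snd y), expand (snd (snd y)))) (pl d2 (es y))"
    using ptE[OF pt_loop_bodies(2)] by metis
  obtain f3 d3 where f3: "\<And>y :: nat list \<times> ctx3 \<times> nat list list list list \<times> nat list list list list.
     cr f3 (enc y) (enc (fst (snd y), split_step (par_t (fst (fst (snd y)))) (fst (snd (fst (snd y)))) (snd (snd y)))) (pl d3 (es y))"
    using ptE[OF pt_loop_bodies(3)] by metis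
  define b1 where "b1 N = pl dA N + 1 + 8 * (N * N)" for N
  define b2 where "b2 N = pl dB (b1 N) + 1 + 8 * (N * N)" for N
  define b3 where "b3 N = pl dC (b2 N) + 1 + (N + N * N)" for N
  define p where "p N = Suc (pl dA N + Suc (loop_time d1 (b1 N) + Suc (pl dB (b1 N) + Suc (loop_time d2 (b2 N) +
    Suc (pl dC (b2 N) + Suc (loop_time d3 (b3 N) + pl dD (b3 N)))))))" for N
  define c where "c = Sq cA (Sq (foldc f1) (Sq cB (Sq (foldc f2) (Sq cC (Sq (foldc f3) cD)))))"
  have "PB (\<lambda>N. b1 N)" unfolding b1_def by (intro PB_intros)
  then have "PB (\<lambda>N. b2 N)" unfolding b2_def by (intro PB_intros)
  then have "PB (\<lambda>N. b3 N)" unfolding b3_def by (intro PB_intros)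
  have "PB (\<lambda>N. p N)" unfolding p_def
    by (intro PB_intros' PB_loop_time \<open>PB (\<lambda>N. b1 N)\<close> \<open>PB (\<lambda>N. b2 N)\<close> \<open>PB (\<lambda>N. b3 N)\<close>)
  moreover have "cr c (enc (P, rs)) (enc (all_queries P rs, [] :: tagged list)) (p N) \<and> es (all_queries P rs) \<le> p N"
    if N: "es P + es rs + 1 \<le> N" "3 ^ chunk_size P rs \<le> N" "3 ^ fuel_size P rs \<le> N"
      and st: "\<forall>i. es ((split_step (par_t P) (input_lits rs) ^^ i) ([initial_formula (input_clauses rs)], [])) \<le> N + N * i"
    for P rs N
  proof -
    let ?L = "chunk_size P rs" let ?J = "fuel_size P rs" let ?l = "input_lits rs" let ?\<phi> = "initial_formula (input_clauses rs)"
    let ?W = "(expand ^^ ?L) [[]]" let ?V = "(expand ^^ ?J) [[]]"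
    let ?c1 = "(P, ?l, ?\<phi>, ?L, ?J)" let ?c2 = "((P, ?l, ?\<phi>, ?L), ?W)" let ?c3 = "(P, ?l, ?L, ?W)"
    let ?s = "(split_step (par_t P) ?l ^^ 3 ^ ?J) ([?\<phi>], [])"
    have ex: "es ((expand ^^ i) [[]]) \<le> 8 * (N * N)" if i: "i \<le> j" "3 ^ j \<le> N" for i j
    proof -
      have "(3::nat) ^ i \<le> 3 ^ j" using i(1) by (intro power_increasing) auto
      from order_trans[OF this i(2)] have "(3::nat) ^ i \<le> N" .
      from mult_le_mono[OF this this] have "(3::nat) ^ i * 3 ^ i \<le> N * N" .
      then show ?thesis using es_expand_pow[of i] by linarith
    qed
    have sA: "stageA (P, rs) = (replicate ?L (), ?c1, [[]])" by (simp add: stageA_def)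
    have tA: "pl dA (es (P, rs)) \<le> pl dA N" by (rule pl_mono) (use N(1) in auto)
    have 1: "cr cA (enc (P, rs)) (enc (replicate ?L (), ?c1, [[]] :: nat list list)) (pl dA N)"
      using cr_mono[OF A(1) tA] unfolding sA .
    have z1: "es (replicate ?L (), ?c1, [[]] :: nat list list) \<le> pl dA N"
      using order_trans[OF A(2) tA] unfolding sA .
    note l1 = cr_loop_context[where f = "\<lambda>_. expand", OF f1 z1, of "8 * (N * N)"]
    have i1: "es ((expand ^^ i) [[]]) \<le> 8 * (N * N)" if "i \<le> length (replicate ?L ())" for i
      using ex[OF _ N(2), of i] that by simp
    have 2: "cr (foldc f1) (enc (replicate ?L (), ?c1, [[]] :: nat list list)) (enc (?c1, ?W)) (loop_time d1 (b1 N))"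
      and z2: "es (?c1, ?W) \<le> b1 N"
      using l1[OF i1] unfolding length_replicate b1_def by blast+
    have sB: "stageB (?c1, ?W) = (replicate ?J (), ?c2, [[]])" by (simp add: stageB_def)
    have tB: "pl dB (es (?c1, ?W)) \<le> pl dB (b1 N)" by (rule pl_mono[OF order_refl z2])
    have 3: "cr cB (enc (?c1, ?W)) (enc (replicate ?J (), ?c2, [[]] :: nat list list)) (pl dB (b1 N))"
      using cr_mono[OF B(1) tB] unfolding sB .
    have z3: "es (replicate ?J (), ?c2, [[]] :: nat list list) \<le> pl dB (b1 N)"
      using order_trans[OF B(2) tB] unfolding sB .
    note l2 = cr_loop_context[where f = "\<lambda>_. expand", OF f2 z3, of "8 * (N * N)"]
    have i2: "es ((expand ^^ i) [[]]) \<le> 8 * (N * N)" if "i \<le> length (replicate ?J ())" for i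
      using ex[OF _ N(3), of i] that by simp
    have 4: "cr (foldc f2) (enc (replicate ?J (), ?c2, [[]] :: nat list list)) (enc (?c2, ?V)) (loop_time d2 (b2 N))"
      and z4: "es (?c2, ?V) \<le> b2 N"
      using l2[OF i2] unfolding length_replicate b2_def by blast+
    have sC: "stageC (?c2, ?V) = (?V, ?c3, ([?\<phi>], []))" by (simp add: stageC_def)
    have tC: "pl dC (es (?c2, ?V)) \<le> pl dC (b2 N)" by (rule pl_mono[OF order_refl z4])
    have 5: "cr cC (enc (?c2, ?V)) (enc (?V, ?c3, ([?\<phi>], [] :: nat list list list list))) (pl dC (b2 N))"
      using cr_mono[OF C(1) tC] unfolding sC .
    have z5: "es (?V, ?c3, ([?\<phi>], [] :: nat list list list list)) \<le> pl dC (b2 N)"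
      using order_trans[OF C(2) tC] unfolding sC .
    note l3 = cr_loop_context[where f = "\<lambda>c. split_step (par_t (fst c)) (fst (snd c))", OF f3 z5, of "N + N * N", unfolded fst_conv snd_conv length_expand_pow]
    have i3: "es ((split_step (par_t P) ?l ^^ i) ([?\<phi>], [])) \<le> N + N * N" if i: "i \<le> 3 ^ ?J" for i
    proof -
      have "N * i \<le> N * N" using order_trans[OF i N(3)] by (rule mult_le_mono2)
      then show ?thesis using spec[OF st, of i] by linarith
    qed
    have 6: "cr (foldc f3) (enc (?V, ?c3, ([?\<phi>], [] :: nat list list list list))) (enc (?c3, ?s)) (loop_time d3 (b3 N))"
      and z6: "es (?c3, ?s) \<le> b3 N"
      using l3[OF i3] unfolding b3_def by blast+
    have sD: "stageD (?c3, ?s) = (all_queries P rs, [])"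
      by (simp add: stageD_def all_queries_def final_formulas_def)
    have tD: "pl dD (es (?c3, ?s)) \<le> pl dD (b3 N)" by (rule pl_mono[OF order_refl z6])
    have 7: "cr cD (enc (?c3, ?s)) (enc (all_queries P rs, [] :: tagged list)) (pl dD (b3 N))"
      using cr_mono[OF D(1) tD] unfolding sD .
    have z7: "es (all_queries P rs, [] :: tagged list) \<le> pl dD (b3 N)"
      using order_trans[OF D(2) tD] unfolding sD .
    have "cr c (enc (P, rs)) (enc (all_queries P rs, [] :: tagged list)) (p N)"
      unfolding c_def p_def by (rule cr_Sq[OF 1 cr_Sq[OF 2 cr_Sq[OF 3 cr_Sq[OF 4 cr_Sq[OF 5 cr_Sq[OF 6 7]]]]]])
    moreover have "es (all_queries P rs) \<le> p N" using z7 by (simp add: p_def)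
    ultimately show ?thesis ..
  qed
  ultimately show ?thesis by (intro exI[of _ c] exI[of _ p]) simp
qed

definition answered :: "(nat list \<Rightarrow> nat list) \<Rightarrow> tagged \<Rightarrow> tagged" where
  "answered ans x = (fst x, rev (ans (rev (snd x))))"

text \<open>The polynomial \<open>q\<close> precedes \<open>M\<close>; only the program and the
  factor \<open>\<kappa>\<close> depend on the machine whose answers are computed.\<close>

lemma query_loop:
  "\<exists>q. PB q \<and> (\<forall>M. is_tm M \<longrightarrow> (\<exists>c \<kappa>. \<forall>xs ans N. es xs \<le> N \<longrightarrow>
     (\<forall>x\<in>set xs. set (snd x) \<subseteq> {1, 2, 3} \<and> ans (rev (snd x)) \<noteq> [] \<and> set (ans (rev (snd x))) \<subseteq> {1, 2, 3} \<and>
        (\<exists>t\<le>N. halts_with M (rev (snd x)) t (ans (rev (snd x))))) \<longrightarrow>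
     cr c (enc (xs, [] :: tagged list)) (enc (rev (map (answered ans) xs))) (\<kappa> * q N) \<and> es (rev (map (answered ans) xs)) \<le> q N))"
proof -
  define B where "B N = N + 1 + N * (17 * N + 11)" for N :: nat
  define q where "q N = B N + (B N * ((2 * N + 1) + 1000 * (2 * B N + 1) + 100 * (17 * N + 10) + 10) + 3000 * ((B N + 1) * (2 * B N + 1)))" for N
  have "PB (\<lambda>N. B N)" unfolding B_def by (intro PB_intros)
  then have "PB (\<lambda>N. q N)" unfolding q_def by (intro PB_intros)
  moreover have "\<exists>c \<kappa>. \<forall>xs ans N. es xs \<le> N \<longrightarrow>
     (\<forall>x\<in>set xs. set (snd x) \<subseteq> {1, 2, 3} \<and> ans (rev (snd x)) \<noteq> [] \<and> set (ans (rev (snd x))) \<subseteq> {1, 2, 3} \<and>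
        (\<exists>t\<le>N. halts_with M (rev (snd x)) t (ans (rev (snd x))))) \<longrightarrow>
     cr c (enc (xs, [] :: tagged list)) (enc (rev (map (answered ans) xs))) (\<kappa> * q N) \<and> es (rev (map (answered ans) xs)) \<le> q N"
    if M: "is_tm M" for M
  proof -
    obtain cM \<kappa> where cM: "\<And>w v t. set w \<subseteq> {1, 2, 3} \<Longrightarrow> v \<noteq> [] \<Longrightarrow> set v \<subseteq> {1, 2, 3} \<Longrightarrow> halts_with M w t v \<Longrightarrow>
       cr cM (enc (rev w)) (enc (rev v)) (\<kappa> * (t + length w + 1)) \<and> length v \<le> length w + 1 + t"
      using cr_simulation[OF M] by metis
    define f where "f = pairc (pairc (Sq fstc fstc) (Sq (Sq fstc sndc) cM)) sndc"
    have "cr (foldc f) (enc (xs, [] :: tagged list)) (enc (rev (map (answered ans) xs))) ((\<kappa> + 1) * q N) \<and>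
        es (rev (map (answered ans) xs)) \<le> q N"
      if xs: "es xs \<le> N" and ans: "\<And>x. x \<in> set xs \<Longrightarrow> set (snd x) \<subseteq> {1, 2, 3} \<and> ans (rev (snd x)) \<noteq> [] \<and>
        set (ans (rev (snd x))) \<subseteq> {1, 2, 3} \<and> (\<exists>t\<le>N. halts_with M (rev (snd x)) t (ans (rev (snd x))))" for xs ans N
    proof -
      let ?s = "\<lambda>i. rev (map (answered ans) (take i xs))"
      have one: "cr cM (enc (snd x)) (enc (rev (ans (rev (snd x))))) (\<kappa> * (2 * N + 1)) \<and> es (answered ans x) \<le> 17 * N + 10"
        if x: "x \<in> set xs" for x
      proof -
        obtain t where t: "t \<le> N" "halts_with M (rev (snd x)) t (ans (rev (snd x)))" using ans[OF x] by blast
        have c: "cr cM (enc (rev (rev (snd x)))) (enc (rev (ans (rev (snd x))))) (\<kappa> * (t + length (rev (snd x)) + 1)) \<and>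
            length (ans (rev (snd x))) \<le> length (rev (snd x)) + 1 + t"
          by (rule cM) (use ans[OF x] t(2) in auto)
        have ex: "es x < N" using es_member[OF x] xs by simp
        have xx: "es x = 1 + es (fst x) + es (snd x)" by (simp add: enc_prod_def)
        have l: "length (snd x) \<le> N" using length_le_es[of "snd x"] ex xx by simp
        have "\<kappa> * (t + length (rev (snd x)) + 1) \<le> \<kappa> * (2 * N + 1)" using t(1) l by (intro mult_le_mono2) simp
        then have 1: "cr cM (enc (snd x)) (enc (rev (ans (rev (snd x))))) (\<kappa> * (2 * N + 1))"
          using cr_mono[OF conjunct1[OF c]] by simp
        have "es y \<le> 7" if "y \<in> set (ans (rev (snd x)))" for y using ans[OF x] that by auto
        then have "es (ans (rev (snd x))) \<le> 1 + length (ans (rev (snd x))) * (1 + 7)" by (rule es_le)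
        moreover have "length (ans (rev (snd x))) \<le> 2 * N + 1" using c t(1) l by simp
        ultimately have "es (answered ans x) \<le> 17 * N + 10" using ex xx by (simp add: answered_def)
        with 1 show ?thesis ..
      qed
      have Bx: "es xs \<le> B N" using xs by (simp add: B_def)
      have Bs: "es (?s i) \<le> B N" for i
      proof -
        have "es y \<le> 17 * N + 10" if "y \<in> set (map (answered ans) (take i xs))" for y
          using that one by (auto dest: in_set_takeD)
        then have "es (map (answered ans) (take i xs)) \<le> 1 + length (map (answered ans) (take i xs)) * (1 + (17 * N + 10))"
          by (rule es_le)
        also have "\<dots> \<le> 1 + N * (1 + (17 * N + 10))"
          using length_le_es[of xs] xs by (intro add_left_mono mult_le_mono1) simp
        also have "\<dots> \<le> B N" unfolding B_def by (simp add: algebra_simps)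
        finally show ?thesis by simp
      qed
      have "cr f (enc (xs ! i, ?s i)) (enc (?s (Suc i))) (\<kappa> * (2 * N + 1) + 1000 * (2 * B N + 1) + 100 * (17 * N + 10) + 10)"
        if i: "i < length xs" for i
      proof -
        obtain tg rq where x: "xs ! i = (tg, rq)" by fastforce
        let ?S = "es (xs ! i, ?s i)"
        have m: "xs ! i \<in> set xs" using i by simp
        have S: "?S \<le> 2 * B N + 1" using es_member[OF m] Bx Bs[of i] by simp
        have c1: "cr (Sq fstc fstc) (enc (xs ! i, ?s i)) (enc tg) (Suc (100 * ?S + 100 * ?S))"
        proof (rule cr_mono[OF cr_Sq[OF cr_fstc cr_fstc, THEN back_subst[where P = "\<lambda>z. cr _ _ z _"]]])
        qed (simp_all add: x)
        have c2: "cr (Sq (Sq fstc sndc) cM) (enc (xs ! i, ?s i)) (enc (rev (ans (rev rq)))) (Suc (Suc (100 * ?S + 100 * ?S) + \<kappa> * (2 * N + 1)))"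
        proof (rule cr_Sq)
          show "cr (Sq fstc sndc) (enc (xs ! i, ?s i)) (enc rq) (Suc (100 * ?S + 100 * ?S))"
            by (rule cr_mono[OF cr_Sq[OF cr_fstc cr_sndc, THEN back_subst[where P = "\<lambda>z. cr _ _ z _"]]]) (simp_all add: x)
          show "cr cM (enc rq) (enc (rev (ans (rev rq)))) (\<kappa> * (2 * N + 1))" using one[OF m] by (simp add: x)
        qed
        have c3: "cr sndc (enc (xs ! i, ?s i)) (enc (?s i)) (100 * ?S)"
          using cr_sndc[of "enc (xs ! i, ?s i)"] by simp
        note c4 = cr_pairc[OF cr_pairc[OF c1 c2] c3, folded f_def]
        have a: "answered ans (xs ! i) = (tg, rev (ans (rev rq)))" by (simp add: answered_def x)
        have v: "es (tg, rev (ans (rev rq))) \<le> 17 * N + 10" using one[OF m] unfolding a by blast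
        have r: "Cn (Cn (enc tg) (enc (rev (ans (rev rq))))) (enc (?s i)) = enc (?s (Suc i))"
          using i by (simp add: take_Suc_conv_app_nth a)
        have tg: "es tg \<le> ?S" by (simp add: x)
        show ?thesis
        proof (rule cr_mono[OF c4[unfolded r]])
          have ar: "Suc (100 * S + 100 * S) + Suc (Suc (100 * S + 100 * S) + K) + 100 * (S + T) + 100 * S + 100 * (S + V) \<le>
             K + 1000 * b + 100 * W + 10" if "S \<le> b" "T \<le> S" "V \<le> W" for S T V W K b :: nat
            using that by simp
          show "Suc (100 * ?S + 100 * ?S) + Suc (Suc (100 * ?S + 100 * ?S) + \<kappa> * (2 * N + 1)) + 100 * (?S + es tg) + 100 * ?S +
             100 * (?S + sz (Cn (enc tg) (enc (rev (ans (rev rq)))))) \<le> \<kappa> * (2 * N + 1) + 1000 * (2 * B N + 1) + 100 * (17 * N + 10) + 10"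
            by (rule ar[OF S tg]) (use v in simp)
        qed
      qed
      from cr_loop[where s = ?s, OF this Bx Bs]
      have 1: "cr (foldc f) (enc (xs, [] :: tagged list)) (enc (rev (map (answered ans) xs)))
        (B N * (\<kappa> * (2 * N + 1) + 1000 * (2 * B N + 1) + 100 * (17 * N + 10) + 10) + 3000 * ((B N + 1) * (2 * B N + 1)))"
        by simp
      define a b where "a = 1000 * (2 * B N + 1) + 100 * (17 * N + 10) + 10" and "b = 3000 * ((B N + 1) * (2 * B N + 1))"
      have q: "q N = B N + (B N * ((2 * N + 1) + a) + b)" by (simp add: q_def a_def b_def)
      have "B N * (\<kappa> * (2 * N + 1) + a) + b \<le> (\<kappa> + 1) * q N" unfolding q by (simp add: algebra_simps)
      then have "B N * (\<kappa> * (2 * N + 1) + 1000 * (2 * B N + 1) + 100 * (17 * N + 10) + 10) + 3000 * ((B N + 1) * (2 * B N + 1)) \<le> (\<kappa> + 1) * q N"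
        by (simp add: a_def b_def add.assoc)
      from cr_mono[OF 1 this] have "cr (foldc f) (enc (xs, [] :: tagged list)) (enc (rev (map (answered ans) xs))) ((\<kappa> + 1) * q N)" .
      moreover have "es (rev (map (answered ans) xs)) \<le> q N" using Bs[of "length xs"] by (simp add: q_def)
      ultimately show ?thesis ..
    qed
    then show ?thesis by (intro exI[of _ "foldc f"] exI[of _ "\<kappa> + 1"]) blast
  qed
  ultimately show ?thesis by (intro exI[of _ q]) simp
qed

text \<open>The order of the quantifiers is the point: \<open>e\<close> comes before
  \<open>M\<close> and \<open>P\<close>, because \<open>q\<close>, and with it
  \<open>\<beta>\<close>, is later computed from \<open>e\<close>.\<close>

lemma solver:
  "\<exists>e. \<forall>M P. is_tm M \<longrightarrow> (\<exists>c \<kappa>. \<forall>rs N ans. es P + es rs + 1 \<le> N \<longrightarrow> 3 ^ chunk_size P rs \<le> N \<longrightarrow> 3 ^ fuel_size P rs \<le> N \<longrightarrow>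
     (\<forall>i. es ((split_step (par_t P) (input_lits rs) ^^ i) ([initial_formula (input_clauses rs)], [])) \<le> N + N * i) \<longrightarrow>
     (\<forall>x\<in>set (all_queries P rs). set (snd x) \<subseteq> {1, 2, 3} \<and> ans (rev (snd x)) \<noteq> [] \<and> set (ans (rev (snd x))) \<subseteq> {1, 2, 3} \<and>
        (\<exists>t\<le>N. halts_with M (rev (snd x)) t (ans (rev (snd x))))) \<longrightarrow>
     cr c (enc rs) (enc (final_answer (rev (map (answered ans) (all_queries P rs))))) (\<kappa> * pl e N))"
proof -
  obtain cQ p where p: "PB p" and Q: "\<And>P rs N. es P + es rs + 1 \<le> N \<Longrightarrow> 3 ^ chunk_size P rs \<le> N \<Longrightarrow> 3 ^ fuel_size P rs \<le> N \<Longrightarrow>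
     (\<forall>i. es ((split_step (par_t P) (input_lits rs) ^^ i) ([initial_formula (input_clauses rs)], [])) \<le> N + N * i) \<Longrightarrow>
     cr cQ (enc (P, rs)) (enc (all_queries P rs, [] :: tagged list)) (p N) \<and> es (all_queries P rs) \<le> p N"
    using query_pipeline by metis
  obtain q where q: "PB q" and R: "\<And>M. is_tm M \<Longrightarrow> (\<exists>c \<kappa>. \<forall>xs ans N. es xs \<le> N \<longrightarrow>
     (\<forall>x\<in>set xs. set (snd x) \<subseteq> {1, 2, 3} \<and> ans (rev (snd x)) \<noteq> [] \<and> set (ans (rev (snd x))) \<subseteq> {1, 2, 3} \<and>
        (\<exists>t\<le>N. halts_with M (rev (snd x)) t (ans (rev (snd x))))) \<longrightarrow>
     cr c (enc (xs, [] :: tagged list)) (enc (rev (map (answered ans) xs))) (\<kappa> * q N) \<and> es (rev (map (answered ans) xs)) \<le> q N)"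
    using query_loop by metis
  obtain cE dE where E: "\<And>x. cr cE (enc x) (enc (final_answer x)) (pl dE (es x))" 
    using ptE[OF pt_final_answer0] by metis
  obtain dp where dp: "\<And>n. p n \<le> pl dp n" using PB_obtain[OF p] by metis
  obtain dq where dq: "\<And>n. q n \<le> pl dq n" using PB_obtain[OF q] by metis
  define r where "r N = 4 * (N + 1) + 1 + pl dp N + pl dq (pl dp N + N) + pl dE (pl dq (pl dp N + N)) + 3" for N
  have "PB (\<lambda>N. r N)" unfolding r_def by (intro PB_intros)
  then obtain e where e: "\<And>N. r N \<le> pl e N" using PB_obtain by metis
  have "\<exists>c \<kappa>. \<forall>rs N ans. es P + es rs + 1 \<le> N \<longrightarrow> 3 ^ chunk_size P rs \<le> N \<longrightarrow> 3 ^ fuel_size P rs \<le> N \<longrightarrow>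
     (\<forall>i. es ((split_step (par_t P) (input_lits rs) ^^ i) ([initial_formula (input_clauses rs)], [])) \<le> N + N * i) \<longrightarrow>
     (\<forall>x\<in>set (all_queries P rs). set (snd x) \<subseteq> {1, 2, 3} \<and> ans (rev (snd x)) \<noteq> [] \<and> set (ans (rev (snd x))) \<subseteq> {1, 2, 3} \<and>
        (\<exists>t\<le>N. halts_with M (rev (snd x)) t (ans (rev (snd x))))) \<longrightarrow>
     cr c (enc rs) (enc (final_answer (rev (map (answered ans) (all_queries P rs))))) (\<kappa> * pl e N)"
    if M: "is_tm M" for M P
  proof -
    obtain cR \<kappa> where cR: "\<And>xs ans N. es xs \<le> N \<Longrightarrow>
     (\<forall>x\<in>set xs. set (snd x) \<subseteq> {1, 2, 3} \<and> ans (rev (snd x)) \<noteq> [] \<and> set (ans (rev (snd x))) \<subseteq> {1, 2, 3} \<and>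
        (\<exists>t\<le>N. halts_with M (rev (snd x)) t (ans (rev (snd x))))) \<Longrightarrow>
     cr cR (enc (xs, [] :: tagged list)) (enc (rev (map (answered ans) xs))) (\<kappa> * q N) \<and> es (rev (map (answered ans) xs)) \<le> q N"
      using R[OF M] by metis
    define c where "c = Sq (push_word (2 # code (enc P))) (Sq cQ (Sq cR cE))"
    have "cr c (enc rs) (enc (final_answer (rev (map (answered ans) (all_queries P rs))))) ((\<kappa> + 1) * pl e N)"
      if N: "es P + es rs + 1 \<le> N" "3 ^ chunk_size P rs \<le> N" "3 ^ fuel_size P rs \<le> N"
        and st: "\<forall>i. es ((split_step (par_t P) (input_lits rs) ^^ i) ([initial_formula (input_clauses rs)], [])) \<le> N + N * i"
        and an: "\<forall>x\<in>set (all_queries P rs). set (snd x) \<subseteq> {1, 2, 3} \<and> ans (rev (snd x)) \<noteq> [] \<and> set (ans (rev (snd x))) \<subseteq> {1, 2, 3} \<and>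
          (\<exists>t\<le>N. halts_with M (rev (snd x)) t (ans (rev (snd x))))" for rs N ans
    proof -
      let ?xs = "all_queries P rs" let ?N = "pl dp N + N"
      have 0: "cr (push_word (2 # code (enc P))) (enc rs) (enc (P, rs)) (4 * (N + 1) + 1)"
      proof (rule crI)
        fix \<sigma> :: "nat \<Rightarrow> nat list" and r assume s: "\<sigma> 0 = code (enc rs) @ r"
        have "sx (push_word (2 # code (enc P))) \<sigma> (\<sigma>(0 := (2 # code (enc P)) @ \<sigma> 0)) (4 * (N + 1) + 1)"
          by (rule sx_mono[OF sx_push_word]) (use N(1) in \<open>simp add: sz_def\<close>)
        then show "sx (push_word (2 # code (enc P))) \<sigma> (\<sigma>(0 := code (enc (P, rs)) @ r)) (4 * (N + 1) + 1)"
          by (simp add: s)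
      qed
      note 1 = Q[OF N st]
      have x: "es ?xs \<le> ?N" using 1 dp[of N] by (simp add: trans_le_add1)
      have an': "\<forall>x\<in>set ?xs. set (snd x) \<subseteq> {1, 2, 3} \<and> ans (rev (snd x)) \<noteq> [] \<and> set (ans (rev (snd x))) \<subseteq> {1, 2, 3} \<and>
          (\<exists>t\<le>?N. halts_with M (rev (snd x)) t (ans (rev (snd x))))"
      proof
        fix x assume "x \<in> set ?xs"
        note a = bspec[OF an this]
        then obtain t where "t \<le> N" "halts_with M (rev (snd x)) t (ans (rev (snd x)))" by blast
        then have "\<exists>t\<le>?N. halts_with M (rev (snd x)) t (ans (rev (snd x)))" by (intro exI[of _ t]) simp
        then show "set (snd x) \<subseteq> {1, 2, 3} \<and> ans (rev (snd x)) \<noteq> [] \<and> set (ans (rev (snd x))) \<subseteq> {1, 2, 3} \<and>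
          (\<exists>t\<le>?N. halts_with M (rev (snd x)) t (ans (rev (snd x))))" using a by blast
      qed
      note 2 = cR[OF x an']
      have z: "es (rev (map (answered ans) ?xs)) \<le> pl dq ?N" using 2 dq[of ?N] by (meson order_trans)
      have 3: "cr cE (enc (rev (map (answered ans) ?xs))) (enc (final_answer (rev (map (answered ans) ?xs)))) (pl dE (pl dq ?N))"
        by (rule cr_mono[OF E pl_mono[OF order_refl z]])
      note all = cr_Sq[OF 0 cr_Sq[OF conjunct1[OF 1] cr_Sq[OF conjunct1[OF 2] 3]], folded c_def]
      show ?thesis
      proof (rule cr_mono[OF all])
        have "\<kappa> * q ?N \<le> \<kappa> * pl dq ?N" using dq by (rule mult_le_mono2)
        also have "\<dots> \<le> \<kappa> * pl e N" using e[of N] by (intro mult_le_mono2) (simp add: r_def)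
        finally have k: "\<kappa> * q ?N \<le> \<kappa> * pl e N" .
        have "4 * (N + 1) + 1 + pl dp N + pl dE (pl dq ?N) + 3 \<le> pl e N" using e[of N] by (simp add: r_def)
        then show "Suc (4 * (N + 1) + 1 + Suc (p N + Suc (\<kappa> * q ?N + pl dE (pl dq ?N)))) \<le> (\<kappa> + 1) * pl e N"
          using k dp[of N] unfolding add_mult_distrib by linarith
      qed
    qed
    then show ?thesis by (intro exI[of _ c] exI[of _ "\<kappa> + 1"]) blast
  qed
  then show ?thesis by (intro exI[of _ e]) simp
qed

section \<open>Words exchanged with the given machine\<close>

lemma enc_graph_symbols: "set (enc_graph G) \<subseteq> {1, 2, 3}"
  using bin_symbols by (fastforce simp: enc_graph_def Let_def Defs.enc_nat_def enc_bit_def)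

lemma enc_nat_symbols: "set (Defs.enc_nat n) \<subseteq> {1, 2, 3}"
  using bin_symbols[of n] by (auto simp: Defs.enc_nat_def)

lemma enc_colored_symbols: "set (enc_colored H G c) \<subseteq> {1, 2, 3}"
proof -
  have "set (concat (map (\<lambda>v. Defs.enc_nat (c v)) xs)) \<subseteq> {1, 2, 3}" for xs
    using enc_nat_symbols by (induction xs) auto
  from this[of "[0..<card (verts G)]"] show ?thesis
    using enc_graph_symbols[of H] enc_graph_symbols[of G] unfolding enc_colored_def by simp
qed

lemma enc_rat_symbols: "enc_rat r \<noteq> []" "set (enc_rat r) \<subseteq> {1, 2, 3}"
proof -
  have "set (enc_int i) \<subseteq> {1, 2, 3} \<and> enc_int i \<noteq> []" for i
    using enc_nat_symbols[of "nat \<bar>i\<bar>"] by (auto simp: enc_int_def enc_bit_def)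
  then show "enc_rat r \<noteq> []" "set (enc_rat r) \<subseteq> {1, 2, 3}"
    by (auto simp: enc_rat_def split: prod.splits)
qed

lemma enc_cnf_symbols: "set (enc_cnf \<phi>) \<subseteq> {1, 2, 3}"
proof -
  have "set (enc_clause C) \<subseteq> {1, 2, 3}" for C
  proof (induction C)
    case (Cons l C)
    then show ?case using enc_nat_symbols[of "snd l"] by (cases l) (auto simp: enc_clause_def enc_bit_def)
  qed (simp add: enc_clause_def)
  then show ?thesis by (induction \<phi>) (auto simp: enc_cnf_def)
qed

text \<open>A tape does not show where trailing blanks begin, so a word is determined by it only if
  it contains no blank.\<close>

lemma word_tape_inj:
  assumes "word_tape v = word_tape w" "0 \<notin> set v" "0 \<notin> set w" shows "v = w"
proof -
  have n: "u ! i = 0 \<longleftrightarrow> False" if "i < length u" "0 \<notin> set u" for u :: "nat list" and i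
    using that nth_mem[of i u] by metis
  have l: "i < length v \<longleftrightarrow> i < length w" for i
    using fun_cong[OF assms(1), of "int i"] n[of i v] n[of i w] assms(2,3) by (auto simp: word_tape_def split: if_splits)
  have "length v = length w" using l[of "length v"] l[of "length w"] by simp
  moreover have "v ! i = w ! i" if "i < length v" for i
    using fun_cong[OF assms(1), of "int i"] that l[of i] by (simp add: word_tape_def)
  ultimately show ?thesis by (rule nth_equalityI)
qed

lemma halts_with_unique:
  assumes "halts_with M w t v" "halts_with M w t' v'" "set v \<subseteq> {1, 2, 3}" "set v' \<subseteq> {1, 2, 3}"
  shows "v = v'"
proof -
  have "\<not> t < t'" "\<not> t' < t" using assms(1,2) by (auto simp: halts_with_def)
  then have "t = t'" by simp
  then have "word_tape v = word_tape v'" using assms(1,2) by (simp add: halts_with_def)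
  then show ?thesis by (rule word_tape_inj) (use assms(3,4) in auto)
qed

text \<open>The list that the program computes as \<open>gverts\<close>, with numbers in place of
  words as colours, which is the form that the combinatorial lemmas refer to.\<close>

definition leaf_vertices :: "nat \<Rightarrow> (nat \<Rightarrow> nat) \<Rightarrow> nat \<Rightarrow> nat list list list \<Rightarrow> (nat \<times> nat list list) list" where
  "leaf_vertices k \<chi> L \<psi> = concat (map (\<lambda>u. map (\<lambda>s. (u, s)) (selections (chunk L \<psi> (\<chi> u)) ((expand ^^ L) [[]]))) [0..<k])"

definition leaf_color :: "nat \<Rightarrow> (nat \<Rightarrow> nat) \<Rightarrow> nat \<Rightarrow> nat list list list \<Rightarrow> nat \<Rightarrow> nat" where
  "leaf_color k \<chi> L \<psi> = (\<lambda>i. fst (leaf_vertices k \<chi> L \<psi> ! i))"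

definition leaf_graph :: "nat \<Rightarrow> (nat \<Rightarrow> nat) \<Rightarrow> nat \<Rightarrow> nat list list list \<Rightarrow> nat set set \<Rightarrow> graph" where
  "leaf_graph k \<chi> L \<psi> S = colored_graph (length (leaf_vertices k \<chi> L \<psi>)) (leaf_color k \<chi> L \<psi>)
     (\<lambda>i j. compatible conflict \<chi> (leaf_vertices k \<chi> L \<psi> ! i) (leaf_vertices k \<chi> L \<psi> ! j)) S"

lemma length_leaf_vertices: "length (leaf_vertices k \<chi> L \<psi>) \<le> k * 3 ^ L"
proof -
  have "length (selections ch ((expand ^^ L) [[]])) \<le> 3 ^ L" for ch
    unfolding selections_def using length_filter_le[of _ "map (\<lambda>w. choose_lits ch w) ((expand ^^ L) [[]])"]
    by (simp add: length_expand_pow)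
  then show ?thesis unfolding leaf_vertices_def by (induction k) (simp_all add: add_mono add.commute)
qed

lemma set_leaf_vertices:
  "set (leaf_vertices k \<chi> L \<psi>) = {(u, s). u < k \<and> s \<in> set (selections (chunk L \<psi> (\<chi> u)) ((expand ^^ L) [[]]))}"
  by (auto simp: leaf_vertices_def)

lemma compatible_sym: "compatible conflict \<chi> x y \<Longrightarrow> compatible conflict \<chi> y x"
  unfolding compatible_def conflict_def by metis

definition color_list :: "nat \<Rightarrow> (nat \<Rightarrow> nat) \<Rightarrow> (nat list \<times> nat) list" where
  "color_list k \<chi> = map (\<lambda>u. (Defs.enc_nat u, \<chi> u)) [0..<k]"

lemma gverts_leaf: "gverts (color_list k \<chi>) L ((expand ^^ L) [[]]) \<psi> = map (word_vertex \<chi>) (leaf_vertices k \<chi> L \<psi>)"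
  by (simp add: gverts_def color_list_def leaf_vertices_def map_concat comp_def word_vertex_def)

definition pair_list :: "nat \<Rightarrow> nat set set \<Rightarrow> (nat list \<times> nat list) list" where
  "pair_list k S = map (\<lambda>p. (Defs.enc_nat (fst p), Defs.enc_nat (snd p))) (filter (\<lambda>p. {fst p, snd p} \<in> S) (List.product [0..<k] [0..<k]))"

lemma set_pair_list:
  assumes "\<And>e. e \<in> S \<Longrightarrow> e \<subseteq> {..<k}"
  shows "set (pair_list k S) = {(Defs.enc_nat u, Defs.enc_nat v) | u v. {u, v} \<in> S}"
proof
  show "set (pair_list k S) \<subseteq> {(Defs.enc_nat u, Defs.enc_nat v) | u v. {u, v} \<in> S}"
    by (auto simp: pair_list_def)
  show "{(Defs.enc_nat u, Defs.enc_nat v) | u v. {u, v} \<in> S} \<subseteq> set (pair_list k S)"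
  proof clarify
    fix u v assume uv: "{u, v} \<in> S"
    then have "(u, v) \<in> set (filter (\<lambda>p. {fst p, snd p} \<in> S) (List.product [0..<k] [0..<k]))"
      using assms[OF uv] by simp
    from imageI[OF this, of "\<lambda>p. (Defs.enc_nat (fst p), Defs.enc_nat (snd p))"]
    show "(Defs.enc_nat u, Defs.enc_nat v) \<in> set (pair_list k S)" by (simp add: pair_list_def)
  qed
qed

definition edge_subsets :: "nat \<Rightarrow> nat set set list \<Rightarrow> subset_list" where
  "edge_subsets k Sl = map (\<lambda>i. (Suc i = length Sl, odd (card (Sl ! i)), pair_list k (Sl ! i))) [0..<length Sl]"

lemma items_leaf:
  assumes "\<And>S e. S \<in> set Sl \<Longrightarrow> e \<in> S \<Longrightarrow> e \<subseteq> {..<k}"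
  shows "items (edge_subsets k Sl) (enc_graph F) (gverts (color_list k \<chi>) L ((expand ^^ L) [[]]) \<psi>) =
    map (\<lambda>i. ((Suc i = length Sl, odd (card (Sl ! i))), rev (enc_colored F (leaf_graph k \<chi> L \<psi> (Sl ! i)) (leaf_color k \<chi> L \<psi>)))) [0..<length Sl]"
proof -
  have "query (enc_graph F) (pair_list k (Sl ! i)) (map (word_vertex \<chi>) (leaf_vertices k \<chi> L \<psi>)) =
      enc_colored F (leaf_graph k \<chi> L \<psi> (Sl ! i)) (leaf_color k \<chi> L \<psi>)" if i: "i < length Sl" for i
    unfolding leaf_graph_def leaf_color_def
  proof (rule query_eq, rule set_pair_list)
    fix e assume "e \<in> Sl ! i"
    with i show "e \<subseteq> {..<k}" by (intro assms) auto
  qed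
  then show ?thesis by (auto simp: items_def edge_subsets_def gverts_leaf)
qed

text \<open>\<open>g\<close> embeds the complete bipartite graph with sides \<open>{..<h}\<close>
  and \<open>{h..<2 * h}\<close>. \<open>\<chi>\<close> gives the \<open>i\<close>-th vertices of
  both sides chunk \<open>i\<close>; the chunk of any other vertex is arbitrary. \<open>Sl\<close>
  lists the edge sets over which the alternating sum runs.\<close>

locale pattern =
  fixes \<Phi> :: "graph \<Rightarrow> rat" and F :: graph and k h :: nat and g \<chi> :: "nat \<Rightarrow> nat" and Sl :: "nat set set list"
  assumes iso: "iso_invariant \<Phi>" and F: "simple_graph F" "verts F = {..<k}" and nz: "ae \<Phi> F \<noteq> 0"
    and g: "\<And>i. i < 2 * h \<Longrightarrow> g i < k" "\<And>i j. i < h \<Longrightarrow> h \<le> j \<Longrightarrow> j < 2 * h \<Longrightarrow> {g i, g j} \<in> edges F"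
      "\<And>i. i < h \<Longrightarrow> \<chi> (g i) = i" "\<And>i. i < h \<Longrightarrow> \<chi> (g (h + i)) = i"
    and Sl: "set Sl = Pow (edges F)" "distinct Sl"
begin

lemma subset_edges: "S \<in> set Sl \<Longrightarrow> e \<in> S \<Longrightarrow> e \<subseteq> {..<k}"
  using F Sl(1) by (auto simp: simple_graph_def)

lemma leaf_decision:
  assumes len: "length \<psi> \<le> h * L" and c3: "\<And>c. c \<in> set \<psi> \<Longrightarrow> length c \<le> 3" and L: "L > 0"
  shows "(\<Sum>S\<in>Pow (edges F). cpIndSub \<Phi> F (leaf_graph k \<chi> L \<psi> S) (leaf_color k \<chi> L \<psi>) * (-1) ^ card S) \<noteq> 0 \<longleftrightarrow>
     (\<exists>T. consistent T \<and> hits T (clauses \<psi>))"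
proof -
  let ?chunk = "\<lambda>i. set ` set (chunk L \<psi> i)"
  have U: "(\<Union>i. ?chunk i) = clauses \<psi>"
    unfolding clauses_def image_UN[symmetric] Union_chunks[OF L] ..
  have "(\<exists>A. A \<subseteq> {..<length (leaf_vertices k \<chi> L \<psi>)} \<and> card A = k \<and> leaf_color k \<chi> L \<psi> ` A = {..<k} \<and>
       full_copy F (leaf_color k \<chi> L \<psi>) (\<lambda>i j. compatible conflict \<chi> (leaf_vertices k \<chi> L \<psi> ! i) (leaf_vertices k \<chi> L \<psi> ! j)) A) \<longleftrightarrow>
     (\<exists>T. (\<forall>l\<in>T. \<forall>l'\<in>T. \<not> conflict l l') \<and> hits T (\<Union>i. ?chunk i))"
    unfolding leaf_color_def
  proof (rule full_copy_iff[where g = g and h = h, OF F _ _ _ _ set_leaf_vertices])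
    show "g i < k" if "i < 2 * h" for i using g(1)[OF that] .
    show "{g i, g j} \<in> edges F" if "i < h" "h \<le> j" "j < 2 * h" for i j using g(2)[OF that] .
    show "\<chi> (g i) = i" if "i < h" for i using g(3)[OF that] .
    show "\<chi> (g (h + i)) = i" if "i < h" for i using g(4)[OF that] .
    show "set s \<inter> D \<noteq> {}" if "s \<in> set (selections (chunk L \<psi> i) ((expand ^^ L) [[]]))" "D \<in> ?chunk i" for i s D
      using that selections_hit by blast
    show "\<exists>s\<in>set (selections (chunk L \<psi> i) ((expand ^^ L) [[]])). set s \<subseteq> T" if T: "hits T (\<Union>i. ?chunk i)" for i T
    proof (rule selections_complete[OF _ _ length_chunk])
      show "\<forall>c\<in>set (chunk L \<psi> i). T \<inter> set c \<noteq> {}" using T unfolding hits_def by blast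
      show "\<forall>c\<in>set (chunk L \<psi> i). length c \<le> 3"
        using c3 by (auto simp: chunk_def dest: in_set_takeD in_set_dropD)
    qed
    show "?chunk i = {}" if "i \<ge> h" for i using chunk_empty[OF len that] by simp
    show "conflict l' l" if "conflict l l'" for l l' using that by (auto simp: conflict_def)
  qed
  moreover have "(\<Sum>S\<in>Pow (edges F). cpIndSub \<Phi> F (leaf_graph k \<chi> L \<psi> S) (leaf_color k \<chi> L \<psi>) * (-1) ^ card S) \<noteq> 0 \<longleftrightarrow>
     (\<exists>A. A \<subseteq> {..<length (leaf_vertices k \<chi> L \<psi>)} \<and> card A = k \<and> leaf_color k \<chi> L \<psi> ` A = {..<k} \<and>
       full_copy F (leaf_color k \<chi> L \<psi>) (\<lambda>i j. compatible conflict \<chi> (leaf_vertices k \<chi> L \<psi> ! i) (leaf_vertices k \<chi> L \<psi> ! j)) A)"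
    unfolding leaf_graph_def by (rule alternating_sum_nonzero[OF iso F _ nz]) (rule compatible_sym)
  ultimately show ?thesis unfolding U consistent_def by simp
qed

definition parameters :: "nat \<Rightarrow> nat \<Rightarrow> params" where
  "parameters t q = (t, q, 1 + t + 2 * t\<^sup>2, h, color_list k \<chi>, enc_graph F, edge_subsets k Sl)"

lemma all_queries_leaf:
  "all_queries (parameters t q) rs = concat (map (\<lambda>\<psi>. map (\<lambda>i. ((Suc i = length Sl, odd (card (Sl ! i))),
     rev (enc_colored F (leaf_graph k \<chi> (chunk_size (parameters t q) rs) \<psi> (Sl ! i)) (leaf_color k \<chi> (chunk_size (parameters t q) rs) \<psi>))))
     [0..<length Sl]) (final_formulas (parameters t q) rs))"
proof -
  have par: "par_S (parameters t q) = edge_subsets k Sl" "par_F (parameters t q) = enc_graph F" "par_cols (parameters t q) = color_list k \<chi>"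
    by (simp_all add: parameters_def)
  have "items (edge_subsets k Sl) (enc_graph F) (gverts (color_list k \<chi>) L ((expand ^^ L) [[]]) \<psi>) =
    map (\<lambda>i. ((Suc i = length Sl, odd (card (Sl ! i))), rev (enc_colored F (leaf_graph k \<chi> L \<psi> (Sl ! i)) (leaf_color k \<chi> L \<psi>)))) [0..<length Sl]" for L \<psi>
    by (rule items_leaf) (rule subset_edges)
  then show ?thesis unfolding all_queries_def par by (simp only:)
qed

lemma final_answer_correct:
  assumes ans: "\<And>\<psi> S. S \<subseteq> edges F \<Longrightarrow>
      ans (enc_colored F (leaf_graph k \<chi> (chunk_size (parameters t q) rs) \<psi> S) (leaf_color k \<chi> (chunk_size (parameters t q) rs) \<psi>)) =
      enc_rat (cpIndSub \<Phi> F (leaf_graph k \<chi> (chunk_size (parameters t q) rs) \<psi> S) (leaf_color k \<chi> (chunk_size (parameters t q) rs) \<psi>))"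
  shows "final_answer (rev (map (answered ans) (all_queries (parameters t q) rs))) \<longleftrightarrow>
    (\<exists>\<psi>\<in>set (final_formulas (parameters t q) rs).
       (\<Sum>S\<in>Pow (edges F). cpIndSub \<Phi> F (leaf_graph k \<chi> (chunk_size (parameters t q) rs) \<psi> S) (leaf_color k \<chi> (chunk_size (parameters t q) rs) \<psi>) * (-1) ^ card S) \<noteq> 0)"
proof -
  let ?L = "chunk_size (parameters t q) rs"
  let ?X = "\<lambda>\<psi> i. cpIndSub \<Phi> F (leaf_graph k \<chi> ?L \<psi> (Sl ! i)) (leaf_color k \<chi> ?L \<psi>)"
  let ?zs = "[0..<length Sl]"
  have ne: "Sl \<noteq> []" using Sl(1) by auto
  have a: "map (answered ans) (all_queries (parameters t q) rs) = concat (map (\<lambda>\<psi>. map (\<lambda>i. ((Suc i = length Sl, odd (card (Sl ! i))),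
     rev (enc_rat (?X \<psi> i)))) ?zs) (final_formulas (parameters t q) rs))"
  proof -
    have one: "answered ans ((b, b'), rev (enc_colored F (leaf_graph k \<chi> ?L \<psi> (Sl ! i)) (leaf_color k \<chi> ?L \<psi>))) = ((b, b'), rev (enc_rat (?X \<psi> i)))"
      if i: "i < length Sl" for b b' i \<psi>
    proof -
      have "Sl ! i \<in> set Sl" using i by simp
      then have "Sl ! i \<subseteq> edges F" unfolding Sl(1) by simp
      from ans[OF this] show ?thesis by (simp add: answered_def)
    qed
    show ?thesis unfolding all_queries_leaf map_concat map_map comp_def
      by (intro arg_cong[of _ _ concat] map_cong refl one) simp
  qed
  have s: "(\<Sum>i\<leftarrow>?zs. if odd (card (Sl ! i)) then - ?X \<psi> i else ?X \<psi> i) =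
      (\<Sum>S\<in>Pow (edges F). cpIndSub \<Phi> F (leaf_graph k \<chi> ?L \<psi> S) (leaf_color k \<chi> ?L \<psi>) * (-1) ^ card S)" for \<psi>
  proof -
    let ?f = "\<lambda>S. cpIndSub \<Phi> F (leaf_graph k \<chi> ?L \<psi> S) (leaf_color k \<chi> ?L \<psi>) * (-1) ^ card S"
    have "(\<Sum>i\<leftarrow>?zs. if odd (card (Sl ! i)) then - ?X \<psi> i else ?X \<psi> i) = (\<Sum>i\<leftarrow>?zs. ?f (Sl ! i))"
      by (intro arg_cong[of _ _ sum_list] map_cong refl) auto
    also have "\<dots> = sum_list (map ?f (map ((!) Sl) ?zs))" by (simp only: map_map comp_def)
    also have "\<dots> = sum_list (map ?f Sl)" by (simp only: map_nth)
    also have "sum_list (map ?f Sl) = sum ?f (set Sl)" by (rule sum_list_distinct_conv_sum_set[OF Sl(2)])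
    finally show ?thesis unfolding Sl(1) .
  qed
  have "final_answer (rev (concat (map (\<lambda>\<psi>. map (\<lambda>i. ((Suc i = length Sl, odd (card (Sl ! i))), rev (enc_rat (?X \<psi> i)))) ?zs) (final_formulas (parameters t q) rs)))) \<longleftrightarrow>
     (\<exists>\<psi>\<in>set (final_formulas (parameters t q) rs). (\<Sum>i\<leftarrow>?zs. if odd (card (Sl ! i)) then - ?X \<psi> i else ?X \<psi> i) \<noteq> 0)"
  proof (rule final_answer_groups)
    show "?zs \<noteq> []" using ne by simp
    show "Suc (last ?zs) = length Sl" using ne by simp
    show "\<not> Suc z = length Sl" if "z \<in> set (butlast ?zs)" for z
    proof -
      have "butlast ?zs = [0..<length Sl - 1]" using ne by (cases "length Sl") simp_all
      then show ?thesis using that by auto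
    qed
  qed
  then show ?thesis unfolding a s .
qed

lemma leaves_correct:
  assumes \<phi>: "is_3cnf \<phi>" and t: "t > 0" and h: "h > 0" and q: "q > 0"
    and mu: "(\<mu> :: real) > 1" "\<mu> ^ (2 * t\<^sup>2 - 1) + 1 \<le> \<mu> ^ (2 * t\<^sup>2)" "\<forall>n q'. n \<le> q * q' \<longrightarrow> \<mu> ^ (6 * t * n) \<le> 3 ^ q'"
  defines "rs \<equiv> rev (enc_cnf \<phi>)"
  shows "(\<exists>\<psi>\<in>set (final_formulas (parameters t q) rs). \<exists>T. consistent T \<and> hits T (clauses \<psi>)) \<longleftrightarrow> satisfiable \<phi>"
    and "\<And>\<psi>. \<psi> \<in> set (final_formulas (parameters t q) rs) \<Longrightarrow> length \<psi> \<le> h * chunk_size (parameters t q) rs"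
    and "\<And>\<psi> c. \<psi> \<in> set (final_formulas (parameters t q) rs) \<Longrightarrow> c \<in> set \<psi> \<Longrightarrow> length c \<le> 3"
    and "split_inv (twos (clauses (initial_formula (input_clauses rs)))) t (input_lits rs)
       (\<lambda>T. \<forall>c\<in>set (input_clauses rs). T \<inter> set c \<noteq> {}) ([initial_formula (input_clauses rs)], [])"
proof -
  let ?cs = "input_clauses rs" let ?l = "input_lits rs" let ?P = "parameters t q" let ?J = "fuel_size ?P rs"
  let ?\<phi> = "initial_formula ?cs"
  have cs: "?cs = rev (map (\<lambda>C. rev (map lit_word C)) \<phi>)"
    by (simp add: input_clauses_def rs_def parse_enc_cnf)
  have "\<forall>c\<in>set ?cs. length c \<le> 3" using \<phi> by (auto simp: cs is_3cnf_def)
  from split_inv_initial[OF this] show inv: "split_inv (twos (clauses ?\<phi>)) t ?l (\<lambda>T. \<forall>c\<in>set ?cs. T \<inter> set c \<noteq> {}) ([?\<phi>], [])"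
    by (simp add: input_lits_def)
  have cl: "card (set ?l) = length ?l" unfolding input_lits_def by (rule distinct_card[OF dedup(2)])
  have fz: "?J = Suc (Suc (length ?l div q))" by (simp add: fuel_size_def parameters_def)
  have "length ?l \<le> q * Suc (length ?l div q)" using q dividend_less_times_div[of q "length ?l"] by simp
  then have "\<mu> ^ (6 * t * card (set ?l)) \<le> 3 ^ Suc (length ?l div q)" unfolding cl using mu(3) by blast
  moreover have "real (3 ^ ?J) = 3 * 3 ^ Suc (length ?l div q)" unfolding fz by simp
  moreover have "(0 :: real) \<le> 3 ^ Suc (length ?l div q)" by (rule zero_le_power) simp
  ultimately have fuel: "2 * \<mu> ^ (6 * t * card (set ?l)) \<le> real (3 ^ ?J)" by linarith
  have ff: "final_formulas ?P rs = snd ((split_step t ?l ^^ 3 ^ ?J) ([?\<phi>], []))"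
    by (simp add: final_formulas_def parameters_def)
  note fin = split_finishes[OF inv t mu(1,2) fuel, folded ff]
  show "length \<psi> \<le> h * chunk_size ?P rs" if "\<psi> \<in> set (final_formulas ?P rs)" for \<psi>
  proof -
    let ?m = "(1 + t + 2 * t\<^sup>2) * length ?l"
    have "length \<psi> \<le> 1 + ?m" using fin(3) that unfolding cl by (simp add: mult.commute)
    moreover have "?m < h + h * (?m div h)" using dividend_less_times_div[OF h, of ?m] .
    moreover have "chunk_size ?P rs = Suc (?m div h)" by (simp add: chunk_size_def parameters_def)
    ultimately show ?thesis by simp
  qed
  show "length c \<le> 3" if "\<psi> \<in> set (final_formulas ?P rs)" "c \<in> set \<psi>" for \<psi> c
  proof -
    have "formula_ok (twos (clauses ?\<phi>)) t ?l \<psi>"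
      using conjunct1[OF split_steps[OF inv t mu(1,2), of "3 ^ ?J"]] that(1) unfolding ff split_inv_def by blast
    then have "distinct c" "card (set c) \<le> 3" using that(2)
      by (auto simp: formula_ok_def list_inv_def sparse_inv_def clauses_def)
    then show ?thesis by (simp add: distinct_card)
  qed
  have "satisfiable \<phi> \<longleftrightarrow> (\<exists>T. consistent T \<and> (\<forall>c\<in>set ?cs. T \<inter> set c \<noteq> {}))"
    unfolding satisfiable_iff_hits cs by simp
  also have "\<dots> \<longleftrightarrow> (\<exists>T. consistent T \<and> (\<exists>\<psi>\<in>set (final_formulas ?P rs). hits T (clauses \<psi>)))"
    using fin(2) by simp
  finally show "(\<exists>\<psi>\<in>set (final_formulas ?P rs). \<exists>T. consistent T \<and> hits T (clauses \<psi>)) \<longleftrightarrow> satisfiable \<phi>" by blast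
qed

end

section \<open>Size and time estimates\<close>

lemma pt_input_lits: "pt (\<lambda>rs. input_lits rs)"
  unfolding input_lits_def input_clauses_def by (intro pt_intros pt_dedup pt_parse_clauses)

text \<open>All formulas that occur have polynomial size and each step adds at most one, hence the
  bound linear in \<open>i\<close>, as \<open>solver\<close> expects it in the form
  \<open>N + N * i\<close>.\<close>

lemma split_size_exponent:
  "\<exists>d. \<forall>t Q A rs \<phi> \<mu> i. t > 0 \<longrightarrow> (\<mu> :: real) > 1 \<longrightarrow> \<mu> ^ (2 * t\<^sup>2 - 1) + 1 \<le> \<mu> ^ (2 * t\<^sup>2) \<longrightarrow>
     split_inv Q t (input_lits rs) A ([\<phi>], []) \<longrightarrow>
     es ((split_step t (input_lits rs) ^^ i) ([\<phi>], [])) \<le> pl d (es rs) * (i + 1)"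
proof -
  obtain d where d: "\<And>rs. es (input_lits rs) \<le> pl d (es rs)" using ptE[OF pt_input_lits] by metis
  define p where "p n = 3 + 2 * (1 + formula_bound (pl d n))" for n
  have "PB (\<lambda>n. p n)" unfolding p_def formula_bound_def power3_eq_cube by (intro PB_intros)
  then obtain d' where d': "\<And>n. p n \<le> pl d' n" using PB_obtain by metis
  have "es ((split_step t (input_lits rs) ^^ i) ([\<phi>], [])) \<le> pl d' (es rs) * (i + 1)"
    if "t > 0" "(\<mu> :: real) > 1" "\<mu> ^ (2 * t\<^sup>2 - 1) + 1 \<le> \<mu> ^ (2 * t\<^sup>2)"
      "split_inv Q t (input_lits rs) A ([\<phi>], [])" for t Q A rs \<phi> \<mu> i
  proof -
    let ?b = "1 + formula_bound (pl d (es rs))"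
    have "es ((split_step t (input_lits rs) ^^ i) ([\<phi>], [])) \<le> 3 + 2 * ((i + 1) * ?b)"
      by (rule es_split_steps[OF that(4,1) d that(2,3)])
    also have "\<dots> \<le> p (es rs) * (i + 1)" by (simp add: p_def algebra_simps)
    also have "\<dots> \<le> pl d' (es rs) * (i + 1)" by (rule mult_le_mono1[OF d'])
    finally show ?thesis .
  qed
  then show ?thesis by (intro exI[of _ d']) simp
qed

lemma length_input_lits: "length (input_lits (rev (enc_cnf \<phi>))) \<le> 2 * card (cnf_vars \<phi>)"
proof -
  let ?l = "input_lits (rev (enc_cnf \<phi>))"
  have "set ?l = (\<Union>C\<in>set \<phi>. lit_word ` set C)"
    by (simp add: input_lits_def input_clauses_def dedup parse_enc_cnf)
  moreover have "lit_word ` set C \<subseteq> lit_word ` (UNIV \<times> cnf_vars \<phi>)" if "C \<in> set \<phi>" for C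
  proof (rule image_mono, rule subsetI)
    fix l assume "l \<in> set C"
    then have "snd l \<in> cnf_vars \<phi>" using that unfolding cnf_vars_def by blast
    then show "l \<in> UNIV \<times> cnf_vars \<phi>" by (cases l) simp
  qed
  ultimately have "set ?l \<subseteq> lit_word ` (UNIV \<times> cnf_vars \<phi>)" by blast
  moreover have f: "finite (cnf_vars \<phi>)" by (simp add: cnf_vars_def)
  ultimately have "card (set ?l) \<le> card (lit_word ` (UNIV \<times> cnf_vars \<phi>))" by (intro card_mono) simp_all
  also have "\<dots> \<le> card (UNIV \<times> cnf_vars \<phi> :: (bool \<times> nat) set)" by (rule card_image_le) (simp add: f)
  also have "\<dots> = 2 * card (cnf_vars \<phi>)" by (simp add: card_cartesian_product)
  finally show ?thesis unfolding input_lits_def by (simp add: distinct_card[OF dedup(2)])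
qed

text \<open>The summand \<open>A\<close> covers the finitely many small \<open>n\<close>, among them
  \<open>n = 0\<close>, where the power vanishes.\<close>

lemma bigo_powr_bound:
  assumes "T \<in> O(\<lambda>n. real n powr b)"
  shows "\<exists>A\<ge>0. \<forall>n. T n \<le> A * (real n powr b) + A"
proof -
  obtain c where c: "c > 0" "eventually (\<lambda>n. norm (T n) \<le> c * norm (real n powr b)) sequentially"
    using landau_o.bigE[OF assms] by metis
  then obtain m where m: "\<And>n. n \<ge> m \<Longrightarrow> norm (T n) \<le> c * norm (real n powr b)"
    by (auto simp: eventually_sequentially)
  define A where "A = c + (\<Sum>i<m. \<bar>T i\<bar>)"
  have s: "(\<Sum>i<m. \<bar>T i\<bar>) \<ge> 0" by (intro sum_nonneg) simp
  have "T n \<le> A * (real n powr b) + A" for n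
  proof (cases "n < m")
    case True
    have "\<bar>T n\<bar> \<le> (\<Sum>i<m. \<bar>T i\<bar>)" by (rule member_le_sum) (use True in auto)
    moreover have "(\<Sum>i<m. \<bar>T i\<bar>) \<le> A" "0 \<le> A" using c(1) s by (simp_all add: A_def)
    moreover have "0 \<le> A * (real n powr b)" using \<open>0 \<le> A\<close> by simp
    ultimately show ?thesis by linarith
  next
    case False
    then have "T n \<le> c * (real n powr b)" using m[of n] by simp
    also have "\<dots> \<le> A * (real n powr b)" by (rule mult_right_mono) (use s in \<open>simp_all add: A_def\<close>)
    finally have "T n \<le> A * (real n powr b)" .
    moreover have "0 \<le> A" using c(1) s by (simp add: A_def)
    ultimately show ?thesis by linarith
  qed
  moreover have "A \<ge> 0" using c(1) s by (simp add: A_def)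
  ultimately show ?thesis by blast
qed

text \<open>In the exponent \<open>L * b\<close> the factor \<open>C / h\<close> of the chunk size
  cancels against \<open>b = h / (q * C)\<close> and leaves \<open>nl / q\<close>; the roundings
  cost the factors \<open>3 powr b\<close> and 3.\<close>

lemma graph_size_powr:
  fixes m k L C h q nl :: nat
  assumes "m \<le> k * 3 ^ L" "L = Suc (C * nl div h)" "h > 0" "q > 0" "C > 0" "b = real h / real (q * C)"
  shows "real m powr b \<le> real k powr b * (3 powr b * 3 * 3 ^ (nl div q))"
proof -
  have b: "b > 0" using assms by simp
  have "real m \<le> real k * 3 ^ L" using of_nat_mono[OF assms(1), where 'a = real] by simp
  then have "real m powr b \<le> (real k * 3 ^ L) powr b" using b by (intro powr_mono2) auto
  also have "\<dots> = real k powr b * (3 ^ L) powr b" by (simp add: powr_mult)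
  also have "(3 ^ L :: real) = 3 powr real L" by (simp add: powr_realpow)
  also have "(3 powr real L) powr b = 3 powr (real L * b)" by (rule powr_powr)
  also have "\<dots> \<le> 3 powr (b + 1 + real (nl div q))"
  proof (intro powr_mono)
    have "real (C * nl div h) * b \<le> (real (C * nl) / real h) * b"
    proof (rule mult_right_mono)
      have "real (h * (C * nl div h)) \<le> real (C * nl)" by (intro of_nat_mono times_div_less_eq_dividend)
      then have "real (C * nl div h) * real h \<le> real (C * nl)" by (simp only: of_nat_mult mult.commute)
      then show "real (C * nl div h) \<le> real (C * nl) / real h" using assms(3) by (subst pos_le_divide_eq) simp_all
    qed (use b in simp)
    also have "\<dots> = real nl / real q" using assms(3-6) by (simp add: field_simps)
    also have "\<dots> \<le> 1 + real (nl div q)"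
    proof -
      have "nl \<le> q * (1 + nl div q)" using dividend_less_times_div[OF assms(4), of nl] by simp
      then have "real nl \<le> real (q * (1 + nl div q))" by (rule of_nat_mono)
      then have "real nl \<le> (1 + real (nl div q)) * real q" by (simp only: of_nat_mult of_nat_add of_nat_1 mult.commute)
      then show ?thesis using assms(4) by (subst pos_divide_le_eq) simp_all
    qed
    finally have "real (C * nl div h) * b \<le> 1 + real (nl div q)" .
    moreover have "real L * b = b + real (C * nl div h) * b"
      unfolding assms(2) of_nat_Suc by (rule ring_distribs(2)[THEN trans]) (simp only: mult_1)
    ultimately show "real L * b \<le> b + 1 + real (nl div q)" by linarith
  qed simp
  also have "\<dots> = 3 powr b * 3 * 3 ^ (nl div q)" by (simp add: powr_add powr_realpow)
  finally show ?thesis by (simp add: mult_left_mono)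
qed

text \<open>The 4 is a product of two factors 2: one from \<open>3 \<le> 2 ^ 2\<close>, one from the
  two literals of each variable.\<close>

lemma exponent_bound:
  fixes \<delta> :: real
  assumes "4 * real e \<le> \<delta> * real q" "q > 0" "nl \<le> 2 * n"
  shows "(3 ^ (nl div q)) ^ e \<le> 2 powr (\<delta> * real n)"
proof -
  let ?m = "(nl div q) * e"
  have "((3 :: real) ^ (nl div q)) ^ e = 3 ^ ?m" by (rule power_mult[symmetric])
  also have "\<dots> \<le> 4 ^ ?m" by (rule power_mono) simp_all
  also have "(4 :: real) ^ ?m = (2 ^ 2) ^ ?m" by simp
  also have "\<dots> = 2 ^ (2 * ?m)" by (rule power_mult[symmetric])
  also have "\<dots> = 2 powr real (2 * ?m)" by (rule powr_realpow[symmetric]) simp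
  also have "\<dots> \<le> 2 powr (\<delta> * real n)"
  proof (rule powr_mono)
    have "q * (2 * ?m) = 2 * e * (q * (nl div q))" by (simp only: mult.assoc mult.commute mult.left_commute)
    also have "\<dots> \<le> 2 * e * nl" by (intro mult_le_mono2 times_div_less_eq_dividend)
    also have "\<dots> \<le> 2 * e * (2 * n)" using assms(3) by (rule mult_le_mono2)
    finally have "real (q * (2 * ?m)) \<le> real (2 * e * (2 * n))" by (rule of_nat_mono)
    then have "real q * real (2 * ?m) \<le> 4 * real e * real n" by simp
    also have "\<dots> \<le> \<delta> * real q * real n" using assms(1) by (rule mult_right_mono) simp
    also have "\<dots> = real q * (\<delta> * real n)" by simp
    finally show "real (2 * ?m) \<le> \<delta> * real n" using assms(2) by (subst (asm) mult_le_cancel_left_pos) simp_all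
  qed simp
  finally show ?thesis .
qed

context pattern
begin

lemma leaf_graph_solved:
  assumes sol: "solves_cpIndSub M \<Phi> k T" and S: "S \<subseteq> edges F"
  shows "\<exists>t. halts_with M (enc_colored F (leaf_graph k \<chi> L \<psi> S) (leaf_color k \<chi> L \<psi>)) t
      (enc_rat (cpIndSub \<Phi> F (leaf_graph k \<chi> L \<psi> S) (leaf_color k \<chi> L \<psi>))) \<and> real t \<le> T (length (leaf_vertices k \<chi> L \<psi>))"
proof -
  let ?G = "leaf_graph k \<chi> L \<psi> S" let ?c = "leaf_color k \<chi> L \<psi>"
  have "simple_graph ?G" unfolding leaf_graph_def
  proof (rule simple_colored_graph)
    show "card e = 2" if "e \<in> S" for e using that S F(1) by (auto simp: simple_graph_def)
  qed
  moreover have "verts ?G = {..<length (leaf_vertices k \<chi> L \<psi>)}" by (simp add: leaf_graph_def colored_graph_def)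
  moreover have "graph_hom ?c ?G F" unfolding leaf_graph_def
  proof (rule hom_colored_graph[OF F(2) S])
    show "?c i < k" if "i < length (leaf_vertices k \<chi> L \<psi>)" for i
    proof -
      have "leaf_vertices k \<chi> L \<psi> ! i \<in> set (leaf_vertices k \<chi> L \<psi>)" using that by simp
      then show ?thesis unfolding set_leaf_vertices leaf_color_def by auto
    qed
  qed (rule compatible_sym)
  ultimately show ?thesis using sol F unfolding solves_cpIndSub_def by blast
qed

text \<open>Every hypothesis of \<open>sol\<close> is met by an \<open>N\<close> of the form
  constant times \<open>l ^ (d + 1) * X\<close> with \<open>X = 3 ^ (nl div q)\<close>. Raising it
  to the power \<open>e\<close> leaves a polynomial in the input length times
  \<open>X ^ e\<close>.\<close>

lemma sat_machine:
  assumes M: "solves_cpIndSub M \<Phi> k T" "\<And>n. T n \<le> A * (real n powr b) + A" "A \<ge> 0"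
    and C: "C = 1 + t + 2 * t\<^sup>2" "h \<ge> q * C" "b = real h / real (q * C)" and t: "t > 0" "q > 0"
    and mu: "(\<mu> :: real) > 1" "\<mu> ^ (2 * t\<^sup>2 - 1) + 1 \<le> \<mu> ^ (2 * t\<^sup>2)" "\<forall>n q'. n \<le> q * q' \<longrightarrow> \<mu> ^ (6 * t * n) \<le> 3 ^ q'"
    and sol: "\<forall>rs N ans. es (parameters t q) + es rs + 1 \<le> N \<longrightarrow> 3 ^ chunk_size (parameters t q) rs \<le> N \<longrightarrow> 3 ^ fuel_size (parameters t q) rs \<le> N \<longrightarrow>
     (\<forall>i. es ((split_step (par_t (parameters t q)) (input_lits rs) ^^ i) ([initial_formula (input_clauses rs)], [])) \<le> N + N * i) \<longrightarrow>
     (\<forall>x\<in>set (all_queries (parameters t q) rs). set (snd x) \<subseteq> {1, 2, 3} \<and> ans (rev (snd x)) \<noteq> [] \<and> set (ans (rev (snd x))) \<subseteq> {1, 2, 3} \<and>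
        (\<exists>t\<le>N. halts_with M (rev (snd x)) t (ans (rev (snd x))))) \<longrightarrow>
     cr c (enc rs) (enc (final_answer (rev (map (answered ans) (all_queries (parameters t q) rs))))) (\<kappa> * pl e N)"
  shows "\<exists>M' K a. is_tm M' \<and> (\<forall>\<phi>. is_3cnf \<phi> \<longrightarrow> (\<exists>t'. halts_with M' (enc_cnf \<phi>) t' [enc_bit (satisfiable \<phi>)] \<and>
     t' \<le> K * ((length (enc_cnf \<phi>) + 1) ^ a * (3 ^ (length (input_lits (rev (enc_cnf \<phi>))) div q)) ^ e)))"
proof -
  let ?P = "parameters t q"
  have C0: "C > 0" and h0: "h > 0" using C(1,2) t(2) by (auto intro: less_le_trans[of 0 "q * C"])
  obtain d where d: "\<And>Q A' rs \<phi> i. split_inv Q t (input_lits rs) A' ([\<phi>], []) \<Longrightarrow>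
     es ((split_step t (input_lits rs) ^^ i) ([\<phi>], [])) \<le> pl d (es rs) * (i + 1)"
    using split_size_exponent t(1) mu(1,2) by metis
  \<comment> \<open>\<open>K1 * X\<close> bounds the time of a single query, by
    \<open>graph_size_powr\<close>.\<close>
  define K1 where "K1 = nat \<lceil>A * (real k powr b * (3 powr b * 3)) + A\<rceil>"
  \<comment> \<open>The summands pay for the hard-wired data, for a query, for
    \<open>3 ^ fuel_size = 9 * X\<close> and the input, and for the size of the formulas, where
    \<open>(es rs + 1) ^ d \<le> (9 * l) ^ d\<close>.\<close>
  define K2 where "K2 = es ?P + K1 + 9 * 2 + d * 9 ^ d"
  obtain M' where M': "is_tm M'" "\<And>s b T. set s \<subseteq> {1, 2, 3} \<Longrightarrow> cr c (enc (rev s)) (enc (b :: bool)) T \<Longrightarrow>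
     \<exists>t\<le>T + 100 * (length s + 1). halts_with M' s t [enc_bit b]"
    using machine_of_com[of c] by blast
  define K where "K = \<kappa> * (e * (2 * K2) ^ e) + 100"
  have "\<exists>t'. halts_with M' (enc_cnf \<phi>) t' [enc_bit (satisfiable \<phi>)] \<and>
     t' \<le> K * ((length (enc_cnf \<phi>) + 1) ^ ((d + 1) * e + 1) * (3 ^ (length (input_lits (rev (enc_cnf \<phi>))) div q)) ^ e)"
    if \<phi>: "is_3cnf \<phi>" for \<phi>
  proof -
    define rs where "rs = rev (enc_cnf \<phi>)"
    define nl where "nl = length (input_lits rs)"
    define L where "L = chunk_size ?P rs"
    define X :: nat where "X = 3 ^ (nl div q)"
    define l where "l = length (enc_cnf \<phi>) + 1"
    define N where "N = K2 * (l ^ (d + 1) * X)"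
    \<comment> \<open>The value is arbitrary on words that \<open>M\<close> does not answer; on a
      query it is the right one, since outputs over these symbols are unique.\<close>
    define ans where "ans w = (SOME v. set v \<subseteq> {1, 2, 3} \<and> (\<exists>t. halts_with M w t v))" for w
    note lc = leaves_correct[OF \<phi> t(1) h0 t(2) mu, folded rs_def]
    have X1: "X \<ge> 1" and l1: "l \<ge> 1" by (simp_all add: X_def l_def)
    have ll: "l ^ (d + 1) \<ge> 1" by (rule one_le_power[OF l1])
    have Leq: "L = Suc (C * nl div h)" by (simp add: L_def chunk_size_def parameters_def nl_def C(1))
    \<comment> \<open>Here the lower bound on \<open>h\<close> enters: a chunk has at most
      \<open>Suc (nl div q)\<close> clauses, and the list of its choices stays within
      \<open>3 * X\<close>.\<close>
    have "C * nl div h \<le> C * nl div (q * C)" using C(2) C0 t(2) by (intro div_le_mono2) simp_all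
    also have "\<dots> = nl div q" using C0 by (simp add: mult.commute[of q C])
    finally have "(3::nat) ^ L \<le> 3 ^ Suc (nl div q)" unfolding Leq by (intro power_increasing) simp_all
    then have L3: "3 ^ L \<le> 3 * X" by (simp add: X_def)
    have J3: "3 ^ fuel_size ?P rs = 9 * X" by (simp add: fuel_size_def parameters_def nl_def X_def)
    have X9: "9 * 2 * X \<le> N"
    proof -
      have "9 * 2 * X \<le> K2 * X" by (intro mult_le_mono1) (simp add: K2_def)
      also have "\<dots> \<le> K2 * (l ^ (d + 1) * X)" using ll by (intro mult_le_mono2) simp
      finally show ?thesis by (simp add: N_def)
    qed
    have "es y \<le> 7" if "y \<in> set rs" for y
      using that enc_cnf_symbols[of \<phi>] unfolding rs_def by auto
    then have "es rs \<le> 1 + length rs * (1 + 7)" by (rule es_le)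
    then have rs8: "es rs + 1 \<le> 8 * l" by (simp add: rs_def l_def)
    have pd: "pl d (es rs) \<le> d * 9 ^ d * l ^ d"
    proof -
      have "(es rs + 1) ^ d \<le> (9 * l) ^ d" using rs8 by (intro power_mono) auto
      then have "d * (es rs + 1) ^ d \<le> d * (9 * l) ^ d" by (rule mult_le_mono2)
      then show ?thesis by (simp add: pl_def power_mult_distrib)
    qed
    have big: "es ?P + K1 * X + (es rs + 1) + pl d (es rs) \<le> N"
    proof -
      have lX: "1 \<le> l ^ (d + 1) * X" "l \<le> l ^ (d + 1) * X" "X \<le> l ^ (d + 1) * X" "l ^ d \<le> l ^ (d + 1) * X"
      proof -
        show X: "X \<le> l ^ (d + 1) * X" using mult_le_mono1[OF ll, of X] by (simp only: mult_1)
        show "1 \<le> l ^ (d + 1) * X" by (rule order_trans[OF X1 X])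
        have m: "l ^ (d + 1) \<le> l ^ (d + 1) * X" using mult_le_mono2[OF X1, of "l ^ (d + 1)"] by (simp only: mult_1_right)
        have "l ^ 1 \<le> l ^ (d + 1)" using l1 by (intro power_increasing) simp_all
        from order_trans[OF this m] show "l \<le> l ^ (d + 1) * X" by (simp only: power_one_right)
        have "l ^ d \<le> l ^ (d + 1)" using l1 by (intro power_increasing) simp_all
        from order_trans[OF this m] show "l ^ d \<le> l ^ (d + 1) * X" .
      qed
      have "es ?P * 1 + K1 * X + 8 * l + d * 9 ^ d * l ^ d \<le>
          es ?P * (l ^ (d + 1) * X) + K1 * (l ^ (d + 1) * X) + 8 * (l ^ (d + 1) * X) + d * 9 ^ d * (l ^ (d + 1) * X)"
        by (intro add_mono mult_le_mono2 lX)
      also have "\<dots> \<le> N" by (simp add: N_def K2_def algebra_simps)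
      finally show ?thesis using rs8 pd by simp
    qed
    have ans: "ans (enc_colored F (leaf_graph k \<chi> L \<psi> S) (leaf_color k \<chi> L \<psi>)) =
       enc_rat (cpIndSub \<Phi> F (leaf_graph k \<chi> L \<psi> S) (leaf_color k \<chi> L \<psi>))" if S: "S \<subseteq> edges F" for S \<psi>
      unfolding ans_def
    proof (rule some_equality)
      obtain t where "halts_with M (enc_colored F (leaf_graph k \<chi> L \<psi> S) (leaf_color k \<chi> L \<psi>)) t
        (enc_rat (cpIndSub \<Phi> F (leaf_graph k \<chi> L \<psi> S) (leaf_color k \<chi> L \<psi>)))"
        using leaf_graph_solved[OF M(1) S] by blast
      note t = this
      show "set (enc_rat (cpIndSub \<Phi> F (leaf_graph k \<chi> L \<psi> S) (leaf_color k \<chi> L \<psi>))) \<subseteq> {1, 2, 3} \<and>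
        (\<exists>t. halts_with M (enc_colored F (leaf_graph k \<chi> L \<psi> S) (leaf_color k \<chi> L \<psi>)) t
        (enc_rat (cpIndSub \<Phi> F (leaf_graph k \<chi> L \<psi> S) (leaf_color k \<chi> L \<psi>))))"
        using t enc_rat_symbols(2) by blast
      show "v = enc_rat (cpIndSub \<Phi> F (leaf_graph k \<chi> L \<psi> S) (leaf_color k \<chi> L \<psi>))"
        if "set v \<subseteq> {1, 2, 3} \<and> (\<exists>t. halts_with M (enc_colored F (leaf_graph k \<chi> L \<psi> S) (leaf_color k \<chi> L \<psi>)) t v)" for v
        using that halts_with_unique[OF _ t _ enc_rat_symbols(2)] by blast
    qed
    have time: "T (length (leaf_vertices k \<chi> L \<psi>)) \<le> real (K1 * X)" for \<psi>
    proof -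
      let ?m = "real (length (leaf_vertices k \<chi> L \<psi>)) powr b"
      have "?m \<le> real k powr b * (3 powr b * 3 * 3 ^ (nl div q))"
        by (rule graph_size_powr[OF length_leaf_vertices Leq h0 t(2) C0 C(3)])
      then have m: "A * ?m \<le> A * (real k powr b * (3 powr b * 3 * 3 ^ (nl div q)))" using M(3) by (rule mult_left_mono)
      have x: "A \<le> A * real X" using mult_left_mono[of 1 "real X" A] M(3) X1 by simp
      have "T (length (leaf_vertices k \<chi> L \<psi>)) \<le> A * ?m + A" by (rule M(2))
      also have "\<dots> \<le> A * (real k powr b * (3 powr b * 3 * 3 ^ (nl div q))) + A * real X" using m x by (rule add_mono)
      also have "\<dots> = (A * (real k powr b * (3 powr b * 3)) + A) * real X" by (simp add: X_def algebra_simps)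
      also have "\<dots> \<le> real K1 * real X" unfolding K1_def by (intro mult_right_mono) linarith+
      finally show ?thesis by simp
    qed
    have queries: "\<forall>x\<in>set (all_queries ?P rs). set (snd x) \<subseteq> {1, 2, 3} \<and> ans (rev (snd x)) \<noteq> [] \<and> set (ans (rev (snd x))) \<subseteq> {1, 2, 3} \<and>
        (\<exists>t\<le>N. halts_with M (rev (snd x)) t (ans (rev (snd x))))"
    proof
      fix x assume "x \<in> set (all_queries ?P rs)"
      then obtain \<psi> i where i: "i < length Sl" "snd x = rev (enc_colored F (leaf_graph k \<chi> L \<psi> (Sl ! i)) (leaf_color k \<chi> L \<psi>))"
        unfolding all_queries_leaf L_def[symmetric] by auto
      have "Sl ! i \<in> set Sl" using i(1) by simp
      then have S: "Sl ! i \<subseteq> edges F" unfolding Sl(1) by simp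
      obtain t where t: "halts_with M (enc_colored F (leaf_graph k \<chi> L \<psi> (Sl ! i)) (leaf_color k \<chi> L \<psi>)) t
        (enc_rat (cpIndSub \<Phi> F (leaf_graph k \<chi> L \<psi> (Sl ! i)) (leaf_color k \<chi> L \<psi>)))" "real t \<le> T (length (leaf_vertices k \<chi> L \<psi>))"
        using leaf_graph_solved[OF M(1) S] by blast
      have "real t \<le> real (K1 * X)" using order_trans[OF t(2) time] .
      then have "t \<le> K1 * X" by (simp only: of_nat_le_iff)
      then have tN: "t \<le> N" using big by simp
      have r: "rev (snd x) = enc_colored F (leaf_graph k \<chi> L \<psi> (Sl ! i)) (leaf_color k \<chi> L \<psi>)" by (simp add: i(2))
      have "set (snd x) \<subseteq> {1, 2, 3}" unfolding i(2) set_rev by (rule enc_colored_symbols)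
      moreover have "\<exists>t\<le>N. halts_with M (rev (snd x)) t (ans (rev (snd x)))"
        unfolding r ans[OF S] using t(1) tN by blast
      ultimately show "set (snd x) \<subseteq> {1, 2, 3} \<and> ans (rev (snd x)) \<noteq> [] \<and> set (ans (rev (snd x))) \<subseteq> {1, 2, 3} \<and>
        (\<exists>t\<le>N. halts_with M (rev (snd x)) t (ans (rev (snd x))))"
        unfolding r ans[OF S] using enc_rat_symbols by blast
    qed
    have split: "\<forall>i. es ((split_step (par_t ?P) (input_lits rs) ^^ i) ([initial_formula (input_clauses rs)], [])) \<le> N + N * i"
    proof
      fix i
      have "es ((split_step t (input_lits rs) ^^ i) ([initial_formula (input_clauses rs)], [])) \<le> pl d (es rs) * (i + 1)"
        by (rule d[OF lc(4)])
      also have "\<dots> \<le> N * (i + 1)" using big by (intro mult_le_mono1) simp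
      finally show "es ((split_step (par_t ?P) (input_lits rs) ^^ i) ([initial_formula (input_clauses rs)], [])) \<le> N + N * i"
        by (simp add: parameters_def)
    qed
    have "es ?P + es rs + 1 \<le> N" "3 ^ chunk_size ?P rs \<le> N" "3 ^ fuel_size ?P rs \<le> N"
      using big L3 J3 X9 unfolding L_def[symmetric] by linarith+
    then have cr: "cr c (enc rs) (enc (final_answer (rev (map (answered ans) (all_queries ?P rs))))) (\<kappa> * pl e N)"
      using sol split queries by blast
    have "final_answer (rev (map (answered ans) (all_queries ?P rs))) \<longleftrightarrow>
      (\<exists>\<psi>\<in>set (final_formulas ?P rs). (\<Sum>S\<in>Pow (edges F). cpIndSub \<Phi> F (leaf_graph k \<chi> L \<psi> S) (leaf_color k \<chi> L \<psi>) * (-1) ^ card S) \<noteq> 0)"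
      unfolding L_def by (rule final_answer_correct) (rule ans[unfolded L_def])
    also have "\<dots> \<longleftrightarrow> (\<exists>\<psi>\<in>set (final_formulas ?P rs). \<exists>T. consistent T \<and> hits T (clauses \<psi>))"
    proof (rule bex_cong[OF refl])
      fix \<psi> assume \<psi>: "\<psi> \<in> set (final_formulas ?P rs)"
      show "(\<Sum>S\<in>Pow (edges F). cpIndSub \<Phi> F (leaf_graph k \<chi> L \<psi> S) (leaf_color k \<chi> L \<psi>) * (-1) ^ card S) \<noteq> 0 \<longleftrightarrow>
        (\<exists>T. consistent T \<and> hits T (clauses \<psi>))"
      proof (rule leaf_decision)
        show "length \<psi> \<le> h * L" unfolding L_def by (rule lc(2)[OF \<psi>])
        show "length c \<le> 3" if "c \<in> set \<psi>" for c by (rule lc(3)[OF \<psi> that])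
        show "L > 0" by (simp add: Leq)
      qed
    qed
    also have "\<dots> \<longleftrightarrow> satisfiable \<phi>" by (rule lc(1))
    finally have "final_answer (rev (map (answered ans) (all_queries ?P rs))) = satisfiable \<phi>" .
    then have "cr c (enc (rev (enc_cnf \<phi>))) (enc (satisfiable \<phi>)) (\<kappa> * pl e N)" using cr by (simp add: rs_def)
    then obtain t' where t': "t' \<le> \<kappa> * pl e N + 100 * (length (enc_cnf \<phi>) + 1)" "halts_with M' (enc_cnf \<phi>) t' [enc_bit (satisfiable \<phi>)]"
      using M'(2)[OF enc_cnf_symbols] by blast
    let ?Y = "l ^ ((d + 1) * e + 1) * X ^ e"
    have "pl e N \<le> e * (2 * K2) ^ e * ?Y"
    proof -
      have "1 \<le> N" using X9 X1 by linarith
      then have "(N + 1) ^ e \<le> (2 * N) ^ e" by (intro power_mono) simp_all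
      also have "\<dots> = (2 * K2) ^ e * (l ^ ((d + 1) * e) * X ^ e)"
        by (simp only: N_def power_mult_distrib power_mult mult.assoc)
      also have "\<dots> \<le> (2 * K2) ^ e * ?Y"
        using l1 by (intro mult_le_mono2 mult_le_mono1 power_increasing) simp_all
      finally have "e * (N + 1) ^ e \<le> e * ((2 * K2) ^ e * ?Y)" by (rule mult_le_mono2)
      then show ?thesis by (simp add: pl_def mult.assoc)
    qed
    then have "\<kappa> * pl e N \<le> \<kappa> * (e * (2 * K2) ^ e * ?Y)" by (rule mult_le_mono2)
    moreover have "l \<le> ?Y"
    proof -
      have "l ^ 1 * 1 \<le> ?Y" using l1 X1 by (intro mult_le_mono power_increasing) simp_all
      then show ?thesis by simp
    qed
    ultimately have "t' \<le> \<kappa> * (e * (2 * K2) ^ e * ?Y) + 100 * ?Y" using t'(1) unfolding l_def[symmetric] by linarith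
    also have "\<dots> = K * ?Y" by (simp add: K_def add_mult_distrib mult.assoc)
    finally show ?thesis using t'(2) unfolding X_def nl_def rs_def l_def by blast
  qed
  then show ?thesis using M'(1) by blast
qed

end

text \<open>Inputs of the machine live on \<open>{..<k}\<close>, so \<open>F0\<close> is moved there
  by a bijection \<open>f\<close>. It maps edge subsets bijectively to edge subsets of the same
  size, and invariance of \<open>\<Phi>\<close> preserves every term of \<open>ae\<close>.\<close>

lemma pattern_exists:
  assumes iso: "iso_invariant \<Phi>" and F0: "simple_graph F0" "card (verts F0) = k" and nz: "ae \<Phi> F0 \<noteq> 0"
    and K: "contains_subgraph F0 (complete_bipartite h h)"
  shows "\<exists>F g \<chi> Sl. pattern \<Phi> F k h g \<chi> Sl"
proof -
  have fin: "finite (verts F0)" and e2: "\<And>e. e \<in> edges F0 \<Longrightarrow> e \<subseteq> verts F0 \<and> card e = 2"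
    using F0(1) by (auto simp: simple_graph_def)
  obtain f where f: "bij_betw f (verts F0) {..<k}"
    using ex_bij_betw_finite_nat[OF fin] F0(2) by (auto simp: atLeast0LessThan)
  then have inj: "inj_on f (verts F0)" and im: "f ` verts F0 = {..<k}" by (auto simp: bij_betw_def)
  define F where "F = Graph {..<k} ((`) f ` edges F0)"
  have inj_e: "inj_on ((`) f) (Pow (verts F0))" by (rule inj_on_image_Pow[OF inj])
  have inj_E: "inj_on ((`) f) (edges F0)" by (rule inj_on_subset[OF inj_e]) (use e2 in auto)
  have simple: "simple_graph (Graph {..<k} ((`) f ` S))" if "S \<subseteq> edges F0" for S
  proof -
    have "f ` e \<subseteq> {..<k} \<and> card (f ` e) = 2" if "e \<in> S" for e
    proof -
      have e: "e \<subseteq> verts F0" "card e = 2" using e2 \<open>S \<subseteq> edges F0\<close> that by auto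
      then show ?thesis using im card_image[OF inj_on_subset[OF inj e(1)]] by auto
    qed
    then show ?thesis by (auto simp: simple_graph_def)
  qed
  have \<Phi>: "\<Phi> (Graph (verts F0) S) = \<Phi> (Graph {..<k} ((`) f ` S))" if S: "S \<subseteq> edges F0" for S
  proof -
    have "{u, v} \<in> S \<longleftrightarrow> {f u, f v} \<in> (`) f ` S" if uv: "u \<in> verts F0" "v \<in> verts F0" for u v
    proof
      assume "{u, v} \<in> S"
      from imageI[OF this, of "(`) f"] show "{f u, f v} \<in> (`) f ` S" by simp
    next
      assume "{f u, f v} \<in> (`) f ` S"
      then obtain e where e: "e \<in> S" "f ` {u, v} = f ` e" by auto
      have "{u, v} = e" by (rule inj_onD[OF inj_e e(2)]) (use uv e(1) S e2 in auto)
      then show "{u, v} \<in> S" using e(1) by simp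
    qed
    then have "graph_iso f (Graph (verts F0) S) (Graph {..<k} ((`) f ` S))" using f by (simp add: graph_iso_def)
    moreover have "simple_graph (Graph (verts F0) S)" using fin e2 S by (auto simp: simple_graph_def)
    ultimately show ?thesis using iso simple[OF S] unfolding iso_invariant_def by blast
  qed
  have "ae \<Phi> F = (\<Sum>S\<in>Pow (edges F0). \<Phi> (Graph {..<k} ((`) f ` S)) * (- 1) ^ card ((`) f ` S))"
  proof -
    have "bij_betw ((`) ((`) f)) (Pow (edges F0)) (Pow (edges F))"
      using inj_on_image_Pow[OF inj_E] image_Pow_surj[of "(`) f" "edges F0"] by (simp add: bij_betw_def F_def)
    from sum.reindex_bij_betw[OF this, of "\<lambda>S. \<Phi> (Graph {..<k} S) * (- 1) ^ card S"]
    show ?thesis by (simp add: ae_def F_def)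
  qed
  also have "\<dots> = ae \<Phi> F0" unfolding ae_def
  proof (rule sum.cong[OF refl])
    fix S assume "S \<in> Pow (edges F0)"
    then have S: "S \<subseteq> edges F0" by simp
    show "\<Phi> (Graph {..<k} ((`) f ` S)) * (- 1) ^ card ((`) f ` S) = \<Phi> (Graph (verts F0) S) * (- 1) ^ card S"
      unfolding \<Phi>[OF S] card_image[OF inj_on_subset[OF inj_E S]] ..
  qed
  finally have ae: "ae \<Phi> F \<noteq> 0" using nz by simp
  obtain f1 where f1: "inj_on f1 (verts (complete_bipartite h h))" "graph_hom f1 (complete_bipartite h h) F0"
    using K unfolding contains_subgraph_def by blast
  have v0: "verts (complete_bipartite h h) = {..<2 * h}" by (simp add: complete_bipartite_def mult_2)
  have v1: "f1 i \<in> verts F0" if "i < 2 * h" for i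
    using f1(2) that unfolding graph_hom_def v0 by blast
  define g where "g i = f (f1 i)" for i
  have ginj: "inj_on g {..<2 * h}"
  proof (rule inj_onI)
    fix i j assume ij: "i \<in> {..<2 * h}" "j \<in> {..<2 * h}" "g i = g j"
    have "f1 i = f1 j" by (rule inj_onD[OF inj]) (use ij v1 in \<open>simp_all add: g_def\<close>)
    then show "i = j" by (rule inj_onD[OF f1(1)[unfolded v0] _ ij(1,2)])
  qed
  \<comment> \<open>The index within its side of the complete bipartite graph; for vertices outside
    the image of \<open>g\<close> it is whatever \<open>inv_into\<close> yields.\<close>
  define \<chi> where "\<chi> u = (if inv_into {..<2 * h} g u < h then inv_into {..<2 * h} g u else inv_into {..<2 * h} g u - h)" for u
  have inv: "inv_into {..<2 * h} g (g i) = i" if "i < 2 * h" for i by (rule inv_into_f_f[OF ginj]) (use that in simp)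
  have "edges F0 \<subseteq> Pow (verts F0)" using e2 by blast
  then have "finite (edges F0)" by (rule finite_subset) (simp add: fin)
  then have "finite (Pow (edges F))" by (simp add: F_def)
  from finite_distinct_list[OF this] obtain Sl where Sl: "set Sl = Pow (edges F)" "distinct Sl" by (elim exE conjE)
  have "pattern \<Phi> F k h g \<chi> Sl"
  proof
    show "iso_invariant \<Phi>" "ae \<Phi> F \<noteq> 0" "set Sl = Pow (edges F)" "distinct Sl" by fact+
    show "simple_graph F" "verts F = {..<k}" using simple[OF order_refl] by (simp_all add: F_def)
    show "g i < k" if "i < 2 * h" for i using im v1[OF that] by (auto simp: g_def)
    show "{g i, g j} \<in> edges F" if ij: "i < h" "h \<le> j" "j < 2 * h" for i j
    proof -
      have "{i, j} \<in> edges (complete_bipartite h h)" unfolding complete_bipartite_def graph.sel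
        by (rule CollectI, rule exI[of _ i], rule exI[of _ j]) (use ij in simp)
      moreover have "i \<in> {..<2 * h}" "j \<in> {..<2 * h}" using ij by simp_all
      ultimately have "{f1 i, f1 j} \<in> edges F0" using f1(2) unfolding graph_hom_def v0 by blast
      from imageI[OF this, of "(`) f"] show ?thesis by (simp add: g_def F_def)
    qed
    show "\<chi> (g i) = i" if "i < h" for i using inv[of i] that by (simp add: \<chi>_def)
    show "\<chi> (g (h + i)) = i" if "i < h" for i using inv[of "h + i"] that by (simp add: \<chi>_def)
  qed
  then show ?thesis by blast
qed

theorem theorem3p5:
  assumes "ETH"
  shows "\<exists>\<beta>::real. \<exists>N::nat. \<beta> > 0 \<and> N > 0 \<and>
    (\<forall>(\<Phi> :: graph \<Rightarrow> rat) (h :: nat \<Rightarrow> nat) (k :: nat).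
       graph_parameter \<Phi> \<and> h k \<ge> N \<and>
       (\<exists>F. simple_graph F \<and> card (verts F) = k \<and> ae \<Phi> F \<noteq> 0 \<and>
            contains_subgraph F (complete_bipartite (h k) (h k))) \<longrightarrow>
       \<not> (\<exists>(M :: tm) (T :: nat \<Rightarrow> real).
            is_tm M \<and> solves_cpIndSub M \<Phi> k T \<and>
            T \<in> O(\<lambda>n. real n powr (\<beta> * real (h k)))))"
proof -
  obtain \<delta> :: real where \<delta>: "\<delta> > 0" and no: "\<not> (\<exists>M (d::nat). is_tm M \<and> (\<forall>\<phi>. is_3cnf \<phi> \<longrightarrow>
      (\<exists>t. halts_with M (enc_cnf \<phi>) t [enc_bit (satisfiable \<phi>)] \<and>
        real t \<le> real d * 2 powr (\<delta> * real (card (cnf_vars \<phi>))) * (real (length (enc_cnf \<phi>)) + 1) ^ d)))"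
    using assms unfolding ETH_def by (elim exE conjE)
  obtain e where e: "\<forall>M P. is_tm M \<longrightarrow> (\<exists>c \<kappa>. \<forall>rs N ans. es P + es rs + 1 \<le> N \<longrightarrow> 3 ^ chunk_size P rs \<le> N \<longrightarrow> 3 ^ fuel_size P rs \<le> N \<longrightarrow>
     (\<forall>i. es ((split_step (par_t P) (input_lits rs) ^^ i) ([initial_formula (input_clauses rs)], [])) \<le> N + N * i) \<longrightarrow>
     (\<forall>x\<in>set (all_queries P rs). set (snd x) \<subseteq> {1, 2, 3} \<and> ans (rev (snd x)) \<noteq> [] \<and> set (ans (rev (snd x))) \<subseteq> {1, 2, 3} \<and>
        (\<exists>t\<le>N. halts_with M (rev (snd x)) t (ans (rev (snd x))))) \<longrightarrow>
     cr c (enc rs) (enc (final_answer (rev (map (answered ans) (all_queries P rs))))) (\<kappa> * pl e N))"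
    using solver by (elim exE)
  \<comment> \<open>The least demand of \<open>exponent_bound\<close> is
    \<open>4 * e \<le> \<delta> * q\<close>; the successor keeps \<open>q\<close> positive.\<close>
  define q where "q = Suc (nat \<lceil>4 * real e / \<delta>\<rceil>)"
  have q0: "q > 0" by (simp add: q_def)
  have "4 * real e / \<delta> \<le> real q" unfolding q_def by linarith
  then have qe: "4 * real e \<le> \<delta> * real q" using \<delta> by (simp add: pos_divide_le_eq mult.commute)
  obtain t and \<mu> :: real where t: "t > 0" and mu: "\<mu> > 1" "\<mu> ^ (2 * t\<^sup>2 - 1) + 1 \<le> \<mu> ^ (2 * t\<^sup>2)"
    "\<forall>n q'. n \<le> q * q' \<longrightarrow> \<mu> ^ (6 * t * n) \<le> 3 ^ q'"
    using threshold_exists[OF q0] by (elim exE conjE)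
  \<comment> \<open>The number of clauses per literal in a sparse formula. With
    \<open>\<beta> = 1 / (q * C)\<close> the power \<open>\<beta> * h k\<close> turns
    \<open>3 ^ (C * nl / h k)\<close> into \<open>3 ^ (nl / q)\<close>, and \<open>q * C\<close> is
    the threshold for \<open>h k\<close>.\<close>
  define C where "C = 1 + t + 2 * t\<^sup>2"
  define \<beta> where "\<beta> = 1 / real (q * C)"
  have qC: "q * C > 0" using q0 by (simp add: C_def)
  show ?thesis
  proof (rule exI[of _ \<beta>], rule exI[of _ "q * C"], intro conjI allI impI notI)
    show "\<beta> > 0" using qC by (simp only: \<beta>_def of_nat_0_less_iff zero_less_divide_1_iff)
    show "q * C > 0" by (rule qC)
  next
    fix \<Phi> h k
    assume A: "graph_parameter \<Phi> \<and> h k \<ge> q * C \<and>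
       (\<exists>F. simple_graph F \<and> card (verts F) = k \<and> ae \<Phi> F \<noteq> 0 \<and>
            contains_subgraph F (complete_bipartite (h k) (h k)))"
      and B: "\<exists>(M :: tm) (T :: nat \<Rightarrow> real). is_tm M \<and> solves_cpIndSub M \<Phi> k T \<and>
            T \<in> O(\<lambda>n. real n powr (\<beta> * real (h k)))"
    have iso: "iso_invariant \<Phi>" and hk: "h k \<ge> q * C" using A by (simp_all add: graph_parameter_def)
    obtain F0 where F0: "simple_graph F0" "card (verts F0) = k" "ae \<Phi> F0 \<noteq> 0" "contains_subgraph F0 (complete_bipartite (h k) (h k))"
      using A by (elim exE conjE)
    obtain M T where M: "is_tm M" "solves_cpIndSub M \<Phi> k T" "T \<in> O(\<lambda>n. real n powr (\<beta> * real (h k)))"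
      using B by (elim exE conjE)
    obtain D where D: "D \<ge> 0" "\<forall>n. T n \<le> D * (real n powr (\<beta> * real (h k))) + D"
      using bigo_powr_bound[OF M(3)] by (elim exE conjE)
    obtain F g \<chi> Sl where "pattern \<Phi> F k (h k) g \<chi> Sl"
      using pattern_exists[OF iso F0] by (elim exE)
    then interpret pattern \<Phi> F k "h k" g \<chi> Sl .
    obtain c \<kappa> where sol: "\<forall>rs N ans. es (parameters t q) + es rs + 1 \<le> N \<longrightarrow> 3 ^ chunk_size (parameters t q) rs \<le> N \<longrightarrow> 3 ^ fuel_size (parameters t q) rs \<le> N \<longrightarrow>
     (\<forall>i. es ((split_step (par_t (parameters t q)) (input_lits rs) ^^ i) ([initial_formula (input_clauses rs)], [])) \<le> N + N * i) \<longrightarrow>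
     (\<forall>x\<in>set (all_queries (parameters t q) rs). set (snd x) \<subseteq> {1, 2, 3} \<and> ans (rev (snd x)) \<noteq> [] \<and> set (ans (rev (snd x))) \<subseteq> {1, 2, 3} \<and>
        (\<exists>t\<le>N. halts_with M (rev (snd x)) t (ans (rev (snd x))))) \<longrightarrow>
     cr c (enc rs) (enc (final_answer (rev (map (answered ans) (all_queries (parameters t q) rs))))) (\<kappa> * pl e N)"
      using e[THEN spec[of _ M], THEN spec[of _ "parameters t q"], THEN mp, OF M(1)] by (elim exE)
    have b: "\<beta> * real (h k) = real (h k) / real (q * C)" by (simp add: \<beta>_def)
    note machine = sat_machine[OF M(2) D(2)[rule_format] D(1) C_def hk b t q0 mu sol]
    obtain M' K a where M': "is_tm M'" "\<forall>\<phi>. is_3cnf \<phi> \<longrightarrow> (\<exists>t'. halts_with M' (enc_cnf \<phi>) t' [enc_bit (satisfiable \<phi>)] \<and>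
        t' \<le> K * ((length (enc_cnf \<phi>) + 1) ^ a * (3 ^ (length (input_lits (rev (enc_cnf \<phi>))) div q)) ^ e))"
      using machine by (elim exE conjE)
    \<comment> \<open>The ETH uses a single number as coefficient and as exponent of the polynomial;
      \<open>K + a\<close> dominates both.\<close>
    have "\<exists>t. halts_with M' (enc_cnf \<phi>) t [enc_bit (satisfiable \<phi>)] \<and>
        real t \<le> real (K + a) * 2 powr (\<delta> * real (card (cnf_vars \<phi>))) * (real (length (enc_cnf \<phi>)) + 1) ^ (K + a)"
      if \<phi>: "is_3cnf \<phi>" for \<phi>
    proof -
      let ?l = "real (length (enc_cnf \<phi>)) + 1" and ?X = "(3 ^ (length (input_lits (rev (enc_cnf \<phi>))) div q)) ^ e"
        and ?E = "2 powr (\<delta> * real (card (cnf_vars \<phi>)))"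
      obtain t' where t': "halts_with M' (enc_cnf \<phi>) t' [enc_bit (satisfiable \<phi>)]" "t' \<le> K * ((length (enc_cnf \<phi>) + 1) ^ a * ?X)"
        using M'(2)[rule_format, OF \<phi>] by (elim exE conjE)
      have "real t' \<le> real (K * ((length (enc_cnf \<phi>) + 1) ^ a * ?X))" using t'(2) by (rule of_nat_mono)
      also have "\<dots> = real K * (?l ^ a * ?X)" by (simp add: add.commute)
      also have "\<dots> \<le> real (K + a) * (?l ^ (K + a) * ?E)"
        by (intro mult_mono power_increasing exponent_bound[OF qe q0 length_input_lits]) simp_all
      also have "\<dots> = real (K + a) * ?E * ?l ^ (K + a)" by (simp only: mult.assoc mult.commute mult.left_commute)
      finally show ?thesis using t'(1) by (intro exI conjI)
    qed
    then show False using no M'(1) by blast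
  qed
qed

end
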